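(* Let $k\to S$ be a ring homomorphism such that $S$ is flat as a left $k$-module. Let $A$ be the ring of $n\times n$ lower triangular matrices with diagonal entries in $k$ and entries below the diagonal in $S$, let $N$ be the left $A$-module of columns of length $n$ with entries in $S$, and let $M$ be the right $A$-module of rows of length $n$ with entries in $S$. Then the Tor-groups are $$\mathrm{Tor}^A_i(M,N)=\begin{cases} S & \text{if } i=0,\\ \mathcal K^n(S) & \text{if } i=n-1,\\ 0 & \text{otherwise.}\end{cases}$$ Consequently $$\mathrm{Tor}^A_i(M_n(S),M_n(S))=M_n(\mathrm{Tor}^A_i(M,N))=\begin{cases} M_n(S) & \text{if } i=0,\\ M_n(\mathcal K^n(S)) & \text{if } i=n-1,\\ 0 & \text{otherwise.}\end{cases}$$
   Context: Rings are associative with $1$, not necessarily commutative. For a left $S$-module $L$, $\mathcal K(L)$ denotes the kernel of the multiplication map $\mu_L:S\otimes_k L\to L$, $s\otimes x\mapsto sx$; it is a left $S$-module. Put $\mathcal K^0(L)=L$ and $\mathcal K^{j}(L)=\mathcal K(\mathcal K^{j-1}(L))$ for $j\ge1$. The ring $$A=\begin{pmatrix} k&0&\cdots&0\\ S&k&\cdots&0\\ \vdots&\vdots&\ddots&\vdots\\ S&S&\cdots&k\end{pmatrix}$$ (zero above the diagonal, diagonal entries in $k$, arbitrary elements of $S$ below the diagonal) maps to the matrix ring $M_n(S)$ via $k\to S$ on the diagonal entries; $M$, $N$ and $M_n(S)$ are $A$-modules via this homomorphism and matrix multiplication. For an abelian group $L$, $M_n(L)$ denotes the $n\times n$ matrices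 with entries in $L$.
   Formalization: The matrix size n is assumed to be at least 2: for n = 1 the cases i = 0 and i = n−1 coincide and the formula fails, since then A = k and Tor_0(M,N) is the tensor product of S with S over k, in general neither S nor K(S). *)

theory Defs
  imports "HOL-Algebra.Module" "HOL-Algebra.Free_Abelian_Groups" "HOL-Library.FSet" "HOL-Library.Poly_Mapping"
begin

section \<open>Modules over a not necessarily commutative ring\<close>

text \<open>
  The locale \<^locale>\<open>module\<close> of the library is restricted to commutative rings.  Here a module
  is an abelian group, written multiplicatively as in \<^theory>\<open>HOL-Algebra.Free_Abelian_Groups\<close>,
  together with an action.  For a right module \<open>X\<close> the expression \<open>act X a x\<close> stands for
  the product of \<open>x\<close> with the scalar \<open>a\<close> on its right.
\<close>

record ('r, 'm) rmodule = "'m monoid" +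
  act :: "'r \<Rightarrow> 'm \<Rightarrow> 'm"

definition with_act :: "('m, 'z) monoid_scheme \<Rightarrow> ('r \<Rightarrow> 'm \<Rightarrow> 'm) \<Rightarrow> ('r, 'm) rmodule" where
  "with_act G f = \<lparr>carrier = carrier G, monoid.mult = monoid.mult G, one = one G, act = f\<rparr>"

definition left_module :: "'r ring \<Rightarrow> ('r, 'm) rmodule \<Rightarrow> bool" where
  "left_module R L \<longleftrightarrow> ring R \<and> comm_group L \<and>
    (\<forall>a\<in>carrier R. \<forall>x\<in>carrier L. act L a x \<in> carrier L) \<and>
    (\<forall>a\<in>carrier R. \<forall>x\<in>carrier L. \<forall>y\<in>carrier L.
       act L a (x \<otimes>\<^bsub>L\<^esub> y) = act L a x \<otimes>\<^bsub>L\<^esub> act L a y) \<and>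
    (\<forall>a\<in>carrier R. \<forall>b\<in>carrier R. \<forall>x\<in>carrier L.
       act L (a \<oplus>\<^bsub>R\<^esub> b) x = act L a x \<otimes>\<^bsub>L\<^esub> act L b x) \<and>
    (\<forall>a\<in>carrier R. \<forall>b\<in>carrier R. \<forall>x\<in>carrier L.
       act L (a \<otimes>\<^bsub>R\<^esub> b) x = act L a (act L b x)) \<and>
    (\<forall>x\<in>carrier L. act L \<one>\<^bsub>R\<^esub> x = x)"

definition right_module :: "'r ring \<Rightarrow> ('r, 'm) rmodule \<Rightarrow> bool" where
  "right_module R X \<longleftrightarrow> ring R \<and> comm_group X \<and>
    (\<forall>a\<in>carrier R. \<forall>x\<in>carrier X. act X a x \<in> carrier X) \<and>
    (\<forall>a\<in>carrier R. \<forall>x\<in>carrier X. \<forall>y\<in>carrier X.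
       act X a (x \<otimes>\<^bsub>X\<^esub> y) = act X a x \<otimes>\<^bsub>X\<^esub> act X a y) \<and>
    (\<forall>a\<in>carrier R. \<forall>b\<in>carrier R. \<forall>x\<in>carrier X.
       act X (a \<oplus>\<^bsub>R\<^esub> b) x = act X a x \<otimes>\<^bsub>X\<^esub> act X b x) \<and>
    (\<forall>a\<in>carrier R. \<forall>b\<in>carrier R. \<forall>x\<in>carrier X.
       act X (a \<otimes>\<^bsub>R\<^esub> b) x = act X b (act X a x)) \<and>
    (\<forall>x\<in>carrier X. act X \<one>\<^bsub>R\<^esub> x = x)"

definition module_hom :: "'r ring \<Rightarrow> ('r, 'm) rmodule \<Rightarrow> ('r, 'n) rmodule \<Rightarrow> ('m \<Rightarrow> 'n) set" where
  "module_hom R X Y =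
    {h \<in> hom X Y. \<forall>a\<in>carrier R. \<forall>x\<in>carrier X. h (act X a x) = act Y a (h x)}"

definition kernel_module ::
  "('r, 'm) rmodule \<Rightarrow> ('r, 'n) rmodule \<Rightarrow> ('m \<Rightarrow> 'n) \<Rightarrow> ('r, 'm) rmodule" where
  "kernel_module X Y h = X\<lparr>carrier := kernel X Y h\<rparr>"

definition restrict_scalars :: "('q \<Rightarrow> 'r) \<Rightarrow> ('r, 'm) rmodule \<Rightarrow> ('q, 'm) rmodule" where
  "restrict_scalars \<phi> L = with_act L (\<lambda>a. act L (\<phi> a))"

definition left_regular :: "'r ring \<Rightarrow> ('r, 'r) rmodule" where
  "left_regular R = with_act (add_monoid R) (\<lambda>a x. a \<otimes>\<^bsub>R\<^esub> x)"

definition right_regular :: "'r ring \<Rightarrow> ('r, 'r) rmodule" where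
  "right_regular R = with_act (add_monoid R) (\<lambda>a x. x \<otimes>\<^bsub>R\<^esub> a)"

text \<open>The isomorphic copy of a module along a map \<open>e\<close> that is injective on its carrier.\<close>

definition transport :: "('m \<Rightarrow> 'n) \<Rightarrow> ('r, 'm) rmodule \<Rightarrow> ('r, 'n) rmodule" where
  "transport e L =
    (let d = inv_into (carrier L) e in
      \<lparr>carrier = e ` carrier L, monoid.mult = (\<lambda>x y. e (d x \<otimes>\<^bsub>L\<^esub> d y)), one = e \<one>\<^bsub>L\<^esub>,
       act = (\<lambda>a x. e (act L a (d x)))\<rparr>)"


section \<open>Tensor products and flatness\<close>

definition tensor_relations ::
  "'r ring \<Rightarrow> ('r, 'm) rmodule \<Rightarrow> ('r, 'n) rmodule \<Rightarrow> ('m \<times> 'n \<Rightarrow>\<^sub>0 int) set" where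
  "tensor_relations R X L =
    {frag_of (x \<otimes>\<^bsub>X\<^esub> x', y) - frag_of (x, y) - frag_of (x', y) | x x' y.
       x \<in> carrier X \<and> x' \<in> carrier X \<and> y \<in> carrier L} \<union>
    {frag_of (x, y \<otimes>\<^bsub>L\<^esub> y') - frag_of (x, y) - frag_of (x, y') | x y y'.
       x \<in> carrier X \<and> y \<in> carrier L \<and> y' \<in> carrier L} \<union>
    {frag_of (act X a x, y) - frag_of (x, act L a y) | a x y.
       a \<in> carrier R \<and> x \<in> carrier X \<and> y \<in> carrier L}"

definition tensor_subgroup ::
  "'r ring \<Rightarrow> ('r, 'm) rmodule \<Rightarrow> ('r, 'n) rmodule \<Rightarrow> ('m \<times> 'n \<Rightarrow>\<^sub>0 int) set" where
  "tensor_subgroup R X L =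
    generate (free_Abelian_group (carrier X \<times> carrier L)) (tensor_relations R X L)"

text \<open>The tensor product of a right module \<open>X\<close> and a left module \<open>L\<close>, an abelian group.\<close>

definition tensor ::
  "'r ring \<Rightarrow> ('r, 'm) rmodule \<Rightarrow> ('r, 'n) rmodule \<Rightarrow> ('m \<times> 'n \<Rightarrow>\<^sub>0 int) set monoid" where
  "tensor R X L =
    free_Abelian_group (carrier X \<times> carrier L) Mod tensor_subgroup R X L"

definition pure_tensor ::
  "'r ring \<Rightarrow> ('r, 'm) rmodule \<Rightarrow> ('r, 'n) rmodule \<Rightarrow> 'm \<Rightarrow> 'n \<Rightarrow> ('m \<times> 'n \<Rightarrow>\<^sub>0 int) set" where
  "pure_tensor R X L x y =
    tensor_subgroup R X L #>\<^bsub>free_Abelian_group (carrier X \<times> carrier L)\<^esub> frag_of (x, y)"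

text \<open>
  The homomorphism from a tensor product to \<open>G\<close> that is induced by a balanced biadditive map
  \<open>\<beta>\<close>: its linear extension to the free abelian group is constant on every coset \<open>C\<close>.
\<close>

definition tensor_lift ::
  "('g, 'z) monoid_scheme \<Rightarrow> ('m \<Rightarrow> 'n \<Rightarrow> 'g) \<Rightarrow> ('m \<times> 'n \<Rightarrow>\<^sub>0 int) set \<Rightarrow> 'g" where
  "tensor_lift G \<beta> C =
    the_elem ((\<lambda>c. finprod G (\<lambda>(x, y). \<beta> x y [^]\<^bsub>G\<^esub> Poly_Mapping.lookup c (x, y))
      (Poly_Mapping.keys c)) ` C)"

definition tensor_map ::
  "'r ring \<Rightarrow> ('r, 'm') rmodule \<Rightarrow> ('r, 'n') rmodule \<Rightarrow> ('m \<Rightarrow> 'm') \<Rightarrow> ('n \<Rightarrow> 'n') \<Rightarrow>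
    ('m \<times> 'n \<Rightarrow>\<^sub>0 int) set \<Rightarrow> ('m' \<times> 'n' \<Rightarrow>\<^sub>0 int) set" where
  "tensor_map R X' L' g h =
    tensor_lift (tensor R X' L') (\<lambda>x y. pure_tensor R X' L' (g x) (h y))"

text \<open>
  Flatness of a left module: tensoring with it preserves injectivity of homomorphisms of right
  modules.  A definition cannot quantify over all types; the modules \<open>X\<close> and \<open>Y\<close> range over
  those with elements of type \<^typ>\<open>(nat \<Rightarrow> 'r) set\<close>.  This is no restriction: every finitely
  generated right module has a copy there (a quotient of a free module on finitely many
  generators consists of cosets, that is, of sets of tuples), and injectivity for all modules
  reduces to finitely generated \<open>X\<close> and \<open>Y\<close>, since an element of a tensor product and a
  derivation of its vanishing involve only finitely many elements.
\<close>

definition flat_left_module :: "'r ring \<Rightarrow> ('r, 'n) rmodule \<Rightarrow> bool" where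
  "flat_left_module R L \<longleftrightarrow> left_module R L \<and>
    (\<forall>(X :: ('r, (nat \<Rightarrow> 'r) set) rmodule) (Y :: ('r, (nat \<Rightarrow> 'r) set) rmodule) g.
       right_module R X \<and> right_module R Y \<and> g \<in> module_hom R X Y \<and> inj_on g (carrier X) \<longrightarrow>
       inj_on (tensor_map R Y L g (\<lambda>y. y)) (carrier (tensor R X L)))"


section \<open>Finite formal sums\<close>

text \<open>
  The constructions iterated below (kernels in tensor products, syzygies) would change the type of
  the elements at each step.  Nested formal sums of atoms provide one type that is closed under them:
  a finitely supported function is encoded by the finite graph of its restriction to its support.
\<close>

datatype ('x, 'c) formal = Atom 'x | Formal "(('x, 'c) formal \<times> 'c) fset"


section \<open>The kernel of the multiplication map\<close>

text \<open>The left \<open>S\<close>-module obtained from a left \<open>S\<close>-module \<open>L\<close> by tensoring with \<open>S\<close> over \<open>k\<close>.\<close>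

definition induced ::
  "'k ring \<Rightarrow> 's ring \<Rightarrow> ('k \<Rightarrow> 's) \<Rightarrow> ('s, 'l) rmodule \<Rightarrow> ('s, ('s \<times> 'l \<Rightarrow>\<^sub>0 int) set) rmodule" where
  "induced k S \<phi> L =
    (let X = restrict_scalars \<phi> (right_regular S); Y = restrict_scalars \<phi> L in
      with_act (tensor k X Y) (\<lambda>s. tensor_map k X Y (\<lambda>t. s \<otimes>\<^bsub>S\<^esub> t) (\<lambda>y. y)))"

definition mult_kernel ::
  "'k ring \<Rightarrow> 's ring \<Rightarrow> ('k \<Rightarrow> 's) \<Rightarrow> ('s, 'l) rmodule \<Rightarrow> ('s, ('s \<times> 'l \<Rightarrow>\<^sub>0 int) set) rmodule" where
  "mult_kernel k S \<phi> L = kernel_module (induced k S \<phi> L) L (tensor_lift L (act L))"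

text \<open>
  A coset is encoded by the graph of a chosen representative.  The coefficient \<open>c\<close> of the
  generator \<open>(s, x)\<close> becomes the pair \<open>(x, (s, c))\<close> of the graph.
\<close>

definition encode_coset ::
  "('s \<times> ('l, 's \<times> int) formal \<Rightarrow>\<^sub>0 int) set \<Rightarrow> ('l, 's \<times> int) formal" where
  "encode_coset C =
    (let p = (SOME p. p \<in> C) in
      Formal (Abs_fset ((\<lambda>(s, x). (x, (s, Poly_Mapping.lookup p (s, x)))) ` Poly_Mapping.keys p)))"

primrec iter_mult_kernel ::
  "'k ring \<Rightarrow> 's ring \<Rightarrow> ('k \<Rightarrow> 's) \<Rightarrow> ('s, 'l) rmodule \<Rightarrow> nat \<Rightarrow>
    ('s, ('l, 's \<times> int) formal) rmodule" where
  "iter_mult_kernel k S \<phi> L 0 = transport Atom L"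
| "iter_mult_kernel k S \<phi> L (Suc j) =
    transport encode_coset (mult_kernel k S \<phi> (iter_mult_kernel k S \<phi> L j))"


section \<open>Tor\<close>

text \<open>
  \<open>Tor\<close> is computed from the canonical free resolution of the right module \<open>M\<close>: the module in
  degree \<open>j\<close> is free on the underlying set of the \<open>j\<close>-th syzygy, which is \<open>M\<close> for \<open>j = 0\<close> and
  the kernel of the canonical surjection from the free module in degree \<open>j - 1\<close> otherwise.
\<close>

definition free_right_module :: "'r ring \<Rightarrow> 'b set \<Rightarrow> ('r, 'b \<Rightarrow> 'r) rmodule" where
  "free_right_module R B =
    \<lparr>carrier = {f. (\<forall>b. f b \<in> carrier R) \<and> (\<forall>b. b \<notin> B \<longrightarrow> f b = \<zero>\<^bsub>R\<^esub>) \<and> finite {b. f b \<noteq> \<zero>\<^bsub>R\<^esub>}},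
     monoid.mult = (\<lambda>f g b. f b \<oplus>\<^bsub>R\<^esub> g b), one = (\<lambda>b. \<zero>\<^bsub>R\<^esub>), act = (\<lambda>a f b. f b \<otimes>\<^bsub>R\<^esub> a)\<rparr>"

text \<open>The homomorphism from a free right module to \<open>M\<close> with values \<open>v\<close> on the basis.\<close>

definition free_lift :: "'r ring \<Rightarrow> ('r, 'm) rmodule \<Rightarrow> ('b \<Rightarrow> 'm) \<Rightarrow> ('b \<Rightarrow> 'r) \<Rightarrow> 'm" where
  "free_lift R M v f = finprod M (\<lambda>b. act M (f b) (v b)) {b. f b \<noteq> \<zero>\<^bsub>R\<^esub>}"

definition relation_module :: "'r ring \<Rightarrow> ('r, 'm) rmodule \<Rightarrow> ('r, 'm \<Rightarrow> 'r) rmodule" where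
  "relation_module R M =
    kernel_module (free_right_module R (carrier M)) M (free_lift R M (\<lambda>x. x))"

definition encode_fun :: "'r ring \<Rightarrow> (('m, 'r) formal \<Rightarrow> 'r) \<Rightarrow> ('m, 'r) formal" where
  "encode_fun R f = Formal (Abs_fset ((\<lambda>x. (x, f x)) ` {x. f x \<noteq> \<zero>\<^bsub>R\<^esub>}))"

primrec syzygy ::
  "'r ring \<Rightarrow> ('r, 'm) rmodule \<Rightarrow> nat \<Rightarrow> ('r, ('m, 'r) formal) rmodule" where
  "syzygy R M 0 = transport Atom M"
| "syzygy R M (Suc j) = transport (encode_fun R) (relation_module R (syzygy R M j))"

definition resolution ::
  "'r ring \<Rightarrow> ('r, 'm) rmodule \<Rightarrow> nat \<Rightarrow> ('r, ('m, 'r) formal \<Rightarrow> 'r) rmodule" where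
  "resolution R M j = free_right_module R (carrier (syzygy R M j))"

text \<open>The differential from degree \<open>j + 1\<close> to degree \<open>j\<close>: a basis element is sent to the syzygy it encodes.\<close>

definition resolution_diff ::
  "'r ring \<Rightarrow> ('r, 'm) rmodule \<Rightarrow> nat \<Rightarrow> (('m, 'r) formal \<Rightarrow> 'r) \<Rightarrow> (('m, 'r) formal \<Rightarrow> 'r)" where
  "resolution_diff R M j =
    free_lift R (resolution R M j)
      (inv_into (carrier (relation_module R (syzygy R M j))) (encode_fun R))"

definition Tor_chain ::
  "'r ring \<Rightarrow> ('r, 'm) rmodule \<Rightarrow> ('r, 'n) rmodule \<Rightarrow> nat \<Rightarrow>
    ((('m, 'r) formal \<Rightarrow> 'r) \<times> 'n \<Rightarrow>\<^sub>0 int) set monoid" where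
  "Tor_chain R M N j = tensor R (resolution R M j) N"

definition Tor_diff ::
  "'r ring \<Rightarrow> ('r, 'm) rmodule \<Rightarrow> ('r, 'n) rmodule \<Rightarrow> nat \<Rightarrow>
    ((('m, 'r) formal \<Rightarrow> 'r) \<times> 'n \<Rightarrow>\<^sub>0 int) set \<Rightarrow> ((('m, 'r) formal \<Rightarrow> 'r) \<times> 'n \<Rightarrow>\<^sub>0 int) set" where
  "Tor_diff R M N j = tensor_map R (resolution R M j) N (resolution_diff R M j) (\<lambda>y. y)"

definition Tor_cycles ::
  "'r ring \<Rightarrow> ('r, 'm) rmodule \<Rightarrow> ('r, 'n) rmodule \<Rightarrow> nat \<Rightarrow>
    ((('m, 'r) formal \<Rightarrow> 'r) \<times> 'n \<Rightarrow>\<^sub>0 int) set set" where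
  "Tor_cycles R M N i =
    (case i of 0 \<Rightarrow> carrier (Tor_chain R M N 0)
     | Suc j \<Rightarrow> kernel (Tor_chain R M N (Suc j)) (Tor_chain R M N j) (Tor_diff R M N j))"

definition Tor ::
  "'r ring \<Rightarrow> nat \<Rightarrow> ('r, 'm) rmodule \<Rightarrow> ('r, 'n) rmodule \<Rightarrow>
    ((('m, 'r) formal \<Rightarrow> 'r) \<times> 'n \<Rightarrow>\<^sub>0 int) set set monoid" where
  "Tor R i M N =
    (Tor_chain R M N i)\<lparr>carrier := Tor_cycles R M N i\<rparr> Mod
      (Tor_diff R M N i ` carrier (Tor_chain R M N (Suc i)))"


section \<open>Matrices\<close>

text \<open>Rows, columns and matrices are extensional functions; indices start at 0.\<close>

definition mat_mult ::
  "'s ring \<Rightarrow> nat \<Rightarrow> (nat \<times> nat \<Rightarrow> 's) \<Rightarrow> (nat \<times> nat \<Rightarrow> 's) \<Rightarrow> nat \<times> nat \<Rightarrow> 's" where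
  "mat_mult S n X Y =
    (\<lambda>(i, j)\<in>{..<n} \<times> {..<n}. \<Oplus>\<^bsub>S\<^esub>l\<in>{..<n}. X (i, l) \<otimes>\<^bsub>S\<^esub> Y (l, j))"

definition matrix_group :: "nat \<Rightarrow> ('g, 'z) monoid_scheme \<Rightarrow> (nat \<times> nat \<Rightarrow> 'g) monoid" where
  "matrix_group n L = product_group ({..<n} \<times> {..<n}) (\<lambda>_. L)"

definition matrix_ring :: "nat \<Rightarrow> 's ring \<Rightarrow> (nat \<times> nat \<Rightarrow> 's) ring" where
  "matrix_ring n S =
    \<lparr>carrier = carrier (matrix_group n (add_monoid S)),
     monoid.mult = mat_mult S n,
     one = (\<lambda>(i, j)\<in>{..<n} \<times> {..<n}. if i = j then \<one>\<^bsub>S\<^esub> else \<zero>\<^bsub>S\<^esub>),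
     ring.zero = one (matrix_group n (add_monoid S)),
     ring.add = monoid.mult (matrix_group n (add_monoid S))\<rparr>"

definition column_module :: "nat \<Rightarrow> 's ring \<Rightarrow> (nat \<times> nat \<Rightarrow> 's, nat \<Rightarrow> 's) rmodule" where
  "column_module n S =
    with_act (product_group {..<n} (\<lambda>_. add_monoid S))
      (\<lambda>X v. \<lambda>i\<in>{..<n}. \<Oplus>\<^bsub>S\<^esub>l\<in>{..<n}. X (i, l) \<otimes>\<^bsub>S\<^esub> v l)"

definition row_module :: "nat \<Rightarrow> 's ring \<Rightarrow> (nat \<times> nat \<Rightarrow> 's, nat \<Rightarrow> 's) rmodule" where
  "row_module n S =
    with_act (product_group {..<n} (\<lambda>_. add_monoid S))
      (\<lambda>X v. \<lambda>j\<in>{..<n}. \<Oplus>\<^bsub>S\<^esub>l\<in>{..<n}. v l \<otimes>\<^bsub>S\<^esub> X (l, j))"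

text \<open>
  An element of the triangular ring is a pair \<open>(d, s)\<close> of the family of its diagonal entries, in
  \<open>k\<close>, and the family of its entries below the diagonal, in \<open>S\<close>.  The map \<open>\<phi>\<close> need not be
  injective, so the ring is not a subring of the matrix ring over \<open>S\<close>.
\<close>

definition below_diag :: "nat \<Rightarrow> (nat \<times> nat) set" where
  "below_diag n = {(i, j). j < i \<and> i < n}"

definition triangular_to_matrix ::
  "'s ring \<Rightarrow> ('k \<Rightarrow> 's) \<Rightarrow> nat \<Rightarrow> (nat \<Rightarrow> 'k) \<times> (nat \<times> nat \<Rightarrow> 's) \<Rightarrow> nat \<times> nat \<Rightarrow> 's" where
  "triangular_to_matrix S \<phi> n =
    (\<lambda>(d, s). \<lambda>(i, j)\<in>{..<n} \<times> {..<n}.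
       if i = j then \<phi> (d i) else if j < i then s (i, j) else \<zero>\<^bsub>S\<^esub>)"

definition triangular_ring ::
  "'k ring \<Rightarrow> 's ring \<Rightarrow> ('k \<Rightarrow> 's) \<Rightarrow> nat \<Rightarrow> ((nat \<Rightarrow> 'k) \<times> (nat \<times> nat \<Rightarrow> 's)) ring" where
  "triangular_ring k S \<phi> n =
    \<lparr>carrier = ({..<n} \<rightarrow>\<^sub>E carrier k) \<times> (below_diag n \<rightarrow>\<^sub>E carrier S),
     monoid.mult = (\<lambda>a b.
       (\<lambda>i\<in>{..<n}. fst a i \<otimes>\<^bsub>k\<^esub> fst b i,
        restrict (mat_mult S n (triangular_to_matrix S \<phi> n a) (triangular_to_matrix S \<phi> n b))
          (below_diag n))),
     one = (\<lambda>i\<in>{..<n}. \<one>\<^bsub>k\<^esub>, \<lambda>p\<in>below_diag n. \<zero>\<^bsub>S\<^esub>),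
     ring.zero = (\<lambda>i\<in>{..<n}. \<zero>\<^bsub>k\<^esub>, \<lambda>p\<in>below_diag n. \<zero>\<^bsub>S\<^esub>),
     ring.add = (\<lambda>a b.
       (\<lambda>i\<in>{..<n}. fst a i \<oplus>\<^bsub>k\<^esub> fst b i, \<lambda>p\<in>below_diag n. snd a p \<oplus>\<^bsub>S\<^esub> snd b p))\<rparr>"

end

theory Submission imports Defs
begin

text \<open>
  Let \<open>L\<^sub>j\<close> be the \<open>j\<close>-th iterated kernel of \<open>S\<close> and number rows and columns from 0.  The \<open>A\<close>-module
  \<open>N\<close> is the first of the modules \<open>N\<^sub>j\<close> of columns with entries in \<open>L\<^sub>j\<close> whose first \<open>j\<close> entries
  vanish.  Inside the columns over \<open>S \<otimes>\<^sub>k L\<^sub>j\<close> let \<open>F\<^sub>j\<close> consist of those whose first \<open>j\<close> entries vanish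
  and whose entry in row \<open>j\<close> lies in \<open>1 \<otimes> L\<^sub>j\<close>; this is an \<open>A\<close>-submodule because the diagonal of \<open>A\<close> is in
  \<open>k\<close>.  The multiplication map \<open>S \<otimes>\<^sub>k L\<^sub>j \<rightarrow> L\<^sub>j\<close> is bijective on \<open>1 \<otimes> L\<^sub>j\<close> and has the kernel \<open>L\<^sub>j\<^sub>+\<^sub>1\<close>, so
  applied to every entry it gives exact sequences \<open>0 \<rightarrow> N\<^sub>j\<^sub>+\<^sub>1 \<rightarrow> F\<^sub>j \<rightarrow> N\<^sub>j \<rightarrow> 0\<close>
  (\<open>columns_short_exact\<close>).

  The cover \<open>F\<^sub>j\<close> is \<open>Ae\<^sub>j \<otimes>\<^sub>k L\<^sub>j\<close> for the idempotent matrix \<open>e\<^sub>j\<close>.  Over \<open>k\<close> the multiplication map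
  splits, by \<open>x \<mapsto> 1 \<otimes> x\<close>; hence \<open>L\<^sub>j\<^sub>+\<^sub>1\<close> is a direct summand of \<open>S \<otimes>\<^sub>k L\<^sub>j\<close> and all \<open>L\<^sub>j\<close> are flat over
  \<open>k\<close>.  So \<open>F\<^sub>j\<close> is flat over \<open>A\<close> (\<open>Fcols_flat\<close>), and dimension shifting identifies the Tor group of degree
  \<open>i + 1\<close> of any right module \<open>X\<close> and \<open>N\<close> with the kernel of \<open>X \<otimes> N\<^sub>i\<^sub>+\<^sub>1 \<rightarrow> X \<otimes> F\<^sub>i\<close> (\<open>Tor_res_N\<close>).

  For the module \<open>M\<close> of rows all these tensor products are computed by the pairing of a row with a column.
  It is injective on \<open>M \<otimes> F\<^sub>i\<close>.  It identifies \<open>M \<otimes> N\<^sub>j\<close> with \<open>L\<^sub>j\<close> if \<open>j < n - 1\<close>, where matrix units of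
  \<open>A\<close> move an entry from one row to another.  If \<open>j = n - 1\<close>, only one entry is left, \<open>M \<otimes> N\<^sub>j\<close> is
  \<open>S \<otimes>\<^sub>k L\<^sub>j\<close>, and the pairing is the multiplication map.  For \<open>j \<ge> n\<close> the module \<open>N\<^sub>j\<close> is zero.
  Therefore \<open>M \<otimes> N\<close> is \<open>S\<close>, and the kernel in question vanishes unless \<open>i + 1 = n - 1\<close>, when it is the
  kernel of the multiplication map on \<open>S \<otimes>\<^sub>k L\<^sub>n\<^sub>-\<^sub>1\<close>.

  As \<open>A\<close>-modules, the matrix ring over \<open>S\<close> is on the right a direct sum of \<open>n\<close> copies of \<open>M\<close> and on the left
  a direct sum of \<open>n\<close> copies of \<open>N\<close>; the second formula is additivity of Tor.
\<close>

section \<open>Modules and their homomorphisms\<close>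

lemma left_moduleD:
  assumes "left_module R L"
  shows left_module_ring: "ring R" and left_module_group: "comm_group L"
    and left_module_closed: "\<And>a x. a \<in> carrier R \<Longrightarrow> x \<in> carrier L \<Longrightarrow> act L a x \<in> carrier L"
    and left_module_add: "\<And>a x y. a \<in> carrier R \<Longrightarrow> x \<in> carrier L \<Longrightarrow> y \<in> carrier L \<Longrightarrow>
       act L a (x \<otimes>\<^bsub>L\<^esub> y) = act L a x \<otimes>\<^bsub>L\<^esub> act L a y"
    and left_module_scal: "\<And>a b x. a \<in> carrier R \<Longrightarrow> b \<in> carrier R \<Longrightarrow> x \<in> carrier L \<Longrightarrow>
       act L (a \<oplus>\<^bsub>R\<^esub> b) x = act L a x \<otimes>\<^bsub>L\<^esub> act L b x"
    and left_module_assoc: "\<And>a b x. a \<in> carrier R \<Longrightarrow> b \<in> carrier R \<Longrightarrow> x \<in> carrier L \<Longrightarrow>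
       act L (a \<otimes>\<^bsub>R\<^esub> b) x = act L a (act L b x)"
    and left_module_one: "\<And>x. x \<in> carrier L \<Longrightarrow> act L \<one>\<^bsub>R\<^esub> x = x"
  using assms by (simp_all add: left_module_def)

lemma right_moduleD:
  assumes "right_module R X"
  shows right_module_ring: "ring R" and right_module_group: "comm_group X"
    and right_module_closed: "\<And>a x. a \<in> carrier R \<Longrightarrow> x \<in> carrier X \<Longrightarrow> act X a x \<in> carrier X"
    and right_module_add: "\<And>a x y. a \<in> carrier R \<Longrightarrow> x \<in> carrier X \<Longrightarrow> y \<in> carrier X \<Longrightarrow>
       act X a (x \<otimes>\<^bsub>X\<^esub> y) = act X a x \<otimes>\<^bsub>X\<^esub> act X a y"
    and right_module_scal: "\<And>a b x. a \<in> carrier R \<Longrightarrow> b \<in> carrier R \<Longrightarrow> x \<in> carrier X \<Longrightarrow>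
       act X (a \<oplus>\<^bsub>R\<^esub> b) x = act X a x \<otimes>\<^bsub>X\<^esub> act X b x"
    and right_module_assoc: "\<And>a b x. a \<in> carrier R \<Longrightarrow> b \<in> carrier R \<Longrightarrow> x \<in> carrier X \<Longrightarrow>
       act X (a \<otimes>\<^bsub>R\<^esub> b) x = act X b (act X a x)"
    and right_module_one: "\<And>x. x \<in> carrier X \<Longrightarrow> act X \<one>\<^bsub>R\<^esub> x = x"
  using assms by (simp_all add: right_module_def)

lemma comm_group_homI:
  assumes "comm_group G" "comm_group H" "h \<in> hom G H"
  shows "group_hom G H h"
  using assms by (simp add: group_hom_def group_hom_axioms_def comm_group.axioms)

lemma hom_inj_onI:
  assumes "comm_group G" "comm_group H" "h \<in> hom G H"
    and "\<And>x. x \<in> carrier G \<Longrightarrow> h x = \<one>\<^bsub>H\<^esub> \<Longrightarrow> x = \<one>\<^bsub>G\<^esub>"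
  shows "inj_on h (carrier G)"
  using comm_group_homI[OF assms(1-3)] assms(4) by (simp add: group_hom.inj_on_one_iff)

lemma hom_finprod:
  assumes "comm_group G" "comm_group H" "h \<in> hom G H" "f \<in> A \<rightarrow> carrier G"
  shows "h (finprod G f A) = finprod H (\<lambda>i. h (f i)) A"
proof -
  interpret G: comm_group G by fact
  interpret H: comm_group H by fact
  interpret group_hom G H h by (rule comm_group_homI) fact+
  show ?thesis using assms(4)
  proof (induction A rule: infinite_finite_induct)
    case (insert a A)
    then have "h (finprod G f A) = finprod H (\<lambda>i. h (f i)) A" by auto
    moreover have "f \<in> A \<rightarrow> carrier G" "f a \<in> carrier G" using insert by auto
    ultimately show ?case using insert by (auto simp: Pi_iff)
  qed auto
qed

lemma hom_finprod_pointwise: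
  assumes H: "comm_group H" and f: "\<And>i. i \<in> I \<Longrightarrow> f i \<in> hom G H"
  shows "(\<lambda>x. finprod H (\<lambda>i. f i x) I) \<in> hom G H"
proof -
  interpret comm_group H by fact
  show ?thesis
  proof (rule homI)
    show "finprod H (\<lambda>i. f i x) I \<in> carrier H" if "x \<in> carrier G" for x
      using that hom_in_carrier[OF f] by (intro finprod_closed) auto
    show "finprod H (\<lambda>i. f i (x \<otimes>\<^bsub>G\<^esub> y)) I = finprod H (\<lambda>i. f i x) I \<otimes>\<^bsub>H\<^esub> finprod H (\<lambda>i. f i y) I"
      if xy: "x \<in> carrier G" "y \<in> carrier G" for x y
    proof -
      have c: "(\<lambda>i. f i x) \<in> I \<rightarrow> carrier H" "(\<lambda>i. f i y) \<in> I \<rightarrow> carrier H" using hom_in_carrier[OF f] xy by auto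
      have "finprod H (\<lambda>i. f i (x \<otimes>\<^bsub>G\<^esub> y)) I = finprod H (\<lambda>i. f i x \<otimes>\<^bsub>H\<^esub> f i y) I"
        by (rule finprod_cong') (use c hom_mult[OF f] xy in \<open>auto simp: Pi_iff\<close>)
      then show ?thesis using finprod_multf[OF c] by simp
    qed
  qed
qed

lemma module_homD:
  assumes "h \<in> module_hom R X Y"
  shows module_hom_hom: "h \<in> hom X Y"
    and module_hom_act: "\<And>a x. a \<in> carrier R \<Longrightarrow> x \<in> carrier X \<Longrightarrow> h (act X a x) = act Y a (h x)"
    and module_hom_closed: "\<And>x. x \<in> carrier X \<Longrightarrow> h x \<in> carrier Y"
    and module_hom_mult: "\<And>x y. x \<in> carrier X \<Longrightarrow> y \<in> carrier X \<Longrightarrow> h (x \<otimes>\<^bsub>X\<^esub> y) = h x \<otimes>\<^bsub>Y\<^esub> h y"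
  using assms by (auto simp: module_hom_def hom_def)

lemma module_homI:
  assumes "\<And>x. x \<in> carrier X \<Longrightarrow> h x \<in> carrier Y"
    and "\<And>x y. x \<in> carrier X \<Longrightarrow> y \<in> carrier X \<Longrightarrow> h (x \<otimes>\<^bsub>X\<^esub> y) = h x \<otimes>\<^bsub>Y\<^esub> h y"
    and "\<And>a x. a \<in> carrier R \<Longrightarrow> x \<in> carrier X \<Longrightarrow> h (act X a x) = act Y a (h x)"
  shows "h \<in> module_hom R X Y"
  using assms by (auto simp: module_hom_def hom_def)

lemma module_hom_id: "(\<lambda>x. x) \<in> module_hom R X X"
  by (simp add: module_homI)

lemma module_hom_comp:
  assumes "g \<in> module_hom R X Y" "h \<in> module_hom R Y Z"
  shows "(\<lambda>x. h (g x)) \<in> module_hom R X Z"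
  using module_homD[OF assms(1)] module_homD[OF assms(2)] by (intro module_homI) auto

lemma left_module_hom_action:
  assumes "left_module R L" "a \<in> carrier R" shows "act L a \<in> hom L L"
  using left_moduleD[OF assms(1)] assms(2) by (auto simp: hom_def)

lemma right_module_hom_action:
  assumes "right_module R X" "a \<in> carrier R" shows "act X a \<in> hom X X"
  using right_moduleD[OF assms(1)] assms(2) by (auto simp: hom_def)

lemma left_module_hom_scalar:
  assumes "left_module R L" "x \<in> carrier L" shows "(\<lambda>a. act L a x) \<in> hom (add_monoid R) L"
  using left_moduleD[OF assms(1)] assms(2) by (auto simp: hom_def)

lemma right_module_hom_scalar:
  assumes "right_module R L" "x \<in> carrier L" shows "(\<lambda>a. act L a x) \<in> hom (add_monoid R) L"
  using right_moduleD[OF assms(1)] assms(2) by (auto simp: hom_def)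

lemma ring_add_comm_group: "ring R \<Longrightarrow> comm_group (add_monoid R)"
  by (meson abelian_group.a_comm_group ring_def)

lemma comm_hom_one:
  assumes "h \<in> hom G H" "comm_group G" "comm_group H"
  shows "h \<one>\<^bsub>G\<^esub> = \<one>\<^bsub>H\<^esub>"
  using hom_one[OF assms(1)] assms(2,3) by (simp add: comm_group.axioms)

lemma left_module_act_one:
  assumes "left_module R L" "a \<in> carrier R" shows "act L a \<one>\<^bsub>L\<^esub> = \<one>\<^bsub>L\<^esub>"
  using comm_hom_one[OF left_module_hom_action[OF assms]] assms left_module_group by blast

lemma right_module_act_one:
  assumes "right_module R L" "a \<in> carrier R" shows "act L a \<one>\<^bsub>L\<^esub> = \<one>\<^bsub>L\<^esub>"
  using comm_hom_one[OF right_module_hom_action[OF assms]] assms right_module_group by blast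

lemma left_module_act_zero:
  assumes "left_module R L" "x \<in> carrier L" shows "act L \<zero>\<^bsub>R\<^esub> x = \<one>\<^bsub>L\<^esub>"
  using comm_hom_one[OF left_module_hom_scalar[OF assms] ring_add_comm_group]
    left_moduleD(1,2)[OF assms(1)] by simp

lemma right_module_act_zero:
  assumes "right_module R L" "x \<in> carrier L" shows "act L \<zero>\<^bsub>R\<^esub> x = \<one>\<^bsub>L\<^esub>"
  using comm_hom_one[OF right_module_hom_scalar[OF assms] ring_add_comm_group]
    right_moduleD(1,2)[OF assms(1)] by simp

section \<open>Tensor products\<close>

abbreviation tensor_generators :: "('r, 'm) rmodule \<Rightarrow> ('r, 'n) rmodule \<Rightarrow> ('m \<times> 'n \<Rightarrow>\<^sub>0 int) monoid" where
  "tensor_generators X L \<equiv> free_Abelian_group (carrier X \<times> carrier L)"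

definition tensor_class ::
  "'r ring \<Rightarrow> ('r, 'm) rmodule \<Rightarrow> ('r, 'n) rmodule \<Rightarrow> ('m \<times> 'n \<Rightarrow>\<^sub>0 int) \<Rightarrow> ('m \<times> 'n \<Rightarrow>\<^sub>0 int) set" where
  "tensor_class R X L c = tensor_subgroup R X L #>\<^bsub>tensor_generators X L\<^esub> c"

lemma pure_tensor_class: "pure_tensor R X L x y = tensor_class R X L (frag_of (x, y))"
  by (simp add: pure_tensor_def tensor_class_def)

lemma tensor_relations_subset:
  assumes X: "right_module R X" and L: "left_module R L"
  shows "tensor_relations R X L \<subseteq> carrier (tensor_generators X L)"
proof -
  interpret comm_group X using right_moduleD[OF X] by simp
  interpret L: comm_group L using left_moduleD[OF L] by simp
  have d: "\<And>a b c K. Poly_Mapping.keys a \<subseteq> K \<Longrightarrow> Poly_Mapping.keys b \<subseteq> K \<Longrightarrow> Poly_Mapping.keys c \<subseteq> K \<Longrightarrow> Poly_Mapping.keys (a - b - c) \<subseteq> K"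
    "\<And>a b K. Poly_Mapping.keys a \<subseteq> K \<Longrightarrow> Poly_Mapping.keys b \<subseteq> K \<Longrightarrow> Poly_Mapping.keys (a - b) \<subseteq> K" for K :: "('b \<times> 'c) set" and a b c :: "'b \<times> 'c \<Rightarrow>\<^sub>0 int"
    by (meson keys_diff Un_least order_trans)+
  show ?thesis
    unfolding tensor_relations_def
    using right_moduleD[OF X] left_moduleD[OF L]
    by (auto intro!: d simp del: keys_frag_of dest!: subsetD[OF keys_diff])
qed

lemma subgroup_tensor_subgroup:
  assumes "right_module R X" "left_module R L"
  shows "subgroup (tensor_subgroup R X L) (tensor_generators X L)"
  unfolding tensor_subgroup_def
  by (intro group.generate_is_subgroup tensor_relations_subset assms) simp

lemma normal_tensor_subgroup:
  assumes "right_module R X" "left_module R L"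
  shows "tensor_subgroup R X L \<lhd> tensor_generators X L"
  using subgroup_tensor_subgroup[OF assms] abelian_free_Abelian_group comm_group.normal_iff_subgroup by blast

lemma comm_group_tensor:
  assumes "right_module R X" "left_module R L"
  shows "comm_group (tensor R X L)"
  unfolding tensor_def
  by (intro comm_group.abelian_FactGroup abelian_free_Abelian_group subgroup_tensor_subgroup assms)

lemma tensor_class_hom:
  assumes "right_module R X" "left_module R L"
  shows "tensor_class R X L \<in> hom (tensor_generators X L) (tensor R X L)"
  unfolding tensor_def tensor_class_def
  using normal.r_coset_hom_Mod[OF normal_tensor_subgroup[OF assms]] .

lemma tensor_carrier: "carrier (tensor R X L) = tensor_class R X L ` carrier (tensor_generators X L)"
  unfolding tensor_def tensor_class_def by (simp add: carrier_FactGroup)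

lemma tensor_one:
  assumes "right_module R X" "left_module R L"
  shows "\<one>\<^bsub>tensor R X L\<^esub> = tensor_subgroup R X L"
  by (simp add: tensor_def)

lemma tensor_class_eq_one_iff:
  assumes "right_module R X" "left_module R L" "c \<in> carrier (tensor_generators X L)"
  shows "tensor_class R X L c = \<one>\<^bsub>tensor R X L\<^esub> \<longleftrightarrow> c \<in> tensor_subgroup R X L"
  unfolding tensor_one[OF assms(1,2)] tensor_class_def
  using group.coset_join1[OF group_free_Abelian_group _ assms(3)]
    group.coset_join2[OF group_free_Abelian_group assms(3)] subgroup_tensor_subgroup[OF assms(1,2)]
  by (metis subgroup.subset subgroup.subgroup_is_group group.rcos_self assms(3) group_free_Abelian_group)

lemma tensor_class_relation:
  assumes "right_module R X" "left_module R L" "c \<in> tensor_relations R X L"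
  shows "tensor_class R X L c = \<one>\<^bsub>tensor R X L\<^esub>"
proof -
  have "c \<in> carrier (tensor_generators X L)" using assms(3) tensor_relations_subset[OF assms(1,2)] by blast
  moreover have "c \<in> tensor_subgroup R X L" unfolding tensor_subgroup_def using assms(3) by (rule generate.incl)
  ultimately show ?thesis using tensor_class_eq_one_iff[OF assms(1,2)] by blast
qed

lemma tensor_class_diff:
  assumes "right_module R X" "left_module R L"
    "c \<in> carrier (tensor_generators X L)" "d \<in> carrier (tensor_generators X L)"
    "tensor_class R X L (c - d) = \<one>\<^bsub>tensor R X L\<^esub>"
  shows "tensor_class R X L c = tensor_class R X L d"
proof -
  interpret comm_group "tensor R X L" using assms comm_group_tensor by blast
  have m: "c - d \<in> carrier (tensor_generators X L)"
    using assms keys_diff[of c d] by auto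
  have "tensor_class R X L (c - d + d) = tensor_class R X L (c - d) \<otimes>\<^bsub>tensor R X L\<^esub> tensor_class R X L d"
    using hom_mult[OF tensor_class_hom[OF assms(1,2)] m assms(4)] by simp
  then show ?thesis using assms hom_in_carrier[OF tensor_class_hom[OF assms(1,2)] assms(4)] by simp
qed

lemma pure_tensor_closed:
  assumes "right_module R X" "left_module R L" "x \<in> carrier X" "y \<in> carrier L"
  shows "pure_tensor R X L x y \<in> carrier (tensor R X L)"
  unfolding pure_tensor_class tensor_carrier using assms by simp

lemma pure_tensor_mult_left:
  assumes "right_module R X" "left_module R L" "x \<in> carrier X" "x' \<in> carrier X" "y \<in> carrier L"
  shows "pure_tensor R X L (x \<otimes>\<^bsub>X\<^esub> x') y = pure_tensor R X L x y \<otimes>\<^bsub>tensor R X L\<^esub> pure_tensor R X L x' y"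
proof -
  interpret comm_group X using right_moduleD[OF assms(1)] by simp
  have k: "Poly_Mapping.keys (frag_of (x, y) + frag_of (x', y)) \<subseteq> carrier X \<times> carrier L"
    using assms keys_add[of "frag_of (x, y)" "frag_of (x', y)"] by auto
  have "frag_of (x \<otimes>\<^bsub>X\<^esub> x', y) - frag_of (x, y) - frag_of (x', y) \<in> tensor_relations R X L"
    unfolding tensor_relations_def using assms(3-5) by blast
  from tensor_class_relation[OF assms(1,2) this]
  have "tensor_class R X L (frag_of (x \<otimes>\<^bsub>X\<^esub> x', y) - (frag_of (x, y) + frag_of (x', y))) = \<one>\<^bsub>tensor R X L\<^esub>"
    by (simp add: diff_diff_eq)
  from tensor_class_diff[OF assms(1,2) _ _ this]
  have "tensor_class R X L (frag_of (x \<otimes>\<^bsub>X\<^esub> x', y)) = tensor_class R X L (frag_of (x, y) + frag_of (x', y))"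
    using assms k by simp
  also have "\<dots> = tensor_class R X L (frag_of (x, y)) \<otimes>\<^bsub>tensor R X L\<^esub> tensor_class R X L (frag_of (x', y))"
    using hom_mult[OF tensor_class_hom[OF assms(1,2)], of "frag_of (x, y)" "frag_of (x', y)"] assms by simp
  finally show ?thesis unfolding pure_tensor_class .
qed

lemma pure_tensor_mult_right:
  assumes "right_module R X" "left_module R L" "x \<in> carrier X" "y \<in> carrier L" "y' \<in> carrier L"
  shows "pure_tensor R X L x (y \<otimes>\<^bsub>L\<^esub> y') = pure_tensor R X L x y \<otimes>\<^bsub>tensor R X L\<^esub> pure_tensor R X L x y'"
proof -
  interpret comm_group L using left_moduleD[OF assms(2)] by simp
  have k: "Poly_Mapping.keys (frag_of (x, y) + frag_of (x, y')) \<subseteq> carrier X \<times> carrier L"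
    using assms keys_add[of "frag_of (x, y)" "frag_of (x, y')"] by auto
  have "frag_of (x, y \<otimes>\<^bsub>L\<^esub> y') - frag_of (x, y) - frag_of (x, y') \<in> tensor_relations R X L"
    unfolding tensor_relations_def using assms(3-5) by blast
  from tensor_class_relation[OF assms(1,2) this]
  have "tensor_class R X L (frag_of (x, y \<otimes>\<^bsub>L\<^esub> y') - (frag_of (x, y) + frag_of (x, y'))) = \<one>\<^bsub>tensor R X L\<^esub>"
    by (simp add: diff_diff_eq)
  from tensor_class_diff[OF assms(1,2) _ _ this]
  have "tensor_class R X L (frag_of (x, y \<otimes>\<^bsub>L\<^esub> y')) = tensor_class R X L (frag_of (x, y) + frag_of (x, y'))"
    using assms k by simp
  also have "\<dots> = tensor_class R X L (frag_of (x, y)) \<otimes>\<^bsub>tensor R X L\<^esub> tensor_class R X L (frag_of (x, y'))"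
    using hom_mult[OF tensor_class_hom[OF assms(1,2)], of "frag_of (x, y)" "frag_of (x, y')"] assms by simp
  finally show ?thesis unfolding pure_tensor_class .
qed

lemma pure_tensor_act:
  assumes "right_module R X" "left_module R L" "a \<in> carrier R" "x \<in> carrier X" "y \<in> carrier L"
  shows "pure_tensor R X L (act X a x) y = pure_tensor R X L x (act L a y)"
  unfolding pure_tensor_class
proof (rule tensor_class_diff[OF assms(1,2)])
  have "frag_of (act X a x, y) - frag_of (x, act L a y) \<in> tensor_relations R X L"
    unfolding tensor_relations_def using assms(3-5) by blast
  from tensor_class_relation[OF assms(1,2) this]
  show "tensor_class R X L (frag_of (act X a x, y) - frag_of (x, act L a y)) = \<one>\<^bsub>tensor R X L\<^esub>" .
qed (use assms right_moduleD[OF assms(1)] left_moduleD[OF assms(2)] in auto)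

lemma pure_tensor_hom_left:
  assumes "right_module R X" "left_module R L" "y \<in> carrier L"
  shows "(\<lambda>x. pure_tensor R X L x y) \<in> hom X (tensor R X L)"
  using assms by (intro homI) (auto simp: pure_tensor_closed pure_tensor_mult_left)

lemma pure_tensor_hom_right:
  assumes "right_module R X" "left_module R L" "x \<in> carrier X"
  shows "pure_tensor R X L x \<in> hom L (tensor R X L)"
  using assms by (intro homI) (auto simp: pure_tensor_closed pure_tensor_mult_right)

lemma pure_tensor_one_left:
  assumes "right_module R X" "left_module R L" "y \<in> carrier L"
  shows "pure_tensor R X L \<one>\<^bsub>X\<^esub> y = \<one>\<^bsub>tensor R X L\<^esub>"
  using comm_hom_one[OF pure_tensor_hom_left[OF assms]] comm_group_tensor[OF assms(1,2)] assms(1)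
  by (simp add: right_module_group)

lemma pure_tensor_one_right:
  assumes "right_module R X" "left_module R L" "x \<in> carrier X"
  shows "pure_tensor R X L x \<one>\<^bsub>L\<^esub> = \<one>\<^bsub>tensor R X L\<^esub>"
  using comm_hom_one[OF pure_tensor_hom_right[OF assms]] comm_group_tensor[OF assms(1,2)] assms(2)
  by (simp add: left_module_group)

lemma tensor_induct:
  assumes "right_module R X" "left_module R L" and U: "subgroup U (tensor R X L)"
    and pure: "\<And>x y. x \<in> carrier X \<Longrightarrow> y \<in> carrier L \<Longrightarrow> pure_tensor R X L x y \<in> U"
    and t: "t \<in> carrier (tensor R X L)"
  shows "t \<in> U"
proof -
  interpret T: comm_group "tensor R X L" using assms comm_group_tensor by blast
  interpret h: group_hom "tensor_generators X L" "tensor R X L" "tensor_class R X L"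
    by (rule comm_group_homI) (use assms in \<open>simp_all add: abelian_free_Abelian_group T.comm_group_axioms tensor_class_hom\<close>)
  obtain c where c: "Poly_Mapping.keys c \<subseteq> carrier X \<times> carrier L" and tc: "t = tensor_class R X L c"
    using t unfolding tensor_carrier by auto
  have "tensor_class R X L c \<in> U"
  proof (rule free_Abelian_group_induct[OF c])
    show "tensor_class R X L 0 \<in> U" using h.hom_one subgroup.one_closed[OF U] by simp
  next
    fix c d assume cd: "Poly_Mapping.keys c \<subseteq> carrier X \<times> carrier L" "Poly_Mapping.keys d \<subseteq> carrier X \<times> carrier L"
      "tensor_class R X L c \<in> U" "tensor_class R X L d \<in> U"
    have "tensor_class R X L (c + (- d)) = tensor_class R X L c \<otimes>\<^bsub>tensor R X L\<^esub> inv\<^bsub>tensor R X L\<^esub> tensor_class R X L d"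
      using h.hom_mult[of c "- d"] h.hom_inv[of d] cd by simp
    then show "tensor_class R X L (c - d) \<in> U"
      using cd subgroup.m_closed[OF U] subgroup.m_inv_closed[OF U] by simp
  next
    fix p assume "p \<in> carrier X \<times> carrier L"
    then show "tensor_class R X L (frag_of p) \<in> U" using pure unfolding pure_tensor_class by auto
  qed
  then show ?thesis by (simp add: tc)
qed

lemma subgroup_equalizer:
  assumes "comm_group G" "comm_group H" "f \<in> hom G H" "g \<in> hom G H"
  shows "subgroup {t \<in> carrier G. f t = g t} G"
proof -
  interpret f: group_hom G H f using assms by (intro comm_group_homI)
  interpret g: group_hom G H g using assms by (intro comm_group_homI)
  show ?thesis by unfold_locales auto
qed

lemma tensor_hom_eqI:
  assumes "right_module R X" "left_module R L" "comm_group G"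
    "f \<in> hom (tensor R X L) G" "g \<in> hom (tensor R X L) G"
    and "\<And>x y. x \<in> carrier X \<Longrightarrow> y \<in> carrier L \<Longrightarrow> f (pure_tensor R X L x y) = g (pure_tensor R X L x y)"
    and "t \<in> carrier (tensor R X L)"
  shows "f t = g t"
  using tensor_induct[OF assms(1,2) subgroup_equalizer[OF comm_group_tensor[OF assms(1,2)] assms(3-5)] _ assms(7)]
    assms(6) pure_tensor_closed[OF assms(1,2)] by blast

definition balanced ::
  "'r ring \<Rightarrow> ('r, 'm) rmodule \<Rightarrow> ('r, 'n) rmodule \<Rightarrow> ('g, 'z) monoid_scheme \<Rightarrow> ('m \<Rightarrow> 'n \<Rightarrow> 'g) \<Rightarrow> bool" where
  "balanced R X L G \<beta> \<longleftrightarrow>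
    (\<forall>x\<in>carrier X. \<beta> x \<in> hom L G) \<and> (\<forall>y\<in>carrier L. (\<lambda>x. \<beta> x y) \<in> hom X G) \<and>
    (\<forall>a\<in>carrier R. \<forall>x\<in>carrier X. \<forall>y\<in>carrier L. \<beta> (act X a x) y = \<beta> x (act L a y))"

lemma balancedI:
  assumes "\<And>x y. x \<in> carrier X \<Longrightarrow> y \<in> carrier L \<Longrightarrow> \<beta> x y \<in> carrier G"
    and "\<And>x y y'. x \<in> carrier X \<Longrightarrow> y \<in> carrier L \<Longrightarrow> y' \<in> carrier L \<Longrightarrow> \<beta> x (y \<otimes>\<^bsub>L\<^esub> y') = \<beta> x y \<otimes>\<^bsub>G\<^esub> \<beta> x y'"
    and "\<And>x x' y. x \<in> carrier X \<Longrightarrow> x' \<in> carrier X \<Longrightarrow> y \<in> carrier L \<Longrightarrow> \<beta> (x \<otimes>\<^bsub>X\<^esub> x') y = \<beta> x y \<otimes>\<^bsub>G\<^esub> \<beta> x' y"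
    and "\<And>a x y. a \<in> carrier R \<Longrightarrow> x \<in> carrier X \<Longrightarrow> y \<in> carrier L \<Longrightarrow> \<beta> (act X a x) y = \<beta> x (act L a y)"
  shows "balanced R X L G \<beta>"
  using assms by (auto simp: balanced_def hom_def)

text \<open>
  The value that \<open>tensor_lift\<close> assigns to a coset is the value of this function at any representative.
\<close>

definition linear_extension :: "('g, 'z) monoid_scheme \<Rightarrow> ('m \<Rightarrow> 'n \<Rightarrow> 'g) \<Rightarrow> ('m \<times> 'n \<Rightarrow>\<^sub>0 int) \<Rightarrow> 'g" where
  "linear_extension G \<beta> c = finprod G (\<lambda>(x, y). \<beta> x y [^]\<^bsub>G\<^esub> Poly_Mapping.lookup c (x, y)) (Poly_Mapping.keys c)"

lemma linear_extension_hom: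
  assumes "comm_group G" and \<beta>: "\<And>x y. (x, y) \<in> K \<Longrightarrow> \<beta> x y \<in> carrier G"
  shows "linear_extension G \<beta> \<in> hom (free_Abelian_group K) G"
proof -
  interpret comm_group G by fact
  have sup: "linear_extension G \<beta> c = finprod G (\<lambda>(x, y). \<beta> x y [^]\<^bsub>G\<^esub> Poly_Mapping.lookup c (x, y)) T"
    if "finite T" "Poly_Mapping.keys c \<subseteq> T" "T \<subseteq> K" for c T
    unfolding linear_extension_def
    by (rule finprod_mono_neutral_cong_left) (use that \<beta> in \<open>auto simp: Pi_iff in_keys_iff\<close>)
  show ?thesis
  proof (rule homI)
    fix c d assume cd: "c \<in> carrier (free_Abelian_group K)" "d \<in> carrier (free_Abelian_group K)"
    let ?T = "Poly_Mapping.keys c \<union> Poly_Mapping.keys d"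
    have T: "finite ?T" "?T \<subseteq> K" using cd by auto
    show "linear_extension G \<beta> (c \<otimes>\<^bsub>free_Abelian_group K\<^esub> d) = linear_extension G \<beta> c \<otimes>\<^bsub>G\<^esub> linear_extension G \<beta> d"
    proof -
      let ?f = "\<lambda>c (x, y). \<beta> x y [^]\<^bsub>G\<^esub> Poly_Mapping.lookup c (x, y)"
      have cl: "?f c \<in> ?T \<rightarrow> carrier G" for c :: "_ \<Rightarrow>\<^sub>0 int"
        using T \<beta> by (auto simp: Pi_iff subset_iff intro!: int_pow_closed)
      have "linear_extension G \<beta> (c + d) = finprod G (?f (c + d)) ?T"
        using T keys_add[of c d] by (intro sup) auto
      also have "\<dots> = finprod G (\<lambda>p. ?f c p \<otimes>\<^bsub>G\<^esub> ?f d p) ?T"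
      proof (rule finprod_cong')
        show "(\<lambda>p. ?f c p \<otimes>\<^bsub>G\<^esub> ?f d p) \<in> ?T \<rightarrow> carrier G" using cl[of c] cl[of d] by (simp add: Pi_iff)
        show "?f (c + d) p = ?f c p \<otimes>\<^bsub>G\<^esub> ?f d p" if "p \<in> ?T" for p
        proof -
          obtain x y where p: "p = (x, y)" by (cases p)
          then have "\<beta> x y \<in> carrier G" using that T \<beta> by blast
          then show ?thesis by (simp add: p Poly_Mapping.lookup_add int_pow_mult)
        qed
      qed simp
      also have "\<dots> = finprod G (?f c) ?T \<otimes>\<^bsub>G\<^esub> finprod G (?f d) ?T"
        by (rule finprod_multf[OF cl cl])
      also have "\<dots> = linear_extension G \<beta> c \<otimes>\<^bsub>G\<^esub> linear_extension G \<beta> d"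
        using sup[of ?T c] sup[of ?T d] T by simp
      finally show ?thesis by simp
    qed
  qed (use \<beta> in \<open>auto simp: linear_extension_def Pi_iff subset_iff intro!: finprod_closed\<close>)
qed

lemma linear_extension_frag_of:
  assumes "comm_group G" "\<beta> x y \<in> carrier G"
  shows "linear_extension G \<beta> (frag_of (x, y)) = \<beta> x y"
proof -
  interpret comm_group G by fact
  have "linear_extension G \<beta> (frag_of (x, y)) = finprod G (\<lambda>_. \<beta> x y) {(x, y)}"
    unfolding linear_extension_def using assms
    by (intro finprod_cong') auto
  then show ?thesis using assms by simp
qed

text \<open>
  Each of the three kinds of relations expresses one of the conditions on a balanced map.
\<close>

lemma linear_extension_tensor_subgroup:
  assumes X: "right_module R X" and L: "left_module R L" and G: "comm_group G" and b: "balanced R X L G \<beta>"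
    and c: "c \<in> tensor_subgroup R X L"
  shows "linear_extension G \<beta> c = \<one>\<^bsub>G\<^esub>"
proof -
  interpret G: comm_group G by fact
  interpret X: comm_group X using right_moduleD[OF X] by simp
  interpret L: comm_group L using left_moduleD[OF L] by simp
  note bd = b[unfolded balanced_def hom_def Pi_iff]
  have \<beta>: "\<beta> x y \<in> carrier G" if "x \<in> carrier X" "y \<in> carrier L" for x y
    using bd that by blast
  have h: "linear_extension G \<beta> \<in> hom (tensor_generators X L) G"
    by (rule linear_extension_hom[OF G]) (use \<beta> in auto)
  interpret h: group_hom "tensor_generators X L" G "linear_extension G \<beta>"
    by (rule comm_group_homI[OF abelian_free_Abelian_group G h])
  have dif: "linear_extension G \<beta> (c - d) = linear_extension G \<beta> c \<otimes>\<^bsub>G\<^esub> inv\<^bsub>G\<^esub> linear_extension G \<beta> d"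
    if "Poly_Mapping.keys c \<subseteq> carrier X \<times> carrier L" "Poly_Mapping.keys d \<subseteq> carrier X \<times> carrier L" for c d
    using h.hom_mult[of c "- d"] h.hom_inv[of d] that by simp
  have fr: "linear_extension G \<beta> (frag_of (x, y)) = \<beta> x y" if "x \<in> carrier X" "y \<in> carrier L" for x y
    using linear_extension_frag_of[OF G, of \<beta> x y] \<beta> that by simp
  have k2: "Poly_Mapping.keys (c - d) \<subseteq> carrier X \<times> carrier L"
    if "Poly_Mapping.keys c \<subseteq> carrier X \<times> carrier L" "Poly_Mapping.keys d \<subseteq> carrier X \<times> carrier L" for c d :: "_ \<Rightarrow>\<^sub>0 int"
    using that keys_diff[of c d] by auto
  have "linear_extension G \<beta> r = \<one>\<^bsub>G\<^esub>" if "r \<in> tensor_relations R X L" for r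
  proof -
    from that consider
      (1) x x' y where "r = frag_of (x \<otimes>\<^bsub>X\<^esub> x', y) - frag_of (x, y) - frag_of (x', y)"
        "x \<in> carrier X" "x' \<in> carrier X" "y \<in> carrier L"
      | (2) x y y' where "r = frag_of (x, y \<otimes>\<^bsub>L\<^esub> y') - frag_of (x, y) - frag_of (x, y')"
        "x \<in> carrier X" "y \<in> carrier L" "y' \<in> carrier L"
      | (3) a x y where "r = frag_of (act X a x, y) - frag_of (x, act L a y)"
        "a \<in> carrier R" "x \<in> carrier X" "y \<in> carrier L"
      unfolding tensor_relations_def by blast
    then show ?thesis
    proof cases
      case 1
      have "\<beta> (x \<otimes>\<^bsub>X\<^esub> x') y = \<beta> x y \<otimes>\<^bsub>G\<^esub> \<beta> x' y" using bd 1 by blast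
      then show ?thesis using 1 \<beta> by (simp add: dif fr k2) (simp add: G.m_ac G.inv_mult_group)
    next
      case 2
      have "\<beta> x (y \<otimes>\<^bsub>L\<^esub> y') = \<beta> x y \<otimes>\<^bsub>G\<^esub> \<beta> x y'" using bd 2 by blast
      then show ?thesis using 2 \<beta> by (simp add: dif fr k2) (simp add: G.m_ac G.inv_mult_group)
    next
      case 3
      have "\<beta> (act X a x) y = \<beta> x (act L a y)" using bd 3 by blast
      then show ?thesis using 3 \<beta> right_moduleD[OF X] left_moduleD[OF L] by (simp add: dif fr k2)
    qed
  qed
  then have "tensor_relations R X L \<subseteq> kernel (tensor_generators X L) G (linear_extension G \<beta>)"
    using tensor_relations_subset[OF X L] unfolding kernel_def by blast
  then have "tensor_subgroup R X L \<subseteq> kernel (tensor_generators X L) G (linear_extension G \<beta>)"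
    unfolding tensor_subgroup_def by (rule h.generate_subgroup_incl[OF _ h.subgroup_kernel])
  then show ?thesis using c by (auto simp: kernel_def)
qed

lemma tensor_lift_class:
  assumes X: "right_module R X" and L: "left_module R L" and G: "comm_group G" and b: "balanced R X L G \<beta>"
    and c: "c \<in> carrier (tensor_generators X L)"
  shows "tensor_lift G \<beta> (tensor_class R X L c) = linear_extension G \<beta> c"
proof -
  interpret G: comm_group G by fact
  have \<beta>: "\<beta> x y \<in> carrier G" if "x \<in> carrier X" "y \<in> carrier L" for x y
    using b that by (auto simp: balanced_def hom_def)
  have h: "linear_extension G \<beta> \<in> hom (tensor_generators X L) G"
    by (rule linear_extension_hom[OF G]) (use \<beta> in auto)
  have s: "r \<in> tensor_subgroup R X L \<Longrightarrow> r \<in> carrier (tensor_generators X L)" for r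
    using subgroup.subset[OF subgroup_tensor_subgroup[OF X L]] by blast
  have "linear_extension G \<beta> ` tensor_class R X L c = {linear_extension G \<beta> c}"
  proof -
    have "linear_extension G \<beta> (r \<otimes>\<^bsub>tensor_generators X L\<^esub> c) = linear_extension G \<beta> c" if "r \<in> tensor_subgroup R X L" for r
      using hom_mult[OF h s[OF that] c] linear_extension_tensor_subgroup[OF X L G b that] hom_in_carrier[OF h c] by simp
    moreover have "tensor_subgroup R X L \<noteq> {}"
      using subgroup.one_closed[OF subgroup_tensor_subgroup[OF X L]] by auto
    ultimately show ?thesis unfolding tensor_class_def r_coset_def by (simp add: image_UN)
  qed
  then show ?thesis unfolding tensor_lift_def linear_extension_def[symmetric] by (simp add: the_elem_def)
qed

lemma tensor_lift_hom:
  assumes X: "right_module R X" and L: "left_module R L" and G: "comm_group G" and b: "balanced R X L G \<beta>"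
  shows "tensor_lift G \<beta> \<in> hom (tensor R X L) G"
proof (rule homI)
  have \<beta>: "\<beta> x y \<in> carrier G" if "x \<in> carrier X" "y \<in> carrier L" for x y
    using b that by (auto simp: balanced_def hom_def)
  have h: "linear_extension G \<beta> \<in> hom (tensor_generators X L) G"
    by (rule linear_extension_hom[OF G]) (use \<beta> in auto)
  note l = tensor_lift_class[OF X L G b]
  show "tensor_lift G \<beta> t \<in> carrier G" if "t \<in> carrier (tensor R X L)" for t
    using that l hom_in_carrier[OF h] unfolding tensor_carrier by fastforce
  show "tensor_lift G \<beta> (t \<otimes>\<^bsub>tensor R X L\<^esub> t') = tensor_lift G \<beta> t \<otimes>\<^bsub>G\<^esub> tensor_lift G \<beta> t'"
    if tt: "t \<in> carrier (tensor R X L)" "t' \<in> carrier (tensor R X L)" for t t'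
  proof -
    obtain c c' where c: "c \<in> carrier (tensor_generators X L)" "c' \<in> carrier (tensor_generators X L)"
      "t = tensor_class R X L c" "t' = tensor_class R X L c'" using tt unfolding tensor_carrier by blast
    have m: "c \<otimes>\<^bsub>tensor_generators X L\<^esub> c' \<in> carrier (tensor_generators X L)"
      by (rule monoid.m_closed[OF group.is_monoid[OF group_free_Abelian_group] c(1,2)])
    show ?thesis
      unfolding c(3,4) hom_mult[OF tensor_class_hom[OF X L] c(1,2), symmetric] l[OF m] l[OF c(1)] l[OF c(2)]
      by (rule hom_mult[OF h c(1,2)])
  qed
qed

lemma tensor_lift_pure:
  assumes "right_module R X" "left_module R L" "comm_group G" and b: "balanced R X L G \<beta>"
    and xy: "x \<in> carrier X" "y \<in> carrier L"
  shows "tensor_lift G \<beta> (pure_tensor R X L x y) = \<beta> x y"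
  using tensor_lift_class[OF assms(1-4), of "frag_of (x, y)"] linear_extension_frag_of[OF assms(3), of \<beta> x y] xy b
  by (simp add: pure_tensor_class balanced_def hom_def Pi_iff)

lemma balanced_pure_tensor_map:
  assumes "right_module R X" "left_module R L" "right_module R X'" "left_module R L'"
    "g \<in> module_hom R X X'" "h \<in> module_hom R L L'"
  shows "balanced R X L (tensor R X' L') (\<lambda>x y. pure_tensor R X' L' (g x) (h y))"
  using module_homD[OF assms(5)] module_homD[OF assms(6)] assms(3,4)
  by (intro balancedI) (simp_all add: pure_tensor_closed pure_tensor_mult_left pure_tensor_mult_right pure_tensor_act)

lemma tensor_map_hom:
  assumes "right_module R X" "left_module R L" "right_module R X'" "left_module R L'"
    "g \<in> module_hom R X X'" "h \<in> module_hom R L L'"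
  shows "tensor_map R X' L' g h \<in> hom (tensor R X L) (tensor R X' L')"
  unfolding tensor_map_def
  by (intro tensor_lift_hom balanced_pure_tensor_map comm_group_tensor assms)

lemma tensor_map_pure:
  assumes "right_module R X" "left_module R L" "right_module R X'" "left_module R L'"
    "g \<in> module_hom R X X'" "h \<in> module_hom R L L'" "x \<in> carrier X" "y \<in> carrier L"
  shows "tensor_map R X' L' g h (pure_tensor R X L x y) = pure_tensor R X' L' (g x) (h y)"
  unfolding tensor_map_def
  by (rule tensor_lift_pure[OF assms(1,2) comm_group_tensor[OF assms(3,4)] balanced_pure_tensor_map[OF assms(1-6)] assms(7,8)])

abbreviation tensor_left ::
  "'r ring \<Rightarrow> ('r, 'm') rmodule \<Rightarrow> ('r, 'n) rmodule \<Rightarrow> ('m \<Rightarrow> 'm') \<Rightarrow>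
    ('m \<times> 'n \<Rightarrow>\<^sub>0 int) set \<Rightarrow> ('m' \<times> 'n \<Rightarrow>\<^sub>0 int) set" where
  "tensor_left R X' L g \<equiv> tensor_map R X' L g (\<lambda>y. y)"

abbreviation tensor_right ::
  "'r ring \<Rightarrow> ('r, 'm) rmodule \<Rightarrow> ('r, 'n') rmodule \<Rightarrow> ('n \<Rightarrow> 'n') \<Rightarrow>
    ('m \<times> 'n \<Rightarrow>\<^sub>0 int) set \<Rightarrow> ('m \<times> 'n' \<Rightarrow>\<^sub>0 int) set" where
  "tensor_right R X L' h \<equiv> tensor_map R X L' (\<lambda>x. x) h"

lemma tensor_map_comp:
  assumes "right_module R X" "left_module R L" "right_module R X'" "left_module R L'"
    "right_module R X''" "left_module R L''"
    "g \<in> module_hom R X X'" "h \<in> module_hom R L L'" "g' \<in> module_hom R X' X''" "h' \<in> module_hom R L' L''"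
    "t \<in> carrier (tensor R X L)"
  shows "tensor_map R X'' L'' g' h' (tensor_map R X' L' g h t) = tensor_map R X'' L'' (\<lambda>x. g' (g x)) (\<lambda>y. h' (h y)) t"
proof (rule tensor_hom_eqI[OF assms(1,2) comm_group_tensor[OF assms(5,6)] _ _ _ assms(11)])
  have "tensor_map R X'' L'' g' h' \<circ> tensor_map R X' L' g h \<in> hom (tensor R X L) (tensor R X'' L'')"
    by (rule hom_compose[OF tensor_map_hom[OF assms(1-4,7,8)] tensor_map_hom[OF assms(3-6,9,10)]])
  then show "(\<lambda>t. tensor_map R X'' L'' g' h' (tensor_map R X' L' g h t)) \<in> hom (tensor R X L) (tensor R X'' L'')"
    by (simp add: comp_def)
  show "tensor_map R X'' L'' (\<lambda>x. g' (g x)) (\<lambda>y. h' (h y)) \<in> hom (tensor R X L) (tensor R X'' L'')"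
    by (intro tensor_map_hom assms module_hom_comp[OF assms(7,9)] module_hom_comp[OF assms(8,10)])
  show "tensor_map R X'' L'' g' h' (tensor_map R X' L' g h (pure_tensor R X L x y)) =
      tensor_map R X'' L'' (\<lambda>x. g' (g x)) (\<lambda>y. h' (h y)) (pure_tensor R X L x y)"
    if "x \<in> carrier X" "y \<in> carrier L" for x y
    using tensor_map_pure[OF assms(1-4,7,8) that]
      tensor_map_pure[OF assms(3-6,9,10) module_hom_closed[OF assms(7) that(1)] module_hom_closed[OF assms(8) that(2)]]
      tensor_map_pure[OF assms(1,2,5,6) module_hom_comp[OF assms(7,9)] module_hom_comp[OF assms(8,10)] that]
    by simp
qed

lemma tensor_map_cong:
  assumes "right_module R X" "left_module R L" "right_module R X'" "left_module R L'"
    "g \<in> module_hom R X X'" "h \<in> module_hom R L L'" "g' \<in> module_hom R X X'" "h' \<in> module_hom R L L'"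
    "\<And>x. x \<in> carrier X \<Longrightarrow> g x = g' x" "\<And>y. y \<in> carrier L \<Longrightarrow> h y = h' y"
    "t \<in> carrier (tensor R X L)"
  shows "tensor_map R X' L' g h t = tensor_map R X' L' g' h' t"
  by (rule tensor_hom_eqI[OF assms(1,2) comm_group_tensor[OF assms(3,4)] tensor_map_hom[OF assms(1-6)]
        tensor_map_hom[OF assms(1-4,7,8)] _ assms(11)])
    (simp add: tensor_map_pure[OF assms(1-6)] tensor_map_pure[OF assms(1-4,7,8)] assms(9,10))

lemma tensor_map_id:
  assumes "right_module R X" "left_module R L" "t \<in> carrier (tensor R X L)"
  shows "tensor_map R X L (\<lambda>x. x) (\<lambda>y. y) t = t"
  by (rule tensor_hom_eqI[OF assms(1,2) comm_group_tensor[OF assms(1,2)]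
        tensor_map_hom[OF assms(1,2,1,2) module_hom_id module_hom_id] _ _ assms(3)])
    (simp_all add: tensor_map_pure[OF assms(1,2,1,2) module_hom_id module_hom_id] iso_imp_homomorphism iso_set_refl)

lemma tensor_map_id_cong:
  assumes "right_module R X" "left_module R L" "g \<in> module_hom R X X" "h \<in> module_hom R L L"
    "\<And>x. x \<in> carrier X \<Longrightarrow> g x = x" "\<And>y. y \<in> carrier L \<Longrightarrow> h y = y" "t \<in> carrier (tensor R X L)"
  shows "tensor_map R X L g h t = t"
  using tensor_map_cong[OF assms(1,2,1,2,3,4) module_hom_id module_hom_id] tensor_map_id[OF assms(1,2)] assms by simp

lemma tensor_map_eq_one:
  assumes m: "right_module R X" "left_module R L" "right_module R X'" "left_module R L'"
    and g: "g \<in> module_hom R X X'" and h: "h \<in> module_hom R L L'"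
    and z: "\<And>x y. x \<in> carrier X \<Longrightarrow> y \<in> carrier L \<Longrightarrow> g x = \<one>\<^bsub>X'\<^esub> \<or> h y = \<one>\<^bsub>L'\<^esub>"
    and t: "t \<in> carrier (tensor R X L)"
  shows "tensor_map R X' L' g h t = \<one>\<^bsub>tensor R X' L'\<^esub>"
proof (rule tensor_hom_eqI[OF m(1,2) comm_group_tensor[OF m(3,4)] tensor_map_hom[OF m g h] _ _ t])
  show "(\<lambda>_. \<one>\<^bsub>tensor R X' L'\<^esub>) \<in> hom (tensor R X L) (tensor R X' L')"
    using comm_group_tensor[OF m(3,4)] by (intro homI) (simp_all add: comm_group.axioms(2) group.is_monoid)
  show "tensor_map R X' L' g h (pure_tensor R X L x y) = \<one>\<^bsub>tensor R X' L'\<^esub>"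
    if "x \<in> carrier X" "y \<in> carrier L" for x y
    using z[OF that] pure_tensor_one_left[OF m(3,4) module_hom_closed[OF h that(2)]]
      pure_tensor_one_right[OF m(3,4) module_hom_closed[OF g that(1)]]
    unfolding tensor_map_pure[OF m g h that] by auto
qed

section \<open>Submodules and isomorphic copies\<close>

lemma comm_group_subgroup:
  assumes "comm_group G" "subgroup H G"
  shows "comm_group (G\<lparr>carrier := H\<rparr>)"
proof -
  interpret comm_group G by fact
  show ?thesis
    using assms(2) subgroup.mem_carrier[OF assms(2)]
    by (intro group.group_comm_groupI subgroup.subgroup_is_group) (auto simp: m_comm)
qed

definition stable_subgroup :: "'r ring \<Rightarrow> 'm set \<Rightarrow> ('r, 'm) rmodule \<Rightarrow> bool" where
  "stable_subgroup R H X \<longleftrightarrow> subgroup H X \<and> (\<forall>a\<in>carrier R. \<forall>x\<in>H. act X a x \<in> H)"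

lemma left_module_submodule:
  assumes "left_module R X" "stable_subgroup R H X"
  shows "left_module R (X\<lparr>carrier := H\<rparr>)"
  using assms comm_group_subgroup[of X H] subgroup.mem_carrier[of H X]
  unfolding left_module_def stable_subgroup_def by auto

lemma right_module_submodule:
  assumes "right_module R X" "stable_subgroup R H X"
  shows "right_module R (X\<lparr>carrier := H\<rparr>)"
  using assms comm_group_subgroup[of X H] subgroup.mem_carrier[of H X]
  unfolding right_module_def stable_subgroup_def by auto

lemma submodule_inclusion:
  assumes "stable_subgroup R H X"
  shows "(\<lambda>x. x) \<in> module_hom R (X\<lparr>carrier := H\<rparr>) X"
  using assms subgroup.mem_carrier[of H X] by (intro module_homI) (auto simp: stable_subgroup_def)

lemma kernel_subgroup:
  assumes "comm_group X" "comm_group Y" "h \<in> hom X Y"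
  shows "subgroup (kernel X Y h) X"
  using group_hom.subgroup_kernel[OF comm_group_homI[OF assms]] .

lemma submodule_kernel_left:
  assumes "left_module R X" "left_module R Y" "h \<in> module_hom R X Y"
  shows "stable_subgroup R (kernel X Y h) X"
  using kernel_subgroup[OF left_module_group[OF assms(1)] left_module_group[OF assms(2)] module_hom_hom[OF assms(3)]]
    left_module_act_one[OF assms(2)] module_hom_act[OF assms(3)] left_module_closed[OF assms(1)]
  by (auto simp: stable_subgroup_def kernel_def)

lemma submodule_kernel_right:
  assumes "right_module R X" "right_module R Y" "h \<in> module_hom R X Y"
  shows "stable_subgroup R (kernel X Y h) X"
  using kernel_subgroup[OF right_module_group[OF assms(1)] right_module_group[OF assms(2)] module_hom_hom[OF assms(3)]]
    right_module_act_one[OF assms(2)] module_hom_act[OF assms(3)] right_module_closed[OF assms(1)]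
  by (auto simp: stable_subgroup_def kernel_def)

lemma transport_simps:
  assumes "inj_on e (carrier L)"
  shows "carrier (transport e L) = e ` carrier L"
    and "x \<in> carrier L \<Longrightarrow> y \<in> carrier L \<Longrightarrow> e x \<otimes>\<^bsub>transport e L\<^esub> e y = e (x \<otimes>\<^bsub>L\<^esub> y)"
    and "\<one>\<^bsub>transport e L\<^esub> = e \<one>\<^bsub>L\<^esub>"
    and "x \<in> carrier L \<Longrightarrow> act (transport e L) a (e x) = e (act L a x)"
  using assms by (auto simp: transport_def Let_def)

lemma comm_group_transport:
  assumes e: "inj_on e (carrier L)" and L: "comm_group L"
  shows "comm_group (transport e L)"
proof -
  interpret comm_group L by fact
  show ?thesis
  proof (rule comm_groupI)
    show "\<exists>y\<in>carrier (transport e L). y \<otimes>\<^bsub>transport e L\<^esub> x = \<one>\<^bsub>transport e L\<^esub>"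
      if "x \<in> carrier (transport e L)" for x
    proof -
      from that obtain u where "u \<in> carrier L" "x = e u" by (auto simp: transport_simps[OF e])
      then show ?thesis
        by (intro bexI[of _ "e (inv\<^bsub>L\<^esub> u)"]) (simp_all add: transport_simps[OF e])
    qed
  qed (auto simp: transport_simps[OF e] m_ac)
qed

lemma left_module_transport:
  assumes e: "inj_on e (carrier L)" and L: "left_module R L"
  shows "left_module R (transport e L)"
proof -
  interpret comm_group L using left_module_group[OF L] .
  show ?thesis
    using comm_group_transport[OF e left_module_group[OF L]] left_moduleD[OF L]
    unfolding left_module_def by (auto simp: transport_simps[OF e])
qed

lemma right_module_transport:
  assumes e: "inj_on e (carrier L)" and L: "right_module R L"
  shows "right_module R (transport e L)"
proof -
  interpret comm_group L using right_module_group[OF L] .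
  show ?thesis
    using comm_group_transport[OF e right_module_group[OF L]] right_moduleD[OF L]
    unfolding right_module_def by (auto simp: transport_simps[OF e])
qed

lemma transport_hom:
  assumes "inj_on e (carrier L)"
  shows "e \<in> module_hom R L (transport e L)"
  by (intro module_homI) (auto simp: transport_simps[OF assms])

lemma transport_inv_hom:
  assumes e: "inj_on e (carrier L)" and L: "monoid L"
    and "\<And>a x. a \<in> carrier R \<Longrightarrow> x \<in> carrier L \<Longrightarrow> act L a x \<in> carrier L"
  shows "inv_into (carrier L) e \<in> module_hom R (transport e L) L"
proof -
  interpret monoid L by fact
  show ?thesis using assms(3)
    by (intro module_homI) (auto simp: transport_simps[OF e] inv_into_f_f[OF e])
qed

section \<open>Right exactness of the tensor product\<close>

definition short_exact ::
  "'r ring \<Rightarrow> ('r, 'a) rmodule \<Rightarrow> ('r, 'b) rmodule \<Rightarrow> ('r, 'c) rmodule \<Rightarrow> ('a \<Rightarrow> 'b) \<Rightarrow> ('b \<Rightarrow> 'c) \<Rightarrow> bool" where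
  "short_exact R X Y Z i p \<longleftrightarrow>
    i \<in> module_hom R X Y \<and> inj_on i (carrier X) \<and> p \<in> module_hom R Y Z \<and>
    p ` carrier Y = carrier Z \<and> i ` carrier X = kernel Y Z p"

lemma hom_eq_of_kernel:
  assumes G: "comm_group G" "comm_group H" "comm_group K" and h: "h \<in> hom G H" and f: "f \<in> hom G K"
    and ker: "\<And>x. x \<in> carrier G \<Longrightarrow> f x = \<one>\<^bsub>K\<^esub> \<Longrightarrow> h x = \<one>\<^bsub>H\<^esub>"
    and x: "x \<in> carrier G" "x' \<in> carrier G" "f x = f x'"
  shows "h x = h x'"
proof -
  interpret G: comm_group G by fact
  interpret H: comm_group H by fact
  interpret K: comm_group K by fact
  interpret h: group_hom G H h by (rule comm_group_homI) fact+
  interpret f: group_hom G K f by (rule comm_group_homI) fact+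
  have "f (x \<otimes>\<^bsub>G\<^esub> inv\<^bsub>G\<^esub> x') = \<one>\<^bsub>K\<^esub>" using x by simp
  then have "h (x \<otimes>\<^bsub>G\<^esub> inv\<^bsub>G\<^esub> x') = \<one>\<^bsub>H\<^esub>" using ker x by simp
  then have "h x \<otimes>\<^bsub>H\<^esub> inv\<^bsub>H\<^esub> h x' = \<one>\<^bsub>H\<^esub>" using x by simp
  then show ?thesis using x H.inv_equality[of "h x" "inv\<^bsub>H\<^esub> h x'"] by simp
qed

lemma hom_image_subgroup:
  assumes "comm_group G" "comm_group H" "f \<in> hom G H"
  shows "subgroup (f ` carrier G) H"
  using group_hom.img_is_subgroup[OF comm_group_homI[OF assms]] .

lemma pure_tensor_in_image:
  assumes m: "right_module R X" "left_module R L" "right_module R X'" "left_module R L'"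
    and f: "f \<in> module_hom R X X'" and g: "g \<in> module_hom R L L'" and "x \<in> carrier X" "y \<in> carrier L"
  shows "pure_tensor R X' L' (f x) (g y) \<in> tensor_map R X' L' f g ` carrier (tensor R X L)"
  unfolding tensor_map_pure[OF assms, symmetric] by (rule imageI) (rule pure_tensor_closed[OF m(1,2) assms(7,8)])

lemma tensor_map_surj:
  assumes m: "right_module R X" "left_module R L" "right_module R X'" "left_module R L'"
    and f: "f \<in> module_hom R X X'" "f ` carrier X = carrier X'"
    and g: "g \<in> module_hom R L L'" "g ` carrier L = carrier L'"
  shows "tensor_map R X' L' f g ` carrier (tensor R X L) = carrier (tensor R X' L')"
proof
  let ?h = "tensor_map R X' L' f g"
  have h: "?h \<in> hom (tensor R X L) (tensor R X' L')" by (intro tensor_map_hom m f g)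
  then show "?h ` carrier (tensor R X L) \<subseteq> carrier (tensor R X' L')" by (rule hom_carrier)
  have "t \<in> ?h ` carrier (tensor R X L)" if t: "t \<in> carrier (tensor R X' L')" for t
  proof (rule tensor_induct[OF m(3,4) _ _ t])
    show "subgroup (?h ` carrier (tensor R X L)) (tensor R X' L')"
      by (rule hom_image_subgroup[OF _ _ h]) (simp_all add: comm_group_tensor m)
    fix x' y' assume "x' \<in> carrier X'" "y' \<in> carrier L'"
    then obtain x y where "x \<in> carrier X" "x' = f x" "y \<in> carrier L" "y' = g y" using f(2) g(2) by blast
    then show "pure_tensor R X' L' x' y' \<in> ?h ` carrier (tensor R X L)"
      using pure_tensor_in_image[OF m f(1) g(1), of x y] by simp
  qed
  then show "carrier (tensor R X' L') \<subseteq> ?h ` carrier (tensor R X L)" by blast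
qed

text \<open>
  Modulo \<open>U\<close>, a pure tensor depends only on the images of its factors under \<open>f\<close> and \<open>g\<close>.  Hence it defines a
  balanced map on the targets, through which the quotient map by \<open>U\<close> factors.  Right exactness in either
  variable is the case in which \<open>U\<close> is the image of the preceding map.
\<close>

lemma tensor_map_kernel_subset:
  assumes m: "right_module R X" "left_module R L" "right_module R X'" "left_module R L'"
    and f: "f \<in> module_hom R X X'" "f ` carrier X = carrier X'"
    and g: "g \<in> module_hom R L L'" "g ` carrier L = carrier L'"
    and U: "subgroup U (tensor R X L)"
    and Uf: "\<And>x y. x \<in> carrier X \<Longrightarrow> y \<in> carrier L \<Longrightarrow> f x = \<one>\<^bsub>X'\<^esub> \<Longrightarrow> pure_tensor R X L x y \<in> U"
    and Ug: "\<And>x y. x \<in> carrier X \<Longrightarrow> y \<in> carrier L \<Longrightarrow> g y = \<one>\<^bsub>L'\<^esub> \<Longrightarrow> pure_tensor R X L x y \<in> U"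
    and t: "t \<in> carrier (tensor R X L)" "tensor_map R X' L' f g t = \<one>\<^bsub>tensor R X' L'\<^esub>"
  shows "t \<in> U"
proof -
  let ?T = "tensor R X L" and ?T' = "tensor R X' L'"
  let ?Q = "?T Mod U" and ?q = "\<lambda>t. U #>\<^bsub>?T\<^esub> t"
  interpret T: comm_group ?T by (rule comm_group_tensor[OF m(1,2)])
  have Q: "comm_group ?Q" using T.abelian_FactGroup[OF U] .
  interpret Q: comm_group ?Q by fact
  have q: "?q \<in> hom ?T ?Q" using normal.r_coset_hom_Mod T.normal_iff_subgroup U by blast
  have q1: "?q u = \<one>\<^bsub>?Q\<^esub> \<longleftrightarrow> u \<in> U" if "u \<in> carrier ?T" for u
    using that U T.coset_join1[OF _ that U] T.coset_join2[OF that U] by (auto dest: subgroup.subset)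
  define \<kappa> where "\<kappa> x y = ?q (pure_tensor R X L x y)" for x y
  have kl: "(\<lambda>x. \<kappa> x y) \<in> hom X ?Q" if "y \<in> carrier L" for y
    using hom_compose[OF pure_tensor_hom_left[OF m(1,2) that] q] by (simp add: \<kappa>_def comp_def)
  have kr: "\<kappa> x \<in> hom L ?Q" if "x \<in> carrier X" for x
    using hom_compose[OF pure_tensor_hom_right[OF m(1,2) that] q] by (simp add: \<kappa>_def[abs_def] comp_def)
  have dl: "\<kappa> x y = \<kappa> x' y" if "x \<in> carrier X" "x' \<in> carrier X" "y \<in> carrier L" "f x = f x'" for x x' y
    using hom_eq_of_kernel[OF right_module_group[OF m(1)] Q right_module_group[OF m(3)] kl[OF that(3)]
        module_hom_hom[OF f(1)] _ that(1,2,4)] Uf that(3) q1 pure_tensor_closed[OF m(1,2)]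
    by (simp add: \<kappa>_def)
  have dr: "\<kappa> x y = \<kappa> x y'" if "y \<in> carrier L" "y' \<in> carrier L" "x \<in> carrier X" "g y = g y'" for x y y'
    using hom_eq_of_kernel[OF left_module_group[OF m(2)] Q left_module_group[OF m(4)] kr[OF that(3)]
        module_hom_hom[OF g(1)] _ that(1,2,4)] Ug that(3) q1 pure_tensor_closed[OF m(1,2)]
    by (simp add: \<kappa>_def)
  define s where "s = inv_into (carrier X) f"
  define r where "r = inv_into (carrier L) g"
  have s: "s x \<in> carrier X" "f (s x) = x" if "x \<in> carrier X'" for x
    using that f(2) by (auto simp: s_def inv_into_into f_inv_into_f)
  have r: "r y \<in> carrier L" "g (r y) = y" if "y \<in> carrier L'" for y
    using that g(2) by (auto simp: r_def inv_into_into f_inv_into_f)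
  define \<beta> where "\<beta> x y = \<kappa> (s x) (r y)" for x y
  interpret X: comm_group X using right_module_group[OF m(1)] .
  interpret L: comm_group L using left_module_group[OF m(2)] .
  interpret X': comm_group X' using right_module_group[OF m(3)] .
  interpret L': comm_group L' using left_module_group[OF m(4)] .
  have \<beta>f: "\<beta> (f x) (g y) = \<kappa> x y" if "x \<in> carrier X" "y \<in> carrier L" for x y
    using dl[of "s (f x)" x "r (g y)"] dr[of "r (g y)" y x] that s[of "f x"] r[of "g y"]
      module_hom_closed[OF f(1)] module_hom_closed[OF g(1)] by (simp add: \<beta>_def)
  have bal: "balanced R X' L' ?Q \<beta>"
  proof (rule balancedI)
    show "\<beta> x y \<in> carrier ?Q" if "x \<in> carrier X'" "y \<in> carrier L'" for x y
      unfolding \<beta>_def using hom_in_carrier[OF kr] s r that by blast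
    show "\<beta> x (y \<otimes>\<^bsub>L'\<^esub> y') = \<beta> x y \<otimes>\<^bsub>?Q\<^esub> \<beta> x y'" if "x \<in> carrier X'" "y \<in> carrier L'" "y' \<in> carrier L'" for x y y'
      using \<beta>f[of "s x" "r y \<otimes>\<^bsub>L\<^esub> r y'"] that s[of x] r[of y] r[of y'] hom_mult[OF kr, of "s x" "r y" "r y'"]
        module_hom_mult[OF g(1)] by (simp add: \<beta>_def)
    show "\<beta> (x \<otimes>\<^bsub>X'\<^esub> x') y = \<beta> x y \<otimes>\<^bsub>?Q\<^esub> \<beta> x' y" if "x \<in> carrier X'" "x' \<in> carrier X'" "y \<in> carrier L'" for x x' y
      using \<beta>f[of "s x \<otimes>\<^bsub>X\<^esub> s x'" "r y"] that s[of x] s[of x'] r[of y] hom_mult[OF kl, of "r y" "s x" "s x'"]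
        module_hom_mult[OF f(1)] by (simp add: \<beta>_def)
    show "\<beta> (act X' a x) y = \<beta> x (act L' a y)" if "a \<in> carrier R" "x \<in> carrier X'" "y \<in> carrier L'" for a x y
      using \<beta>f[of "act X a (s x)" "r y"] \<beta>f[of "s x" "act L a (r y)"] that s[of x] r[of y]
        module_hom_act[OF f(1)] module_hom_act[OF g(1)] right_module_closed[OF m(1)] left_module_closed[OF m(2)]
        pure_tensor_act[OF m(1,2), of a "s x" "r y"] by (simp add: \<kappa>_def)
  qed
  have "?q t = tensor_lift ?Q \<beta> (tensor_map R X' L' f g t)"
  proof (rule tensor_hom_eqI[OF m(1,2) Q q _ _ t(1)])
    show "(\<lambda>t. tensor_lift ?Q \<beta> (tensor_map R X' L' f g t)) \<in> hom ?T ?Q"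
      using hom_compose[OF tensor_map_hom[OF m f(1) g(1)] tensor_lift_hom[OF m(3,4) Q bal]] by (simp add: comp_def)
    show "?q (pure_tensor R X L x y) = tensor_lift ?Q \<beta> (tensor_map R X' L' f g (pure_tensor R X L x y))"
      if "x \<in> carrier X" "y \<in> carrier L" for x y
      using that tensor_map_pure[OF m f(1) g(1) that] \<beta>f[OF that]
        tensor_lift_pure[OF m(3,4) Q bal] module_hom_closed[OF f(1)] module_hom_closed[OF g(1)]
      by (simp add: \<kappa>_def)
  qed
  also have "\<dots> = \<one>\<^bsub>?Q\<^esub>"
    unfolding t(2) by (rule comm_hom_one[OF tensor_lift_hom[OF m(3,4) Q bal] comm_group_tensor[OF m(3,4)] Q])
  finally show ?thesis using q1 t(1) by blast
qed

lemma short_exactD: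
  assumes "short_exact R X Y Z i p"
  shows "i \<in> module_hom R X Y" "inj_on i (carrier X)" "p \<in> module_hom R Y Z"
    "p ` carrier Y = carrier Z" "i ` carrier X = kernel Y Z p"
  using assms by (auto simp: short_exact_def)

lemma short_exact_comp_one:
  assumes "short_exact R X Y Z i p" "x \<in> carrier X"
  shows "p (i x) = \<one>\<^bsub>Z\<^esub>"
  using short_exactD(5)[OF assms(1)] assms(2) by (auto simp: kernel_def)

lemma tensor_right_exact_left_factor:
  assumes m: "right_module R X" "right_module R Y" "right_module R Z" "left_module R L"
    and e: "short_exact R X Y Z i p" and t: "t \<in> carrier (tensor R Y L)"
  shows "tensor_left R Z L p t = \<one>\<^bsub>tensor R Z L\<^esub> \<longleftrightarrow>
    t \<in> tensor_left R Y L i ` carrier (tensor R X L)"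
proof
  note e' = short_exactD[OF e]
  let ?i = "tensor_left R Y L i" and ?p = "tensor_left R Z L p"
  have ih: "?i \<in> hom (tensor R X L) (tensor R Y L)" by (intro tensor_map_hom m e' module_hom_id)
  show "t \<in> ?i ` carrier (tensor R X L)" if "?p t = \<one>\<^bsub>tensor R Z L\<^esub>"
  proof (rule tensor_map_kernel_subset[OF m(2,4,3,4) e'(3,4) module_hom_id _ _ _ _ t that])
    show sg: "subgroup (?i ` carrier (tensor R X L)) (tensor R Y L)"
      by (rule hom_image_subgroup[OF _ _ ih]) (simp_all add: comm_group_tensor m)
    show "pure_tensor R Y L x y \<in> ?i ` carrier (tensor R X L)"
      if "x \<in> carrier Y" "y \<in> carrier L" "p x = \<one>\<^bsub>Z\<^esub>" for x y
    proof -
      have "x \<in> kernel Y Z p" using that by (simp add: kernel_def)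
      then obtain x' where "x' \<in> carrier X" "x = i x'" unfolding e'(5)[symmetric] by blast
      then show ?thesis using pure_tensor_in_image[OF m(1,4,2,4) e'(1) module_hom_id, of x' y] that(2) by simp
    qed
    show "pure_tensor R Y L x y \<in> ?i ` carrier (tensor R X L)"
      if "x \<in> carrier Y" "y \<in> carrier L" "y = \<one>\<^bsub>L\<^esub>" for x y
      using pure_tensor_one_right[OF m(2,4) that(1)] subgroup.one_closed[OF sg] that(3) by simp
  qed simp
  assume "t \<in> ?i ` carrier (tensor R X L)"
  then obtain u where u: "u \<in> carrier (tensor R X L)" "t = ?i u" by blast
  have "?p (?i u) = tensor_left R Z L (\<lambda>x. p (i x)) u"
    by (rule tensor_map_comp[OF m(1,4,2,4,3,4) e'(1) module_hom_id e'(3) module_hom_id u(1)])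
  also have "\<dots> = \<one>\<^bsub>tensor R Z L\<^esub>"
    by (rule tensor_map_eq_one[OF m(1,4,3,4) module_hom_comp[OF e'(1,3)] module_hom_id _ u(1)])
      (simp add: short_exact_comp_one[OF e])
  finally show "?p t = \<one>\<^bsub>tensor R Z L\<^esub>" using u by simp
qed

lemma tensor_right_exact_right_factor:
  assumes m: "left_module R X" "left_module R Y" "left_module R Z" "right_module R L"
    and e: "short_exact R X Y Z i p" and t: "t \<in> carrier (tensor R L Y)"
  shows "tensor_right R L Z p t = \<one>\<^bsub>tensor R L Z\<^esub> \<longleftrightarrow>
    t \<in> tensor_right R L Y i ` carrier (tensor R L X)"
proof
  note e' = short_exactD[OF e]
  let ?i = "tensor_right R L Y i" and ?p = "tensor_right R L Z p"
  have ih: "?i \<in> hom (tensor R L X) (tensor R L Y)" by (intro tensor_map_hom m e' module_hom_id)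
  show "t \<in> ?i ` carrier (tensor R L X)" if "?p t = \<one>\<^bsub>tensor R L Z\<^esub>"
  proof (rule tensor_map_kernel_subset[OF m(4,2,4,3) module_hom_id _ e'(3,4) _ _ _ t that])
    show sg: "subgroup (?i ` carrier (tensor R L X)) (tensor R L Y)"
      by (rule hom_image_subgroup[OF _ _ ih]) (simp_all add: comm_group_tensor m)
    show "pure_tensor R L Y x y \<in> ?i ` carrier (tensor R L X)"
      if "x \<in> carrier L" "y \<in> carrier Y" "p y = \<one>\<^bsub>Z\<^esub>" for x y
    proof -
      have "y \<in> kernel Y Z p" using that by (simp add: kernel_def)
      then obtain x' where "x' \<in> carrier X" "y = i x'" unfolding e'(5)[symmetric] by blast
      then show ?thesis using pure_tensor_in_image[OF m(4,1,4,2) module_hom_id e'(1), of x x'] that(1) by simp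
    qed
    show "pure_tensor R L Y x y \<in> ?i ` carrier (tensor R L X)"
      if "x \<in> carrier L" "y \<in> carrier Y" "x = \<one>\<^bsub>L\<^esub>" for x y
      using pure_tensor_one_left[OF m(4,2) that(2)] subgroup.one_closed[OF sg] that(3) by simp
  qed simp
  assume "t \<in> ?i ` carrier (tensor R L X)"
  then obtain u where u: "u \<in> carrier (tensor R L X)" "t = ?i u" by blast
  have "?p (?i u) = tensor_right R L Z (\<lambda>x. p (i x)) u"
    by (rule tensor_map_comp[OF m(4,1,4,2,4,3) module_hom_id e'(1) module_hom_id e'(3) u(1)])
  also have "\<dots> = \<one>\<^bsub>tensor R L Z\<^esub>"
    by (rule tensor_map_eq_one[OF m(4,1,4,3) module_hom_id module_hom_comp[OF e'(1,3)] _ u(1)])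
      (simp add: short_exact_comp_one[OF e])
  finally show "?p t = \<one>\<^bsub>tensor R L Z\<^esub>" using u by simp
qed

section \<open>Free modules\<close>

lemma free_right_module_simps:
  shows "f \<in> carrier (free_right_module R B) \<longleftrightarrow>
      (\<forall>b. f b \<in> carrier R) \<and> (\<forall>b. b \<notin> B \<longrightarrow> f b = \<zero>\<^bsub>R\<^esub>) \<and> finite {b. f b \<noteq> \<zero>\<^bsub>R\<^esub>}"
    and "f \<otimes>\<^bsub>free_right_module R B\<^esub> g = (\<lambda>b. f b \<oplus>\<^bsub>R\<^esub> g b)"
    and "\<one>\<^bsub>free_right_module R B\<^esub> = (\<lambda>b. \<zero>\<^bsub>R\<^esub>)"
    and "act (free_right_module R B) a f = (\<lambda>b. f b \<otimes>\<^bsub>R\<^esub> a)"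
  by (simp_all add: free_right_module_def)

lemma right_module_free:
  assumes "ring R"
  shows "right_module R (free_right_module R B)"
proof -
  interpret ring R by fact
  let ?F = "free_right_module R B"
  have fin: "finite {b. u b \<noteq> \<zero>\<^bsub>R\<^esub>}" if "finite {b. f b \<noteq> \<zero>\<^bsub>R\<^esub>}" "finite {b. g b \<noteq> \<zero>\<^bsub>R\<^esub>}"
    "\<And>b. f b = \<zero>\<^bsub>R\<^esub> \<Longrightarrow> g b = \<zero>\<^bsub>R\<^esub> \<Longrightarrow> u b = \<zero>\<^bsub>R\<^esub>" for f g u :: "'b \<Rightarrow> 'a"
    by (rule finite_subset[OF _ finite_UnI[OF that(1,2)]]) (use that(3) in auto)
  have "comm_group ?F"
  proof (rule comm_groupI)
    show "\<exists>g\<in>carrier ?F. g \<otimes>\<^bsub>?F\<^esub> f = \<one>\<^bsub>?F\<^esub>" if "f \<in> carrier ?F" for f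
    proof (rule bexI[of _ "\<lambda>b. \<ominus>\<^bsub>R\<^esub> f b"])
      show "(\<lambda>b. \<ominus>\<^bsub>R\<^esub> f b) \<in> carrier ?F" using that fin[of f f "\<lambda>b. \<ominus>\<^bsub>R\<^esub> f b"]
        by (auto simp: free_right_module_simps)
    qed (use that in \<open>auto simp: free_right_module_simps l_neg\<close>)
    show "f \<otimes>\<^bsub>?F\<^esub> g \<in> carrier ?F" if "f \<in> carrier ?F" "g \<in> carrier ?F" for f g
      using that fin[of f g "\<lambda>b. f b \<oplus>\<^bsub>R\<^esub> g b"] by (auto simp: free_right_module_simps)
  qed (auto simp: free_right_module_simps a_ac)
  moreover have "act ?F a f \<in> carrier ?F" if "a \<in> carrier R" "f \<in> carrier ?F" for a f
    using that fin[of f f "\<lambda>b. f b \<otimes>\<^bsub>R\<^esub> a"] by (auto simp: free_right_module_simps)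
  ultimately show ?thesis using assms unfolding right_module_def
    by (auto simp: free_right_module_simps l_distr r_distr m_assoc)
qed

lemma free_lift_superset:
  assumes M: "right_module R M" and v: "v \<in> B \<rightarrow> carrier M" and f: "f \<in> carrier (free_right_module R B)"
    and T: "finite T" "{b. f b \<noteq> \<zero>\<^bsub>R\<^esub>} \<subseteq> T" "T \<subseteq> B"
  shows "free_lift R M v f = finprod M (\<lambda>b. act M (f b) (v b)) T"
proof -
  interpret comm_group M using right_module_group[OF M] .
  show ?thesis unfolding free_lift_def
    by (rule finprod_mono_neutral_cong_left)
      (use assms right_module_closed[OF M] right_module_act_zero[OF M] in
        \<open>auto simp: free_right_module_simps Pi_iff subset_iff\<close>)
qed

lemma free_lift_hom:
  assumes M: "right_module R M" and v: "v \<in> B \<rightarrow> carrier M"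
  shows "free_lift R M v \<in> module_hom R (free_right_module R B) M"
proof -
  interpret M: comm_group M using right_module_group[OF M] .
  let ?F = "free_right_module R B"
  interpret F: comm_group ?F using right_module_group[OF right_module_free[OF right_module_ring[OF M]]] .
  have cl: "(\<lambda>b. act M (f b) (v b)) \<in> T \<rightarrow> carrier M" if "f \<in> carrier ?F" "T \<subseteq> B" for f T
    using that v right_module_closed[OF M] by (auto simp: free_right_module_simps Pi_iff)
  have sup: "{b. f b \<noteq> \<zero>\<^bsub>R\<^esub>} \<subseteq> B" "finite {b. f b \<noteq> \<zero>\<^bsub>R\<^esub>}" if "f \<in> carrier ?F" for f
    using that by (auto simp: free_right_module_simps)
  note ms = right_module_free[OF right_module_ring[OF M], of B]
  show ?thesis
  proof (rule module_homI)
    show "free_lift R M v f \<in> carrier M" if "f \<in> carrier ?F" for f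
      unfolding free_lift_def by (rule M.finprod_closed[OF cl[OF that sup(1)[OF that]]])
    show "free_lift R M v (f \<otimes>\<^bsub>?F\<^esub> g) = free_lift R M v f \<otimes>\<^bsub>M\<^esub> free_lift R M v g"
      if fg: "f \<in> carrier ?F" "g \<in> carrier ?F" for f g
    proof -
      let ?T = "{b. f b \<noteq> \<zero>\<^bsub>R\<^esub>} \<union> {b. g b \<noteq> \<zero>\<^bsub>R\<^esub>}"
      have T: "finite ?T" "?T \<subseteq> B" using sup fg by auto
      interpret ring R using right_module_ring[OF M] .
      have "free_lift R M v (f \<otimes>\<^bsub>?F\<^esub> g) = finprod M (\<lambda>b. act M ((f \<otimes>\<^bsub>?F\<^esub> g) b) (v b)) ?T"
        by (rule free_lift_superset[OF M v F.m_closed[OF fg] T(1) _ T(2)])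
          (auto simp: free_right_module_simps)
      also have "\<dots> = finprod M (\<lambda>b. act M (f b) (v b) \<otimes>\<^bsub>M\<^esub> act M (g b) (v b)) ?T"
        by (rule M.finprod_cong')
          (use fg T v right_module_scal[OF M] right_module_closed[OF M] in
            \<open>auto simp: free_right_module_simps Pi_iff subset_iff\<close>)
      also have "\<dots> = finprod M (\<lambda>b. act M (f b) (v b)) ?T \<otimes>\<^bsub>M\<^esub> finprod M (\<lambda>b. act M (g b) (v b)) ?T"
        by (rule M.finprod_multf[OF cl[OF fg(1) T(2)] cl[OF fg(2) T(2)]])
      also have "\<dots> = free_lift R M v f \<otimes>\<^bsub>M\<^esub> free_lift R M v g"
        using free_lift_superset[OF M v fg(1) T(1) _ T(2)] free_lift_superset[OF M v fg(2) T(1) _ T(2)] by simp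
      finally show ?thesis .
    qed
    show "free_lift R M v (act ?F a f) = act M a (free_lift R M v f)" if af: "a \<in> carrier R" "f \<in> carrier ?F" for a f
    proof -
      interpret ring R using right_module_ring[OF M] .
      let ?T = "{b. f b \<noteq> \<zero>\<^bsub>R\<^esub>}"
      note T = sup[OF af(2)]
      have "free_lift R M v (act ?F a f) = finprod M (\<lambda>b. act M (act ?F a f b) (v b)) ?T"
        by (rule free_lift_superset[OF M v right_module_closed[OF ms af] T(2) _ T(1)])
          (use af in \<open>auto simp: free_right_module_simps\<close>)
      also have "\<dots> = finprod M (\<lambda>b. act M a (act M (f b) (v b))) ?T"
        by (rule M.finprod_cong')
          (use af T v right_module_assoc[OF M] right_module_closed[OF M] in
            \<open>auto simp: free_right_module_simps Pi_iff subset_iff\<close>)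
      also have "\<dots> = act M a (free_lift R M v f)"
        unfolding free_lift_def
        by (rule hom_finprod[OF right_module_group[OF M] right_module_group[OF M]
              right_module_hom_action[OF M af(1)] cl[OF af(2) T(1)], symmetric])
      finally show ?thesis .
    qed
  qed
qed

lemma free_lift_comp:
  assumes M: "right_module R M" and M': "right_module R M'" and h: "h \<in> module_hom R M M'"
    and v: "v \<in> B \<rightarrow> carrier M" and f: "f \<in> carrier (free_right_module R B)"
  shows "h (free_lift R M v f) = free_lift R M' (\<lambda>b. h (v b)) f"
proof -
  interpret M': comm_group M' using right_module_group[OF M'] .
  have b: "f b \<in> carrier R" "v b \<in> carrier M" if "f b \<noteq> \<zero>\<^bsub>R\<^esub>" for b
    using f v that by (auto simp: free_right_module_simps Pi_iff)
  have cl: "(\<lambda>b. act M (f b) (v b)) \<in> {b. f b \<noteq> \<zero>\<^bsub>R\<^esub>} \<rightarrow> carrier M"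
    using b right_module_closed[OF M] by simp
  show ?thesis
    unfolding free_lift_def
      hom_finprod[OF right_module_group[OF M] right_module_group[OF M'] module_hom_hom[OF h] cl]
  proof (rule M'.finprod_cong'[OF refl])
    show "(\<lambda>b. act M' (f b) (h (v b))) \<in> {b. f b \<noteq> \<zero>\<^bsub>R\<^esub>} \<rightarrow> carrier M'"
      using b right_module_closed[OF M'] module_hom_closed[OF h] by simp
    show "h (act M (f i) (v i)) = act M' (f i) (h (v i))" if "i \<in> {b. f b \<noteq> \<zero>\<^bsub>R\<^esub>}" for i
      using that b module_hom_act[OF h] by simp
  qed
qed

definition unit_vector :: "'r ring \<Rightarrow> 'b \<Rightarrow> 'b \<Rightarrow> 'r" where
  "unit_vector R b = (\<lambda>x. if x = b then \<one>\<^bsub>R\<^esub> else \<zero>\<^bsub>R\<^esub>)"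

lemma unit_vector_closed:
  assumes "ring R" "b \<in> B"
  shows "unit_vector R b \<in> carrier (free_right_module R B)"
proof -
  interpret ring R by fact
  have "finite {x. unit_vector R b x \<noteq> \<zero>\<^bsub>R\<^esub>}"
    by (rule finite_subset[of _ "{b}"]) (auto simp: unit_vector_def)
  then show ?thesis using assms by (auto simp: free_right_module_simps unit_vector_def)
qed

lemma free_lift_unit_vector:
  assumes M: "right_module R M" and v: "v \<in> B \<rightarrow> carrier M" and b: "b \<in> B"
  shows "free_lift R M v (unit_vector R b) = v b"
proof -
  interpret comm_group M using right_module_group[OF M] .
  have vb: "v b \<in> carrier M" using v b by auto
  have "free_lift R M v (unit_vector R b) = finprod M (\<lambda>x. act M (unit_vector R b x) (v x)) {b}"
    by (rule free_lift_superset[OF M v unit_vector_closed[OF right_module_ring[OF M] b]])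
      (use b in \<open>auto simp: unit_vector_def\<close>)
  also have "\<dots> = v b" using right_module_one[OF M vb] vb by (simp add: unit_vector_def)
  finally show ?thesis .
qed

lemma free_lift_eq_id:
  assumes R: "ring R" and f: "f \<in> carrier (free_right_module R B)"
  shows "free_lift R (free_right_module R B) (unit_vector R) f = f"
proof
  interpret ring R by fact
  let ?F = "free_right_module R B"
  let ?g = "\<lambda>b. act ?F (f b) (unit_vector R b)"
  note F = right_module_free[OF R, of B]
  fix x
  have fin: "finite {b. f b \<noteq> \<zero>\<^bsub>R\<^esub>}" and sup: "{b. f b \<noteq> \<zero>\<^bsub>R\<^esub>} \<subseteq> B" and fR: "\<And>b. f b \<in> carrier R"
    using f by (auto simp: free_right_module_simps)
  have cl: "?g \<in> {b. f b \<noteq> \<zero>\<^bsub>R\<^esub>} \<rightarrow> carrier ?F"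
    using sup by (auto intro!: right_module_closed[OF F] unit_vector_closed[OF R] fR)
  have ev: "(\<lambda>h. h x) \<in> hom ?F (add_monoid R)"
    by (intro homI) (auto simp: free_right_module_simps)
  have "free_lift R ?F (unit_vector R) f x = finprod (add_monoid R) (\<lambda>b. ?g b x) {b. f b \<noteq> \<zero>\<^bsub>R\<^esub>}"
    unfolding free_lift_def
    using hom_finprod[OF right_module_group[OF F] ring_add_comm_group[OF R] ev cl] .
  also have "\<dots> = finprod (add_monoid R) (\<lambda>b. if x = b then f b else \<one>\<^bsub>add_monoid R\<^esub>) {b. f b \<noteq> \<zero>\<^bsub>R\<^esub>}"
    by (rule comm_monoid.finprod_cong'[OF comm_group.axioms(1)[OF ring_add_comm_group[OF R]]])
      (use fR in \<open>auto simp: free_right_module_simps unit_vector_def\<close>)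
  also have "\<dots> = f x"
  proof (cases "f x = \<zero>\<^bsub>R\<^esub>")
    case True
    have "finprod (add_monoid R) (\<lambda>b. if x = b then f b else \<one>\<^bsub>add_monoid R\<^esub>) {b. f b \<noteq> \<zero>\<^bsub>R\<^esub>} = \<one>\<^bsub>add_monoid R\<^esub>"
      by (rule comm_monoid.finprod_one_eqI[OF comm_group.axioms(1)[OF ring_add_comm_group[OF R]]]) (use True in auto)
    then show ?thesis using True by simp
  next
    case False
    show ?thesis
      by (rule comm_monoid.finprod_singleton[OF comm_group.axioms(1)[OF ring_add_comm_group[OF R]]])
        (use False fin fR in auto)
  qed
  finally show "free_lift R ?F (unit_vector R) f x = f x" .
qed

text \<open>
  The bound variable \<open>E'\<close> makes the union directed although \<open>W\<close> need not be monotone.  In the application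
  \<open>W E\<close> contains the tensors that are recovered from their coordinates in \<open>E\<close>.
\<close>

lemma directed_union_subgroup:
  assumes G: "comm_group G" and W: "\<And>E. E \<subseteq> B \<Longrightarrow> subgroup (W E) G"
  shows "subgroup {t \<in> carrier G. \<exists>E. finite E \<and> E \<subseteq> B \<and> (\<forall>E'. finite E' \<and> E \<subseteq> E' \<and> E' \<subseteq> B \<longrightarrow> t \<in> W E')} G"
    (is "subgroup ?U G")
proof -
  interpret comm_group G by fact
  have I: "t \<in> ?U" if "t \<in> carrier G" "finite E" "E \<subseteq> B" "\<And>E'. finite E' \<and> E \<subseteq> E' \<and> E' \<subseteq> B \<Longrightarrow> t \<in> W E'" for t E
    by (intro CollectI exI[of _ E] conjI[OF that(1)] conjI[OF that(2)] conjI[OF that(3)] allI impI that(4))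
  show ?thesis
  proof (rule subgroup.intro)
    show "\<one>\<^bsub>G\<^esub> \<in> ?U" by (rule I[of _ "{}"]) (simp_all add: subgroup.one_closed[OF W])
    fix t assume "t \<in> ?U"
    then obtain E where t: "t \<in> carrier G" and E: "finite E" "E \<subseteq> B"
      and tW: "\<forall>E'. finite E' \<and> E \<subseteq> E' \<and> E' \<subseteq> B \<longrightarrow> t \<in> W E'" by (elim CollectE conjE exE)
    show "inv\<^bsub>G\<^esub> t \<in> ?U"
      by (rule I[OF inv_closed[OF t] E], rule subgroup.m_inv_closed[OF W]) (simp_all add: tW)
    fix u assume "u \<in> ?U"
    then obtain D where u: "u \<in> carrier G" and D: "finite D" "D \<subseteq> B"
      and uW: "\<forall>E'. finite E' \<and> D \<subseteq> E' \<and> E' \<subseteq> B \<longrightarrow> u \<in> W E'" by (elim CollectE conjE exE)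
    show "t \<otimes>\<^bsub>G\<^esub> u \<in> ?U"
      by (rule I[OF m_closed[OF t u], of "E \<union> D"], simp_all add: E D, rule subgroup.m_closed[OF W]) (simp_all add: tW uW)
  qed (rule subsetI, erule CollectE, erule conjunct1)
qed

text \<open>
  A tensor over a free module has coordinates in \<open>N\<close>, obtained by evaluating the first factor at a basis
  element, and \<open>h\<close> acts on the coordinates.
\<close>

lemma free_tensor_injective:
  assumes R: "ring R" and N: "left_module R N" and N': "left_module R N'"
    and h: "h \<in> module_hom R N N'" and inj: "inj_on h (carrier N)"
  shows "inj_on (tensor_right R (free_right_module R B) N' h) (carrier (tensor R (free_right_module R B) N))"
proof -
  let ?F = "free_right_module R B"
  note F = right_module_free[OF R, of B]
  let ?T = "tensor R ?F N" and ?T' = "tensor R ?F N'"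
  interpret N: comm_group N using left_module_group[OF N] .
  interpret N': comm_group N' using left_module_group[OF N'] .
  interpret T: comm_group ?T using comm_group_tensor[OF F N] .
  have bal: "balanced R ?F L L (\<lambda>f y. act L (f b) y)" if L: "left_module R L" for b and L :: "('a, 'l) rmodule"
    using left_moduleD[OF L] by (intro balancedI) (auto simp: free_right_module_simps)
  define ev where "ev b = tensor_lift N (\<lambda>f y. act N (f b) y)" for b :: 'd
  define ev' where "ev' b = tensor_lift N' (\<lambda>f y. act N' (f b) y)" for b :: 'd
  have ev: "ev b \<in> hom ?T N" for b unfolding ev_def by (rule tensor_lift_hom[OF F N left_module_group[OF N] bal[OF N]])
  have ev': "ev' b \<in> hom ?T' N'" for b unfolding ev'_def by (rule tensor_lift_hom[OF F N' left_module_group[OF N'] bal[OF N']])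
  have evp: "ev b (pure_tensor R ?F N f y) = act N (f b) y" if "f \<in> carrier ?F" "y \<in> carrier N" for b f y
    unfolding ev_def by (rule tensor_lift_pure[OF F N left_module_group[OF N] bal[OF N] that])
  have evp': "ev' b (pure_tensor R ?F N' f y) = act N' (f b) y" if "f \<in> carrier ?F" "y \<in> carrier N'" for b f y
    unfolding ev'_def by (rule tensor_lift_pure[OF F N' left_module_group[OF N'] bal[OF N'] that])
  have th: "tensor_right R ?F N' h \<in> hom ?T ?T'" by (rule tensor_map_hom[OF F N F N' module_hom_id h])
  have nat: "ev' b (tensor_right R ?F N' h t) = h (ev b t)" if "t \<in> carrier ?T" for b t
  proof (rule tensor_hom_eqI[OF F N left_module_group[OF N'] _ _ _ that])
    show "(\<lambda>t. ev' b (tensor_right R ?F N' h t)) \<in> hom ?T N'"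
      using hom_compose[OF th ev'] by (simp add: comp_def)
    show "(\<lambda>t. h (ev b t)) \<in> hom ?T N'"
      using hom_compose[OF ev module_hom_hom[OF h]] by (simp add: comp_def)
    show "ev' b (tensor_right R ?F N' h (pure_tensor R ?F N f y)) = h (ev b (pure_tensor R ?F N f y))"
      if "f \<in> carrier ?F" "y \<in> carrier N" for f y
      using that tensor_map_pure[OF F N F N' module_hom_id h that] evp[OF that] evp'[of f "h y" b]
        module_hom_closed[OF h] module_hom_act[OF h]
      by (simp add: free_right_module_simps(1))
  qed
  \<comment> \<open>a tensor is recovered from its coordinates, almost all of which vanish\<close>
  have coord: "\<exists>E. finite E \<and> E \<subseteq> B \<and> (\<forall>E'. finite E' \<and> E \<subseteq> E' \<and> E' \<subseteq> B \<longrightarrow>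
      t = finprod ?T (\<lambda>b. pure_tensor R ?F N (unit_vector R b) (ev b t)) E')"
    if t: "t \<in> carrier ?T" for t
  proof -
    define g where "g b t = pure_tensor R ?F N (unit_vector R b) (ev b t)" for b t
    have g: "g b \<in> hom ?T ?T" if "b \<in> B" for b
      using hom_compose[OF ev pure_tensor_hom_right[OF F N unit_vector_closed[OF R that]], of b]
      by (simp add: g_def[abs_def] comp_def)
    have gc: "(\<lambda>b. g b t) \<in> E \<rightarrow> carrier ?T" if "E \<subseteq> B" "t \<in> carrier ?T" for E t
      using hom_in_carrier[OF g _ ] that by blast
    define W where "W E = {t \<in> carrier ?T. t = finprod ?T (\<lambda>b. g b t) E}" for E
    have W: "subgroup (W E) ?T" if "E \<subseteq> B" for E
      unfolding W_def
      by (rule subgroup_equalizer[OF T.comm_group_axioms T.comm_group_axioms iso_imp_homomorphism[OF iso_set_refl]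
            hom_finprod_pointwise[OF T.comm_group_axioms g]]) (use that in blast)
    have "t \<in> {t \<in> carrier ?T. \<exists>E. finite E \<and> E \<subseteq> B \<and> (\<forall>E'. finite E' \<and> E \<subseteq> E' \<and> E' \<subseteq> B \<longrightarrow> t \<in> W E')}"
    proof (rule tensor_induct[OF F N directed_union_subgroup[OF T.comm_group_axioms W] _ t])
      fix f y assume fy: "f \<in> carrier ?F" "y \<in> carrier N"
      have fB: "finite {b. f b \<noteq> \<zero>\<^bsub>R\<^esub>}" "{b. f b \<noteq> \<zero>\<^bsub>R\<^esub>} \<subseteq> B" "\<And>b. f b \<in> carrier R"
        using fy by (auto simp: free_right_module_simps)
      have uv: "unit_vector R \<in> B \<rightarrow> carrier ?F" using unit_vector_closed[OF R] by auto
      have "pure_tensor R ?F N f y \<in> W E'" if E': "finite E' \<and> {b. f b \<noteq> \<zero>\<^bsub>R\<^esub>} \<subseteq> E' \<and> E' \<subseteq> B" for E'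
      proof -
        have c: "(\<lambda>b. act ?F (f b) (unit_vector R b)) \<in> E' \<rightarrow> carrier ?F"
          using E' by (auto intro!: right_module_closed[OF F] unit_vector_closed[OF R] fB(3))
        have "f = finprod ?F (\<lambda>b. act ?F (f b) (unit_vector R b)) E'"
          using free_lift_superset[OF F uv fy(1)] free_lift_eq_id[OF R fy(1)] E' by simp
        then have "pure_tensor R ?F N f y = pure_tensor R ?F N (finprod ?F (\<lambda>b. act ?F (f b) (unit_vector R b)) E') y"
          by simp
        also have "\<dots> = finprod ?T (\<lambda>b. pure_tensor R ?F N (act ?F (f b) (unit_vector R b)) y) E'"
          by (rule hom_finprod[OF right_module_group[OF F] T.comm_group_axioms pure_tensor_hom_left[OF F N fy(2)] c])
        also have "\<dots> = finprod ?T (\<lambda>b. g b (pure_tensor R ?F N f y)) E'"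
        proof (rule T.finprod_cong'[OF refl])
          show "(\<lambda>b. g b (pure_tensor R ?F N f y)) \<in> E' \<rightarrow> carrier ?T"
            using E' by (intro gc pure_tensor_closed[OF F N fy]) simp
          show "pure_tensor R ?F N (act ?F (f b) (unit_vector R b)) y = g b (pure_tensor R ?F N f y)" if "b \<in> E'" for b
            unfolding g_def evp[OF fy]
            using that E' by (intro pure_tensor_act[OF F N fB(3)] unit_vector_closed[OF R] fy) auto
        qed
        finally show ?thesis unfolding W_def using pure_tensor_closed[OF F N fy] by (intro CollectI conjI)
      qed
      then show "pure_tensor R ?F N f y \<in> {t \<in> carrier ?T. \<exists>E. finite E \<and> E \<subseteq> B \<and>
          (\<forall>E'. finite E' \<and> E \<subseteq> E' \<and> E' \<subseteq> B \<longrightarrow> t \<in> W E')}"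
        by (intro CollectI conjI exI[of _ "{b. f b \<noteq> \<zero>\<^bsub>R\<^esub>}"] allI impI fB(1,2) pure_tensor_closed[OF F N fy])
    qed
    then obtain E where E: "finite E" "E \<subseteq> B" and all: "\<forall>E'. finite E' \<and> E \<subseteq> E' \<and> E' \<subseteq> B \<longrightarrow> t \<in> W E'"
      by (elim CollectE conjE exE)
    show ?thesis
    proof (intro exI[of _ E] conjI allI impI E)
      fix E' assume "finite E' \<and> E \<subseteq> E' \<and> E' \<subseteq> B"
      from all[rule_format, OF this] show "t = finprod ?T (\<lambda>b. pure_tensor R ?F N (unit_vector R b) (ev b t)) E'"
        unfolding W_def g_def by (elim CollectE conjE)
    qed
  qed
  show ?thesis
  proof (rule hom_inj_onI[OF T.comm_group_axioms comm_group_tensor[OF F N'] th])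
    fix t assume t: "t \<in> carrier ?T" and one: "tensor_right R ?F N' h t = \<one>\<^bsub>?T'\<^esub>"
    have "h (ev b t) = \<one>\<^bsub>N'\<^esub>" for b
      using nat[OF t] one comm_hom_one[OF ev' comm_group_tensor[OF F N'] left_module_group[OF N']] by metis
    then have z: "ev b t = \<one>\<^bsub>N\<^esub>" for b
      using inj hom_in_carrier[OF ev t] comm_hom_one[OF module_hom_hom[OF h] left_module_group[OF N] left_module_group[OF N']]
      by (metis N.one_closed inj_onD)
    from coord[OF t] obtain E where E: "finite E" "E \<subseteq> B"
      and all: "\<forall>E'. finite E' \<and> E \<subseteq> E' \<and> E' \<subseteq> B \<longrightarrow>
        t = finprod ?T (\<lambda>b. pure_tensor R ?F N (unit_vector R b) (ev b t)) E'"
      by (elim exE conjE)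
    have t_eq: "t = finprod ?T (\<lambda>b. pure_tensor R ?F N (unit_vector R b) (ev b t)) E"
      by (rule all[rule_format]) (simp add: E)
    have "finprod ?T (\<lambda>b. pure_tensor R ?F N (unit_vector R b) (ev b t)) E = \<one>\<^bsub>?T\<^esub>"
      by (rule T.finprod_one_eqI)
        (use E(2) z pure_tensor_one_right[OF F N unit_vector_closed[OF R]] in auto)
    then show "t = \<one>\<^bsub>?T\<^esub>" by (rule trans[OF t_eq])
  qed
qed

section \<open>The syzygies of the canonical resolution\<close>

lemma inj_on_encode_fun:
  fixes R :: "'r ring"
  shows "inj_on (encode_fun R) {f :: ('m, 'r) formal \<Rightarrow> 'r. finite {x. f x \<noteq> \<zero>\<^bsub>R\<^esub>}}"
proof (rule inj_onI)
  fix f g :: "('m, 'r) formal \<Rightarrow> 'r" assume fg: "f \<in> {f. finite {x. f x \<noteq> \<zero>\<^bsub>R\<^esub>}}" "g \<in> {f. finite {x. f x \<noteq> \<zero>\<^bsub>R\<^esub>}}"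
    and "encode_fun R f = encode_fun R g"
  then have eq: "(\<lambda>x. (x, f x)) ` {x. f x \<noteq> \<zero>\<^bsub>R\<^esub>} = (\<lambda>x. (x, g x)) ` {x. g x \<noteq> \<zero>\<^bsub>R\<^esub>}"
    by (simp add: encode_fun_def Abs_fset_inject)
  show "f = g"
  proof
    fix x
    have "h x \<noteq> \<zero>\<^bsub>R\<^esub> \<and> y = h x \<longleftrightarrow> (x, y) \<in> (\<lambda>x. (x, h x)) ` {x. h x \<noteq> \<zero>\<^bsub>R\<^esub>}" for h :: "('m, 'r) formal \<Rightarrow> 'r" and y by auto
    from this[of f] this[of g] show "f x = g x" unfolding eq by metis
  qed
qed

abbreviation syzygy_cover ::
  "'r ring \<Rightarrow> ('r, 'm) rmodule \<Rightarrow> nat \<Rightarrow> (('m, 'r) formal \<Rightarrow> 'r) \<Rightarrow> ('m, 'r) formal" where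
  "syzygy_cover R M j \<equiv> free_lift R (syzygy R M j) (\<lambda>x. x)"

abbreviation syzygy_inclusion ::
  "'r ring \<Rightarrow> ('r, 'm) rmodule \<Rightarrow> nat \<Rightarrow> ('m, 'r) formal \<Rightarrow> (('m, 'r) formal \<Rightarrow> 'r)" where
  "syzygy_inclusion R M j \<equiv> inv_into (carrier (relation_module R (syzygy R M j))) (encode_fun R)"

lemma right_module_relation_module:
  assumes "right_module R M"
  shows "right_module R (relation_module R M)"
  unfolding relation_module_def kernel_module_def
  by (intro right_module_submodule submodule_kernel_right right_module_free right_module_ring[OF assms] assms free_lift_hom) simp

lemma inj_on_encode_relation: "inj_on (encode_fun R) (carrier (relation_module R M))"
  by (rule inj_on_subset[OF inj_on_encode_fun])
    (auto simp: relation_module_def kernel_module_def kernel_def free_right_module_simps)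

lemma right_module_syzygy:
  assumes "right_module R M"
  shows "right_module R (syzygy R M j)"
proof (induction j)
  case 0 then show ?case using assms by (simp add: right_module_transport inj_on_def)
next
  case (Suc j) then show ?case
    by (simp add: right_module_transport inj_on_encode_relation right_module_relation_module)
qed

lemma right_module_resolution:
  assumes "right_module R M" shows "right_module R (resolution R M j)"
  unfolding resolution_def by (rule right_module_free[OF right_module_ring[OF assms]])

text \<open>
  The cover sends the basis vector of a syzygy to this syzygy, so it is surjective; its kernel is the relation
  module, whose encoded copy is the next syzygy.
\<close>

lemma syzygy_short_exact:
  assumes M: "right_module R M"
  shows "short_exact R (syzygy R M (Suc j)) (resolution R M j) (syzygy R M j) (syzygy_inclusion R M j) (syzygy_cover R M j)"
proof -
  let ?Om = "syzygy R M j" and ?K = "relation_module R (syzygy R M j)"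
  note Om = right_module_syzygy[OF M, of j]
  have K: "right_module R ?K" by (rule right_module_relation_module[OF Om])
  have cov: "syzygy_cover R M j \<in> module_hom R (resolution R M j) ?Om"
    unfolding resolution_def by (rule free_lift_hom[OF Om]) simp
  have inc: "syzygy_inclusion R M j \<in> module_hom R (syzygy R M (Suc j)) ?K"
    using transport_inv_hom[OF inj_on_encode_relation, of R ?Om R] right_module_closed[OF K]
      right_module_group[OF K] by (simp add: comm_group.axioms group.is_monoid)
  have sub: "stable_subgroup R (kernel (resolution R M j) ?Om (syzygy_cover R M j)) (resolution R M j)"
    by (rule submodule_kernel_right[OF right_module_resolution[OF M] Om cov])
  have Kd: "?K = (resolution R M j)\<lparr>carrier := kernel (resolution R M j) ?Om (syzygy_cover R M j)\<rparr>"
    by (simp add: relation_module_def kernel_module_def resolution_def)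
  have 1: "syzygy_inclusion R M j \<in> module_hom R (syzygy R M (Suc j)) (resolution R M j)"
    using module_hom_comp[OF inc[unfolded Kd] submodule_inclusion[OF sub]] by (simp add: Kd)
  have 2: "bij_betw (syzygy_inclusion R M j) (carrier (syzygy R M (Suc j))) (carrier ?K)"
    using bij_betw_inv_into[OF inj_on_imp_bij_betw[OF inj_on_encode_relation[of R ?Om]]]
    by (simp add: transport_simps[OF inj_on_encode_relation])
  have 3: "syzygy_cover R M j ` carrier (resolution R M j) = carrier ?Om"
  proof
    show "syzygy_cover R M j ` carrier (resolution R M j) \<subseteq> carrier ?Om"
      using module_hom_closed[OF cov] by blast
    show "carrier ?Om \<subseteq> syzygy_cover R M j ` carrier (resolution R M j)"
    proof
      fix x assume x: "x \<in> carrier ?Om"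
      have "syzygy_cover R M j (unit_vector R x) = x" by (rule free_lift_unit_vector[OF Om _ x]) simp
      moreover have "unit_vector R x \<in> carrier (resolution R M j)"
        unfolding resolution_def by (rule unit_vector_closed[OF right_module_ring[OF M] x])
      ultimately show "x \<in> syzygy_cover R M j ` carrier (resolution R M j)" by (metis imageI)
    qed
  qed
  have 4: "carrier ?K = kernel (resolution R M j) ?Om (syzygy_cover R M j)" by (simp add: Kd)
  show ?thesis
    unfolding short_exact_def
    by (intro conjI 1 cov 3 bij_betw_imp_inj_on[OF 2] trans[OF bij_betw_imp_surj_on[OF 2] 4])
qed

lemma resolution_diff_factor:
  assumes M: "right_module R M" and f: "f \<in> carrier (resolution R M (Suc j))"
  shows "resolution_diff R M j f = syzygy_inclusion R M j (syzygy_cover R M (Suc j) f)"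
proof -
  have "(\<lambda>x. x) \<in> carrier (syzygy R M (Suc j)) \<rightarrow> carrier (syzygy R M (Suc j))" by (rule funcsetI)
  from free_lift_comp[OF right_module_syzygy[OF M] right_module_resolution[OF M]
      short_exactD(1)[OF syzygy_short_exact[OF M]] this f[unfolded resolution_def]]
  show ?thesis unfolding resolution_diff_def by (rule sym)
qed

lemma resolution_diff_hom:
  assumes M: "right_module R M"
  shows "resolution_diff R M j \<in> module_hom R (resolution R M (Suc j)) (resolution R M j)"
  unfolding resolution_diff_def resolution_def[of R M "Suc j"]
  by (rule free_lift_hom[OF right_module_resolution[OF M]], rule funcsetI,
      rule module_hom_closed[OF short_exactD(1)[OF syzygy_short_exact[OF M]]])

section \<open>Flat modules\<close>

lemma free_Abelian_group_hom_eqI: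
  assumes G: "comm_group G" and f: "f \<in> hom (free_Abelian_group K) G" and g: "g \<in> hom (free_Abelian_group K) G"
    and eq: "\<And>p. p \<in> K \<Longrightarrow> f (frag_of p) = g (frag_of p)" and c: "c \<in> carrier (free_Abelian_group K)"
  shows "f c = g c"
proof -
  interpret f: group_hom "free_Abelian_group K" G f by (rule comm_group_homI[OF abelian_free_Abelian_group G f])
  interpret g: group_hom "free_Abelian_group K" G g by (rule comm_group_homI[OF abelian_free_Abelian_group G g])
  from c have k: "Poly_Mapping.keys c \<subseteq> K" by simp
  show ?thesis
  proof (rule free_Abelian_group_induct[OF k])
    show "f 0 = g 0" using f.hom_one g.hom_one by simp
    fix c d assume "Poly_Mapping.keys c \<subseteq> K" "Poly_Mapping.keys d \<subseteq> K" "f c = g c" "f d = g d"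
    then show "f (c - d) = g (c - d)"
      using f.hom_mult[of c "- d"] g.hom_mult[of c "- d"] f.hom_inv[of d] g.hom_inv[of d] by simp
  qed (rule eq)
qed

lemma tensor_map_class:
  assumes m: "right_module R X" "left_module R L" "right_module R X'" "left_module R L'"
    and g: "g \<in> module_hom R X X'" and h: "h \<in> module_hom R L L'" and c: "c \<in> carrier (tensor_generators X L)"
  shows "tensor_map R X' L' g h (tensor_class R X L c) =
    tensor_class R X' L' (frag_extend (\<lambda>(x, y). frag_of (g x, h y)) c)"
proof (rule free_Abelian_group_hom_eqI[OF comm_group_tensor[OF m(3,4)] _ _ _ c])
  show "(\<lambda>c. tensor_map R X' L' g h (tensor_class R X L c)) \<in> hom (tensor_generators X L) (tensor R X' L')"
    using hom_compose[OF tensor_class_hom[OF m(1,2)] tensor_map_hom[OF m g h]] by (simp add: comp_def)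
  have e: "frag_extend (\<lambda>(x, y). frag_of (g x, h y)) \<in> hom (tensor_generators X L) (tensor_generators X' L')"
  proof (rule homI)
    fix c assume c: "c \<in> carrier (tensor_generators X L)"
    have "Poly_Mapping.keys (frag_extend (\<lambda>(x, y). frag_of (g x, h y)) c)
        \<subseteq> (\<Union>p\<in>Poly_Mapping.keys c. Poly_Mapping.keys ((\<lambda>(x, y). frag_of (g x, h y)) p))"
      by (rule keys_frag_extend)
    also have "\<dots> \<subseteq> carrier X' \<times> carrier L'"
      using c module_hom_closed[OF g] module_hom_closed[OF h] by auto
    finally show "frag_extend (\<lambda>(x, y). frag_of (g x, h y)) c \<in> carrier (tensor_generators X' L')" by simp
  qed (simp add: frag_extend_add)
  show "(\<lambda>c. tensor_class R X' L' (frag_extend (\<lambda>(x, y). frag_of (g x, h y)) c)) \<in> hom (tensor_generators X L) (tensor R X' L')"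
    using hom_compose[OF e tensor_class_hom[OF m(3,4)]] by (simp add: comp_def)
  show "tensor_map R X' L' g h (tensor_class R X L (frag_of p)) =
      tensor_class R X' L' (frag_extend (\<lambda>(x, y). frag_of (g x, h y)) (frag_of p))" if "p \<in> carrier X \<times> carrier L" for p
    using that tensor_map_pure[OF m g h] by (auto simp: pure_tensor_class)
qed

text \<open>
  This lemma and the next reduce flatness to finitely generated modules: a tensor vanishes by a derivation,
  which mentions only finitely many elements of \<open>Y\<close>.
\<close>

lemma tensor_relations_finite_support:
  assumes "r \<in> tensor_relations R Y L"
  shows "\<exists>B. finite B \<and> B \<subseteq> carrier Y \<and> (\<forall>H. B \<subseteq> H \<longrightarrow> r \<in> tensor_relations R (Y\<lparr>carrier := H\<rparr>) L)"
proof -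
  from assms consider
    (1) x x' y where "r = frag_of (x \<otimes>\<^bsub>Y\<^esub> x', y) - frag_of (x, y) - frag_of (x', y)"
      "x \<in> carrier Y" "x' \<in> carrier Y" "y \<in> carrier L"
    | (2) x y y' where "r = frag_of (x, y \<otimes>\<^bsub>L\<^esub> y') - frag_of (x, y) - frag_of (x, y')"
      "x \<in> carrier Y" "y \<in> carrier L" "y' \<in> carrier L"
    | (3) a x y where "r = frag_of (act Y a x, y) - frag_of (x, act L a y)"
      "a \<in> carrier R" "x \<in> carrier Y" "y \<in> carrier L"
    unfolding tensor_relations_def by blast
  then show ?thesis
  proof cases
    case 1 then show ?thesis by (intro exI[of _ "{x, x'}"]) (simp add: tensor_relations_def, blast)
  next
    case 2 then show ?thesis by (intro exI[of _ "{x}"]) (simp add: tensor_relations_def, blast)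
  next
    case 3 then show ?thesis by (intro exI[of _ "{x}"]) (simp add: tensor_relations_def, blast)
  qed
qed

lemma tensor_subgroup_finite_support:
  assumes m: "right_module R Y" "left_module R L" and r: "r \<in> tensor_subgroup R Y L"
  shows "\<exists>B. finite B \<and> B \<subseteq> carrier Y \<and>
    (\<forall>H. stable_subgroup R H Y \<and> B \<subseteq> H \<longrightarrow> r \<in> tensor_subgroup R (Y\<lparr>carrier := H\<rparr>) L)"
  using r unfolding tensor_subgroup_def
proof (induction rule: generate.induct)
  case one
  have "\<one>\<^bsub>tensor_generators Y L\<^esub> \<in> generate (tensor_generators (Y\<lparr>carrier := H\<rparr>) L) (tensor_relations R (Y\<lparr>carrier := H\<rparr>) L)" for H
    using generate.one[of "tensor_generators (Y\<lparr>carrier := H\<rparr>) L"] by simp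
  then show ?case by (intro exI[of _ "{}"]) simp
next
  case (eng r s)
  then obtain B D where B: "finite B" "B \<subseteq> carrier Y"
      "\<forall>H. stable_subgroup R H Y \<and> B \<subseteq> H \<longrightarrow> r \<in> generate (tensor_generators (Y\<lparr>carrier := H\<rparr>) L) (tensor_relations R (Y\<lparr>carrier := H\<rparr>) L)"
    and D: "finite D" "D \<subseteq> carrier Y"
      "\<forall>H. stable_subgroup R H Y \<and> D \<subseteq> H \<longrightarrow> s \<in> generate (tensor_generators (Y\<lparr>carrier := H\<rparr>) L) (tensor_relations R (Y\<lparr>carrier := H\<rparr>) L)"
    by blast
  show ?case
  proof (intro exI[of _ "B \<union> D"] conjI allI impI)
    fix H assume H: "stable_subgroup R H Y \<and> B \<union> D \<subseteq> H"
    have "r \<in> generate (tensor_generators (Y\<lparr>carrier := H\<rparr>) L) (tensor_relations R (Y\<lparr>carrier := H\<rparr>) L)"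
      "s \<in> generate (tensor_generators (Y\<lparr>carrier := H\<rparr>) L) (tensor_relations R (Y\<lparr>carrier := H\<rparr>) L)"
      using B(3) D(3) H by blast+
    from generate.eng[OF this]
    show "r \<otimes>\<^bsub>tensor_generators Y L\<^esub> s \<in> generate (tensor_generators (Y\<lparr>carrier := H\<rparr>) L) (tensor_relations R (Y\<lparr>carrier := H\<rparr>) L)"
      by simp
  qed (use B D in auto)
next
  case (incl r)
  from tensor_relations_finite_support[OF this] obtain B where
    B: "finite B" "B \<subseteq> carrier Y" "\<forall>H. B \<subseteq> H \<longrightarrow> r \<in> tensor_relations R (Y\<lparr>carrier := H\<rparr>) L" by blast
  then show ?case by (intro exI[of _ B] conjI allI impI generate.incl) simp_all
next
  case (inv r)
  from tensor_relations_finite_support[OF inv] obtain B where B: "finite B" "B \<subseteq> carrier Y" "\<forall>H. B \<subseteq> H \<longrightarrow> r \<in> tensor_relations R (Y\<lparr>carrier := H\<rparr>) L" by blast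
  show ?case
  proof (intro exI[of _ B] conjI allI impI B)
    fix H assume H: "stable_subgroup R H Y \<and> B \<subseteq> H"
    let ?Y = "Y\<lparr>carrier := H\<rparr>"
    have r: "r \<in> tensor_relations R ?Y L" using B(3) H by blast
    have k: "Poly_Mapping.keys r \<subseteq> H \<times> carrier L"
      using subsetD[OF tensor_relations_subset[OF right_module_submodule[OF m(1)] m(2)] r] H by simp
    have k': "Poly_Mapping.keys r \<subseteq> carrier Y \<times> carrier L"
      using subsetD[OF tensor_relations_subset[OF m] inv] by simp
    show "inv\<^bsub>tensor_generators Y L\<^esub> r \<in> generate (tensor_generators ?Y L) (tensor_relations R ?Y L)"
      using generate.inv[OF r, of "tensor_generators ?Y L"] k k' by simp
  qed
qed

lemma submodule_image:
  assumes "right_module R X" "right_module R Y" "h \<in> module_hom R X Y"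
  shows "stable_subgroup R (h ` carrier X) Y"
  unfolding stable_subgroup_def
proof (intro conjI ballI)
  show "subgroup (h ` carrier X) Y"
    by (rule hom_image_subgroup[OF right_module_group[OF assms(1)] right_module_group[OF assms(2)] module_hom_hom[OF assms(3)]])
  fix a y assume a: "a \<in> carrier R" and "y \<in> h ` carrier X"
  then obtain x where x: "x \<in> carrier X" "y = h x" by blast
  then have "act Y a y = h (act X a x)" using module_hom_act[OF assms(3) a] by simp
  then show "act Y a y \<in> h ` carrier X" using right_module_closed[OF assms(1) a x(1)] by simp
qed

lemma submodule_vimage:
  assumes X: "right_module R X" and Y: "right_module R Y" and h: "h \<in> module_hom R X Y" and H: "stable_subgroup R H Y"
  shows "stable_subgroup R {x \<in> carrier X. h x \<in> H} X"
proof -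
  interpret group_hom X Y h
    by (rule comm_group_homI[OF right_module_group[OF X] right_module_group[OF Y] module_hom_hom[OF h]])
  have sg: "subgroup H Y" using H by (simp add: stable_subgroup_def)
  interpret H: subgroup H Y by fact
  have "subgroup {x \<in> carrier X. h x \<in> H} X"
    by unfold_locales auto
  then show ?thesis
    using H right_module_closed[OF X] module_hom_act[OF h] by (simp add: stable_subgroup_def)
qed

text \<open>
  An element of a finitely generated module is determined by the set of its preimages in a free module of
  finite rank.  This set has the type over which the definition of flatness quantifies.
\<close>

lemma finitely_generated_submodule:
  fixes R :: "'r ring" and Y :: "('r, 'm) rmodule"
  assumes Y: "right_module R Y" and B: "finite B" "B \<subseteq> carrier Y"
  obtains H and e :: "'m \<Rightarrow> (nat \<Rightarrow> 'r) set" where "stable_subgroup R H Y" "B \<subseteq> H" "inj_on e H"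
proof -
  obtain b and m :: nat where b: "bij_betw b {0..<m} B" using ex_bij_betw_nat_finite[OF B(1)] by blast
  let ?F = "free_right_module R {0..<m}"
  have bY: "b \<in> {0..<m} \<rightarrow> carrier Y" using b B(2) by (auto simp: bij_betw_def)
  let ?l = "free_lift R Y b"
  have l: "?l \<in> module_hom R ?F Y" by (rule free_lift_hom[OF Y bY])
  show thesis
  proof (rule that[of "?l ` carrier ?F" "\<lambda>y. {f \<in> carrier ?F. ?l f = y}"])
    show "stable_subgroup R (?l ` carrier ?F) Y"
      by (rule submodule_image[OF right_module_free[OF right_module_ring[OF Y]] Y l])
    show "B \<subseteq> ?l ` carrier ?F"
    proof
      fix y assume "y \<in> B"
      then obtain i where i: "i \<in> {0..<m}" "y = b i" using b by (auto simp: bij_betw_def)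
      show "y \<in> ?l ` carrier ?F"
        by (rule image_eqI[of _ _ "unit_vector R i"])
          (simp_all add: i free_lift_unit_vector[OF Y bY i(1)] unit_vector_closed[OF right_module_ring[OF Y] i(1)])
    qed
    show "inj_on (\<lambda>y. {f \<in> carrier ?F. ?l f = y}) (?l ` carrier ?F)"
      by (rule inj_onI) blast
  qed
qed

text \<open>
  If the image of \<open>t\<close> vanishes, it already vanishes over a finitely generated submodule \<open>H\<close> of \<open>Y\<close>.  The preimage
  \<open>X0\<close> of \<open>H\<close> need not be finitely generated, but \<open>g\<close> embeds it in \<open>H\<close>; so both have copies with elements of the
  type that the definition of flatness admits.
\<close>

theorem flat_tensor_injective:
  fixes R :: "'r ring" and Y :: "('r, 'm) rmodule"
  assumes fl: "flat_left_module R L" and X: "right_module R X" and Y: "right_module R Y"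
    and g: "g \<in> module_hom R X Y" and inj: "inj_on g (carrier X)"
  shows "inj_on (tensor_left R Y L g) (carrier (tensor R X L))"
proof (rule hom_inj_onI)
  have L: "left_module R L" using fl by (simp add: flat_left_module_def)
  show "comm_group (tensor R X L)" "comm_group (tensor R Y L)"
    by (intro comm_group_tensor X Y L)+
  show "tensor_left R Y L g \<in> hom (tensor R X L) (tensor R Y L)"
    by (rule tensor_map_hom[OF X L Y L g module_hom_id])
  fix t assume t: "t \<in> carrier (tensor R X L)" and one: "tensor_left R Y L g t = \<one>\<^bsub>tensor R Y L\<^esub>"
  let ?push = "frag_extend (\<lambda>(x, y). frag_of (g x, y))"
  obtain c where c: "c \<in> carrier (tensor_generators X L)" and tc: "t = tensor_class R X L c"
    using t unfolding tensor_carrier by blast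
  have kp: "Poly_Mapping.keys (?push d) \<subseteq> (\<lambda>(x, y). (g x, y)) ` Poly_Mapping.keys d" for d
    using keys_frag_extend[of "\<lambda>(x, y). frag_of (g x, y)" d] by fastforce
  have pc: "?push c \<in> carrier (tensor_generators Y L)"
  proof -
    have "(\<lambda>(x, y). (g x, y)) ` Poly_Mapping.keys c \<subseteq> carrier Y \<times> carrier L"
      using c by (auto intro!: module_hom_closed[OF g])
    from subset_trans[OF kp this] show ?thesis by simp
  qed
  have "?push c \<in> tensor_subgroup R Y L"
    using one tensor_map_class[OF X L Y L g module_hom_id c] tensor_class_eq_one_iff[OF Y L pc] by (simp add: tc)
  from tensor_subgroup_finite_support[OF Y L this] obtain B where
    B: "finite B" "B \<subseteq> carrier Y" "\<forall>H. stable_subgroup R H Y \<and> B \<subseteq> H \<longrightarrow> ?push c \<in> tensor_subgroup R (Y\<lparr>carrier := H\<rparr>) L"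
    by (elim exE conjE)
  let ?B = "B \<union> (\<lambda>(x, y). g x) ` Poly_Mapping.keys c"
  have "finite ?B" "?B \<subseteq> carrier Y" using B c module_hom_closed[OF g] by auto
  from finitely_generated_submodule[OF Y this] obtain H and e :: "'m \<Rightarrow> (nat \<Rightarrow> 'r) set"
    where H: "stable_subgroup R H Y" and BH: "?B \<subseteq> H" and e: "inj_on e H" by blast
  define X0 where "X0 = X\<lparr>carrier := {x \<in> carrier X. g x \<in> H}\<rparr>"
  define Y0 where "Y0 = Y\<lparr>carrier := H\<rparr>"
  have HY: "H \<subseteq> carrier Y" using H by (auto simp: stable_subgroup_def dest: subgroup.subset)
  have sX0: "stable_subgroup R {x \<in> carrier X. g x \<in> H} X" by (rule submodule_vimage[OF X Y g H])
  have mX0: "right_module R X0" unfolding X0_def by (rule right_module_submodule[OF X sX0])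
  have mY0: "right_module R Y0" unfolding Y0_def by (rule right_module_submodule[OF Y H])
  have e': "inj_on e (carrier Y0)" using e by (simp add: Y0_def)
  have eg: "inj_on (\<lambda>x. e (g x)) (carrier X0)"
  proof (rule inj_onI)
    fix x x' assume x: "x \<in> carrier X0" "x' \<in> carrier X0" and "e (g x) = e (g x')"
    then have "g x = g x'" using inj_onD[OF e] by (simp add: X0_def)
    then show "x = x'" using inj_onD[OF inj] x by (simp add: X0_def)
  qed
  let ?X' = "transport (\<lambda>x. e (g x)) X0" and ?Y' = "transport e Y0"
  have mX': "right_module R ?X'" by (rule right_module_transport[OF eg mX0])
  have mY': "right_module R ?Y'" by (rule right_module_transport[OF e' mY0])
  have g0: "g \<in> module_hom R X0 Y0"
    by (rule module_homI) (simp_all add: X0_def Y0_def module_hom_mult[OF g] module_hom_act[OF g])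
  have hX: "(\<lambda>x. e (g x)) \<in> module_hom R X0 ?X'" by (rule transport_hom[OF eg])
  have hY: "e \<in> module_hom R Y0 ?Y'" by (rule transport_hom[OF e'])
  interpret X0: comm_group X0 by (rule right_module_group[OF mX0])
  have i': "(\<lambda>x. x) \<in> module_hom R ?X' ?Y'"
  proof (rule module_homI)
    show "x \<in> carrier ?Y'" if "x \<in> carrier ?X'" for x
      using that module_hom_closed[OF g0] by (auto simp: transport_simps[OF eg] transport_simps[OF e'])
    show "u \<otimes>\<^bsub>?X'\<^esub> v = u \<otimes>\<^bsub>?Y'\<^esub> v" if uv: "u \<in> carrier ?X'" "v \<in> carrier ?X'" for u v
    proof -
      obtain x y where "x \<in> carrier X0" "y \<in> carrier X0" "u = e (g x)" "v = e (g y)"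
        using uv unfolding transport_simps(1)[OF eg] by blast
      then show ?thesis
        by (simp add: transport_simps(2)[OF eg] transport_simps(2)[OF e'] module_hom_closed[OF g0] module_hom_mult[OF g0])
    qed
    show "act ?X' a u = act ?Y' a u" if a: "a \<in> carrier R" and u: "u \<in> carrier ?X'" for a u
    proof -
      obtain x where "x \<in> carrier X0" "u = e (g x)"
        using u unfolding transport_simps(1)[OF eg] by blast
      then show ?thesis
        by (simp add: transport_simps(4)[OF eg] transport_simps(4)[OF e'] module_hom_closed[OF g0] module_hom_act[OF g0 a])
    qed
  qed
  have injL: "inj_on (tensor_map R ?Y' L (\<lambda>x. x) (\<lambda>y. y)) (carrier (tensor R ?X' L))"
    by (rule conjunct2[OF fl[unfolded flat_left_module_def], rule_format]) (intro conjI mX' mY' i' inj_on_id2)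
  have c0: "c \<in> carrier (tensor_generators X0 L)"
  proof -
    have "g (fst p) \<in> H \<and> p \<in> carrier X \<times> carrier L" if "p \<in> Poly_Mapping.keys c" for p
      using c BH that by (auto simp: case_prod_unfold)
    then show ?thesis by (fastforce simp: X0_def)
  qed
  let ?t0 = "tensor_class R X0 L c"
  have t0: "?t0 \<in> carrier (tensor R X0 L)" unfolding tensor_carrier using c0 by (rule imageI)
  have p0: "?push c \<in> carrier (tensor_generators Y0 L)"
  proof -
    have "(\<lambda>(x, y). (g x, y)) ` Poly_Mapping.keys c \<subseteq> carrier Y0 \<times> carrier L"
      using c0 by (auto intro!: module_hom_closed[OF g0])
    from subset_trans[OF kp this] show ?thesis by simp
  qed
  let ?t' = "tensor_left R ?X' L (\<lambda>x. e (g x)) ?t0"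
  have t': "?t' \<in> carrier (tensor R ?X' L)"
    by (rule hom_in_carrier[OF tensor_map_hom[OF mX0 L mX' L hX module_hom_id] t0])
  have "tensor_map R ?Y' L (\<lambda>x. x) (\<lambda>y. y) ?t' = tensor_left R ?Y' L (\<lambda>x. e (g x)) ?t0"
    using tensor_map_comp[OF mX0 L mX' L mY' L hX module_hom_id i' module_hom_id t0] .
  also have "\<dots> = tensor_left R ?Y' L e (tensor_left R Y0 L g ?t0)"
    using tensor_map_comp[OF mX0 L mY0 L mY' L g0 module_hom_id hY module_hom_id t0] by (rule sym)
  also have "tensor_left R Y0 L g ?t0 = tensor_class R Y0 L (?push c)"
    by (rule tensor_map_class[OF mX0 L mY0 L g0 module_hom_id c0])
  also have "\<dots> = \<one>\<^bsub>tensor R Y0 L\<^esub>"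
    using B(3) H BH tensor_class_eq_one_iff[OF mY0 L p0] by (simp add: Y0_def)
  also have "tensor_left R ?Y' L e \<one>\<^bsub>tensor R Y0 L\<^esub> = \<one>\<^bsub>tensor R ?Y' L\<^esub>"
    by (rule comm_hom_one[OF tensor_map_hom[OF mY0 L mY' L hY module_hom_id]]) (intro comm_group_tensor mY0 mY' L)+
  finally have one': "tensor_map R ?Y' L (\<lambda>x. x) (\<lambda>y. y) ?t' = \<one>\<^bsub>tensor R ?Y' L\<^esub>" .
  interpret TX': comm_group "tensor R ?X' L" by (rule comm_group_tensor[OF mX' L])
  have "?t' = \<one>\<^bsub>tensor R ?X' L\<^esub>"
    by (rule inj_onD[OF injL _ t' TX'.one_closed])
      (simp only: one' comm_hom_one[OF tensor_map_hom[OF mX' L mY' L i' module_hom_id] TX'.comm_group_axioms comm_group_tensor[OF mY' L]])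
  moreover
  let ?b = "inv_into (carrier X0) (\<lambda>x. e (g x))"
  have b: "?b \<in> module_hom R ?X' X0"
    by (rule transport_inv_hom[OF eg X0.monoid_axioms right_module_closed[OF mX0]])
  have "tensor_left R X0 L ?b ?t' = tensor_left R X0 L (\<lambda>x. ?b (e (g x))) ?t0"
    by (rule tensor_map_comp[OF mX0 L mX' L mX0 L hX module_hom_id b module_hom_id t0])
  moreover have "\<dots> = ?t0"
    by (rule tensor_map_id_cong[OF mX0 L module_hom_comp[OF hX b] module_hom_id _ _ t0])
      (simp_all add: inv_into_f_f[OF eg])
  moreover have "tensor_left R X0 L ?b \<one>\<^bsub>tensor R ?X' L\<^esub> = \<one>\<^bsub>tensor R X0 L\<^esub>"
    by (rule comm_hom_one[OF tensor_map_hom[OF mX' L mX0 L b module_hom_id]]) (intro comm_group_tensor mX0 mX' L)+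
  ultimately have "?t0 = \<one>\<^bsub>tensor R X0 L\<^esub>" by simp
  moreover have inc: "(\<lambda>x. x) \<in> module_hom R X0 X" unfolding X0_def by (rule submodule_inclusion[OF sX0])
  have "tensor_map R X L (\<lambda>x. x) (\<lambda>y. y) ?t0 = tensor_class R X L (frag_extend (\<lambda>(x, y). frag_of (x, y)) c)"
    by (rule tensor_map_class[OF mX0 L X L inc module_hom_id c0])
  moreover have "frag_extend (\<lambda>(x, y). frag_of (x, y)) c = c"
    using frag_expansion[of c] by (simp add: case_prod_unfold)
  moreover have "tensor_map R X L (\<lambda>x. x) (\<lambda>y. y) \<one>\<^bsub>tensor R X0 L\<^esub> = \<one>\<^bsub>tensor R X L\<^esub>"
    by (rule comm_hom_one[OF tensor_map_hom[OF mX0 L X L inc module_hom_id]]) (intro comm_group_tensor mX0 X L)+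
  ultimately show "t = \<one>\<^bsub>tensor R X L\<^esub>" by (simp add: tc)
qed

text \<open>
  The tensor products with \<open>L\<close> embed naturally in those with \<open>F\<close>.
\<close>

lemma flat_retract:
  assumes fl: "flat_left_module R F" and L: "left_module R L" and i: "i \<in> module_hom R L F"
    and p: "p \<in> module_hom R F L" and pi: "\<And>y. y \<in> carrier L \<Longrightarrow> p (i y) = y"
  shows "flat_left_module R L"
  unfolding flat_left_module_def
proof (intro conjI allI impI L)
  fix X Y :: "('a, (nat \<Rightarrow> 'a) set) rmodule" and g
  assume "right_module R X \<and> right_module R Y \<and> g \<in> module_hom R X Y \<and> inj_on g (carrier X)"
  then have X: "right_module R X" and Y: "right_module R Y" and g: "g \<in> module_hom R X Y" and inj: "inj_on g (carrier X)" by auto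
  have F: "left_module R F" using fl by (simp add: flat_left_module_def)
  let ?i = "\<lambda>Z :: ('a, (nat \<Rightarrow> 'a) set) rmodule. tensor_right R Z F i"
  have ii: "inj_on (?i X) (carrier (tensor R X L))"
  proof (rule inj_on_inverseI)
    show "tensor_right R X L p (?i X t) = t" if t: "t \<in> carrier (tensor R X L)" for t
      unfolding tensor_map_comp[OF X L X F X L module_hom_id i module_hom_id p t]
      by (rule tensor_map_id_cong[OF X L module_hom_id module_hom_comp[OF i p] _ _ t]) (simp_all add: pi)
  qed
  have gi: "inj_on (\<lambda>t. tensor_left R Y F g (?i X t)) (carrier (tensor R X L))"
    using comp_inj_on[OF ii inj_on_subset[OF flat_tensor_injective[OF fl X Y g inj]
        hom_carrier[OF tensor_map_hom[OF X L X F module_hom_id i]]]] by (simp add: comp_def)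
  have comm: "?i Y (tensor_left R Y L g t) = tensor_left R Y F g (?i X t)" if t: "t \<in> carrier (tensor R X L)" for t
    unfolding tensor_map_comp[OF X L Y L Y F g module_hom_id module_hom_id i t]
      tensor_map_comp[OF X L X F Y F module_hom_id i g module_hom_id t] ..
  show "inj_on (tensor_left R Y L g) (carrier (tensor R X L))"
  proof (rule inj_onI)
    fix t u assume t: "t \<in> carrier (tensor R X L)" and u: "u \<in> carrier (tensor R X L)"
      and "tensor_left R Y L g t = tensor_left R Y L g u"
    then show "t = u" using inj_onD[OF gi _ t u] comm[OF t] comm[OF u] by simp
  qed
qed

section \<open>The left ideal of an idempotent is flat\<close>

definition idempotent_ideal :: "'r ring \<Rightarrow> 'r \<Rightarrow> ('r, 'r) rmodule" where
  "idempotent_ideal R e = (left_regular R)\<lparr>carrier := {a \<in> carrier R. a \<otimes>\<^bsub>R\<^esub> e = a}\<rparr>"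

lemma with_act_simps [simp]:
  "carrier (with_act G f) = carrier G" "monoid.mult (with_act G f) = monoid.mult G"
  "one (with_act G f) = one G" "act (with_act G f) = f"
  by (simp_all add: with_act_def)

lemma comm_group_cong:
  assumes "comm_group G" "carrier H = carrier G" "monoid.mult H = monoid.mult G" "one H = one G"
  shows "comm_group H"
proof -
  interpret comm_group G by fact
  show ?thesis
    by (rule comm_groupI) (auto simp: assms m_ac intro: l_inv_ex)
qed

lemma comm_group_with_act: "comm_group G \<Longrightarrow> comm_group (with_act G f)"
  by (rule comm_group_cong) simp_all

lemma left_module_regular:
  assumes "ring R" shows "left_module R (left_regular R)"
proof -
  interpret ring R by fact
  show ?thesis
    using assms comm_group_with_act[OF ring_add_comm_group[OF assms]]
    by (simp add: left_module_def left_regular_def l_distr r_distr m_assoc)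
qed

lemma right_module_regular:
  assumes "ring R" shows "right_module R (right_regular R)"
proof -
  interpret ring R by fact
  show ?thesis
    using assms comm_group_with_act[OF ring_add_comm_group[OF assms]]
    by (simp add: right_module_def right_regular_def l_distr r_distr m_assoc)
qed

text \<open>
  The map \<open>x \<otimes> a \<mapsto> xa\<close> from \<open>X \<otimes> Re\<close> to \<open>X\<close> is natural in \<open>X\<close>, and it is injective since \<open>x \<otimes> a = xa \<otimes> e\<close>.
\<close>

lemma idempotent_ideal_flat:
  assumes R: "ring R" and e: "e \<in> carrier R" "e \<otimes>\<^bsub>R\<^esub> e = e"
  shows "flat_left_module R (idempotent_ideal R e)"
proof -
  interpret ring R by fact
  let ?B = "idempotent_ideal R e"
  have cB: "a \<in> carrier ?B \<longleftrightarrow> a \<in> carrier R \<and> a \<otimes>\<^bsub>R\<^esub> e = a" for a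
    by (simp add: idempotent_ideal_def)
  have aB: "act ?B a b = a \<otimes>\<^bsub>R\<^esub> b" "b \<otimes>\<^bsub>?B\<^esub> c = b \<oplus>\<^bsub>R\<^esub> c" for a b c
    by (simp_all add: idempotent_ideal_def left_regular_def)
  have "subgroup {a \<in> carrier R. a \<otimes>\<^bsub>R\<^esub> e = a} (left_regular R)"
  proof -
    interpret reg: comm_group "left_regular R" by (rule left_module_group[OF left_module_regular[OF R]])
    have "(\<lambda>a. a \<otimes>\<^bsub>R\<^esub> e) \<in> hom (left_regular R) (left_regular R)"
      by (rule homI) (simp_all add: left_regular_def e l_distr)
    from subgroup_equalizer[OF reg.comm_group_axioms reg.comm_group_axioms this iso_imp_homomorphism[OF iso_set_refl]]
    show ?thesis by (simp add: left_regular_def)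
  qed
  then have sub: "stable_subgroup R {a \<in> carrier R. a \<otimes>\<^bsub>R\<^esub> e = a} (left_regular R)"
    unfolding stable_subgroup_def using e(1) by (simp add: left_regular_def m_assoc)
  have B: "left_module R ?B"
    unfolding idempotent_ideal_def by (rule left_module_submodule[OF left_module_regular[OF R] sub])
  show ?thesis unfolding flat_left_module_def
  proof (intro conjI allI impI B)
    fix X Y :: "('a, (nat \<Rightarrow> 'a) set) rmodule" and g
    assume "right_module R X \<and> right_module R Y \<and> g \<in> module_hom R X Y \<and> inj_on g (carrier X)"
    then have X: "right_module R X" and Y: "right_module R Y" and g: "g \<in> module_hom R X Y" and inj: "inj_on g (carrier X)" by auto
    define m where "m Z = tensor_lift Z (\<lambda>x a. act Z a x)" for Z :: "('a, (nat \<Rightarrow> 'a) set) rmodule"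
    have bal: "balanced R Z ?B Z (\<lambda>x a. act Z a x)" if Z: "right_module R Z" for Z :: "('a, (nat \<Rightarrow> 'a) set) rmodule"
      by (rule balancedI)
        (simp_all add: cB aB right_module_closed[OF Z] right_module_add[OF Z] right_module_scal[OF Z] right_module_assoc[OF Z])
    have mh: "m Z \<in> hom (tensor R Z ?B) Z" if Z: "right_module R Z" for Z
      unfolding m_def by (rule tensor_lift_hom[OF Z B right_module_group[OF Z] bal[OF Z]])
    have mp: "m Z (pure_tensor R Z ?B x a) = act Z a x" if Z: "right_module R Z" "x \<in> carrier Z" "a \<in> carrier ?B" for Z x a
      unfolding m_def by (rule tensor_lift_pure[OF Z(1) B right_module_group[OF Z(1)] bal[OF Z(1)] Z(2,3)])
    have eB: "e \<in> carrier ?B" using e by (simp add: cB)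
    have recover: "pure_tensor R X ?B (m X t) e = t" if t: "t \<in> carrier (tensor R X ?B)" for t
    proof (rule tensor_hom_eqI[OF X B comm_group_tensor[OF X B] _ iso_imp_homomorphism[OF iso_set_refl] _ t])
      show "(\<lambda>t. pure_tensor R X ?B (m X t) e) \<in> hom (tensor R X ?B) (tensor R X ?B)"
        using hom_compose[OF mh[OF X] pure_tensor_hom_left[OF X B eB]] by (simp add: comp_def)
      show "pure_tensor R X ?B (m X (pure_tensor R X ?B x a)) e = pure_tensor R X ?B x a"
        if "x \<in> carrier X" "a \<in> carrier ?B" for x a
      proof -
        have a: "a \<in> carrier R" "a \<otimes>\<^bsub>R\<^esub> e = a" using that(2) by (simp_all add: cB)
        show ?thesis unfolding mp[OF X that] pure_tensor_act[OF X B a(1) that(1) eB] aB(1) a(2) ..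
      qed
    qed
    have nat: "m Y (tensor_left R Y ?B g t) = g (m X t)" if t: "t \<in> carrier (tensor R X ?B)" for t
    proof (rule tensor_hom_eqI[OF X B right_module_group[OF Y] _ _ _ t])
      show "(\<lambda>t. m Y (tensor_left R Y ?B g t)) \<in> hom (tensor R X ?B) Y"
        using hom_compose[OF tensor_map_hom[OF X B Y B g module_hom_id] mh[OF Y]] by (simp add: comp_def)
      show "(\<lambda>t. g (m X t)) \<in> hom (tensor R X ?B) Y"
        using hom_compose[OF mh[OF X] module_hom_hom[OF g]] by (simp add: comp_def)
      show "m Y (tensor_left R Y ?B g (pure_tensor R X ?B x a)) = g (m X (pure_tensor R X ?B x a))"
        if xa: "x \<in> carrier X" "a \<in> carrier ?B" for x a
      proof -
        have a: "a \<in> carrier R" using xa(2) by (simp add: cB)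
        show ?thesis
          unfolding tensor_map_pure[OF X B Y B g module_hom_id xa] mp[OF Y module_hom_closed[OF g xa(1)] xa(2)]
            mp[OF X xa] module_hom_act[OF g a xa(1)] ..
      qed
    qed
    show "inj_on (tensor_left R Y ?B g) (carrier (tensor R X ?B))"
    proof (rule inj_onI)
      fix t u assume t: "t \<in> carrier (tensor R X ?B)" and u: "u \<in> carrier (tensor R X ?B)"
        and "tensor_left R Y ?B g t = tensor_left R Y ?B g u"
      then have "g (m X t) = g (m X u)" using nat[OF t] nat[OF u] by simp
      then have eq: "m X t = m X u" by (rule inj_onD[OF inj]) (rule hom_in_carrier[OF mh[OF X]], rule t u)+
      from recover[OF t] show "t = u" unfolding eq recover[OF u] by (rule sym)
    qed
  qed
qed

section \<open>Tensoring with a bimodule\<close>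

text \<open>
  A record of type \<open>rmodule\<close> holds one action.  A bimodule is therefore a pair: \<open>B\<close> carries the left action and
  \<open>B'\<close> the right action on the same abelian group.
\<close>

definition bimodule :: "'r ring \<Rightarrow> 'k ring \<Rightarrow> ('r, 'b) rmodule \<Rightarrow> ('k, 'b) rmodule \<Rightarrow> bool" where
  "bimodule R k B B' \<longleftrightarrow> left_module R B \<and> right_module k B' \<and>
    carrier B' = carrier B \<and> monoid.mult B' = monoid.mult B \<and>
    (\<forall>r\<in>carrier R. \<forall>c\<in>carrier k. \<forall>b\<in>carrier B. act B r (act B' c b) = act B' c (act B r b))"

definition bimodule_tensor ::
  "'k ring \<Rightarrow> ('r, 'b) rmodule \<Rightarrow> ('k, 'b) rmodule \<Rightarrow> ('k, 'l) rmodule \<Rightarrow> ('r, ('b \<times> 'l \<Rightarrow>\<^sub>0 int) set) rmodule" where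
  "bimodule_tensor k B B' L = with_act (tensor k B' L) (\<lambda>r. tensor_left k B' L (act B r))"

definition tensor_bimodule ::
  "'r ring \<Rightarrow> ('r, 'x) rmodule \<Rightarrow> ('r, 'b) rmodule \<Rightarrow> ('k, 'b) rmodule \<Rightarrow> ('k, ('x \<times> 'b \<Rightarrow>\<^sub>0 int) set) rmodule" where
  "tensor_bimodule R X B B' = with_act (tensor R X B) (\<lambda>c. tensor_right R X B (act B' c))"

lemma hom_mult_pointwise:
  assumes "comm_group H" "f \<in> hom G H" "g \<in> hom G H"
  shows "(\<lambda>x. f x \<otimes>\<^bsub>H\<^esub> g x) \<in> hom G H"
proof -
  interpret comm_group H by fact
  show ?thesis
    using assms(2,3) by (intro homI) (simp_all add: hom_in_carrier hom_mult m_ac)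
qed

lemma bimoduleD:
  assumes "bimodule R k B B'"
  shows "left_module R B" "right_module k B'" "carrier B' = carrier B" "monoid.mult B' = monoid.mult B"
    and "\<And>r c b. r \<in> carrier R \<Longrightarrow> c \<in> carrier k \<Longrightarrow> b \<in> carrier B \<Longrightarrow> act B r (act B' c b) = act B' c (act B r b)"
  using assms by (simp_all add: bimodule_def)

lemma bimodule_left_act:
  assumes "bimodule R k B B'" "r \<in> carrier R" shows "act B r \<in> module_hom k B' B'"
  using left_module_closed[OF bimoduleD(1)] left_module_add[OF bimoduleD(1)] bimoduleD[OF assms(1)] assms
  by (intro module_homI) simp_all

lemma bimodule_right_act:
  assumes "bimodule R k B B'" "c \<in> carrier k" shows "act B' c \<in> module_hom R B B"
  using right_module_closed[OF bimoduleD(2)[OF assms(1)]] right_module_add[OF bimoduleD(2)[OF assms(1)]] bimoduleD[OF assms(1)] assms(2)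
  by (intro module_homI) simp_all

lemma bimodule_tensor_simps [simp]:
  "carrier (bimodule_tensor k B B' L) = carrier (tensor k B' L)"
  "monoid.mult (bimodule_tensor k B B' L) = monoid.mult (tensor k B' L)"
  "one (bimodule_tensor k B B' L) = one (tensor k B' L)"
  by (simp_all add: bimodule_tensor_def)

lemma hom_bimodule_tensor [simp]:
  "hom (bimodule_tensor k B B' L) G = hom (tensor k B' L) G"
  "hom G (bimodule_tensor k B B' L) = hom G (tensor k B' L)"
  by (simp_all add: hom_def)

lemma tensor_bimodule_simps [simp]:
  "carrier (tensor_bimodule R X B B') = carrier (tensor R X B)"
  "monoid.mult (tensor_bimodule R X B B') = monoid.mult (tensor R X B)"
  "one (tensor_bimodule R X B B') = one (tensor R X B)"
  by (simp_all add: tensor_bimodule_def)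

lemma bimodule_tensor_act_pure:
  assumes "bimodule R k B B'" "left_module k L" "r \<in> carrier R" "b \<in> carrier B" "l \<in> carrier L"
  shows "act (bimodule_tensor k B B' L) r (pure_tensor k B' L b l) = pure_tensor k B' L (act B r b) l"
  using tensor_map_pure[OF bimoduleD(2)[OF assms(1)] assms(2) bimoduleD(2)[OF assms(1)] assms(2)
      bimodule_left_act[OF assms(1,3)] module_hom_id] bimoduleD(3)[OF assms(1)] assms(4,5)
  by (simp add: bimodule_tensor_def)

lemma left_module_bimodule_tensor:
  assumes B: "bimodule R k B B'" and L: "left_module k L"
  shows "left_module R (bimodule_tensor k B B' L)"
proof -
  let ?T = "tensor k B' L" and ?M = "bimodule_tensor k B B' L"
  note b = bimoduleD[OF B]
  have T: "comm_group ?T" by (rule comm_group_tensor[OF b(2) L])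
  let ?a = "\<lambda>r. tensor_left k B' L (act B r)"
  have h: "?a r \<in> hom ?T ?T" if "r \<in> carrier R" for r
    by (rule tensor_map_hom[OF b(2) L b(2) L bimodule_left_act[OF B that] module_hom_id])
  have p: "?a r (pure_tensor k B' L x y) = pure_tensor k B' L (act B r x) y"
    if "r \<in> carrier R" "x \<in> carrier B'" "y \<in> carrier L" for r x y
    by (rule tensor_map_pure[OF b(2) L b(2) L bimodule_left_act[OF B that(1)] module_hom_id that(2,3)])
  interpret R: ring R by (rule left_module_ring[OF b(1)])
  have add: "?a (r \<oplus>\<^bsub>R\<^esub> s) t = ?a r t \<otimes>\<^bsub>?T\<^esub> ?a s t" if "r \<in> carrier R" "s \<in> carrier R" "t \<in> carrier ?T" for r s t
  proof (rule tensor_hom_eqI[OF b(2) L T h[OF R.a_closed[OF that(1,2)]] hom_mult_pointwise[OF T h[OF that(1)] h[OF that(2)]] _ that(3)])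
    show "?a (r \<oplus>\<^bsub>R\<^esub> s) (pure_tensor k B' L x y) = ?a r (pure_tensor k B' L x y) \<otimes>\<^bsub>?T\<^esub> ?a s (pure_tensor k B' L x y)"
      if xy: "x \<in> carrier B'" "y \<in> carrier L" for x y
    proof -
      have x: "x \<in> carrier B" using xy b(3) by simp
      show ?thesis
        using pure_tensor_mult_left[OF b(2) L, of "act B r x" "act B s x" y] left_module_closed[OF b(1) _ x]
          left_module_scal[OF b(1) _ _ x] \<open>r \<in> carrier R\<close> \<open>s \<in> carrier R\<close> xy b(3,4)
        by (simp add: p)
    qed
  qed
  have assoc: "?a (r \<otimes>\<^bsub>R\<^esub> s) t = ?a r (?a s t)" if "r \<in> carrier R" "s \<in> carrier R" "t \<in> carrier ?T" for r s t
    unfolding tensor_map_comp[OF b(2) L b(2) L b(2) L bimodule_left_act[OF B that(2)] module_hom_id bimodule_left_act[OF B that(1)] module_hom_id that(3)]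
    by (rule tensor_map_cong[OF b(2) L b(2) L _ module_hom_id _ module_hom_id _ _ that(3)])
      (use that b(3) left_module_assoc[OF b(1)] in
        \<open>simp_all add: bimodule_left_act[OF B] module_hom_comp[OF bimodule_left_act[OF B] bimodule_left_act[OF B]]\<close>)
  have one: "?a \<one>\<^bsub>R\<^esub> t = t" if "t \<in> carrier ?T" for t
    by (rule tensor_map_id_cong[OF b(2) L bimodule_left_act[OF B R.one_closed] module_hom_id _ _ that])
      (simp_all add: b(3) left_module_one[OF b(1)])
  show ?thesis
    unfolding left_module_def bimodule_tensor_def
    using comm_group_with_act[OF T] R.ring_axioms
    by (simp add: hom_in_carrier[OF h] hom_mult[OF h] add assoc one)
qed

lemma right_module_tensor_bimodule:
  assumes X: "right_module R X" and B: "bimodule R k B B'"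
  shows "right_module k (tensor_bimodule R X B B')"
proof -
  let ?T = "tensor R X B"
  note b = bimoduleD[OF B]
  have T: "comm_group ?T" by (rule comm_group_tensor[OF X b(1)])
  let ?a = "\<lambda>r. tensor_right R X B (act B' r)"
  have h: "?a r \<in> hom ?T ?T" if "r \<in> carrier k" for r
    by (rule tensor_map_hom[OF X b(1) X b(1) module_hom_id bimodule_right_act[OF B that]])
  have p: "?a r (pure_tensor R X B x y) = pure_tensor R X B x (act B' r y)"
    if "r \<in> carrier k" "x \<in> carrier X" "y \<in> carrier B" for r x y
    by (rule tensor_map_pure[OF X b(1) X b(1) module_hom_id bimodule_right_act[OF B that(1)] that(2,3)])
  interpret k: ring k by (rule right_module_ring[OF b(2)])
  have add: "?a (r \<oplus>\<^bsub>k\<^esub> s) t = ?a r t \<otimes>\<^bsub>?T\<^esub> ?a s t" if "r \<in> carrier k" "s \<in> carrier k" "t \<in> carrier ?T" for r s t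
  proof (rule tensor_hom_eqI[OF X b(1) T h[OF k.a_closed[OF that(1,2)]] hom_mult_pointwise[OF T h[OF that(1)] h[OF that(2)]] _ that(3)])
    show "?a (r \<oplus>\<^bsub>k\<^esub> s) (pure_tensor R X B x y) = ?a r (pure_tensor R X B x y) \<otimes>\<^bsub>?T\<^esub> ?a s (pure_tensor R X B x y)"
      if xy: "x \<in> carrier X" "y \<in> carrier B" for x y
    proof -
      have y: "y \<in> carrier B'" using xy b(3) by simp
      show ?thesis
        using pure_tensor_mult_right[OF X b(1), of x "act B' r y" "act B' s y"] right_module_closed[OF b(2) _ y]
          right_module_scal[OF b(2) _ _ y] \<open>r \<in> carrier k\<close> \<open>s \<in> carrier k\<close> xy b(3,4)
        by (simp add: p)
    qed
  qed
  have assoc: "?a (r \<otimes>\<^bsub>k\<^esub> s) t = ?a s (?a r t)" if "r \<in> carrier k" "s \<in> carrier k" "t \<in> carrier ?T" for r s t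
    unfolding tensor_map_comp[OF X b(1) X b(1) X b(1) module_hom_id bimodule_right_act[OF B that(1)] module_hom_id bimodule_right_act[OF B that(2)] that(3)]
    by (rule tensor_map_cong[OF X b(1) X b(1) module_hom_id _ module_hom_id _ _ _ that(3)])
      (use that b(3) right_module_assoc[OF b(2)] in
        \<open>simp_all add: bimodule_right_act[OF B] module_hom_comp[OF bimodule_right_act[OF B] bimodule_right_act[OF B]]\<close>)
  have one: "?a \<one>\<^bsub>k\<^esub> t = t" if "t \<in> carrier ?T" for t
    by (rule tensor_map_id_cong[OF X b(1) module_hom_id bimodule_right_act[OF B k.one_closed] _ _ that])
      (use right_module_one[OF b(2)] in \<open>simp_all add: b(3)\<close>)
  show ?thesis
    unfolding right_module_def tensor_bimodule_def
    using comm_group_with_act[OF T] k.ring_axioms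
    by (simp add: hom_in_carrier[OF h] hom_mult[OF h] add assoc one)
qed

text \<open>
  This is the map \<open>x \<otimes> (b \<otimes> l) \<mapsto> (x \<otimes> b) \<otimes> l\<close>.
\<close>

definition tensor_assoc ::
  "'r ring \<Rightarrow> 'k ring \<Rightarrow> ('r, 'x) rmodule \<Rightarrow> ('r, 'b) rmodule \<Rightarrow> ('k, 'b) rmodule \<Rightarrow> ('k, 'l) rmodule \<Rightarrow> _" where
  "tensor_assoc R k X B B' L = tensor_lift (tensor k (tensor_bimodule R X B B') L)
    (\<lambda>x. tensor_left k (tensor_bimodule R X B B') L (pure_tensor R X B x))"

context
  fixes R :: "'r ring" and k :: "'k ring" and B :: "('r, 'b) rmodule" and B' :: "('k, 'b) rmodule"
    and L :: "('k, 'l) rmodule"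
  assumes B: "bimodule R k B B'" and L: "left_module k L"
begin

private abbreviation "BL \<equiv> bimodule_tensor k B B' L"
private abbreviation "XB X \<equiv> tensor_bimodule R X B B'"

private lemma b: "left_module R B" "right_module k B'" "carrier B' = carrier B" "monoid.mult B' = monoid.mult B"
  using bimoduleD[OF B] by blast+

private lemma BL: "left_module R BL" by (rule left_module_bimodule_tensor[OF B L])
private lemma XB: "right_module R X \<Longrightarrow> right_module k (XB X)" by (rule right_module_tensor_bimodule[OF _ B])

private lemma pure_left:
  assumes X: "right_module R X" and x: "x \<in> carrier X"
  shows "pure_tensor R X B x \<in> module_hom k B' (XB X)"
proof (rule module_homI)
  show "pure_tensor R X B x y \<in> carrier (XB X)" if "y \<in> carrier B'" for y
    using that pure_tensor_closed[OF X b(1) x] by (simp add: b(3))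
  show "pure_tensor R X B x (y \<otimes>\<^bsub>B'\<^esub> y') = pure_tensor R X B x y \<otimes>\<^bsub>XB X\<^esub> pure_tensor R X B x y'"
    if "y \<in> carrier B'" "y' \<in> carrier B'" for y y'
    using that pure_tensor_mult_right[OF X b(1) x] by (simp add: b(3,4))
  show "pure_tensor R X B x (act B' c y) = act (XB X) c (pure_tensor R X B x y)" if "c \<in> carrier k" "y \<in> carrier B'" for c y
    using tensor_map_pure[OF X b(1) X b(1) module_hom_id bimodule_right_act[OF B that(1)] x, of y] that(2)
    by (simp add: b(3) tensor_bimodule_def)
qed

private lemma pure_right:
  assumes l: "l \<in> carrier L"
  shows "(\<lambda>y. pure_tensor k B' L y l) \<in> module_hom R B BL"
proof (rule module_homI)
  show "pure_tensor k B' L y l \<in> carrier BL" if "y \<in> carrier B" for y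
    using that pure_tensor_closed[OF b(2) L _ l] by (simp add: b(3))
  show "pure_tensor k B' L (y \<otimes>\<^bsub>B\<^esub> y') l = pure_tensor k B' L y l \<otimes>\<^bsub>BL\<^esub> pure_tensor k B' L y' l"
    if "y \<in> carrier B" "y' \<in> carrier B" for y y'
    using that pure_tensor_mult_left[OF b(2) L _ _ l] by (simp add: b(3,4))
  show "pure_tensor k B' L (act B r y) l = act BL r (pure_tensor k B' L y l)" if "r \<in> carrier R" "y \<in> carrier B" for r y
    using bimodule_tensor_act_pure[OF B L that l] by simp
qed

private lemma assoc_balanced:
  assumes X: "right_module R X"
  shows "balanced R X BL (tensor k (XB X) L) (\<lambda>x. tensor_left k (XB X) L (pure_tensor R X B x))"
proof -
  let ?T = "tensor k (XB X) L"
  let ?f = "\<lambda>x. tensor_left k (XB X) L (pure_tensor R X B x)"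
  have T: "comm_group ?T" by (rule comm_group_tensor[OF XB[OF X] L])
  have h: "?f x \<in> hom (tensor k B' L) ?T" if "x \<in> carrier X" for x
    by (rule tensor_map_hom[OF b(2) L XB[OF X] L pure_left[OF X that] module_hom_id])
  have p: "?f x (pure_tensor k B' L y l) = pure_tensor k (XB X) L (pure_tensor R X B x y) l"
    if "x \<in> carrier X" "y \<in> carrier B'" "l \<in> carrier L" for x y l
    by (rule tensor_map_pure[OF b(2) L XB[OF X] L pure_left[OF X that(1)] module_hom_id that(2,3)])
  interpret X: comm_group X by (rule right_module_group[OF X])
  show ?thesis
  proof (rule balancedI)
    show "?f x t \<in> carrier ?T" if "x \<in> carrier X" "t \<in> carrier BL" for x t
      using hom_in_carrier[OF h[OF that(1)]] that(2) by simp
    show "?f x (t \<otimes>\<^bsub>BL\<^esub> u) = ?f x t \<otimes>\<^bsub>?T\<^esub> ?f x u" if "x \<in> carrier X" "t \<in> carrier BL" "u \<in> carrier BL" for x t u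
      using hom_mult[OF h[OF that(1)]] that(2,3) by simp
    show "?f (x \<otimes>\<^bsub>X\<^esub> x') t = ?f x t \<otimes>\<^bsub>?T\<^esub> ?f x' t" if x: "x \<in> carrier X" "x' \<in> carrier X" and t: "t \<in> carrier BL" for x x' t
    proof (rule tensor_hom_eqI[OF b(2) L T h[OF X.m_closed[OF x]] hom_mult_pointwise[OF T h[OF x(1)] h[OF x(2)]]])
      show "t \<in> carrier (tensor k B' L)" using t by simp
      show "?f (x \<otimes>\<^bsub>X\<^esub> x') (pure_tensor k B' L y l) = ?f x (pure_tensor k B' L y l) \<otimes>\<^bsub>?T\<^esub> ?f x' (pure_tensor k B' L y l)"
        if "y \<in> carrier B'" "l \<in> carrier L" for y l
        using that x pure_tensor_mult_left[OF X b(1) x, of y] pure_tensor_closed[OF X b(1) _ , of _ y]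
          pure_tensor_mult_left[OF XB[OF X] L, of "pure_tensor R X B x y" "pure_tensor R X B x' y" l]
        by (simp add: p b(3))
    qed
    show "?f (act X r x) t = ?f x (act BL r t)" if r: "r \<in> carrier R" and x: "x \<in> carrier X" and t: "t \<in> carrier BL" for r x t
    proof -
      have t': "t \<in> carrier (tensor k B' L)" using t by simp
      have "?f x (act BL r t) = tensor_left k (XB X) L (\<lambda>y. pure_tensor R X B x (act B r y)) t"
        using tensor_map_comp[OF b(2) L b(2) L XB[OF X] L bimodule_left_act[OF B r] module_hom_id pure_left[OF X x] module_hom_id t']
        by (simp add: bimodule_tensor_def)
      also have "\<dots> = ?f (act X r x) t"
        by (rule tensor_map_cong[OF b(2) L XB[OF X] L module_hom_comp[OF bimodule_left_act[OF B r] pure_left[OF X x]] module_hom_id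
              pure_left[OF X right_module_closed[OF X r x]] module_hom_id _ _ t'])
          (simp_all add: b(3) pure_tensor_act[OF X b(1) r x])
      finally show ?thesis by (rule sym)
    qed
  qed
qed

lemma tensor_assoc_hom:
  assumes X: "right_module R X"
  shows "tensor_assoc R k X B B' L \<in> hom (tensor R X BL) (tensor k (XB X) L)"
  unfolding tensor_assoc_def
  by (rule tensor_lift_hom[OF X BL comm_group_tensor[OF XB[OF X] L] assoc_balanced[OF X]])

lemma tensor_assoc_pure:
  assumes X: "right_module R X" and "x \<in> carrier X" "t \<in> carrier BL"
  shows "tensor_assoc R k X B B' L (pure_tensor R X BL x t) =
    tensor_left k (XB X) L (pure_tensor R X B x) t"
  unfolding tensor_assoc_def
  by (rule tensor_lift_pure[OF X BL comm_group_tensor[OF XB[OF X] L] assoc_balanced[OF X] assms(2,3)])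

text \<open>
  The map \<open>(x \<otimes> b) \<otimes> l \<mapsto> x \<otimes> (b \<otimes> l)\<close> is a left inverse.  It is defined for each \<open>l\<close> by the functoriality of
  the tensor product with \<open>X\<close>.
\<close>

lemma tensor_assoc_injective:
  assumes X: "right_module R X"
  shows "inj_on (tensor_assoc R k X B B' L) (carrier (tensor R X BL))"
proof -
  let ?T = "tensor R X BL"
  let ?g = "\<lambda>u l. tensor_right R X BL (\<lambda>y. pure_tensor k B' L y l) u"
  have T: "comm_group ?T" by (rule comm_group_tensor[OF X BL])
  have h: "(\<lambda>u. ?g u l) \<in> hom (tensor R X B) ?T" if "l \<in> carrier L" for l
    by (rule tensor_map_hom[OF X b(1) X BL module_hom_id pure_right[OF that]])
  have p: "?g (pure_tensor R X B x y) l = pure_tensor R X BL x (pure_tensor k B' L y l)"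
    if "x \<in> carrier X" "y \<in> carrier B" "l \<in> carrier L" for x y l
    by (rule tensor_map_pure[OF X b(1) X BL module_hom_id pure_right[OF that(3)] that(1,2)])
  interpret L: comm_group L by (rule left_module_group[OF L])
  have bal: "balanced k (XB X) L ?T ?g"
  proof (rule balancedI)
    show "?g u l \<in> carrier ?T" if "u \<in> carrier (XB X)" "l \<in> carrier L" for u l
      using hom_in_carrier[OF h[OF that(2)]] that(1) by simp
    show "?g (u \<otimes>\<^bsub>XB X\<^esub> v) l = ?g u l \<otimes>\<^bsub>?T\<^esub> ?g v l" if "u \<in> carrier (XB X)" "v \<in> carrier (XB X)" "l \<in> carrier L" for u v l
      using hom_mult[OF h[OF that(3)]] that(1,2) by simp
    show "?g u (l \<otimes>\<^bsub>L\<^esub> l') = ?g u l \<otimes>\<^bsub>?T\<^esub> ?g u l'" if u: "u \<in> carrier (XB X)" and l: "l \<in> carrier L" "l' \<in> carrier L" for u l l'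
    proof (rule tensor_hom_eqI[OF X b(1) T h[OF L.m_closed[OF l]] hom_mult_pointwise[OF T h[OF l(1)] h[OF l(2)]]])
      show "u \<in> carrier (tensor R X B)" using u by simp
      show "?g (pure_tensor R X B x y) (l \<otimes>\<^bsub>L\<^esub> l') = ?g (pure_tensor R X B x y) l \<otimes>\<^bsub>?T\<^esub> ?g (pure_tensor R X B x y) l'"
        if "x \<in> carrier X" "y \<in> carrier B" for x y
        using that l pure_tensor_mult_right[OF b(2) L _ l, of y] pure_tensor_closed[OF b(2) L, of y]
          pure_tensor_mult_right[OF X BL, of x "pure_tensor k B' L y l" "pure_tensor k B' L y l'"]
        by (simp add: p b(3))
    qed
    show "?g (act (XB X) c u) l = ?g u (act L c l)" if c: "c \<in> carrier k" and u: "u \<in> carrier (XB X)" and l: "l \<in> carrier L" for c u l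
    proof -
      have u': "u \<in> carrier (tensor R X B)" using u by simp
      have "?g (act (XB X) c u) l = tensor_right R X BL (\<lambda>y. pure_tensor k B' L (act B' c y) l) u"
        using tensor_map_comp[OF X b(1) X b(1) X BL module_hom_id bimodule_right_act[OF B c] module_hom_id pure_right[OF l] u']
        by (simp add: tensor_bimodule_def)
      also have "\<dots> = ?g u (act L c l)"
        by (rule tensor_map_cong[OF X b(1) X BL module_hom_id module_hom_comp[OF bimodule_right_act[OF B c] pure_right[OF l]]
              module_hom_id pure_right[OF left_module_closed[OF L c l]] _ _ u'])
          (use pure_tensor_act[OF b(2) L c _ l] in \<open>simp_all add: b(3)\<close>)
      finally show ?thesis .
    qed
  qed
  let ?k = "tensor_lift ?T ?g" and ?a = "tensor_assoc R k X B B' L"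
  have kh: "?k \<in> hom (tensor k (XB X) L) ?T" by (rule tensor_lift_hom[OF XB[OF X] L T bal])
  have kp: "?k (pure_tensor k (XB X) L u l) = ?g u l" if "u \<in> carrier (XB X)" "l \<in> carrier L" for u l
    by (rule tensor_lift_pure[OF XB[OF X] L T bal that])
  show ?thesis
  proof (rule inj_on_inverseI)
    fix t assume t: "t \<in> carrier ?T"
    show "?k (?a t) = t"
    proof (rule tensor_hom_eqI[OF X BL T _ iso_imp_homomorphism[OF iso_set_refl] _ t])
      show "(\<lambda>t. ?k (?a t)) \<in> hom ?T ?T"
        using hom_compose[OF tensor_assoc_hom[OF X] kh] by (simp add: comp_def)
      fix x u assume x: "x \<in> carrier X" and u: "u \<in> carrier BL"
      let ?f = "tensor_left k (XB X) L (pure_tensor R X B x)"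
      have fh: "?f \<in> hom (tensor k B' L) (tensor k (XB X) L)"
        by (rule tensor_map_hom[OF b(2) L XB[OF X] L pure_left[OF X x] module_hom_id])
      have "?k (?f u) = pure_tensor R X BL x u"
      proof (rule tensor_hom_eqI[OF b(2) L T])
        show "(\<lambda>u. ?k (?f u)) \<in> hom (tensor k B' L) ?T" using hom_compose[OF fh kh] by (simp add: comp_def)
        show "pure_tensor R X BL x \<in> hom (tensor k B' L) ?T" using pure_tensor_hom_right[OF X BL x] by simp
        show "u \<in> carrier (tensor k B' L)" using u by simp
        show "?k (?f (pure_tensor k B' L y l)) = pure_tensor R X BL x (pure_tensor k B' L y l)"
          if y: "y \<in> carrier B'" and l: "l \<in> carrier L" for y l
        proof -
          have yB: "y \<in> carrier B" using y b(3) by simp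
          have xy: "pure_tensor R X B x y \<in> carrier (XB X)" using pure_tensor_closed[OF X b(1) x yB] by simp
          show ?thesis
            unfolding tensor_map_pure[OF b(2) L XB[OF X] L pure_left[OF X x] module_hom_id y l] kp[OF xy l] p[OF x yB l] ..
        qed
      qed
      then show "?k (?a (pure_tensor R X BL x u)) = pure_tensor R X BL x u"
        unfolding tensor_assoc_pure[OF X x u] .
    qed
  qed
qed

lemma tensor_bimodule_map:
  assumes X: "right_module R X" and Y: "right_module R Y" and g: "g \<in> module_hom R X Y"
  shows "tensor_left R Y B g \<in> module_hom k (XB X) (XB Y)"
proof (rule module_homI)
  have h: "tensor_left R Y B g \<in> hom (tensor R X B) (tensor R Y B)"
    by (rule tensor_map_hom[OF X b(1) Y b(1) g module_hom_id])
  show "tensor_left R Y B g t \<in> carrier (XB Y)" if "t \<in> carrier (XB X)" for t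
    using hom_in_carrier[OF h] that by simp
  show "tensor_left R Y B g (t \<otimes>\<^bsub>XB X\<^esub> u) = tensor_left R Y B g t \<otimes>\<^bsub>XB Y\<^esub> tensor_left R Y B g u"
    if "t \<in> carrier (XB X)" "u \<in> carrier (XB X)" for t u
    using hom_mult[OF h] that by simp
  show "tensor_left R Y B g (act (XB X) c t) = act (XB Y) c (tensor_left R Y B g t)"
    if c: "c \<in> carrier k" and "t \<in> carrier (XB X)" for c t
  proof -
    have t: "t \<in> carrier (tensor R X B)" using that(2) by simp
    note a = bimodule_right_act[OF B c]
    show ?thesis
      unfolding tensor_bimodule_def with_act_simps
        tensor_map_comp[OF X b(1) X b(1) Y b(1) module_hom_id a g module_hom_id t]
        tensor_map_comp[OF X b(1) Y b(1) Y b(1) g module_hom_id module_hom_id a t] ..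
  qed
qed

text \<open>
  By associativity an injection of right \<open>R\<close>-modules may first be tensored with \<open>B\<close> and then with \<open>L\<close>.
\<close>

theorem flat_bimodule_tensor:
  assumes flB: "flat_left_module R B" and flL: "flat_left_module k L"
  shows "flat_left_module R BL"
  unfolding flat_left_module_def
proof (intro conjI allI impI BL)
  fix X Y :: "('r, (nat \<Rightarrow> 'r) set) rmodule" and g
  assume "right_module R X \<and> right_module R Y \<and> g \<in> module_hom R X Y \<and> inj_on g (carrier X)"
  then have X: "right_module R X" and Y: "right_module R Y" and g: "g \<in> module_hom R X Y" and inj: "inj_on g (carrier X)" by auto
  let ?G = "tensor_left R Y B g"
  have G: "?G \<in> module_hom k (XB X) (XB Y)" by (rule tensor_bimodule_map[OF X Y g])
  have iG: "inj_on ?G (carrier (XB X))" using flat_tensor_injective[OF flB X Y g inj] by simp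
  have iGL: "inj_on (tensor_left k (XB Y) L ?G) (carrier (tensor k (XB X) L))"
    by (rule flat_tensor_injective[OF flL XB[OF X] XB[OF Y] G iG])
  let ?a = "\<lambda>X. tensor_assoc R k X B B' L"
  have comm: "?a Y (tensor_left R Y BL g t) = tensor_left k (XB Y) L ?G (?a X t)"
    if t: "t \<in> carrier (tensor R X BL)" for t
  proof (rule tensor_hom_eqI[OF X BL comm_group_tensor[OF XB[OF Y] L] _ _ _ t])
    show "(\<lambda>t. ?a Y (tensor_left R Y BL g t)) \<in> hom (tensor R X BL) (tensor k (XB Y) L)"
      using hom_compose[OF tensor_map_hom[OF X BL Y BL g module_hom_id] tensor_assoc_hom[OF Y]] by (simp add: comp_def)
    show "(\<lambda>t. tensor_left k (XB Y) L ?G (?a X t)) \<in> hom (tensor R X BL) (tensor k (XB Y) L)"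
      using hom_compose[OF tensor_assoc_hom[OF X] tensor_map_hom[OF XB[OF X] L XB[OF Y] L G module_hom_id]] by (simp add: comp_def)
    fix x u assume x: "x \<in> carrier X" and u: "u \<in> carrier BL"
    have u': "u \<in> carrier (tensor k B' L)" using u by simp
    note gx = module_hom_closed[OF g x]
    have "tensor_left k (XB Y) L ?G (tensor_left k (XB X) L (pure_tensor R X B x) u) =
        tensor_left k (XB Y) L (\<lambda>y. ?G (pure_tensor R X B x y)) u"
      by (rule tensor_map_comp[OF b(2) L XB[OF X] L XB[OF Y] L pure_left[OF X x] module_hom_id G module_hom_id u'])
    also have "\<dots> = tensor_left k (XB Y) L (pure_tensor R Y B (g x)) u"
      by (rule tensor_map_cong[OF b(2) L XB[OF Y] L module_hom_comp[OF pure_left[OF X x] G] module_hom_id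
            pure_left[OF Y gx] module_hom_id _ _ u'])
        (simp_all add: b(3) tensor_map_pure[OF X b(1) Y b(1) g module_hom_id x])
    finally show "?a Y (tensor_left R Y BL g (pure_tensor R X BL x u)) =
        tensor_left k (XB Y) L ?G (?a X (pure_tensor R X BL x u))"
      unfolding tensor_assoc_pure[OF X x u] tensor_map_pure[OF X BL Y BL g module_hom_id x u] tensor_assoc_pure[OF Y gx u]
      by (rule sym)
  qed
  have inj': "inj_on (\<lambda>t. tensor_left k (XB Y) L ?G (?a X t)) (carrier (tensor R X BL))"
    using comp_inj_on[OF tensor_assoc_injective[OF X] inj_on_subset[OF iGL hom_carrier[OF tensor_assoc_hom[OF X]]]]
    by (simp add: comp_def)
  show "inj_on (tensor_left R Y BL g) (carrier (tensor R X BL))"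
  proof (rule inj_onI)
    fix t u assume t: "t \<in> carrier (tensor R X BL)" and u: "u \<in> carrier (tensor R X BL)"
      and eq: "tensor_left R Y BL g t = tensor_left R Y BL g u"
    have "tensor_left k (XB Y) L ?G (?a X t) = tensor_left k (XB Y) L ?G (?a X u)"
      unfolding comm[OF t, symmetric] comm[OF u, symmetric] eq ..
    from inj_onD[OF inj' this t u] show "t = u" .
  qed
qed

end

section \<open>Tor as a kernel between tensor products\<close>

(* as a rewrite rule it would unfold the syzygies inside tensor products *)
declare syzygy.simps(2) [simp del]

text \<open>
  If \<open>Y\<close> is free and \<open>i\<close> is injective, this is the first Tor group of the cokernel of \<open>i\<close> and \<open>N\<close>.
\<close>

definition tensor_kernel_left ::
  "'r ring \<Rightarrow> ('r, 'x) rmodule \<Rightarrow> ('r, 'y) rmodule \<Rightarrow> ('x \<Rightarrow> 'y) \<Rightarrow> ('r, 'n) rmodule \<Rightarrow> _" where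
  "tensor_kernel_left R X Y i N =
    (tensor R X N)\<lparr>carrier := kernel (tensor R X N) (tensor R Y N) (tensor_left R Y N i)\<rparr>"

definition tensor_kernel_right ::
  "'r ring \<Rightarrow> ('r, 'x) rmodule \<Rightarrow> ('r, 'm) rmodule \<Rightarrow> ('r, 'n) rmodule \<Rightarrow> ('m \<Rightarrow> 'n) \<Rightarrow> _" where
  "tensor_kernel_right R X L N i =
    (tensor R X L)\<lparr>carrier := kernel (tensor R X L) (tensor R X N) (tensor_right R X N i)\<rparr>"

lemma iso_of_same_kernel:
  assumes Z: "group Z" and G: "group G" and H: "group H"
    and f: "f \<in> hom Z G" "f ` carrier Z = carrier G" and g: "g \<in> hom Z H" "g ` carrier Z = carrier H"
    and ker: "\<And>z. z \<in> carrier Z \<Longrightarrow> f z = \<one>\<^bsub>G\<^esub> \<longleftrightarrow> g z = \<one>\<^bsub>H\<^esub>"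
  shows "G \<cong> H"
proof -
  interpret f: group_hom Z G f using Z G f(1) by (simp add: group_hom_def group_hom_axioms_def)
  interpret g: group_hom Z H g using Z H g(1) by (simp add: group_hom_def group_hom_axioms_def)
  have k: "kernel Z G f = kernel Z H g" using ker by (auto simp: kernel_def)
  have "Z Mod kernel Z G f \<cong> G" by (rule f.FactGroup_iso[OF f(2)])
  moreover have "Z Mod kernel Z G f \<cong> H" unfolding k by (rule g.FactGroup_iso[OF g(2)])
  moreover have "group (Z Mod kernel Z G f)" by (rule normal.factorgroup_is_group[OF f.normal_kernel])
  ultimately show ?thesis by (metis group.iso_sym iso_trans)
qed

lemma injective_hom_eq_one_iff:
  assumes G: "comm_group G" and H: "comm_group H" and f: "f \<in> hom G H" and inj: "inj_on f (carrier G)"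
    and x: "x \<in> carrier G"
  shows "f x = \<one>\<^bsub>H\<^esub> \<longleftrightarrow> x = \<one>\<^bsub>G\<^esub>"
proof -
  interpret G: comm_group G by fact
  note f1 = comm_hom_one[OF f G H]
  show ?thesis
  proof
    assume "f x = \<one>\<^bsub>H\<^esub>"
    then have "f x = f \<one>\<^bsub>G\<^esub>" by (simp add: f1)
    from inj_onD[OF inj this x] show "x = \<one>\<^bsub>G\<^esub>" by simp
  qed (simp add: f1)
qed

lemma iso_restrict_carrier:
  assumes h: "h \<in> iso G H" and AB: "A \<subseteq> carrier G" "B \<subseteq> carrier H" "\<And>x. x \<in> carrier G \<Longrightarrow> x \<in> A \<longleftrightarrow> h x \<in> B"
  shows "(G\<lparr>carrier := A\<rparr>) \<cong> (H\<lparr>carrier := B\<rparr>)"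
proof (rule is_isoI, rule isoI)
  have bij: "bij_betw h (carrier G) (carrier H)" and hom: "h \<in> hom G H" using h by (auto simp: iso_def)
  show "h \<in> hom (G\<lparr>carrier := A\<rparr>) (H\<lparr>carrier := B\<rparr>)"
    using AB hom_mult[OF hom] by (intro homI) (auto simp: subset_iff)
  have "h ` A = B"
  proof (intro equalityI subsetI)
    fix y assume "y \<in> h ` A" then show "y \<in> B" using AB by auto
  next
    fix y assume y: "y \<in> B"
    then obtain x where "x \<in> carrier G" "y = h x" using bij AB(2) by (auto simp: bij_betw_def)
    then show "y \<in> h ` A" using y AB(3) by auto
  qed
  then show "bij_betw h (carrier (G\<lparr>carrier := A\<rparr>)) (carrier (H\<lparr>carrier := B\<rparr>))"
    using bij AB(1) by (auto simp: bij_betw_def intro: inj_on_subset)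
qed

lemma module_hom_inv_into:
  assumes h: "h \<in> module_hom R X Y" and bij: "bij_betw h (carrier X) (carrier Y)" and X: "monoid X"
    and act: "\<And>a x. a \<in> carrier R \<Longrightarrow> x \<in> carrier X \<Longrightarrow> act X a x \<in> carrier X"
  shows "inv_into (carrier X) h \<in> module_hom R Y X"
proof -
  interpret monoid X by fact
  let ?k = "inv_into (carrier X) h"
  have k: "?k y \<in> carrier X" "h (?k y) = y" if "y \<in> carrier Y" for y
    using that bij by (auto simp: bij_betw_def inv_into_into f_inv_into_f)
  have u: "?k z = x" if "x \<in> carrier X" "z = h x" for x z
    using that bij by (simp add: bij_betw_def inv_into_f_f)
  show ?thesis
  proof (rule module_homI)
    show "?k y \<in> carrier X" if "y \<in> carrier Y" for y using k[OF that] by simp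
    show "?k (y \<otimes>\<^bsub>Y\<^esub> z) = ?k y \<otimes>\<^bsub>X\<^esub> ?k z" if "y \<in> carrier Y" "z \<in> carrier Y" for y z
      by (rule u) (simp_all add: that k module_hom_mult[OF h])
    show "?k (act Y a y) = act X a (?k y)" if "a \<in> carrier R" "y \<in> carrier Y" for a y
      by (rule u) (simp_all add: that k act module_hom_act[OF h])
  qed
qed

lemma tensor_map_iso:
  assumes m: "right_module R X" "left_module R L" "right_module R X'" "left_module R L'"
    and g: "g \<in> module_hom R X X'" "bij_betw g (carrier X) (carrier X')"
    and h: "h \<in> module_hom R L L'" "bij_betw h (carrier L) (carrier L')"
  shows "tensor_map R X' L' g h \<in> iso (tensor R X L) (tensor R X' L')"
proof (rule isoI)
  show th: "tensor_map R X' L' g h \<in> hom (tensor R X L) (tensor R X' L')"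
    by (rule tensor_map_hom[OF m g(1) h(1)])
  interpret X: comm_group X by (rule right_module_group[OF m(1)])
  interpret L: comm_group L by (rule left_module_group[OF m(2)])
  let ?g = "inv_into (carrier X) g" and ?h = "inv_into (carrier L) h"
  have g': "?g \<in> module_hom R X' X" by (rule module_hom_inv_into[OF g X.monoid_axioms right_module_closed[OF m(1)]])
  have h': "?h \<in> module_hom R L' L" by (rule module_hom_inv_into[OF h L.monoid_axioms left_module_closed[OF m(2)]])
  have ix: "?g (g x) = x" if "x \<in> carrier X" for x using g(2) that by (simp add: bij_betw_def)
  have iy: "?h (h x) = x" if "x \<in> carrier L" for x using h(2) that by (simp add: bij_betw_def)
  have "inj_on (tensor_map R X' L' g h) (carrier (tensor R X L))"
  proof (rule inj_on_inverseI)
    fix t assume t: "t \<in> carrier (tensor R X L)"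
    show "tensor_map R X L ?g ?h (tensor_map R X' L' g h t) = t"
      unfolding tensor_map_comp[OF m m(1,2) g(1) h(1) g' h' t]
      by (rule tensor_map_id_cong[OF m(1,2) module_hom_comp[OF g(1) g'] module_hom_comp[OF h(1) h'] ix iy t])
  qed
  moreover have "tensor_map R X' L' g h ` carrier (tensor R X L) = carrier (tensor R X' L')"
    using g(2) h(2) by (intro tensor_map_surj m g(1) h(1)) (simp_all add: bij_betw_def)
  ultimately show "bij_betw (tensor_map R X' L' g h) (carrier (tensor R X L)) (carrier (tensor R X' L'))"
    by (simp add: bij_betw_def)
qed

lemma Tor_diff_factor:
  assumes M: "right_module R M" and N: "left_module R N" and t: "t \<in> carrier (Tor_chain R M N (Suc i))"
  shows "Tor_diff R M N i t = tensor_left R (resolution R M i) N (syzygy_inclusion R M i)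
    (tensor_left R (syzygy R M (Suc i)) N (syzygy_cover R M (Suc i)) t)"
proof -
  note P = right_module_resolution[OF M] and Om = right_module_syzygy[OF M]
  note inc = short_exactD(1)[OF syzygy_short_exact[OF M]] and cov = short_exactD(3)[OF syzygy_short_exact[OF M]]
  note t' = t[unfolded Tor_chain_def]
  have "Tor_diff R M N i t = tensor_map R (resolution R M i) N
      (\<lambda>x. syzygy_inclusion R M i (syzygy_cover R M (Suc i) x)) (\<lambda>y. y) t"
    unfolding Tor_diff_def
    by (rule tensor_map_cong[OF P N P N resolution_diff_hom[OF M] module_hom_id module_hom_comp[OF cov inc] module_hom_id
          resolution_diff_factor[OF M] refl t'])
  also have "\<dots> = tensor_left R (resolution R M i) N (syzygy_inclusion R M i)
    (tensor_left R (syzygy R M (Suc i)) N (syzygy_cover R M (Suc i)) t)"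
    by (rule tensor_map_comp[OF P N Om N P N cov module_hom_id inc module_hom_id t', symmetric])
  finally show ?thesis .
qed

text \<open>
  The differential factors through the next syzygy, on which the cover stays surjective after tensoring; so this
  is right exactness of the tensor product.
\<close>

lemma Tor_boundaries:
  assumes M: "right_module R M" and N: "left_module R N"
  shows "Tor_diff R M N i ` carrier (Tor_chain R M N (Suc i)) =
    kernel (Tor_chain R M N i) (tensor R (syzygy R M i) N) (tensor_left R (syzygy R M i) N (syzygy_cover R M i))"
proof -
  note P = right_module_resolution[OF M] and Om = right_module_syzygy[OF M]
  note se = syzygy_short_exact[OF M]
  let ?c = "tensor_left R (syzygy R M (Suc i)) N (syzygy_cover R M (Suc i))"
  let ?i = "tensor_left R (resolution R M i) N (syzygy_inclusion R M i)"
  have "Tor_diff R M N i ` carrier (Tor_chain R M N (Suc i)) = ?i ` ?c ` carrier (Tor_chain R M N (Suc i))"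
    unfolding image_image using Tor_diff_factor[OF M N] by (rule image_cong[OF refl])
  also have "?c ` carrier (Tor_chain R M N (Suc i)) = carrier (tensor R (syzygy R M (Suc i)) N)"
    unfolding Tor_chain_def
    by (rule tensor_map_surj[OF P N Om N short_exactD(3,4)[OF se] module_hom_id]) simp
  also have "?i ` \<dots> = kernel (Tor_chain R M N i) (tensor R (syzygy R M i) N)
      (tensor_left R (syzygy R M i) N (syzygy_cover R M i))"
  proof (intro equalityI subsetI)
    fix t assume t: "t \<in> ?i ` carrier (tensor R (syzygy R M (Suc i)) N)"
    then have "t \<in> carrier (tensor R (resolution R M i) N)"
      using hom_carrier[OF tensor_map_hom[OF Om N P N short_exactD(1)[OF se] module_hom_id]] by (rule set_mp[rotated])
    with t tensor_right_exact_left_factor[OF Om P Om N se this]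
    show "t \<in> kernel (Tor_chain R M N i) (tensor R (syzygy R M i) N)
      (tensor_left R (syzygy R M i) N (syzygy_cover R M i))"
      unfolding kernel_def Tor_chain_def by blast
  next
    fix t assume "t \<in> kernel (Tor_chain R M N i) (tensor R (syzygy R M i) N)
      (tensor_left R (syzygy R M i) N (syzygy_cover R M i))"
    then have t: "t \<in> carrier (tensor R (resolution R M i) N)"
      "tensor_left R (syzygy R M i) N (syzygy_cover R M i) t = \<one>\<^bsub>tensor R (syzygy R M i) N\<^esub>"
      unfolding kernel_def Tor_chain_def by blast+
    with tensor_right_exact_left_factor[OF Om P Om N se t(1)]
    show "t \<in> ?i ` carrier (tensor R (syzygy R M (Suc i)) N)" by blast
  qed
  finally show ?thesis .
qed

lemma syzygy_zero_bij:
  "Atom \<in> module_hom R M (syzygy R M 0)" "bij_betw Atom (carrier M) (carrier (syzygy R M 0))"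
  using transport_hom[of Atom M R] by (auto simp: inj_on_def bij_betw_def transport_simps)

theorem Tor_zero_iso:
  assumes M: "right_module R M" and N: "left_module R N"
  shows "Tor R 0 M N \<cong> tensor R M N" and group_Tor_zero: "group (Tor R 0 M N)"
proof -
  note P = right_module_resolution[OF M] and Om = right_module_syzygy[OF M]
  note cov = short_exactD(3,4)[OF syzygy_short_exact[OF M]]
  let ?c = "tensor_left R (syzygy R M 0) N (syzygy_cover R M 0)"
  have C: "comm_group (Tor_chain R M N 0)" unfolding Tor_chain_def by (rule comm_group_tensor[OF P N])
  have h: "?c \<in> hom (Tor_chain R M N 0) (tensor R (syzygy R M 0) N)"
    unfolding Tor_chain_def by (rule tensor_map_hom[OF P N Om N cov(1) module_hom_id])
  interpret group_hom "Tor_chain R M N 0" "tensor R (syzygy R M 0) N" ?c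
    by (rule comm_group_homI[OF C comm_group_tensor[OF Om N] h])
  have Tor: "Tor R 0 M N = Tor_chain R M N 0 Mod kernel (Tor_chain R M N 0) (tensor R (syzygy R M 0) N) ?c"
    unfolding Tor_def Tor_boundaries[OF M N] by (simp add: Tor_cycles_def)
  show "group (Tor R 0 M N)" unfolding Tor by (rule normal.factorgroup_is_group[OF normal_kernel])
  have "Tor R 0 M N \<cong> tensor R (syzygy R M 0) N" unfolding Tor
    by (rule FactGroup_iso) (unfold Tor_chain_def, rule tensor_map_surj[OF P N Om N cov module_hom_id], simp)
  also have "\<dots> \<cong> tensor R M N"
    by (rule group.iso_sym[OF comm_group.axioms(2)[OF comm_group_tensor[OF M N]]], rule is_isoI,
        rule tensor_map_iso[OF M N Om N syzygy_zero_bij module_hom_id]) (simp add: bij_betw_def)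
  finally (iso_trans) show "Tor R 0 M N \<cong> tensor R M N" .
qed

text \<open>
  The cover of a syzygy maps the cycles onto the kernel on the right-hand side, and the boundaries are what it
  maps to the neutral element.
\<close>

theorem Tor_Suc_iso:
  assumes M: "right_module R M" and N: "left_module R N"
  shows "Tor R (Suc i) M N \<cong>
    tensor_kernel_left R (syzygy R M (Suc i)) (resolution R M i) (syzygy_inclusion R M i) N"
    and group_Tor_Suc: "group (Tor R (Suc i) M N)"
proof -
  note P = right_module_resolution[OF M] and Om = right_module_syzygy[OF M]
  note se = syzygy_short_exact[OF M]
  let ?C = "Tor_chain R M N (Suc i)" and ?T = "tensor R (syzygy R M (Suc i)) N" and ?D = "Tor_chain R M N i"
  let ?K = "tensor_kernel_left R (syzygy R M (Suc i)) (resolution R M i) (syzygy_inclusion R M i) N"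
  let ?Z = "?C\<lparr>carrier := Tor_cycles R M N (Suc i)\<rparr>"
  let ?c = "tensor_left R (syzygy R M (Suc i)) N (syzygy_cover R M (Suc i))"
  let ?i = "tensor_left R (resolution R M i) N (syzygy_inclusion R M i)"
  have C: "comm_group ?C" "comm_group ?D" unfolding Tor_chain_def by (rule comm_group_tensor[OF P N])+
  have T: "comm_group ?T" by (rule comm_group_tensor[OF Om N])
  have c: "?c \<in> hom ?C ?T" unfolding Tor_chain_def by (rule tensor_map_hom[OF P N Om N short_exactD(3)[OF se] module_hom_id])
  have i: "?i \<in> hom ?T ?D" unfolding Tor_chain_def by (rule tensor_map_hom[OF Om N P N short_exactD(1)[OF se] module_hom_id])
  have dh: "Tor_diff R M N i \<in> hom ?C ?D"
    unfolding Tor_chain_def Tor_diff_def by (rule tensor_map_hom[OF P N P N resolution_diff_hom[OF M] module_hom_id])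
  have cyc: "t \<in> Tor_cycles R M N (Suc i) \<longleftrightarrow> t \<in> carrier ?C \<and> ?i (?c t) = \<one>\<^bsub>?D\<^esub>" for t
    by (simp add: Tor_cycles_def kernel_def Tor_diff_factor[OF M N, of t i] cong: conj_cong)
  have kc: "t \<in> carrier ?K \<longleftrightarrow> t \<in> carrier ?T \<and> ?i t = \<one>\<^bsub>?D\<^esub>" for t
    by (simp add: tensor_kernel_left_def kernel_def Tor_chain_def)
  have sgZ: "subgroup (Tor_cycles R M N (Suc i)) ?C"
    using kernel_subgroup[OF C dh] by (simp add: Tor_cycles_def)
  have Z: "comm_group ?Z" by (rule comm_group_subgroup[OF C(1) sgZ])
  have K: "comm_group ?K" unfolding tensor_kernel_left_def
    by (rule comm_group_subgroup[OF T kernel_subgroup[OF T comm_group_tensor[OF P N] i[unfolded Tor_chain_def]]])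
  have h: "?c \<in> hom ?Z ?K"
  proof (rule homI)
    show "?c t \<in> carrier ?K" if "t \<in> carrier ?Z" for t
      using that hom_in_carrier[OF c] unfolding kc by (simp add: cyc)
    show "?c (t \<otimes>\<^bsub>?Z\<^esub> u) = ?c t \<otimes>\<^bsub>?K\<^esub> ?c u" if "t \<in> carrier ?Z" "u \<in> carrier ?Z" for t u
      using that hom_mult[OF c] by (simp add: cyc tensor_kernel_left_def)
  qed
  interpret group_hom ?Z ?K ?c by (rule comm_group_homI[OF Z K h])
  have surj: "?c ` carrier ?C = carrier ?T"
    unfolding Tor_chain_def by (rule tensor_map_surj[OF P N Om N short_exactD(3,4)[OF se] module_hom_id]) simp
  have onto: "?c ` carrier ?Z = carrier ?K"
  proof (intro equalityI subsetI)
    fix u assume "u \<in> ?c ` carrier ?Z" then show "u \<in> carrier ?K" by (rule subsetD[OF hom_carrier[OF h]])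
  next
    fix u assume u: "u \<in> carrier ?K"
    then have "u \<in> carrier ?T" unfolding kc by (rule conjunct1)
    then have "u \<in> ?c ` carrier ?C" unfolding surj .
    then obtain t where "u = ?c t" "t \<in> carrier ?C" by (rule imageE)
    then have "t \<in> carrier ?Z" "u = ?c t" using u unfolding kc by (simp_all add: cyc)
    then show "u \<in> ?c ` carrier ?Z" by (intro image_eqI)
  qed
  have i1: "?i \<one>\<^bsub>?T\<^esub> = \<one>\<^bsub>?D\<^esub>" by (rule comm_hom_one[OF i T C(2)])
  have "Tor_diff R M N (Suc i) ` carrier (Tor_chain R M N (Suc (Suc i))) = kernel ?Z ?K ?c"
  proof -
    have k: "t \<in> kernel ?C ?T ?c \<longleftrightarrow> t \<in> kernel ?Z ?K ?c" for t
      by (cases "?c t = \<one>\<^bsub>?T\<^esub>") (simp_all add: kernel_def cyc i1 tensor_kernel_left_def)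
    show ?thesis unfolding Tor_boundaries[OF M N] by (rule Set.set_eqI) (rule k)
  qed
  then have Tor: "Tor R (Suc i) M N = ?Z Mod kernel ?Z ?K ?c" by (simp add: Tor_def)
  show "Tor R (Suc i) M N \<cong> ?K" unfolding Tor by (rule FactGroup_iso[OF onto])
  show "group (Tor R (Suc i) M N)" unfolding Tor by (rule normal.factorgroup_is_group[OF normal_kernel])
qed

section \<open>Dimension shifting\<close>

text \<open>
  The groups form a square array with rows \<open>a\<close>, \<open>b\<close> and columns \<open>u\<close>, \<open>v\<close>.  Both kernels are quotients of the fibre
  product of \<open>G21\<close> and \<open>G12\<close> over \<open>G22\<close>: it maps by \<open>b1\<close> and \<open>v1\<close> onto them, and by exactness and the
  injectivity of \<open>a2\<close> and \<open>u2\<close> the two maps have the same kernel, the image of \<open>G11\<close>.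
\<close>

lemma snake_kernel_iso:
  assumes G: "comm_group G11" "comm_group G12" "comm_group G13" "comm_group G21" "comm_group G22"
      "comm_group G23" "comm_group G31" "comm_group G32"
    and a1: "a1 \<in> hom G11 G12" and b1: "b1 \<in> hom G12 G13" and a2: "a2 \<in> hom G21 G22" and b2: "b2 \<in> hom G22 G23"
    and a3: "a3 \<in> hom G31 G32" and u1: "u1 \<in> hom G11 G21" and u2: "u2 \<in> hom G12 G22" and u3: "u3 \<in> hom G13 G23"
    and v1: "v1 \<in> hom G21 G31" and v2: "v2 \<in> hom G22 G32"
    and c1: "\<And>x. x \<in> carrier G11 \<Longrightarrow> a2 (u1 x) = u2 (a1 x)"
    and c2: "\<And>x. x \<in> carrier G12 \<Longrightarrow> b2 (u2 x) = u3 (b1 x)"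
    and c3: "\<And>x. x \<in> carrier G21 \<Longrightarrow> a3 (v1 x) = v2 (a2 x)"
    and inj: "inj_on a2 (carrier G21)" "inj_on u2 (carrier G12)"
    and surj: "b1 ` carrier G12 = carrier G13" "v1 ` carrier G21 = carrier G31"
    and e1: "\<And>x. x \<in> carrier G12 \<Longrightarrow> b1 x = \<one>\<^bsub>G13\<^esub> \<longleftrightarrow> x \<in> a1 ` carrier G11"
    and e2: "\<And>x. x \<in> carrier G22 \<Longrightarrow> b2 x = \<one>\<^bsub>G23\<^esub> \<longleftrightarrow> x \<in> a2 ` carrier G21"
    and f1: "\<And>x. x \<in> carrier G21 \<Longrightarrow> v1 x = \<one>\<^bsub>G31\<^esub> \<longleftrightarrow> x \<in> u1 ` carrier G11"
    and f2: "\<And>x. x \<in> carrier G22 \<Longrightarrow> v2 x = \<one>\<^bsub>G32\<^esub> \<longleftrightarrow> x \<in> u2 ` carrier G12"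
  shows "(G13\<lparr>carrier := kernel G13 G23 u3\<rparr>) \<cong> (G31\<lparr>carrier := kernel G31 G32 a3\<rparr>)"
proof -
  interpret G11: comm_group G11 by fact
  interpret G12: comm_group G12 by fact
  interpret G21: comm_group G21 by fact
  interpret G22: comm_group G22 by fact
  let ?D = "G21 \<times>\<times> G12"
  have D: "comm_group ?D"
    by (rule group.group_comm_groupI[OF DirProd_group])
      (auto simp: G21.m_comm G12.m_comm G21.is_group G12.is_group)
  let ?Zc = "{p \<in> carrier ?D. a2 (fst p) = u2 (snd p)}"
  let ?Z = "?D\<lparr>carrier := ?Zc\<rparr>"
  have fs: "fst \<in> hom ?D G21" "snd \<in> hom ?D G12" by (auto intro!: homI)
  have "subgroup ?Zc ?D"
    using subgroup_equalizer[OF D G(5), of "\<lambda>p. a2 (fst p)" "\<lambda>p. u2 (snd p)"]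
      hom_compose[OF fs(1) a2] hom_compose[OF fs(2) u2] by (simp add: comp_def)
  from comm_group_subgroup[OF D this] have Z: "comm_group ?Z" .
  have K1: "comm_group (G13\<lparr>carrier := kernel G13 G23 u3\<rparr>)"
    by (rule comm_group_subgroup[OF G(3) kernel_subgroup[OF G(3,6) u3]])
  have K2: "comm_group (G31\<lparr>carrier := kernel G31 G32 a3\<rparr>)"
    by (rule comm_group_subgroup[OF G(7) kernel_subgroup[OF G(7,8) a3]])
  have zc: "p \<in> carrier ?Z \<longleftrightarrow> fst p \<in> carrier G21 \<and> snd p \<in> carrier G12 \<and> a2 (fst p) = u2 (snd p)" for p
    by (auto simp: mem_Times_iff)
  have z1: "z \<in> carrier ?Z \<Longrightarrow> fst z \<in> carrier G21" and z2: "z \<in> carrier ?Z \<Longrightarrow> snd z \<in> carrier G12"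
    and z3: "z \<in> carrier ?Z \<Longrightarrow> a2 (fst z) = u2 (snd z)" for z unfolding zc by blast+
  show ?thesis
  proof (rule iso_of_same_kernel[OF comm_group.axioms(2)[OF Z] comm_group.axioms(2)[OF K1] comm_group.axioms(2)[OF K2]])
    show "(\<lambda>p. b1 (snd p)) \<in> hom ?Z (G13\<lparr>carrier := kernel G13 G23 u3\<rparr>)"
    proof (rule homI)
      fix p assume p: "p \<in> carrier ?Z"
      have "u3 (b1 (snd p)) = b2 (a2 (fst p))" using c2[OF z2[OF p]] z3[OF p] by simp
      also have "\<dots> = \<one>\<^bsub>G23\<^esub>" using e2[OF hom_in_carrier[OF a2 z1[OF p]]] z1[OF p] by blast
      finally show "b1 (snd p) \<in> carrier (G13\<lparr>carrier := kernel G13 G23 u3\<rparr>)"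
        using hom_in_carrier[OF b1 z2[OF p]] by (simp add: kernel_def)
      fix q assume q: "q \<in> carrier ?Z"
      show "b1 (snd (p \<otimes>\<^bsub>?Z\<^esub> q)) = b1 (snd p) \<otimes>\<^bsub>G13\<lparr>carrier := kernel G13 G23 u3\<rparr>\<^esub> b1 (snd q)"
        using hom_mult[OF b1 z2[OF p] z2[OF q]] by (simp add: DirProd_def case_prod_unfold)
    qed
    show "(\<lambda>p. v1 (fst p)) \<in> hom ?Z (G31\<lparr>carrier := kernel G31 G32 a3\<rparr>)"
    proof (rule homI)
      fix p assume p: "p \<in> carrier ?Z"
      have "a3 (v1 (fst p)) = v2 (u2 (snd p))" using c3[OF z1[OF p]] z3[OF p] by simp
      also have "\<dots> = \<one>\<^bsub>G32\<^esub>" using f2[OF hom_in_carrier[OF u2 z2[OF p]]] z2[OF p] by blast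
      finally show "v1 (fst p) \<in> carrier (G31\<lparr>carrier := kernel G31 G32 a3\<rparr>)"
        using hom_in_carrier[OF v1 z1[OF p]] by (simp add: kernel_def)
      fix q assume q: "q \<in> carrier ?Z"
      show "v1 (fst (p \<otimes>\<^bsub>?Z\<^esub> q)) = v1 (fst p) \<otimes>\<^bsub>G31\<lparr>carrier := kernel G31 G32 a3\<rparr>\<^esub> v1 (fst q)"
        using hom_mult[OF v1 z1[OF p] z1[OF q]] by (simp add: DirProd_def case_prod_unfold)
    qed
    show "(\<lambda>p. b1 (snd p)) ` carrier ?Z = carrier (G13\<lparr>carrier := kernel G13 G23 u3\<rparr>)" (is "?f ` _ = ?A")
    proof (intro equalityI subsetI)
      fix x assume "x \<in> ?f ` carrier ?Z"
      then show "x \<in> ?A" using hom_carrier[OF \<open>?f \<in> hom ?Z _\<close>] by blast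
    next
      fix x assume "x \<in> ?A"
      then have x: "x \<in> carrier G13" "u3 x = \<one>\<^bsub>G23\<^esub>" by (simp_all add: kernel_def)
      then obtain y where y: "y \<in> carrier G12" "x = b1 y" using surj(1) by blast
      have "b2 (u2 y) = \<one>\<^bsub>G23\<^esub>" using c2[OF y(1)] x(2) y(2) by simp
      then obtain z where z: "z \<in> carrier G21" "u2 y = a2 z" using e2[OF hom_in_carrier[OF u2 y(1)]] by blast
      then have "(z, y) \<in> carrier ?Z" using y(1) by simp
      then show "x \<in> ?f ` carrier ?Z" using y(2) by (intro image_eqI[of _ _ "(z, y)"]) simp_all
    qed
    show "(\<lambda>p. v1 (fst p)) ` carrier ?Z = carrier (G31\<lparr>carrier := kernel G31 G32 a3\<rparr>)" (is "?g ` _ = ?B")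
    proof (intro equalityI subsetI)
      fix x assume "x \<in> ?g ` carrier ?Z"
      then show "x \<in> ?B" using hom_carrier[OF \<open>?g \<in> hom ?Z _\<close>] by blast
    next
      fix x assume "x \<in> ?B"
      then have x: "x \<in> carrier G31" "a3 x = \<one>\<^bsub>G32\<^esub>" by (simp_all add: kernel_def)
      then obtain z where z: "z \<in> carrier G21" "x = v1 z" using surj(2) by blast
      have "v2 (a2 z) = \<one>\<^bsub>G32\<^esub>" using c3[OF z(1)] x(2) z(2) by simp
      then obtain y where y: "y \<in> carrier G12" "a2 z = u2 y" using f2[OF hom_in_carrier[OF a2 z(1)]] by blast
      then have "(z, y) \<in> carrier ?Z" using z(1) by simp
      then show "x \<in> ?g ` carrier ?Z" using z(2) by (intro image_eqI[of _ _ "(z, y)"]) simp_all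
    qed
    fix p assume p: "p \<in> carrier ?Z"
    show "b1 (snd p) = \<one>\<^bsub>G13\<lparr>carrier := kernel G13 G23 u3\<rparr>\<^esub> \<longleftrightarrow> v1 (fst p) = \<one>\<^bsub>G31\<lparr>carrier := kernel G31 G32 a3\<rparr>\<^esub>"
    proof
      assume "b1 (snd p) = \<one>\<^bsub>G13\<lparr>carrier := kernel G13 G23 u3\<rparr>\<^esub>"
      then obtain w where w: "w \<in> carrier G11" "snd p = a1 w" using e1[OF z2[OF p]] by auto
      then have "a2 (fst p) = a2 (u1 w)" using z3[OF p] c1[OF w(1)] by simp
      then have "fst p = u1 w" by (rule inj_onD[OF inj(1) _ z1[OF p] hom_in_carrier[OF u1 w(1)]])
      then show "v1 (fst p) = \<one>\<^bsub>G31\<lparr>carrier := kernel G31 G32 a3\<rparr>\<^esub>" using f1[OF z1[OF p]] w(1) by simp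
    next
      assume "v1 (fst p) = \<one>\<^bsub>G31\<lparr>carrier := kernel G31 G32 a3\<rparr>\<^esub>"
      then obtain w where w: "w \<in> carrier G11" "fst p = u1 w" using f1[OF z1[OF p]] by auto
      then have "u2 (snd p) = u2 (a1 w)" using z3[OF p] c1[OF w(1)] by simp
      then have "snd p = a1 w" by (rule inj_onD[OF inj(2) _ z2[OF p] hom_in_carrier[OF a1 w(1)]])
      then show "b1 (snd p) = \<one>\<^bsub>G13\<lparr>carrier := kernel G13 G23 u3\<rparr>\<^esub>" using e1[OF z2[OF p]] w(1) by simp
    qed
  qed
qed

text \<open>
  The array is the tensor product of the two exact sequences.  The first map of its middle column is injective
  by the flatness of \<open>F\<close>, the first map of its middle row by \<open>injP\<close>.
\<close>

theorem dimension_shift_kernel: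
  assumes m: "right_module R X'" "right_module R P" "right_module R X"
    and l: "left_module R N'" "left_module R N" and se: "short_exact R X' P X i p" and fl: "flat_left_module R F"
    and se': "short_exact R N' F N a b"
    and injP: "inj_on (tensor_right R P F a) (carrier (tensor R P N'))"
  shows "tensor_kernel_left R X' P i N \<cong> tensor_kernel_right R X N' F a"
proof -
  have F: "left_module R F" using fl by (simp add: flat_left_module_def)
  note s = short_exactD[OF se] and s' = short_exactD[OF se']
  note id = module_hom_id
  show ?thesis
    unfolding tensor_kernel_left_def tensor_kernel_right_def
  proof (rule snake_kernel_iso)
    show "tensor_right R X' F a \<in> hom (tensor R X' N') (tensor R X' F)" by (rule tensor_map_hom[OF m(1) l(1) m(1) F id s'(1)])
    show "tensor_right R X' N b \<in> hom (tensor R X' F) (tensor R X' N)" by (rule tensor_map_hom[OF m(1) F m(1) l(2) id s'(3)])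
    show "tensor_right R P F a \<in> hom (tensor R P N') (tensor R P F)" by (rule tensor_map_hom[OF m(2) l(1) m(2) F id s'(1)])
    show "tensor_right R P N b \<in> hom (tensor R P F) (tensor R P N)" by (rule tensor_map_hom[OF m(2) F m(2) l(2) id s'(3)])
    show "tensor_right R X F a \<in> hom (tensor R X N') (tensor R X F)" by (rule tensor_map_hom[OF m(3) l(1) m(3) F id s'(1)])
    show "tensor_left R P N' i \<in> hom (tensor R X' N') (tensor R P N')" by (rule tensor_map_hom[OF m(1) l(1) m(2) l(1) s(1) id])
    show "tensor_left R P F i \<in> hom (tensor R X' F) (tensor R P F)" by (rule tensor_map_hom[OF m(1) F m(2) F s(1) id])
    show "tensor_left R P N i \<in> hom (tensor R X' N) (tensor R P N)" by (rule tensor_map_hom[OF m(1) l(2) m(2) l(2) s(1) id])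
    show "tensor_left R X N' p \<in> hom (tensor R P N') (tensor R X N')" by (rule tensor_map_hom[OF m(2) l(1) m(3) l(1) s(3) id])
    show "tensor_left R X F p \<in> hom (tensor R P F) (tensor R X F)" by (rule tensor_map_hom[OF m(2) F m(3) F s(3) id])
    show "tensor_right R P F a (tensor_left R P N' i t) = tensor_left R P F i (tensor_right R X' F a t)"
      if t: "t \<in> carrier (tensor R X' N')" for t
      unfolding tensor_map_comp[OF m(1) l(1) m(2) l(1) m(2) F s(1) id id s'(1) t]
        tensor_map_comp[OF m(1) l(1) m(1) F m(2) F id s'(1) s(1) id t] ..
    show "tensor_right R P N b (tensor_left R P F i t) = tensor_left R P N i (tensor_right R X' N b t)"
      if t: "t \<in> carrier (tensor R X' F)" for t
      unfolding tensor_map_comp[OF m(1) F m(2) F m(2) l(2) s(1) id id s'(3) t]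
        tensor_map_comp[OF m(1) F m(1) l(2) m(2) l(2) id s'(3) s(1) id t] ..
    show "tensor_right R X F a (tensor_left R X N' p t) = tensor_left R X F p (tensor_right R P F a t)"
      if t: "t \<in> carrier (tensor R P N')" for t
      unfolding tensor_map_comp[OF m(2) l(1) m(3) l(1) m(3) F s(3) id id s'(1) t]
        tensor_map_comp[OF m(2) l(1) m(2) F m(3) F id s'(1) s(3) id t] ..
    show "inj_on (tensor_right R P F a) (carrier (tensor R P N'))" by (rule injP)
    show "inj_on (tensor_left R P F i) (carrier (tensor R X' F))" by (rule flat_tensor_injective[OF fl m(1,2) s(1,2)])
    show "tensor_right R X' N b ` carrier (tensor R X' F) = carrier (tensor R X' N)"
      by (rule tensor_map_surj[OF m(1) F m(1) l(2) id _ s'(3,4)]) simp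
    show "tensor_left R X N' p ` carrier (tensor R P N') = carrier (tensor R X N')"
      by (rule tensor_map_surj[OF m(2) l(1) m(3) l(1) s(3,4) id]) simp
  qed (rule comm_group_tensor[OF m(1) l(1)] comm_group_tensor[OF m(1) F] comm_group_tensor[OF m(1) l(2)]
      comm_group_tensor[OF m(2) l(1)] comm_group_tensor[OF m(2) F] comm_group_tensor[OF m(2) l(2)]
      comm_group_tensor[OF m(3) l(1)] comm_group_tensor[OF m(3) F]
      tensor_right_exact_right_factor[OF l(1) F l(2) m(1) se'] tensor_right_exact_right_factor[OF l(1) F l(2) m(2) se']
      tensor_right_exact_left_factor[OF m l(1) se] tensor_right_exact_left_factor[OF m F se]; assumption)+
qed

lemma kernel_iso:
  assumes G: "comm_group G'" "comm_group H'" and f: "f \<in> iso G H" and f': "f' \<in> iso G' H'" and a: "a \<in> hom G G'"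
    and comm: "\<And>x. x \<in> carrier G \<Longrightarrow> f' (a x) = b (f x)"
  shows "(G\<lparr>carrier := kernel G G' a\<rparr>) \<cong> (H\<lparr>carrier := kernel H H' b\<rparr>)"
proof (rule iso_restrict_carrier[OF f])
  fix x assume x: "x \<in> carrier G"
  have "inj_on f' (carrier G')" using f' by (simp add: iso_def bij_betw_def)
  then have "a x = \<one>\<^bsub>G'\<^esub> \<longleftrightarrow> b (f x) = \<one>\<^bsub>H'\<^esub>"
    using injective_hom_eq_one_iff[OF G iso_imp_homomorphism[OF f'] _ hom_in_carrier[OF a x]] unfolding comm[OF x] by blast
  then show "x \<in> kernel G G' a \<longleftrightarrow> f x \<in> kernel H H' b"
    using x hom_in_carrier[OF iso_imp_homomorphism[OF f] x] by (simp add: kernel_def)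
qed (auto simp: kernel_def)

theorem Tor_one_dimension_shift:
  assumes M: "right_module R M" and l: "left_module R N'" "left_module R N" and fl: "flat_left_module R F"
    and se: "short_exact R N' F N a b"
  shows "Tor R 1 M N \<cong> tensor_kernel_right R M N' F a"
proof -
  have F: "left_module R F" using fl by (simp add: flat_left_module_def)
  note P = right_module_resolution[OF M] and Om = right_module_syzygy[OF M]
  have "Tor R 1 M N \<cong> tensor_kernel_left R (syzygy R M (Suc 0)) (resolution R M 0) (syzygy_inclusion R M 0) N"
    unfolding One_nat_def by (rule Tor_Suc_iso[OF M l(2)])
  also have "\<dots> \<cong> tensor_kernel_right R (syzygy R M 0) N' F a"
    by (rule dimension_shift_kernel[OF Om P Om l syzygy_short_exact[OF M] fl se])
      (unfold resolution_def, rule free_tensor_injective[OF right_module_ring[OF M] l(1) F short_exactD(1,2)[OF se]])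
  also have "\<dots> \<cong> tensor_kernel_right R M N' F a"
  proof -
    let ?at = "\<lambda>L :: ('a, 'z) rmodule. tensor_left R (syzygy R M 0) L Atom"
    have iso: "tensor_left R (syzygy R M 0) N' Atom \<in> iso (tensor R M N') (tensor R (syzygy R M 0) N')"
      by (rule tensor_map_iso[OF M l(1) Om l(1) syzygy_zero_bij module_hom_id]) (simp add: bij_betw_def)
    have iso': "tensor_left R (syzygy R M 0) F Atom \<in> iso (tensor R M F) (tensor R (syzygy R M 0) F)"
      by (rule tensor_map_iso[OF M F Om F syzygy_zero_bij module_hom_id]) (simp add: bij_betw_def)
    note a = short_exactD(1)[OF se] and at = syzygy_zero_bij(1)[of R M]
    have "tensor_kernel_right R M N' F a \<cong> tensor_kernel_right R (syzygy R M 0) N' F a"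
      unfolding tensor_kernel_right_def
    proof (rule kernel_iso[OF comm_group_tensor[OF M F] comm_group_tensor[OF Om F] iso iso' tensor_map_hom[OF M l(1) M F module_hom_id a]])
      fix t assume t: "t \<in> carrier (tensor R M N')"
      show "tensor_left R (syzygy R M 0) F Atom (tensor_right R M F a t) =
          tensor_right R (syzygy R M 0) F a (tensor_left R (syzygy R M 0) N' Atom t)"
        unfolding tensor_map_comp[OF M l(1) Om l(1) Om F at module_hom_id module_hom_id a t]
          tensor_map_comp[OF M l(1) M F Om F module_hom_id a at module_hom_id t] ..
    qed
    moreover have "group (tensor_kernel_right R M N' F a)"
      unfolding tensor_kernel_right_def
      by (intro comm_group.axioms(2)[OF comm_group_subgroup] comm_group_tensor kernel_subgroup
          tensor_map_hom M l F module_hom_id a)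
    ultimately show ?thesis using group.iso_sym by blast
  qed
  finally (iso_trans) show ?thesis .
qed

text \<open>
  The shift of the next syzygy leads to the kernel of \<open>X \<otimes> N' \<rightarrow> X \<otimes> F\<close> for a syzygy \<open>X\<close> contained in the free
  module \<open>P\<close>, while the right-hand side is the kernel of \<open>X \<otimes> N' \<rightarrow> P \<otimes> N'\<close>.  They agree because both
  targets embed in \<open>P \<otimes> F\<close>.
\<close>

theorem Tor_Suc_dimension_shift:
  assumes M: "right_module R M" and l: "left_module R N'" "left_module R N" and fl: "flat_left_module R F"
    and se: "short_exact R N' F N a b"
  shows "Tor R (Suc (Suc i)) M N \<cong> Tor R (Suc i) M N'"
proof -
  have F: "left_module R F" using fl by (simp add: flat_left_module_def)
  note P = right_module_resolution[OF M] and Om = right_module_syzygy[OF M]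
  note a = short_exactD(1)[OF se] and id = module_hom_id
  let ?X = "syzygy R M (Suc i)" and ?P = "resolution R M i" and ?j = "syzygy_inclusion R M i"
  note s = short_exactD[OF syzygy_short_exact[OF M, of i]]
  have injP: "inj_on (tensor_right R (resolution R M j) F a) (carrier (tensor R (resolution R M j) N'))" for j
    unfolding resolution_def
    by (rule free_tensor_injective[OF right_module_ring[OF M] l(1) F short_exactD(1,2)[OF se]])
  have "Tor R (Suc (Suc i)) M N \<cong> tensor_kernel_left R (syzygy R M (Suc (Suc i))) (resolution R M (Suc i)) (syzygy_inclusion R M (Suc i)) N"
    by (rule Tor_Suc_iso[OF M l(2)])
  also have "\<dots> \<cong> tensor_kernel_right R ?X N' F a"
    by (rule dimension_shift_kernel[OF Om P Om l syzygy_short_exact[OF M] fl se injP])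
  also have "tensor_kernel_right R ?X N' F a = tensor_kernel_left R ?X ?P ?j N'"
  proof -
    have "tensor_right R ?X F a t = \<one>\<^bsub>tensor R ?X F\<^esub> \<longleftrightarrow> tensor_left R ?P N' ?j t = \<one>\<^bsub>tensor R ?P N'\<^esub>"
      if t: "t \<in> carrier (tensor R ?X N')" for t
    proof -
      have t1: "tensor_right R ?X F a t \<in> carrier (tensor R ?X F)"
        by (rule hom_in_carrier[OF tensor_map_hom[OF Om l(1) Om F id a] t])
      have t2: "tensor_left R ?P N' ?j t \<in> carrier (tensor R ?P N')"
        by (rule hom_in_carrier[OF tensor_map_hom[OF Om l(1) P l(1) s(1) id] t])
      have "tensor_left R ?P F ?j (tensor_right R ?X F a t) =
          tensor_right R ?P F a (tensor_left R ?P N' ?j t)"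
        unfolding tensor_map_comp[OF Om l(1) Om F P F id a s(1) id t]
          tensor_map_comp[OF Om l(1) P l(1) P F s(1) id id a t] ..
      then show ?thesis
        using injective_hom_eq_one_iff[OF comm_group_tensor[OF Om F] comm_group_tensor[OF P F] tensor_map_hom[OF Om F P F s(1) id]
            flat_tensor_injective[OF fl Om P s(1,2)] t1]
          injective_hom_eq_one_iff[OF comm_group_tensor[OF P l(1)] comm_group_tensor[OF P F] tensor_map_hom[OF P l(1) P F id a] injP t2]
        by simp
    qed
    then have "kernel (tensor R ?X N') (tensor R ?X F) (tensor_right R ?X F a) =
        kernel (tensor R ?X N') (tensor R ?P N') (tensor_left R ?P N' ?j)"
      unfolding kernel_def by blast
    then show ?thesis unfolding tensor_kernel_left_def tensor_kernel_right_def by simp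
  qed
  also have "\<dots> \<cong> Tor R (Suc i) M N'"
  proof (rule group.iso_sym)
    show "group (Tor R (Suc i) M N')" by (rule group_Tor_Suc[OF M l(1)])
    show "Tor R (Suc i) M N' \<cong> tensor_kernel_left R ?X ?P ?j N'" by (rule Tor_Suc_iso[OF M l(1)])
  qed
  finally (iso_trans) show ?thesis .
qed

section \<open>Restriction of scalars\<close>

lemma restrict_scalars_simps [simp]:
  "carrier (restrict_scalars \<psi> L) = carrier L" "monoid.mult (restrict_scalars \<psi> L) = monoid.mult L"
  "one (restrict_scalars \<psi> L) = one L" "act (restrict_scalars \<psi> L) a = act L (\<psi> a)"
  by (simp_all add: restrict_scalars_def)

lemma left_module_restrict:
  assumes Q: "ring Q" and \<psi>: "\<psi> \<in> ring_hom Q R" and L: "left_module R L"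
  shows "left_module Q (restrict_scalars \<psi> L)"
  using comm_group_with_act[OF left_module_group[OF L]] Q left_moduleD[OF L]
    ring_hom_closed[OF \<psi>] ring_hom_mult[OF \<psi>] ring_hom_add[OF \<psi>] ring_hom_one[OF \<psi>]
  unfolding left_module_def by (simp add: restrict_scalars_def)

lemma right_module_restrict:
  assumes Q: "ring Q" and \<psi>: "\<psi> \<in> ring_hom Q R" and L: "right_module R L"
  shows "right_module Q (restrict_scalars \<psi> L)"
  using comm_group_with_act[OF right_module_group[OF L]] Q right_moduleD[OF L]
    ring_hom_closed[OF \<psi>] ring_hom_mult[OF \<psi>] ring_hom_add[OF \<psi>] ring_hom_one[OF \<psi>]
  unfolding right_module_def by (simp add: restrict_scalars_def)

lemma module_hom_restrict:
  assumes \<psi>: "\<psi> \<in> ring_hom Q R" and h: "h \<in> module_hom R X Y"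
  shows "h \<in> module_hom Q (restrict_scalars \<psi> X) (restrict_scalars \<psi> Y)"
  using module_homD[OF h] ring_hom_closed[OF \<psi>] by (intro module_homI) simp_all

section \<open>Matrices acting on columns and rows\<close>

lemma (in comm_monoid) finprod_swap:
  assumes "finite A" and f: "\<And>a b. a \<in> A \<Longrightarrow> b \<in> B \<Longrightarrow> f a b \<in> carrier G"
  shows "finprod G (\<lambda>a. finprod G (f a) B) A = finprod G (\<lambda>b. finprod G (\<lambda>a. f a b) A) B"
  using assms
proof (induction A rule: finite_induct)
  case empty then show ?case by simp
next
  case (insert a A)
  have "finprod G (\<lambda>a. finprod G (f a) B) (insert a A) = finprod G (f a) B \<otimes> finprod G (\<lambda>b. finprod G (\<lambda>a. f a b) A) B"
    using insert by (subst finprod_insert) (auto intro!: finprod_closed)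
  also have "\<dots> = finprod G (\<lambda>b. f a b \<otimes> finprod G (\<lambda>a. f a b) A) B"
    using insert.prems by (intro finprod_multf[symmetric]) (auto intro!: finprod_closed)
  also have "\<dots> = finprod G (\<lambda>b. finprod G (\<lambda>a. f a b) (insert a A)) B"
    using insert by (intro finprod_cong') (auto intro!: finprod_closed simp: Pi_iff)
  finally show ?case .
qed

lemma finprod_left_regular: "finprod (left_regular S) f I = finsum S f I"
  by (simp add: finsum_def finprod_def left_regular_def)

lemma act_finsum:
  assumes L: "left_module S L" and f: "f \<in> I \<rightarrow> carrier S" and x: "x \<in> carrier L"
  shows "act L (finsum S f I) x = finprod L (\<lambda>i. act L (f i) x) I"
  using hom_finprod[OF ring_add_comm_group[OF left_module_ring[OF L]] left_module_group[OF L]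
      left_module_hom_scalar[OF L x], of f I] f
  by (simp add: finsum_def)

lemma act_finprod:
  assumes L: "left_module S L" and a: "a \<in> carrier S" and f: "f \<in> I \<rightarrow> carrier L"
  shows "act L a (finprod L f I) = finprod L (\<lambda>i. act L a (f i)) I"
  by (rule hom_finprod[OF left_module_group[OF L] left_module_group[OF L] left_module_hom_action[OF L a] f])

text \<open>
  With \<open>L\<close> the ring itself this is the associativity of matrix multiplication.
\<close>

lemma act_sum_assoc:
  assumes L: "left_module S L" and x: "\<And>m. m < n \<Longrightarrow> x m \<in> carrier S"
    and Y: "\<And>m l. m < n \<Longrightarrow> l < n \<Longrightarrow> Y (m, l) \<in> carrier S" and v: "\<And>l. l < n \<Longrightarrow> v l \<in> carrier L"
  shows "finprod L (\<lambda>l. act L (finsum S (\<lambda>m. x m \<otimes>\<^bsub>S\<^esub> Y (m, l)) {..<n}) (v l)) {..<n::nat} =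
    finprod L (\<lambda>m. act L (x m) (finprod L (\<lambda>l. act L (Y (m, l)) (v l)) {..<n})) {..<n}"
proof -
  interpret L: comm_group L by (rule left_module_group[OF L])
  interpret S: ring S by (rule left_module_ring[OF L])
  note cl = left_module_closed[OF L]
  have "finprod L (\<lambda>l. act L (finsum S (\<lambda>m. x m \<otimes>\<^bsub>S\<^esub> Y (m, l)) {..<n}) (v l)) {..<n} =
      finprod L (\<lambda>l. finprod L (\<lambda>m. act L (x m) (act L (Y (m, l)) (v l))) {..<n}) {..<n}"
  proof (rule L.finprod_cong'[OF refl])
    show "(\<lambda>l. finprod L (\<lambda>m. act L (x m) (act L (Y (m, l)) (v l))) {..<n}) \<in> {..<n} \<rightarrow> carrier L"
      by (auto intro!: L.finprod_closed cl x Y v)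
    fix l assume "l \<in> {..<n}"
    then have l: "l < n" by simp
    have "act L (finsum S (\<lambda>m. x m \<otimes>\<^bsub>S\<^esub> Y (m, l)) {..<n}) (v l) = finprod L (\<lambda>m. act L (x m \<otimes>\<^bsub>S\<^esub> Y (m, l)) (v l)) {..<n}"
      by (rule act_finsum[OF L _ v[OF l]]) (auto intro!: x Y l)
    also have "\<dots> = finprod L (\<lambda>m. act L (x m) (act L (Y (m, l)) (v l))) {..<n}"
      by (rule L.finprod_cong'[OF refl]) (auto intro!: cl x Y v l left_module_assoc[OF L])
    finally show "act L (finsum S (\<lambda>m. x m \<otimes>\<^bsub>S\<^esub> Y (m, l)) {..<n}) (v l) =
      finprod L (\<lambda>m. act L (x m) (act L (Y (m, l)) (v l))) {..<n}" .
  qed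
  also have "\<dots> = finprod L (\<lambda>m. finprod L (\<lambda>l. act L (x m) (act L (Y (m, l)) (v l))) {..<n}) {..<n}"
    by (rule L.finprod_swap) (auto intro!: cl x Y v)
  also have "\<dots> = finprod L (\<lambda>m. act L (x m) (finprod L (\<lambda>l. act L (Y (m, l)) (v l)) {..<n})) {..<n}"
  proof (rule L.finprod_cong'[OF refl])
    show "(\<lambda>m. act L (x m) (finprod L (\<lambda>l. act L (Y (m, l)) (v l)) {..<n})) \<in> {..<n} \<rightarrow> carrier L"
      by (auto intro!: L.finprod_closed cl x Y v)
    fix m assume "m \<in> {..<n}"
    then have m: "m < n" by simp
    show "finprod L (\<lambda>l. act L (x m) (act L (Y (m, l)) (v l))) {..<n} = act L (x m) (finprod L (\<lambda>l. act L (Y (m, l)) (v l)) {..<n})"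
      by (rule act_finprod[OF L x[OF m], symmetric]) (auto intro!: cl Y v m)
  qed
  finally show ?thesis .
qed

text \<open>
  The entries are in an arbitrary module because the resolution of the module of columns over \<open>S\<close> consists of
  columns over the iterated kernels.
\<close>

definition columns :: "nat \<Rightarrow> ('s, 'l) rmodule \<Rightarrow> (nat \<times> nat \<Rightarrow> 's, nat \<Rightarrow> 'l) rmodule" where
  "columns n L = with_act (product_group {..<n} (\<lambda>_. L))
    (\<lambda>X v. \<lambda>i\<in>{..<n}. finprod L (\<lambda>l. act L (X (i, l)) (v l)) {..<n})"

lemma column_module_eq: "column_module n S = columns n (left_regular S)"
  unfolding column_module_def columns_def finprod_left_regular
  by (simp add: left_regular_def product_group_def with_act_def)

lemma columns_simps [simp]:
  "carrier (columns n L) = {..<n} \<rightarrow>\<^sub>E carrier L"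
  "v \<otimes>\<^bsub>columns n L\<^esub> w = (\<lambda>i\<in>{..<n}. v i \<otimes>\<^bsub>L\<^esub> w i)"
  "\<one>\<^bsub>columns n L\<^esub> = (\<lambda>i\<in>{..<n}. \<one>\<^bsub>L\<^esub>)"
  "act (columns n L) X v = (\<lambda>i\<in>{..<n}. finprod L (\<lambda>l. act L (X (i, l)) (v l)) {..<n})"
  by (simp_all add: columns_def)

lemma comm_group_product_group:
  assumes "\<And>i. i \<in> I \<Longrightarrow> comm_group (G i)"
  shows "comm_group (product_group I G)"
proof (rule group.group_comm_groupI)
  show "group (product_group I G)" using assms by (simp add: comm_group.axioms)
  show "x \<otimes>\<^bsub>product_group I G\<^esub> y = y \<otimes>\<^bsub>product_group I G\<^esub> x"
    if "x \<in> carrier (product_group I G)" "y \<in> carrier (product_group I G)" for x y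
    using that comm_monoid.m_comm[OF comm_group.axioms(1)[OF assms]] by (auto simp: PiE_iff intro!: restrict_ext)
qed

lemma abelian_group_of_comm_group:
  assumes "comm_group (add_monoid R)" shows "abelian_group R"
  using assms by (simp add: abelian_group_def abelian_group_axioms_def abelian_monoid_def comm_group.axioms)

lemma matrix_ring_simps:
  "X \<in> carrier (matrix_ring n S) \<longleftrightarrow> X \<in> {..<n} \<times> {..<n} \<rightarrow>\<^sub>E carrier S"
  "X \<otimes>\<^bsub>matrix_ring n S\<^esub> Y = mat_mult S n X Y"
  "\<one>\<^bsub>matrix_ring n S\<^esub> = (\<lambda>(i, j)\<in>{..<n} \<times> {..<n}. if i = j then \<one>\<^bsub>S\<^esub> else \<zero>\<^bsub>S\<^esub>)"
  "\<zero>\<^bsub>matrix_ring n S\<^esub> = (\<lambda>p\<in>{..<n} \<times> {..<n}. \<zero>\<^bsub>S\<^esub>)"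
  "X \<oplus>\<^bsub>matrix_ring n S\<^esub> Y = (\<lambda>p\<in>{..<n} \<times> {..<n}. X p \<oplus>\<^bsub>S\<^esub> Y p)"
  by (simp_all add: matrix_ring_def matrix_group_def)

lemma mat_mult_entry:
  "i < n \<Longrightarrow> j < n \<Longrightarrow> mat_mult S n X Y (i, j) = finsum S (\<lambda>l. X (i, l) \<otimes>\<^bsub>S\<^esub> Y (l, j)) {..<n}"
  by (simp add: mat_mult_def)

lemma mat_mult_closed:
  assumes "ring S" "X \<in> {..<n} \<times> {..<n} \<rightarrow>\<^sub>E carrier S" "Y \<in> {..<n} \<times> {..<n} \<rightarrow>\<^sub>E carrier S"
  shows "mat_mult S n X Y \<in> {..<n} \<times> {..<n} \<rightarrow>\<^sub>E carrier S"
proof -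
  interpret ring S by fact
  show ?thesis
    unfolding mat_mult_def
    by (rule restrict_PiE_iff[THEN iffD2]) (use assms(2,3) in \<open>auto intro!: finsum_closed m_closed simp: PiE_iff\<close>)
qed

lemma matrix_eqI:
  assumes "X \<in> {..<n::nat} \<times> {..<n::nat} \<rightarrow>\<^sub>E C" "Y \<in> {..<n} \<times> {..<n} \<rightarrow>\<^sub>E C"
    and "\<And>i j. i < n \<Longrightarrow> j < n \<Longrightarrow> X (i, j) = Y (i, j)"
  shows "X = Y"
  by (rule PiE_ext[OF assms(1,2)]) (use assms(3) in auto)

lemma (in ring) finsum_delta:
  assumes "i < (n::nat)" and f: "\<And>l. l < n \<Longrightarrow> l \<noteq> i \<Longrightarrow> f l = \<zero>" and "f i \<in> carrier R"
  shows "finsum R f {..<n} = f i"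
proof -
  have "finsum R f {..<n} = finsum R (\<lambda>l. if i = l then f l else \<zero>) {..<n}"
    by (rule add.finprod_cong') (use assms in auto)
  also have "\<dots> = f i"
    unfolding finsum_def
    using comm_monoid.finprod_singleton[OF comm_group.axioms(1)[OF a_comm_group], of i "{..<n}" "\<lambda>_. f i"] assms
    by (simp add: if_distrib cong: if_cong)
  finally show ?thesis .
qed

lemma (in comm_group) finprod_delta:
  assumes "i < (n::nat)" and f: "\<And>l. l < n \<Longrightarrow> l \<noteq> i \<Longrightarrow> f l = \<one>" and "f i \<in> carrier G"
  shows "finprod G f {..<n} = f i"
proof -
  have "finprod G f {..<n} = finprod G (\<lambda>l. if i = l then f i else \<one>) {..<n}"
    by (rule finprod_cong') (use assms in auto)
  also have "\<dots> = f i" by (rule finprod_singleton) (use assms in auto)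
  finally show ?thesis .
qed

lemma ring_matrix_ring:
  assumes S: "ring S"
  shows "ring (matrix_ring n S)"
proof -
  interpret S: ring S by fact
  let ?M = "matrix_ring n S"
  have cl: "X (i, j) \<in> carrier S" if "X \<in> carrier ?M" "i < n" "j < n" for X i j
    using that by (auto simp: matrix_ring_simps)
  have m: "X \<otimes>\<^bsub>?M\<^esub> Y \<in> carrier ?M" if "X \<in> carrier ?M" "Y \<in> carrier ?M" for X Y
    using mat_mult_closed[OF S] that by (simp add: matrix_ring_simps)
  have ad: "X \<oplus>\<^bsub>?M\<^esub> Y \<in> carrier ?M" if "X \<in> carrier ?M" "Y \<in> carrier ?M" for X Y
    using that by (auto simp: matrix_ring_simps PiE_iff)
  have one: "\<one>\<^bsub>?M\<^esub> \<in> carrier ?M" by (auto simp: matrix_ring_simps)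
  have eqI: "X = Y" if "X \<in> carrier ?M" "Y \<in> carrier ?M" "\<And>i j. i < n \<Longrightarrow> j < n \<Longrightarrow> X (i, j) = Y (i, j)" for X Y
    using that unfolding matrix_ring_simps by (rule matrix_eqI)
  have me: "(X \<otimes>\<^bsub>?M\<^esub> Y) (i, j) = finsum S (\<lambda>l. X (i, l) \<otimes>\<^bsub>S\<^esub> Y (l, j)) {..<n}" if "i < n" "j < n" for X Y i j
    unfolding matrix_ring_simps using that by (rule mat_mult_entry)
  have ae: "(X \<oplus>\<^bsub>?M\<^esub> Y) (i, j) = X (i, j) \<oplus>\<^bsub>S\<^esub> Y (i, j)" if "i < n" "j < n" for X Y i j
    using that by (simp add: matrix_ring_simps)
  have oe: "\<one>\<^bsub>?M\<^esub> (i, j) = (if i = j then \<one>\<^bsub>S\<^esub> else \<zero>\<^bsub>S\<^esub>)" if "i < n" "j < n" for i j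
    using that by (simp add: matrix_ring_simps)
  have mc: "(\<lambda>l. X (i, l) \<otimes>\<^bsub>S\<^esub> Y (l, j)) \<in> {..<n} \<rightarrow> carrier S" if "X \<in> carrier ?M" "Y \<in> carrier ?M" "i < n" "j < n" for X Y i j
    using cl that by auto
  show ?thesis
  proof (rule ringI)
    have "comm_group (product_group ({..<n} \<times> {..<n}) (\<lambda>_. add_monoid S))"
      by (rule comm_group_product_group) (rule S.a_comm_group)
    then have "comm_group (add_monoid ?M)"
      by (rule comm_group_cong) (simp_all add: matrix_ring_def matrix_group_def)
    then show "abelian_group ?M" by (rule abelian_group_of_comm_group)
    show "monoid ?M"
    proof (rule monoidI[OF m one])
      fix X Y Z assume X: "X \<in> carrier ?M" and Y: "Y \<in> carrier ?M" and Z: "Z \<in> carrier ?M"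
      show "X \<otimes>\<^bsub>?M\<^esub> Y \<otimes>\<^bsub>?M\<^esub> Z = X \<otimes>\<^bsub>?M\<^esub> (Y \<otimes>\<^bsub>?M\<^esub> Z)"
      proof (rule eqI[OF m[OF m[OF X Y] Z] m[OF X m[OF Y Z]]])
        fix i j assume i: "i < n" and j: "j < n"
        have "(X \<otimes>\<^bsub>?M\<^esub> Y \<otimes>\<^bsub>?M\<^esub> Z) (i, j) = finsum S (\<lambda>l. finsum S (\<lambda>m. X (i, m) \<otimes>\<^bsub>S\<^esub> Y (m, l)) {..<n} \<otimes>\<^bsub>S\<^esub> Z (l, j)) {..<n}"
          unfolding me[OF i j]
          by (rule S.add.finprod_cong') (use cl X Y Z i j in \<open>auto simp: me Pi_iff intro!: S.m_closed S.finsum_closed\<close>)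
        also have "\<dots> = finsum S (\<lambda>m. X (i, m) \<otimes>\<^bsub>S\<^esub> finsum S (\<lambda>l. Y (m, l) \<otimes>\<^bsub>S\<^esub> Z (l, j)) {..<n}) {..<n}"
          using act_sum_assoc[OF left_module_regular[OF S], of n "\<lambda>m. X (i, m)" Y "\<lambda>l. Z (l, j)"] cl X Y Z i j
          unfolding finprod_left_regular by (simp add: left_regular_def)
        also have "\<dots> = (X \<otimes>\<^bsub>?M\<^esub> (Y \<otimes>\<^bsub>?M\<^esub> Z)) (i, j)"
          unfolding me[OF i j]
          by (rule S.add.finprod_cong') (use cl X Y Z i j m in \<open>auto simp: me Pi_iff intro!: S.m_closed S.finsum_closed\<close>)
        finally show "(X \<otimes>\<^bsub>?M\<^esub> Y \<otimes>\<^bsub>?M\<^esub> Z) (i, j) = (X \<otimes>\<^bsub>?M\<^esub> (Y \<otimes>\<^bsub>?M\<^esub> Z)) (i, j)" .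
      qed
    next
      fix X assume X: "X \<in> carrier ?M"
      show "\<one>\<^bsub>?M\<^esub> \<otimes>\<^bsub>?M\<^esub> X = X"
      proof (rule eqI[OF m[OF one X] X])
        fix i j assume i: "i < n" and j: "j < n"
        have "finsum S (\<lambda>l. \<one>\<^bsub>?M\<^esub> (i, l) \<otimes>\<^bsub>S\<^esub> X (l, j)) {..<n} = \<one>\<^bsub>?M\<^esub> (i, i) \<otimes>\<^bsub>S\<^esub> X (i, j)"
          by (rule S.finsum_delta[OF i]) (use cl X i j in \<open>auto simp: oe\<close>)
        then show "(\<one>\<^bsub>?M\<^esub> \<otimes>\<^bsub>?M\<^esub> X) (i, j) = X (i, j)" using cl X i j by (simp add: me oe)
      qed
      show "X \<otimes>\<^bsub>?M\<^esub> \<one>\<^bsub>?M\<^esub> = X"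
      proof (rule eqI[OF m[OF X one] X])
        fix i j assume i: "i < n" and j: "j < n"
        have "finsum S (\<lambda>l. X (i, l) \<otimes>\<^bsub>S\<^esub> \<one>\<^bsub>?M\<^esub> (l, j)) {..<n} = X (i, j) \<otimes>\<^bsub>S\<^esub> \<one>\<^bsub>?M\<^esub> (j, j)"
          by (rule S.finsum_delta[OF j]) (use cl X i j in \<open>auto simp: oe\<close>)
        then show "(X \<otimes>\<^bsub>?M\<^esub> \<one>\<^bsub>?M\<^esub>) (i, j) = X (i, j)" using cl X i j by (simp add: me oe)
      qed
    qed
    fix X Y Z assume X: "X \<in> carrier ?M" and Y: "Y \<in> carrier ?M" and Z: "Z \<in> carrier ?M"
    show "(X \<oplus>\<^bsub>?M\<^esub> Y) \<otimes>\<^bsub>?M\<^esub> Z = X \<otimes>\<^bsub>?M\<^esub> Z \<oplus>\<^bsub>?M\<^esub> Y \<otimes>\<^bsub>?M\<^esub> Z"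
    proof (rule eqI[OF m[OF ad[OF X Y] Z] ad[OF m[OF X Z] m[OF Y Z]]])
      fix i j assume i: "i < n" and j: "j < n"
      have "((X \<oplus>\<^bsub>?M\<^esub> Y) \<otimes>\<^bsub>?M\<^esub> Z) (i, j) = finsum S (\<lambda>l. X (i, l) \<otimes>\<^bsub>S\<^esub> Z (l, j) \<oplus>\<^bsub>S\<^esub> Y (i, l) \<otimes>\<^bsub>S\<^esub> Z (l, j)) {..<n}"
        unfolding me[OF i j]
        by (rule S.add.finprod_cong') (use cl X Y Z i j in \<open>auto simp: ae Pi_iff S.l_distr\<close>)
      then show "((X \<oplus>\<^bsub>?M\<^esub> Y) \<otimes>\<^bsub>?M\<^esub> Z) (i, j) = (X \<otimes>\<^bsub>?M\<^esub> Z \<oplus>\<^bsub>?M\<^esub> Y \<otimes>\<^bsub>?M\<^esub> Z) (i, j)"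
        unfolding ae[OF i j] me[OF i j] S.finsum_addf[OF mc[OF X Z i j] mc[OF Y Z i j]] .
    qed
    show "Z \<otimes>\<^bsub>?M\<^esub> (X \<oplus>\<^bsub>?M\<^esub> Y) = Z \<otimes>\<^bsub>?M\<^esub> X \<oplus>\<^bsub>?M\<^esub> Z \<otimes>\<^bsub>?M\<^esub> Y"
    proof (rule eqI[OF m[OF Z ad[OF X Y]] ad[OF m[OF Z X] m[OF Z Y]]])
      fix i j assume i: "i < n" and j: "j < n"
      have "(Z \<otimes>\<^bsub>?M\<^esub> (X \<oplus>\<^bsub>?M\<^esub> Y)) (i, j) = finsum S (\<lambda>l. Z (i, l) \<otimes>\<^bsub>S\<^esub> X (l, j) \<oplus>\<^bsub>S\<^esub> Z (i, l) \<otimes>\<^bsub>S\<^esub> Y (l, j)) {..<n}"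
        unfolding me[OF i j]
        by (rule S.add.finprod_cong') (use cl X Y Z i j in \<open>auto simp: ae Pi_iff S.r_distr\<close>)
      then show "(Z \<otimes>\<^bsub>?M\<^esub> (X \<oplus>\<^bsub>?M\<^esub> Y)) (i, j) = (Z \<otimes>\<^bsub>?M\<^esub> X \<oplus>\<^bsub>?M\<^esub> Z \<otimes>\<^bsub>?M\<^esub> Y) (i, j)"
        unfolding ae[OF i j] me[OF i j] S.finsum_addf[OF mc[OF Z X i j] mc[OF Z Y i j]] .
    qed
  qed
qed

lemma left_module_columns:
  assumes L: "left_module S L"
  shows "left_module (matrix_ring n S) (columns n L)"
proof -
  interpret L: comm_group L by (rule left_module_group[OF L])
  interpret S: ring S by (rule left_module_ring[OF L])
  let ?M = "matrix_ring n S" and ?C = "columns n L"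
  have M: "ring ?M" by (rule ring_matrix_ring) (rule S.ring_axioms)
  have cM: "X (i, j) \<in> carrier S" if "X \<in> carrier ?M" "i < n" "j < n" for X i j
    using that by (auto simp: matrix_ring_simps)
  have cC: "v i \<in> carrier L" if "v \<in> carrier ?C" "i < n" for v i using that by (auto simp: PiE_iff)
  note cl = left_module_closed[OF L]
  have t: "(\<lambda>l. act L (X (i, l)) (v l)) \<in> {..<n} \<rightarrow> carrier L" if "X \<in> carrier ?M" "v \<in> carrier ?C" "i < n" for X v i
    using that cM cC cl by auto
  have e: "act ?C X v i = finprod L (\<lambda>l. act L (X (i, l)) (v l)) {..<n}" if "i < n" for X v i
    using that by simp
  have ac: "act ?C X v \<in> carrier ?C" if "X \<in> carrier ?M" "v \<in> carrier ?C" for X v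
    using L.finprod_closed[OF t[OF that]] by simp
  have ext: "v = w" if "v \<in> carrier ?C" "w \<in> carrier ?C" "\<And>i. i < n \<Longrightarrow> v i = w i" for v w
    using that unfolding columns_simps by (intro PiE_ext[of v]) auto
  have C: "comm_group ?C" unfolding columns_def
    by (rule comm_group_with_act[OF comm_group_product_group]) (rule L.comm_group_axioms)
  interpret C: comm_group ?C by (rule C)
  interpret M: ring ?M by (rule M)
  show ?thesis
    unfolding left_module_def
  proof (intro conjI ballI M C ac)
    fix X v w assume X: "X \<in> carrier ?M" and v: "v \<in> carrier ?C" and w: "w \<in> carrier ?C"
    show "act ?C X (v \<otimes>\<^bsub>?C\<^esub> w) = act ?C X v \<otimes>\<^bsub>?C\<^esub> act ?C X w"
    proof (rule ext[OF ac[OF X C.m_closed[OF v w]] C.m_closed[OF ac[OF X v] ac[OF X w]]])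
      fix i assume i: "i < n"
      have "act ?C X (v \<otimes>\<^bsub>?C\<^esub> w) i = finprod L (\<lambda>l. act L (X (i, l)) (v l) \<otimes>\<^bsub>L\<^esub> act L (X (i, l)) (w l)) {..<n}"
        unfolding e[OF i]
        by (rule L.finprod_cong') (use t[OF X v i] t[OF X w i] cM[OF X i] cC[OF v] cC[OF w] left_module_add[OF L] in \<open>auto simp: Pi_iff\<close>)
      also have "\<dots> = (act ?C X v \<otimes>\<^bsub>?C\<^esub> act ?C X w) i"
        unfolding L.finprod_multf[OF t[OF X v i] t[OF X w i]] using i by simp
      finally show "act ?C X (v \<otimes>\<^bsub>?C\<^esub> w) i = (act ?C X v \<otimes>\<^bsub>?C\<^esub> act ?C X w) i" .
    qed
  next
    fix X Y v assume X: "X \<in> carrier ?M" and Y: "Y \<in> carrier ?M" and v: "v \<in> carrier ?C"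
    show "act ?C (X \<oplus>\<^bsub>?M\<^esub> Y) v = act ?C X v \<otimes>\<^bsub>?C\<^esub> act ?C Y v"
    proof (rule ext[OF ac[OF M.a_closed[OF X Y] v] C.m_closed[OF ac[OF X v] ac[OF Y v]]])
      fix i assume i: "i < n"
      have "act ?C (X \<oplus>\<^bsub>?M\<^esub> Y) v i = finprod L (\<lambda>l. act L (X (i, l)) (v l) \<otimes>\<^bsub>L\<^esub> act L (Y (i, l)) (v l)) {..<n}"
        unfolding e[OF i]
        by (rule L.finprod_cong') (use t[OF X v i] t[OF Y v i] cM[OF X i] cM[OF Y i] cC[OF v] left_module_scal[OF L] i in
            \<open>auto simp: Pi_iff matrix_ring_simps\<close>)
      also have "\<dots> = (act ?C X v \<otimes>\<^bsub>?C\<^esub> act ?C Y v) i"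
        unfolding L.finprod_multf[OF t[OF X v i] t[OF Y v i]] using i by simp
      finally show "act ?C (X \<oplus>\<^bsub>?M\<^esub> Y) v i = (act ?C X v \<otimes>\<^bsub>?C\<^esub> act ?C Y v) i" .
    qed
    show "act ?C (X \<otimes>\<^bsub>?M\<^esub> Y) v = act ?C X (act ?C Y v)"
    proof (rule ext[OF ac[OF M.m_closed[OF X Y] v] ac[OF X ac[OF Y v]]])
      fix i assume i: "i < n"
      have "act ?C (X \<otimes>\<^bsub>?M\<^esub> Y) v i = finprod L (\<lambda>l. act L (finsum S (\<lambda>m. X (i, m) \<otimes>\<^bsub>S\<^esub> Y (m, l)) {..<n}) (v l)) {..<n}"
        unfolding e[OF i] matrix_ring_simps
        by (rule L.finprod_cong')
          (use i cM[OF X i] cM[OF Y] cC[OF v] cl in \<open>auto simp: mat_mult_entry Pi_iff intro!: cl S.finsum_closed\<close>)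
      also have "\<dots> = finprod L (\<lambda>m. act L (X (i, m)) (finprod L (\<lambda>l. act L (Y (m, l)) (v l)) {..<n})) {..<n}"
        by (rule act_sum_assoc[OF L]) (use i cM[OF X i] cM[OF Y] cC[OF v] in auto)
      also have "\<dots> = act ?C X (act ?C Y v) i"
        unfolding e[OF i]
        by (rule L.finprod_cong') (use i t[OF X ac[OF Y v] i] in \<open>auto simp: Pi_iff\<close>)
      finally show "act ?C (X \<otimes>\<^bsub>?M\<^esub> Y) v i = act ?C X (act ?C Y v) i" .
    qed
  next
    fix v assume v: "v \<in> carrier ?C"
    show "act ?C \<one>\<^bsub>?M\<^esub> v = v"
    proof (rule ext[OF ac[OF M.one_closed v] v])
      fix i assume i: "i < n"
      have "finprod L (\<lambda>l. act L (\<one>\<^bsub>?M\<^esub> (i, l)) (v l)) {..<n} = act L (\<one>\<^bsub>?M\<^esub> (i, i)) (v i)"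
        by (rule L.finprod_delta[OF i])
          (use i cC[OF v] left_module_act_zero[OF L] left_module_one[OF L] in \<open>auto simp: matrix_ring_simps\<close>)
      then show "act ?C \<one>\<^bsub>?M\<^esub> v i = v i"
        unfolding e[OF i] using i cC[OF v i] left_module_one[OF L] by (simp add: matrix_ring_simps)
    qed
  qed
qed

lemma columns_map:
  assumes L: "left_module S L" and L': "left_module S L'" and h: "h \<in> module_hom S L L'"
  shows "(\<lambda>v. \<lambda>i\<in>{..<n}. h (v i)) \<in> module_hom (matrix_ring n S) (columns n L) (columns n L')"
proof (rule module_homI)
  show "(\<lambda>i\<in>{..<n}. h (v i)) \<in> carrier (columns n L')" if "v \<in> carrier (columns n L)" for v
    using that module_hom_closed[OF h] by (auto simp: PiE_iff)
  show "(\<lambda>i\<in>{..<n}. h ((v \<otimes>\<^bsub>columns n L\<^esub> w) i)) =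
      (\<lambda>i\<in>{..<n}. h (v i)) \<otimes>\<^bsub>columns n L'\<^esub> (\<lambda>i\<in>{..<n}. h (w i))"
    if "v \<in> carrier (columns n L)" "w \<in> carrier (columns n L)" for v w
    using that module_hom_mult[OF h] by (auto simp: PiE_iff intro!: restrict_ext)
  fix X v assume X: "X \<in> carrier (matrix_ring n S)" and v: "v \<in> carrier (columns n L)"
  interpret L': comm_group L' by (rule left_module_group[OF L'])
  show "(\<lambda>i\<in>{..<n}. h (act (columns n L) X v i)) = act (columns n L') X (\<lambda>i\<in>{..<n}. h (v i))"
    unfolding columns_simps
  proof (rule restrict_ext)
    fix i assume i: "i \<in> {..<n}"
    have c: "X (i, l) \<in> carrier S" "v l \<in> carrier L" if "l < n" for l
      using X v i that by (auto simp: matrix_ring_simps PiE_iff)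
    have "h (finprod L (\<lambda>l. act L (X (i, l)) (v l)) {..<n}) = finprod L' (\<lambda>l. h (act L (X (i, l)) (v l))) {..<n}"
      by (rule hom_finprod[OF left_module_group[OF L] left_module_group[OF L'] module_hom_hom[OF h]])
        (auto intro!: left_module_closed[OF L] c)
    also have "\<dots> = finprod L' (\<lambda>l. act L' (X (i, l)) ((\<lambda>i\<in>{..<n}. h (v i)) l)) {..<n}"
      by (rule L'.finprod_cong'[OF refl])
        (auto intro!: left_module_closed[OF L'] c module_hom_closed[OF h] simp: module_hom_act[OF h] c)
    finally show "h ((\<lambda>i\<in>{..<n}. finprod L (\<lambda>l. act L (X (i, l)) (v l)) {..<n}) i) =
        finprod L' (\<lambda>l. act L' (X (i, l)) ((\<lambda>i\<in>{..<n}. h (v i)) l)) {..<n}" using i by simp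
  qed
qed

lemma row_module_simps [simp]:
  "carrier (row_module n S) = {..<n} \<rightarrow>\<^sub>E carrier S"
  "v \<otimes>\<^bsub>row_module n S\<^esub> w = (\<lambda>i\<in>{..<n}. v i \<oplus>\<^bsub>S\<^esub> w i)"
  "\<one>\<^bsub>row_module n S\<^esub> = (\<lambda>i\<in>{..<n}. \<zero>\<^bsub>S\<^esub>)"
  "act (row_module n S) X v = (\<lambda>j\<in>{..<n}. finsum S (\<lambda>l. v l \<otimes>\<^bsub>S\<^esub> X (l, j)) {..<n})"
  by (simp_all add: row_module_def)

text \<open>
  Repeating a row \<open>n\<close> times embeds the rows in the matrix ring, compatibly with right multiplication.
\<close>

lemma right_module_rows:
  assumes S: "ring S"
  shows "right_module (matrix_ring n S) (row_module n S)"
proof -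
  interpret S: ring S by fact
  let ?M = "matrix_ring n S" and ?C = "row_module n S"
  interpret M: ring ?M by (rule ring_matrix_ring) fact
  define m where "m v = (\<lambda>(i, j)\<in>{..<n} \<times> {..<n}. v j)" for v :: "nat \<Rightarrow> 'a"
  have m: "m v \<in> carrier ?M" if "v \<in> carrier ?C" for v
    using that unfolding m_def matrix_ring_simps by (intro restrict_PiE_iff[THEN iffD2]) auto
  have inj: "v = w" if "v \<in> carrier ?C" "w \<in> carrier ?C" "m v = m w" for v w
  proof (rule PiE_ext[OF that(1,2)[unfolded row_module_simps]])
    show "v j = w j" if "j \<in> {..<n}" for j
      using fun_cong[OF \<open>m v = m w\<close>, of "(j, j)"] that by (simp add: m_def)
  qed
  have ma: "m (act ?C X v) = m v \<otimes>\<^bsub>?M\<^esub> X" if "X \<in> carrier ?M" "v \<in> carrier ?C" for X v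
    using that by (auto simp: m_def matrix_ring_simps mat_mult_def PiE_iff intro!: restrict_ext S.add.finprod_cong')
  have mm: "m (v \<otimes>\<^bsub>?C\<^esub> w) = m v \<oplus>\<^bsub>?M\<^esub> m w" for v w
    by (auto simp: m_def matrix_ring_simps intro!: restrict_ext)
  have ac: "act ?C X v \<in> carrier ?C" if "X \<in> carrier ?M" "v \<in> carrier ?C" for X v
    using that by (auto simp: matrix_ring_simps PiE_iff intro!: S.finsum_closed)
  have C: "comm_group ?C" unfolding row_module_def
    by (rule comm_group_with_act[OF comm_group_product_group]) (rule S.a_comm_group)
  interpret C: comm_group ?C by (rule C)
  note cl = C.m_closed ac
  show ?thesis
    unfolding right_module_def
  proof (intro conjI ballI M.ring_axioms C ac)
    fix X v w assume X: "X \<in> carrier ?M" and v: "v \<in> carrier ?C" and w: "w \<in> carrier ?C"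
    show "act ?C X (v \<otimes>\<^bsub>?C\<^esub> w) = act ?C X v \<otimes>\<^bsub>?C\<^esub> act ?C X w"
      by (rule inj) (simp_all only: cl X v w ma mm M.l_distr m)
  next
    fix X Y v assume X: "X \<in> carrier ?M" and Y: "Y \<in> carrier ?M" and v: "v \<in> carrier ?C"
    show "act ?C (X \<oplus>\<^bsub>?M\<^esub> Y) v = act ?C X v \<otimes>\<^bsub>?C\<^esub> act ?C Y v"
      by (rule inj) (simp_all only: cl X Y v ma mm M.r_distr m M.a_closed)
    show "act ?C (X \<otimes>\<^bsub>?M\<^esub> Y) v = act ?C Y (act ?C X v)"
      by (rule inj) (simp_all only: cl X Y v ma M.m_assoc m M.m_closed)
  next
    fix v assume v: "v \<in> carrier ?C"
    show "act ?C \<one>\<^bsub>?M\<^esub> v = v" by (rule inj) (simp_all only: cl v ma m M.r_one M.one_closed)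
  qed
qed

section \<open>The triangular ring\<close>

type_synonym ('k, 's) triangular_matrix = "(nat \<Rightarrow> 'k) \<times> (nat \<times> nat \<Rightarrow> 's)"

locale triangular =
  fixes k :: "'k ring" and S :: "'s ring" and \<phi> :: "'k \<Rightarrow> 's" and n :: nat
  assumes ring_k: "ring k" and ring_S: "ring S" and hom_\<phi>: "\<phi> \<in> ring_hom k S"
begin

abbreviation "A \<equiv> triangular_ring k S \<phi> n"
abbreviation "\<tau> \<equiv> triangular_to_matrix S \<phi> n"
abbreviation "Mat \<equiv> matrix_ring n S"

sublocale k: ring k by (rule ring_k)
sublocale S: ring S by (rule ring_S)
sublocale Mat: ring "matrix_ring n S" by (rule ring_matrix_ring[OF ring_S])

lemma \<phi>_closed [simp]: "c \<in> carrier k \<Longrightarrow> \<phi> c \<in> carrier S" by (rule ring_hom_closed[OF hom_\<phi>])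
lemma \<phi>_zero [simp]: "\<phi> \<zero>\<^bsub>k\<^esub> = \<zero>\<^bsub>S\<^esub>" by (rule ring_hom_zero[OF hom_\<phi> ring_k ring_S])
lemmas \<phi>_one [simp] = ring_hom_one[OF hom_\<phi>]

lemma triangular_carrier: "a \<in> carrier A \<longleftrightarrow> fst a \<in> {..<n} \<rightarrow>\<^sub>E carrier k \<and> snd a \<in> below_diag n \<rightarrow>\<^sub>E carrier S"
  by (simp add: triangular_ring_def mem_Times_iff)

lemma triangular_fst: "a \<in> carrier A \<Longrightarrow> i < n \<Longrightarrow> fst a i \<in> carrier k"
  unfolding triangular_carrier by auto

lemma triangular_snd: "a \<in> carrier A \<Longrightarrow> p \<in> below_diag n \<Longrightarrow> snd a p \<in> carrier S"
  unfolding triangular_carrier by auto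

lemma triangular_ops:
  "i < n \<Longrightarrow> fst (a \<oplus>\<^bsub>A\<^esub> b) i = fst a i \<oplus>\<^bsub>k\<^esub> fst b i"
  "i < n \<Longrightarrow> fst (a \<otimes>\<^bsub>A\<^esub> b) i = fst a i \<otimes>\<^bsub>k\<^esub> fst b i"
  "i < n \<Longrightarrow> fst \<zero>\<^bsub>A\<^esub> i = \<zero>\<^bsub>k\<^esub>"
  "i < n \<Longrightarrow> fst \<one>\<^bsub>A\<^esub> i = \<one>\<^bsub>k\<^esub>"
  "p \<in> below_diag n \<Longrightarrow> snd (a \<oplus>\<^bsub>A\<^esub> b) p = snd a p \<oplus>\<^bsub>S\<^esub> snd b p"
  "p \<in> below_diag n \<Longrightarrow> snd (a \<otimes>\<^bsub>A\<^esub> b) p = mat_mult S n (\<tau> a) (\<tau> b) p"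
  "p \<in> below_diag n \<Longrightarrow> snd \<zero>\<^bsub>A\<^esub> p = \<zero>\<^bsub>S\<^esub>"
  "p \<in> below_diag n \<Longrightarrow> snd \<one>\<^bsub>A\<^esub> p = \<zero>\<^bsub>S\<^esub>"
  by (simp_all add: triangular_ring_def)

lemma \<tau>_entry: "i < n \<Longrightarrow> j < n \<Longrightarrow> \<tau> a (i, j) = (if i = j then \<phi> (fst a i) else if j < i then snd a (i, j) else \<zero>\<^bsub>S\<^esub>)"
  by (simp add: triangular_to_matrix_def case_prod_unfold)

lemma \<tau>_closed: "a \<in> carrier A \<Longrightarrow> \<tau> a \<in> carrier Mat"
  by (auto simp: matrix_ring_simps triangular_to_matrix_def case_prod_unfold triangular_fst triangular_snd below_diag_def)

lemma \<tau>_entry_closed: "a \<in> carrier A \<Longrightarrow> i < n \<Longrightarrow> j < n \<Longrightarrow> \<tau> a (i, j) \<in> carrier S"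
  using \<tau>_closed[of a] by (auto simp: matrix_ring_simps)

text \<open>
  Since \<open>\<phi>\<close> need not be injective, the diagonal entries have to be compared in \<open>k\<close>; the image in the matrix ring
  decides about the others.  In this way the ring axioms of \<open>A\<close> follow from those of \<open>k\<close> and of the matrix ring.
\<close>

lemma triangular_eqI:
  assumes a: "a \<in> carrier A" and b: "b \<in> carrier A"
    and d: "\<And>i. i < n \<Longrightarrow> fst a i = fst b i" and t: "\<And>i j. j < i \<Longrightarrow> i < n \<Longrightarrow> \<tau> a (i, j) = \<tau> b (i, j)"
  shows "a = b"
proof (rule prod_eqI)
  show "fst a = fst b"
    by (rule PiE_ext[OF conjunct1[OF a[unfolded triangular_carrier]] conjunct1[OF b[unfolded triangular_carrier]]])
      (use d in simp)
  have "snd a p = snd b p" if "p \<in> below_diag n" for p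
    using t[of "snd p" "fst p"] that by (auto simp: \<tau>_entry below_diag_def)
  then show "snd a = snd b"
    by (intro PiE_ext[OF conjunct2[OF a[unfolded triangular_carrier]] conjunct2[OF b[unfolded triangular_carrier]]])
qed

lemma triangular_add_closed: "a \<in> carrier A \<Longrightarrow> b \<in> carrier A \<Longrightarrow> a \<oplus>\<^bsub>A\<^esub> b \<in> carrier A"
  unfolding triangular_carrier by (auto simp: triangular_ring_def PiE_iff)

lemma triangular_mult_closed:
  assumes "a \<in> carrier A" "b \<in> carrier A" shows "a \<otimes>\<^bsub>A\<^esub> b \<in> carrier A"
proof -
  have "mat_mult S n (\<tau> a) (\<tau> b) \<in> {..<n} \<times> {..<n} \<rightarrow>\<^sub>E carrier S"
    using mat_mult_closed[OF ring_S] \<tau>_closed[OF assms(1)] \<tau>_closed[OF assms(2)] by (simp add: matrix_ring_simps)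
  then have "mat_mult S n (\<tau> a) (\<tau> b) p \<in> carrier S" if "p \<in> below_diag n" for p
    using that by (auto simp: below_diag_def PiE_iff)
  then show ?thesis using assms unfolding triangular_carrier by (auto simp: triangular_ring_def PiE_iff)
qed

lemma triangular_zero_one_closed: "\<zero>\<^bsub>A\<^esub> \<in> carrier A" "\<one>\<^bsub>A\<^esub> \<in> carrier A"
  unfolding triangular_carrier by (auto simp: triangular_ring_def)

lemma \<tau>_add:
  assumes "a \<in> carrier A" "b \<in> carrier A"
  shows "\<tau> (a \<oplus>\<^bsub>A\<^esub> b) = \<tau> a \<oplus>\<^bsub>Mat\<^esub> \<tau> b"
proof (rule matrix_eqI)
  show "\<tau> (a \<oplus>\<^bsub>A\<^esub> b) \<in> {..<n} \<times> {..<n} \<rightarrow>\<^sub>E carrier S"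
    using \<tau>_closed[OF triangular_add_closed[OF assms]] by (simp add: matrix_ring_simps)
  show "\<tau> a \<oplus>\<^bsub>Mat\<^esub> \<tau> b \<in> {..<n} \<times> {..<n} \<rightarrow>\<^sub>E carrier S"
    using Mat.a_closed[OF \<tau>_closed[OF assms(1)] \<tau>_closed[OF assms(2)]] unfolding matrix_ring_simps(1) .
  fix i j assume ij: "i < n" "j < n"
  then have p: "j < i \<Longrightarrow> (i, j) \<in> below_diag n" by (simp add: below_diag_def)
  show "\<tau> (a \<oplus>\<^bsub>A\<^esub> b) (i, j) = (\<tau> a \<oplus>\<^bsub>Mat\<^esub> \<tau> b) (i, j)"
    using ij p ring_hom_add[OF hom_\<phi> triangular_fst[OF assms(1)] triangular_fst[OF assms(2)]]
    by (simp add: matrix_ring_simps \<tau>_entry triangular_ops)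
qed

lemma \<tau>_mult:
  assumes "a \<in> carrier A" "b \<in> carrier A"
  shows "\<tau> (a \<otimes>\<^bsub>A\<^esub> b) = \<tau> a \<otimes>\<^bsub>Mat\<^esub> \<tau> b"
proof (rule matrix_eqI)
  show "\<tau> (a \<otimes>\<^bsub>A\<^esub> b) \<in> {..<n} \<times> {..<n} \<rightarrow>\<^sub>E carrier S"
    using \<tau>_closed[OF triangular_mult_closed[OF assms]] by (simp add: matrix_ring_simps)
  show "\<tau> a \<otimes>\<^bsub>Mat\<^esub> \<tau> b \<in> {..<n} \<times> {..<n} \<rightarrow>\<^sub>E carrier S"
    using Mat.m_closed[OF \<tau>_closed[OF assms(1)] \<tau>_closed[OF assms(2)]] unfolding matrix_ring_simps(1) .
  fix i j assume i: "i < n" and j: "j < n"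
  note c = \<tau>_entry_closed[OF assms(1)] \<tau>_entry_closed[OF assms(2)]
  consider "j < i" | "i = j" | "i < j" by linarith
  then show "\<tau> (a \<otimes>\<^bsub>A\<^esub> b) (i, j) = (\<tau> a \<otimes>\<^bsub>Mat\<^esub> \<tau> b) (i, j)"
  proof cases
    case 1
    then show ?thesis using i j by (simp add: matrix_ring_simps \<tau>_entry triangular_ops below_diag_def)
  next
    case 2
    have "finsum S (\<lambda>l. \<tau> a (i, l) \<otimes>\<^bsub>S\<^esub> \<tau> b (l, i)) {..<n} = \<tau> a (i, i) \<otimes>\<^bsub>S\<^esub> \<tau> b (i, i)"
    proof (rule S.finsum_delta[OF i])
      fix l assume l: "l < n" "l \<noteq> i"
      then have "\<tau> a (i, l) = \<zero>\<^bsub>S\<^esub> \<or> \<tau> b (l, i) = \<zero>\<^bsub>S\<^esub>" using i by (auto simp: \<tau>_entry)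
      then show "\<tau> a (i, l) \<otimes>\<^bsub>S\<^esub> \<tau> b (l, i) = \<zero>\<^bsub>S\<^esub>" using c(1)[OF i l(1)] c(2)[OF l(1) i] by auto
    qed (use c i in auto)
    then show ?thesis
      using i ring_hom_mult[OF hom_\<phi> triangular_fst[OF assms(1) i] triangular_fst[OF assms(2) i]]
      by (simp add: matrix_ring_simps mat_mult_entry 2[symmetric]) (simp add: \<tau>_entry triangular_ops)
  next
    case 3
    have "finsum S (\<lambda>l. \<tau> a (i, l) \<otimes>\<^bsub>S\<^esub> \<tau> b (l, j)) {..<n} = \<zero>\<^bsub>S\<^esub>"
    proof (rule S.add.finprod_one_eqI[folded finsum_def, simplified])
      fix l assume "l \<in> {..<n}"
      then have l: "l < n" by simp
      have "\<tau> a (i, l) = \<zero>\<^bsub>S\<^esub> \<or> \<tau> b (l, j) = \<zero>\<^bsub>S\<^esub>" using i j l 3 by (auto simp: \<tau>_entry)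
      then show "\<tau> a (i, l) \<otimes>\<^bsub>S\<^esub> \<tau> b (l, j) = \<zero>\<^bsub>S\<^esub>" using c(1)[OF i l] c(2)[OF l j] by auto
    qed
    then show ?thesis using i j 3 by (simp add: matrix_ring_simps mat_mult_entry) (simp add: \<tau>_entry)
  qed
qed

lemma \<tau>_one: "\<tau> \<one>\<^bsub>A\<^esub> = \<one>\<^bsub>Mat\<^esub>"
proof (rule matrix_eqI)
  show "\<tau> \<one>\<^bsub>A\<^esub> \<in> {..<n} \<times> {..<n} \<rightarrow>\<^sub>E carrier S"
    using \<tau>_closed[OF triangular_zero_one_closed(2)] by (simp add: matrix_ring_simps)
  show "\<one>\<^bsub>Mat\<^esub> \<in> {..<n} \<times> {..<n} \<rightarrow>\<^sub>E carrier S" using Mat.one_closed unfolding matrix_ring_simps(1) .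
  show "\<tau> \<one>\<^bsub>A\<^esub> (i, j) = \<one>\<^bsub>Mat\<^esub> (i, j)" if "i < n" "j < n" for i j
    using that by (simp add: matrix_ring_simps \<tau>_entry triangular_ops below_diag_def)
qed

lemma ring_triangular: "ring A"
proof (rule ringI)
  note cl = triangular_add_closed triangular_mult_closed triangular_zero_one_closed
  have fk: "fst a i \<in> carrier k" if "a \<in> carrier A" "i < n" for a i using triangular_fst that .
  show "abelian_group A"
  proof (rule abelian_groupI)
    show "x \<oplus>\<^bsub>A\<^esub> y \<oplus>\<^bsub>A\<^esub> z = x \<oplus>\<^bsub>A\<^esub> (y \<oplus>\<^bsub>A\<^esub> z)" if "x \<in> carrier A" "y \<in> carrier A" "z \<in> carrier A" for x y z
      by (rule triangular_eqI) (simp_all add: that cl triangular_ops fk k.a_assoc \<tau>_add \<tau>_closed Mat.a_assoc)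
    show "x \<oplus>\<^bsub>A\<^esub> y = y \<oplus>\<^bsub>A\<^esub> x" if "x \<in> carrier A" "y \<in> carrier A" for x y
      by (rule triangular_eqI) (simp_all add: that cl triangular_ops fk k.a_comm \<tau>_add \<tau>_closed Mat.a_comm)
    show "\<zero>\<^bsub>A\<^esub> \<oplus>\<^bsub>A\<^esub> x = x" if x: "x \<in> carrier A" for x
    proof (rule triangular_eqI)
      show "\<tau> (\<zero>\<^bsub>A\<^esub> \<oplus>\<^bsub>A\<^esub> x) (i, j) = \<tau> x (i, j)" if "j < i" "i < n" for i j
        using that triangular_snd[OF x, of "(i, j)"] by (simp add: \<tau>_entry triangular_ops below_diag_def)
    qed (simp_all add: x cl triangular_ops fk)
    show "\<exists>y\<in>carrier A. y \<oplus>\<^bsub>A\<^esub> x = \<zero>\<^bsub>A\<^esub>" if x: "x \<in> carrier A" for x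
    proof
      let ?y = "(\<lambda>i\<in>{..<n}. \<ominus>\<^bsub>k\<^esub> fst x i, \<lambda>p\<in>below_diag n. \<ominus>\<^bsub>S\<^esub> snd x p)"
      show y: "?y \<in> carrier A" using x by (auto simp: triangular_carrier PiE_iff)
      show "?y \<oplus>\<^bsub>A\<^esub> x = \<zero>\<^bsub>A\<^esub>"
      proof (rule triangular_eqI)
        show "\<tau> (?y \<oplus>\<^bsub>A\<^esub> x) (i, j) = \<tau> \<zero>\<^bsub>A\<^esub> (i, j)" if "j < i" "i < n" for i j
          using that triangular_snd[OF x, of "(i, j)"] by (simp add: \<tau>_entry triangular_ops below_diag_def S.l_neg)
      qed (simp_all add: x y cl triangular_ops fk k.l_neg)
    qed
  qed (simp_all add: cl)
  show "monoid A"
  proof (rule monoidI)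
    show "x \<otimes>\<^bsub>A\<^esub> y \<otimes>\<^bsub>A\<^esub> z = x \<otimes>\<^bsub>A\<^esub> (y \<otimes>\<^bsub>A\<^esub> z)" if "x \<in> carrier A" "y \<in> carrier A" "z \<in> carrier A" for x y z
      by (rule triangular_eqI) (simp_all add: that cl triangular_ops fk k.m_assoc \<tau>_mult \<tau>_closed Mat.m_assoc)
    show "\<one>\<^bsub>A\<^esub> \<otimes>\<^bsub>A\<^esub> x = x" "x \<otimes>\<^bsub>A\<^esub> \<one>\<^bsub>A\<^esub> = x" if "x \<in> carrier A" for x
      by (rule triangular_eqI; simp add: that cl triangular_ops fk \<tau>_mult \<tau>_one \<tau>_closed)+
  qed (simp_all add: cl)
  show "(x \<oplus>\<^bsub>A\<^esub> y) \<otimes>\<^bsub>A\<^esub> z = x \<otimes>\<^bsub>A\<^esub> z \<oplus>\<^bsub>A\<^esub> y \<otimes>\<^bsub>A\<^esub> z" if "x \<in> carrier A" "y \<in> carrier A" "z \<in> carrier A" for x y z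
    by (rule triangular_eqI) (simp_all add: that cl triangular_ops fk k.l_distr \<tau>_mult \<tau>_add \<tau>_closed Mat.l_distr)
  show "z \<otimes>\<^bsub>A\<^esub> (x \<oplus>\<^bsub>A\<^esub> y) = z \<otimes>\<^bsub>A\<^esub> x \<oplus>\<^bsub>A\<^esub> z \<otimes>\<^bsub>A\<^esub> y" if "x \<in> carrier A" "y \<in> carrier A" "z \<in> carrier A" for x y z
    by (rule triangular_eqI) (simp_all add: that cl triangular_ops fk k.r_distr \<tau>_mult \<tau>_add \<tau>_closed Mat.r_distr)
qed

sublocale A: ring "triangular_ring k S \<phi> n" by (rule ring_triangular)

lemma \<tau>_ring_hom: "\<tau> \<in> ring_hom A Mat"
  by (rule ring_hom_memI) (simp_all add: \<tau>_closed \<tau>_add \<tau>_mult \<tau>_one)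

lemma \<tau>_mult_entry:
  assumes "a \<in> carrier A" "b \<in> carrier A" "i < n" "j < n"
  shows "\<tau> (a \<otimes>\<^bsub>A\<^esub> b) (i, j) = finsum S (\<lambda>l. \<tau> a (i, l) \<otimes>\<^bsub>S\<^esub> \<tau> b (l, j)) {..<n}"
  using assms by (simp add: \<tau>_mult matrix_ring_simps mat_mult_entry)

lemma \<tau>_add_entry:
  assumes "a \<in> carrier A" "b \<in> carrier A" "i < n" "j < n"
  shows "\<tau> (a \<oplus>\<^bsub>A\<^esub> b) (i, j) = \<tau> a (i, j) \<oplus>\<^bsub>S\<^esub> \<tau> b (i, j)"
  using assms by (simp add: \<tau>_add matrix_ring_simps)

text \<open>
  Right multiplication by the first kind of elements makes \<open>A\<close> a right \<open>k\<close>-module; elements of the other two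
  kinds generate \<open>A\<close> additively.
\<close>

definition scalar :: "'k \<Rightarrow> ('k, 's) triangular_matrix" where
  "scalar c = (\<lambda>i\<in>{..<n}. c, \<lambda>p\<in>below_diag n. \<zero>\<^bsub>S\<^esub>)"

definition diag_unit :: "nat \<Rightarrow> 'k \<Rightarrow> ('k, 's) triangular_matrix" where
  "diag_unit j c = (\<lambda>i\<in>{..<n}. if i = j then c else \<zero>\<^bsub>k\<^esub>, \<lambda>p\<in>below_diag n. \<zero>\<^bsub>S\<^esub>)"

definition lower_unit :: "nat \<Rightarrow> nat \<Rightarrow> 's \<Rightarrow> ('k, 's) triangular_matrix" where
  "lower_unit i j s = (\<lambda>l\<in>{..<n}. \<zero>\<^bsub>k\<^esub>, \<lambda>p\<in>below_diag n. if p = (i, j) then s else \<zero>\<^bsub>S\<^esub>)"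

lemma scalar_closed: "c \<in> carrier k \<Longrightarrow> scalar c \<in> carrier A"
  and diag_unit_closed: "c \<in> carrier k \<Longrightarrow> diag_unit j c \<in> carrier A"
  and lower_unit_closed: "s \<in> carrier S \<Longrightarrow> lower_unit i j s \<in> carrier A"
  unfolding triangular_carrier by (auto simp: scalar_def diag_unit_def lower_unit_def)

lemma fst_units:
  "p < n \<Longrightarrow> fst (scalar c) p = c"
  "p < n \<Longrightarrow> fst (diag_unit j c) p = (if p = j then c else \<zero>\<^bsub>k\<^esub>)"
  "p < n \<Longrightarrow> fst (lower_unit i j s) p = \<zero>\<^bsub>k\<^esub>"
  by (simp_all add: scalar_def diag_unit_def lower_unit_def)

lemma \<tau>_units:
  assumes "p < n" "q < n"
  shows "\<tau> (scalar c) (p, q) = (if p = q then \<phi> c else \<zero>\<^bsub>S\<^esub>)"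
    and "\<tau> (diag_unit j c) (p, q) = (if p = j \<and> q = j then \<phi> c else \<zero>\<^bsub>S\<^esub>)"
    and "j < i \<Longrightarrow> \<tau> (lower_unit i j s) (p, q) = (if p = i \<and> q = j then s else \<zero>\<^bsub>S\<^esub>)"
  using assms by (auto simp: \<tau>_entry scalar_def diag_unit_def lower_unit_def below_diag_def)

lemma scalar_ring_hom: "scalar \<in> ring_hom k A"
proof (rule ring_hom_memI)
  fix c d assume c: "c \<in> carrier k" and d: "d \<in> carrier k"
  show "scalar c \<in> carrier A" by (rule scalar_closed[OF c])
  show "scalar (c \<oplus>\<^bsub>k\<^esub> d) = scalar c \<oplus>\<^bsub>A\<^esub> scalar d"
    by (rule triangular_eqI) (simp_all add: c d scalar_closed triangular_ops fst_units \<tau>_add_entry \<tau>_units)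
  show "scalar (c \<otimes>\<^bsub>k\<^esub> d) = scalar c \<otimes>\<^bsub>A\<^esub> scalar d"
  proof (rule triangular_eqI)
    fix i j assume ij: "j < i" "i < n"
    then have j: "j < n" by simp
    have "finsum S (\<lambda>l. \<tau> (scalar c) (i, l) \<otimes>\<^bsub>S\<^esub> \<tau> (scalar d) (l, j)) {..<n} =
        \<tau> (scalar c) (i, j) \<otimes>\<^bsub>S\<^esub> \<tau> (scalar d) (j, j)"
      by (rule S.finsum_delta[OF j]) (use ij j c d in \<open>simp_all add: \<tau>_units\<close>)
    then show "\<tau> (scalar (c \<otimes>\<^bsub>k\<^esub> d)) (i, j) = \<tau> (scalar c \<otimes>\<^bsub>A\<^esub> scalar d) (i, j)"
      using ij j c d by (simp add: \<tau>_mult_entry scalar_closed) (simp add: \<tau>_units)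
  qed (simp_all add: c d scalar_closed triangular_ops fst_units)
next
  show "scalar \<one>\<^bsub>k\<^esub> = \<one>\<^bsub>A\<^esub>"
    by (rule triangular_eqI) (simp_all add: scalar_closed triangular_ops fst_units \<tau>_units \<tau>_one matrix_ring_simps)
qed

lemma \<tau>_mult_scalar:
  assumes a: "a \<in> carrier A" and c: "c \<in> carrier k" and i: "i < n" and j: "j < n"
  shows "\<tau> (a \<otimes>\<^bsub>A\<^esub> scalar c) (i, j) = \<tau> a (i, j) \<otimes>\<^bsub>S\<^esub> \<phi> c"
proof -
  have "finsum S (\<lambda>l. \<tau> a (i, l) \<otimes>\<^bsub>S\<^esub> \<tau> (scalar c) (l, j)) {..<n} = \<tau> a (i, j) \<otimes>\<^bsub>S\<^esub> \<tau> (scalar c) (j, j)"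
    by (rule S.finsum_delta[OF j]) (use i j c \<tau>_entry_closed[OF a] in \<open>simp_all add: \<tau>_units\<close>)
  then show ?thesis using i j a c by (simp add: \<tau>_mult_entry scalar_closed \<tau>_units)
qed

lemma \<tau>_mult_diag_unit:
  assumes a: "a \<in> carrier A" and c: "c \<in> carrier k" and i: "i < n" and l: "l < n" and j: "j < n"
  shows "\<tau> (a \<otimes>\<^bsub>A\<^esub> diag_unit j c) (i, l) = (if l = j then \<tau> a (i, j) \<otimes>\<^bsub>S\<^esub> \<phi> c else \<zero>\<^bsub>S\<^esub>)"
proof -
  have "finsum S (\<lambda>m. \<tau> a (i, m) \<otimes>\<^bsub>S\<^esub> \<tau> (diag_unit j c) (m, l)) {..<n} = \<tau> a (i, j) \<otimes>\<^bsub>S\<^esub> \<tau> (diag_unit j c) (j, l)"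
    by (rule S.finsum_delta[OF j]) (use i j l c \<tau>_entry_closed[OF a] in \<open>simp_all add: \<tau>_units\<close>)
  then show ?thesis using i j l a c \<tau>_entry_closed[OF a] by (simp add: \<tau>_mult_entry diag_unit_closed \<tau>_units)
qed

section \<open>The column ideals of the triangular ring\<close>

definition column_ideal :: "nat \<Rightarrow> (('k, 's) triangular_matrix, ('k, 's) triangular_matrix) rmodule" where
  "column_ideal j = idempotent_ideal A (diag_unit j \<one>\<^bsub>k\<^esub>)"

text \<open>
  This is the right \<open>k\<close>-module structure that turns the column ideal into a bimodule.
\<close>

definition column_ideal_right :: "nat \<Rightarrow> ('k, ('k, 's) triangular_matrix) rmodule" where
  "column_ideal_right j = with_act (column_ideal j) (\<lambda>c a. a \<otimes>\<^bsub>A\<^esub> scalar c)"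

lemma column_ideal_carrier:
  assumes j: "j < n"
  shows "a \<in> carrier (column_ideal j) \<longleftrightarrow> a \<in> carrier A \<and>
    (\<forall>i<n. i \<noteq> j \<longrightarrow> fst a i = \<zero>\<^bsub>k\<^esub>) \<and> (\<forall>i l. l < i \<longrightarrow> i < n \<longrightarrow> l \<noteq> j \<longrightarrow> \<tau> a (i, l) = \<zero>\<^bsub>S\<^esub>)"
proof (cases "a \<in> carrier A")
  case a: True
  let ?e = "diag_unit j \<one>\<^bsub>k\<^esub>"
  have f: "fst (a \<otimes>\<^bsub>A\<^esub> ?e) i = (if i = j then fst a i else \<zero>\<^bsub>k\<^esub>)" if "i < n" for i
    using triangular_fst[OF a that] that by (auto simp: triangular_ops fst_units)
  have t: "\<tau> (a \<otimes>\<^bsub>A\<^esub> ?e) (i, l) = (if l = j then \<tau> a (i, l) else \<zero>\<^bsub>S\<^esub>)" if "i < n" "l < n" for i l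
    using \<tau>_entry_closed[OF a that] that j by (auto simp: \<tau>_mult_diag_unit[OF a])
  have "a \<otimes>\<^bsub>A\<^esub> ?e = a \<longleftrightarrow>
    (\<forall>i<n. i \<noteq> j \<longrightarrow> fst a i = \<zero>\<^bsub>k\<^esub>) \<and> (\<forall>i l. l < i \<longrightarrow> i < n \<longrightarrow> l \<noteq> j \<longrightarrow> \<tau> a (i, l) = \<zero>\<^bsub>S\<^esub>)" (is "_ \<longleftrightarrow> ?R")
  proof
    assume eq: "a \<otimes>\<^bsub>A\<^esub> ?e = a"
    show ?R
    proof (intro conjI allI impI)
      show "fst a i = \<zero>\<^bsub>k\<^esub>" if "i < n" "i \<noteq> j" for i using f[of i] that unfolding eq by simp
      show "\<tau> a (i, l) = \<zero>\<^bsub>S\<^esub>" if "l < i" "i < n" "l \<noteq> j" for i l using t[of i l] that unfolding eq by simp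
    qed
  next
    assume R: ?R
    show "a \<otimes>\<^bsub>A\<^esub> ?e = a"
    proof (rule triangular_eqI)
      show "fst (a \<otimes>\<^bsub>A\<^esub> ?e) i = fst a i" if "i < n" for i using f[OF that] R that by simp
      show "\<tau> (a \<otimes>\<^bsub>A\<^esub> ?e) (i, l) = \<tau> a (i, l)" if "l < i" "i < n" for i l using t[of i l] R that by simp
    qed (simp_all add: a diag_unit_closed)
  qed
  then show ?thesis using a by (simp add: column_ideal_def idempotent_ideal_def)
qed (simp add: column_ideal_def idempotent_ideal_def)

lemma column_ideal_simps [simp]:
  "monoid.mult (column_ideal j) = (\<oplus>\<^bsub>A\<^esub>)" "one (column_ideal j) = \<zero>\<^bsub>A\<^esub>" "act (column_ideal j) a b = a \<otimes>\<^bsub>A\<^esub> b"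
  by (simp_all add: column_ideal_def idempotent_ideal_def left_regular_def)

lemma column_ideal_closed: "a \<in> carrier (column_ideal j) \<Longrightarrow> a \<in> carrier A"
  by (simp add: column_ideal_def idempotent_ideal_def)

lemma diag_unit_idempotent:
  assumes j: "j < n" shows "diag_unit j \<one>\<^bsub>k\<^esub> \<otimes>\<^bsub>A\<^esub> diag_unit j \<one>\<^bsub>k\<^esub> = diag_unit j \<one>\<^bsub>k\<^esub>"
proof (rule triangular_eqI)
  fix i l assume "l < i" "i < n"
  then show "\<tau> (diag_unit j \<one>\<^bsub>k\<^esub> \<otimes>\<^bsub>A\<^esub> diag_unit j \<one>\<^bsub>k\<^esub>) (i, l) = \<tau> (diag_unit j \<one>\<^bsub>k\<^esub>) (i, l)"
    using j \<tau>_mult_diag_unit[OF diag_unit_closed[OF k.one_closed] k.one_closed, of i l j j] by (simp add: \<tau>_units)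
qed (simp_all add: diag_unit_closed triangular_ops fst_units)

lemma column_ideal_flat: "j < n \<Longrightarrow> flat_left_module A (column_ideal j)"
  unfolding column_ideal_def
  by (intro idempotent_ideal_flat ring_triangular diag_unit_closed diag_unit_idempotent) simp_all

lemma column_ideal_bimodule:
  assumes j: "j < n"
  shows "bimodule A k (column_ideal j) (column_ideal_right j)"
proof -
  have L: "left_module A (column_ideal j)" using column_ideal_flat[OF j] by (simp add: flat_left_module_def)
  have cl: "a \<otimes>\<^bsub>A\<^esub> scalar c \<in> carrier (column_ideal j)" if a: "a \<in> carrier (column_ideal j)" and c: "c \<in> carrier k" for a c
  proof -
    note aA = column_ideal_closed[OF a]
    have "fst (a \<otimes>\<^bsub>A\<^esub> scalar c) i = \<zero>\<^bsub>k\<^esub>" if "i < n" "i \<noteq> j" for i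
      using a that c unfolding column_ideal_carrier[OF j] by (simp add: triangular_ops fst_units)
    moreover have "\<tau> (a \<otimes>\<^bsub>A\<^esub> scalar c) (i, l) = \<zero>\<^bsub>S\<^esub>" if "l < i" "i < n" "l \<noteq> j" for i l
      using a that c \<tau>_mult_scalar[OF aA c, of i l] unfolding column_ideal_carrier[OF j] by simp
    ultimately show ?thesis unfolding column_ideal_carrier[OF j] using aA c by (simp add: scalar_closed)
  qed
  note sc = scalar_closed ring_hom_add[OF scalar_ring_hom] ring_hom_mult[OF scalar_ring_hom] ring_hom_one[OF scalar_ring_hom]
  have R: "right_module k (column_ideal_right j)"
    unfolding right_module_def column_ideal_right_def
    using comm_group_with_act[OF left_module_group[OF L]] ring_k
    by (simp add: cl column_ideal_closed sc A.l_distr A.r_distr A.m_assoc)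
  show ?thesis
    unfolding bimodule_def using L R
    by (simp add: column_ideal_right_def column_ideal_closed sc A.m_assoc)
qed

end

section \<open>The kernel of the multiplication map\<close>

context triangular
begin

abbreviation "Sr \<equiv> restrict_scalars \<phi> (right_regular S)"
abbreviation Lk :: "('s, 'l) rmodule \<Rightarrow> ('k, 'l) rmodule" where "Lk L \<equiv> restrict_scalars \<phi> L"
abbreviation ind :: "('s, 'l) rmodule \<Rightarrow> ('s, ('s \<times> 'l \<Rightarrow>\<^sub>0 int) set) rmodule" where "ind L \<equiv> induced k S \<phi> L"
abbreviation mul :: "('s, 'l) rmodule \<Rightarrow> ('s \<times> 'l \<Rightarrow>\<^sub>0 int) set \<Rightarrow> 'l" where "mul L \<equiv> tensor_lift L (act L)"
abbreviation tens :: "('s, 'l) rmodule \<Rightarrow> 's \<Rightarrow> 'l \<Rightarrow> ('s \<times> 'l \<Rightarrow>\<^sub>0 int) set" where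
  "tens L \<equiv> pure_tensor k Sr (Lk L)"

lemma Sr_module: "right_module k Sr"
  by (rule right_module_restrict[OF ring_k hom_\<phi> right_module_regular[OF ring_S]])

lemma Lk_module: "left_module S L \<Longrightarrow> left_module k (Lk L)"
  by (rule left_module_restrict[OF ring_k hom_\<phi>])

lemma Sr_simps [simp]:
  "carrier (right_regular S) = carrier S" "monoid.mult (right_regular S) = (\<oplus>\<^bsub>S\<^esub>)"
  "one (right_regular S) = \<zero>\<^bsub>S\<^esub>" "act (right_regular S) a x = x \<otimes>\<^bsub>S\<^esub> a"
  "carrier (left_regular S) = carrier S" "monoid.mult (left_regular S) = (\<oplus>\<^bsub>S\<^esub>)"
  "one (left_regular S) = \<zero>\<^bsub>S\<^esub>" "act (left_regular S) a x = a \<otimes>\<^bsub>S\<^esub> x"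
  by (simp_all add: right_regular_def left_regular_def)

lemma S_bimodule: "bimodule S k (left_regular S) Sr" "bimodule k k (restrict_scalars \<phi> (left_regular S)) Sr"
  unfolding bimodule_def
  using Sr_module left_module_regular[OF ring_S] left_module_restrict[OF ring_k hom_\<phi> left_module_regular[OF ring_S]]
  by (simp_all add: S.m_assoc)

lemma induced_eq: "ind L = bimodule_tensor k (left_regular S) Sr (Lk L)"
  by (simp add: induced_def bimodule_tensor_def left_regular_def Let_def)

lemma restrict_induced_eq: "Lk (ind L) = bimodule_tensor k (restrict_scalars \<phi> (left_regular S)) Sr (Lk L)"
proof -
  have "restrict_scalars \<phi> (with_act G f) = with_act G (\<lambda>a. f (\<phi> a))" for G :: "'g monoid" and f
    by (simp add: restrict_scalars_def with_act_def)
  then show ?thesis unfolding induced_eq bimodule_tensor_def by simp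
qed

lemma ind_simps [simp]:
  "carrier (ind L) = carrier (tensor k Sr (Lk L))" "monoid.mult (ind L) = monoid.mult (tensor k Sr (Lk L))"
  "one (ind L) = one (tensor k Sr (Lk L))"
  by (simp_all add: induced_eq)

lemma ind_hom [simp]: "hom (ind L) G = hom (tensor k Sr (Lk L)) G" "hom G (ind L) = hom G (tensor k Sr (Lk L))"
  by (simp_all add: hom_def)

abbreviation "flat_base \<equiv> flat_left_module k (restrict_scalars \<phi> (left_regular S))"

context
  fixes L :: "('s, 'l) rmodule"
  assumes L: "left_module S L"
begin

lemma ind_module: "left_module S (ind L)"
  unfolding induced_eq by (rule left_module_bimodule_tensor[OF S_bimodule(1) Lk_module[OF L]])

lemma ind_act_pure:
  assumes "s \<in> carrier S" "t \<in> carrier S" "x \<in> carrier L"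
  shows "act (ind L) s (tens L t x) = tens L (s \<otimes>\<^bsub>S\<^esub> t) x"
  using bimodule_tensor_act_pure[OF S_bimodule(1) Lk_module[OF L] assms(1), of t x] assms(2,3)
  by (simp add: induced_eq)

lemma tens_closed: "s \<in> carrier S \<Longrightarrow> x \<in> carrier L \<Longrightarrow> tens L s x \<in> carrier (ind L)"
  using pure_tensor_closed[OF Sr_module Lk_module[OF L], of s x] by simp

lemma tens_scalar:
  assumes "s \<in> carrier S" "c \<in> carrier k" "x \<in> carrier L"
  shows "tens L (s \<otimes>\<^bsub>S\<^esub> \<phi> c) x = tens L s (act L (\<phi> c) x)"
  using pure_tensor_act[OF Sr_module Lk_module[OF L] assms(2), of s x] assms(1,3) by simp

lemma mul_balanced: "balanced k Sr (Lk L) L (act L)"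
  by (rule balancedI) (simp_all add: left_moduleD[OF L])

lemma mul_pure: "s \<in> carrier S \<Longrightarrow> x \<in> carrier L \<Longrightarrow> mul L (tens L s x) = act L s x"
  by (rule tensor_lift_pure[OF Sr_module Lk_module[OF L] left_module_group[OF L] mul_balanced]) simp_all

lemma mul_hom: "mul L \<in> module_hom S (ind L) L"
proof (rule module_homI)
  have h: "mul L \<in> hom (tensor k Sr (Lk L)) L"
    by (rule tensor_lift_hom[OF Sr_module Lk_module[OF L] left_module_group[OF L] mul_balanced])
  show "mul L t \<in> carrier L" if "t \<in> carrier (ind L)" for t using hom_in_carrier[OF h] that by simp
  show "mul L (t \<otimes>\<^bsub>ind L\<^esub> u) = mul L t \<otimes>\<^bsub>L\<^esub> mul L u" if "t \<in> carrier (ind L)" "u \<in> carrier (ind L)" for t u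
    using hom_mult[OF h] that by simp
  fix s t assume s: "s \<in> carrier S" and t: "t \<in> carrier (ind L)"
  show "mul L (act (ind L) s t) = act L s (mul L t)"
  proof (rule tensor_hom_eqI[OF Sr_module Lk_module[OF L] left_module_group[OF L]])
    show "t \<in> carrier (tensor k Sr (Lk L))" using t by simp
    show "(\<lambda>t. mul L (act (ind L) s t)) \<in> hom (tensor k Sr (Lk L)) L"
      using hom_compose[OF left_module_hom_action[OF ind_module s, simplified] h] by (simp add: comp_def)
    show "(\<lambda>t. act L s (mul L t)) \<in> hom (tensor k Sr (Lk L)) L"
      using hom_compose[OF h left_module_hom_action[OF L s]] by (simp add: comp_def)
    show "mul L (act (ind L) s (tens L u x)) = act L s (mul L (tens L u x))" if "u \<in> carrier Sr" "x \<in> carrier (Lk L)" for u x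
      using that s by (simp add: ind_act_pure mul_pure left_module_assoc[OF L])
  qed
qed

lemma unit_hom: "tens L \<one>\<^bsub>S\<^esub> \<in> module_hom k (Lk L) (Lk (ind L))"
proof (rule module_homI)
  show "tens L \<one>\<^bsub>S\<^esub> x \<in> carrier (Lk (ind L))" if "x \<in> carrier (Lk L)" for x using that tens_closed by simp
  show "tens L \<one>\<^bsub>S\<^esub> (x \<otimes>\<^bsub>Lk L\<^esub> y) = tens L \<one>\<^bsub>S\<^esub> x \<otimes>\<^bsub>Lk (ind L)\<^esub> tens L \<one>\<^bsub>S\<^esub> y"
    if "x \<in> carrier (Lk L)" "y \<in> carrier (Lk L)" for x y
    using pure_tensor_mult_right[OF Sr_module Lk_module[OF L], of "\<one>\<^bsub>S\<^esub>" x y] that by simp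
  show "tens L \<one>\<^bsub>S\<^esub> (act (Lk L) c x) = act (Lk (ind L)) c (tens L \<one>\<^bsub>S\<^esub> x)" if "c \<in> carrier k" "x \<in> carrier (Lk L)" for c x
    using tens_scalar[of "\<one>\<^bsub>S\<^esub>" c x] that by (simp add: ind_act_pure)
qed

lemma mul_unit: "x \<in> carrier L \<Longrightarrow> mul L (tens L \<one>\<^bsub>S\<^esub> x) = x"
  by (simp add: mul_pure left_module_one[OF L])

lemma flat_induced:
  assumes "flat_base" "flat_left_module k (Lk L)"
  shows "flat_left_module k (Lk (ind L))"
  unfolding restrict_induced_eq by (rule flat_bimodule_tensor[OF S_bimodule(2) Lk_module[OF L] assms])

text \<open>
  Over \<open>k\<close> the multiplication map has the section \<open>x \<mapsto> 1 \<otimes> x\<close>, so its kernel is a direct summand of the induced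
  module.
\<close>

lemma flat_mult_kernel:
  assumes fl: "flat_base" "flat_left_module k (Lk L)"
    and L': "left_module S L'" and se: "short_exact S L' (ind L) L \<rho> (mul L)"
  shows "flat_left_module k (Lk L')"
proof -
  note s = short_exactD[OF se]
  interpret I: comm_group "ind L" by (rule left_module_group[OF ind_module])
  interpret Lg: comm_group L by (rule left_module_group[OF L])
  let ?K = "(ind L)\<lparr>carrier := kernel (ind L) L (mul L)\<rparr>"
  let ?q = "\<lambda>t. t \<otimes>\<^bsub>ind L\<^esub> inv\<^bsub>ind L\<^esub> tens L \<one>\<^bsub>S\<^esub> (mul L t)"
  let ?p = "\<lambda>t. inv_into (carrier L') \<rho> (?q t)"
  \<comment> \<open>\<open>?q\<close> is the projection to the kernel that belongs to the section\<close>
  interpret mulh: group_hom "ind L" L "mul L"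
    by (rule comm_group_homI[OF I.comm_group_axioms Lg.comm_group_axioms module_hom_hom[OF mul_hom]])
  have uc: "tens L \<one>\<^bsub>S\<^esub> x \<in> carrier (ind L)" if "x \<in> carrier L" for x using tens_closed that by blast
  have qc: "?q t \<in> kernel (ind L) L (mul L)" if t: "t \<in> carrier (ind L)" for t
  proof -
    have m: "mul L t \<in> carrier L" using mulh.hom_closed[OF t] .
    have "mul L (?q t) = mul L t \<otimes>\<^bsub>L\<^esub> inv\<^bsub>L\<^esub> mul L (tens L \<one>\<^bsub>S\<^esub> (mul L t))"
      using mulh.hom_mult[OF t I.inv_closed[OF uc[OF m]]] mulh.hom_inv[OF uc[OF m]] by simp
    also have "\<dots> = \<one>\<^bsub>L\<^esub>" unfolding mul_unit[OF m] by (rule Lg.r_inv[OF m])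
    finally have "mul L (?q t) = \<one>\<^bsub>L\<^esub>" .
    moreover have "?q t \<in> carrier (ind L)" by (rule I.m_closed[OF t I.inv_closed[OF uc[OF m]]])
    ultimately show ?thesis unfolding kernel_def by blast
  qed
  have hK: "\<rho> \<in> module_hom S L' ?K"
  proof (rule module_homI)
    show "\<rho> x \<in> carrier ?K" if "x \<in> carrier L'" for x
      using imageI[OF that, of \<rho>] unfolding s(5) by simp
  qed (simp_all add: module_hom_mult[OF s(1)] module_hom_act[OF s(1)])
  have bij: "bij_betw \<rho> (carrier L') (carrier ?K)" using s(2,5) by (simp add: bij_betw_def)
  interpret L'g: comm_group L' by (rule left_module_group[OF L'])
  have inv: "inv_into (carrier L') \<rho> \<in> module_hom S ?K L'"
    by (rule module_hom_inv_into[OF hK bij L'g.monoid_axioms left_module_closed[OF L']])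
  have q: "?q \<in> module_hom k (Lk (ind L)) (Lk ?K)"
  proof (rule module_homI)
    show "?q t \<in> carrier (Lk ?K)" if "t \<in> carrier (Lk (ind L))" for t
      using qc[of t] that by simp
    show "?q (t \<otimes>\<^bsub>Lk (ind L)\<^esub> u) = ?q t \<otimes>\<^bsub>Lk ?K\<^esub> ?q u" if "t \<in> carrier (Lk (ind L))" "u \<in> carrier (Lk (ind L))" for t u
    proof -
      have t: "t \<in> carrier (ind L)" and u: "u \<in> carrier (ind L)" using that by simp_all
      note mt = mulh.hom_closed[OF t] and mu = mulh.hom_closed[OF u]
      have 1: "tens L \<one>\<^bsub>S\<^esub> (mul L (t \<otimes>\<^bsub>ind L\<^esub> u)) = tens L \<one>\<^bsub>S\<^esub> (mul L t) \<otimes>\<^bsub>ind L\<^esub> tens L \<one>\<^bsub>S\<^esub> (mul L u)"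
        unfolding mulh.hom_mult[OF t u] using module_hom_mult[OF unit_hom, of "mul L t" "mul L u"] mt mu by simp
      have "?q (t \<otimes>\<^bsub>ind L\<^esub> u) = ?q t \<otimes>\<^bsub>ind L\<^esub> ?q u"
        unfolding 1 I.inv_mult[OF uc[OF mt] uc[OF mu]]
        by (simp only: I.m_ac t u I.inv_closed uc[OF mt] uc[OF mu] I.m_closed)
      then show ?thesis by simp
    qed
    show "?q (act (Lk (ind L)) c t) = act (Lk ?K) c (?q t)" if c: "c \<in> carrier k" and "t \<in> carrier (Lk (ind L))" for c t
    proof -
      have t: "t \<in> carrier (ind L)" using that by simp
      note mt = mulh.hom_closed[OF t]
      have fc: "\<phi> c \<in> carrier S" using c by simp
      have 1: "tens L \<one>\<^bsub>S\<^esub> (mul L (act (ind L) (\<phi> c) t)) = act (ind L) (\<phi> c) (tens L \<one>\<^bsub>S\<^esub> (mul L t))"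
        unfolding module_hom_act[OF mul_hom fc t] using module_hom_act[OF unit_hom c, of "mul L t"] mt by simp
      interpret ah: group_hom "ind L" "ind L" "act (ind L) (\<phi> c)"
        by (rule comm_group_homI[OF I.comm_group_axioms I.comm_group_axioms left_module_hom_action[OF ind_module fc]])
      have "?q (act (ind L) (\<phi> c) t) = act (ind L) (\<phi> c) (?q t)"
        unfolding 1 ah.hom_mult[OF t I.inv_closed[OF uc[OF mt]]] ah.hom_inv[OF uc[OF mt]] ..
      then show ?thesis by simp
    qed
  qed
  have p: "?p \<in> module_hom k (Lk (ind L)) (Lk L')"
    by (rule module_hom_comp[OF q module_hom_restrict[OF hom_\<phi> inv]])
  have "?p (\<rho> x) = x" if x: "x \<in> carrier L'" for x
  proof -
    have r: "\<rho> x \<in> carrier (ind L)" by (rule module_hom_closed[OF s(1) x])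
    have "mul L (\<rho> x) = \<one>\<^bsub>L\<^esub>" by (rule short_exact_comp_one[OF se x])
    then have "?q (\<rho> x) = \<rho> x \<otimes>\<^bsub>ind L\<^esub> inv\<^bsub>ind L\<^esub> tens L \<one>\<^bsub>S\<^esub> \<one>\<^bsub>L\<^esub>" by simp
    also have "tens L \<one>\<^bsub>S\<^esub> \<one>\<^bsub>L\<^esub> = \<one>\<^bsub>ind L\<^esub>"
      using pure_tensor_one_right[OF Sr_module Lk_module[OF L], of "\<one>\<^bsub>S\<^esub>"] by simp
    finally have "?q (\<rho> x) = \<rho> x" using r by (simp del: ind_simps)
    then show ?thesis using inv_into_f_f[OF s(2) x] by simp
  qed
  then show ?thesis
    by (intro flat_retract[OF flat_induced[OF fl] Lk_module[OF L'] module_hom_restrict[OF hom_\<phi> s(1)] p]) simp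
qed

end

text \<open>
  The code of a coset determines one of its elements, and distinct cosets are disjoint.
\<close>

lemma inj_on_encode_coset:
  fixes L :: "('s, ('l, 's \<times> int) formal) rmodule"
  assumes L: "left_module S L"
  shows "inj_on encode_coset (carrier (ind L))"
proof (rule inj_onI)
  let ?G = "tensor_generators Sr (Lk L)" and ?U = "tensor_subgroup k Sr (Lk L)"
  fix C D assume C: "C \<in> carrier (ind L)" and D: "D \<in> carrier (ind L)" and eq: "encode_coset C = encode_coset D"
  interpret U: subgroup ?U ?G by (rule subgroup_tensor_subgroup[OF Sr_module Lk_module[OF L]])
  interpret G: group ?G by simp
  have rc: "C \<in> rcosets\<^bsub>?G\<^esub> ?U" if "C \<in> carrier (ind L)" for C
    using that by (simp add: tensor_def FactGroup_def)
  have ne: "C \<noteq> {}" if "C \<in> carrier (ind L)" for C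
    by (rule U.rcosets_non_empty[OF rc[OF that]])
  define p where "p = (SOME p. p \<in> C)"
  define q where "q = (SOME p. p \<in> D)"
  have pC: "p \<in> C" unfolding p_def using ne[OF C] by (simp add: some_in_eq)
  have qD: "q \<in> D" unfolding q_def using ne[OF D] by (simp add: some_in_eq)
  let ?g = "\<lambda>r :: 's \<times> ('l, 's \<times> int) formal \<Rightarrow>\<^sub>0 int. (\<lambda>(s, x). (x, (s, Poly_Mapping.lookup r (s, x)))) ` Poly_Mapping.keys r"
  have gr: "?g p = ?g q"
    using eq by (simp add: encode_coset_def Let_def p_def[symmetric] q_def[symmetric] Abs_fset_inject)
  have mem: "(x, (s, c)) \<in> ?g r \<longleftrightarrow> c \<noteq> 0 \<and> Poly_Mapping.lookup r (s, x) = c" for r s x c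
  proof
    assume "(x, (s, c)) \<in> ?g r"
    then show "c \<noteq> 0 \<and> Poly_Mapping.lookup r (s, x) = c" by (auto simp: in_keys_iff)
  next
    assume "c \<noteq> 0 \<and> Poly_Mapping.lookup r (s, x) = c"
    then show "(x, (s, c)) \<in> ?g r" by (intro image_eqI[of _ _ "(s, x)"]) (auto simp: in_keys_iff)
  qed
  have "Poly_Mapping.lookup p (s, x) = Poly_Mapping.lookup q (s, x)" for s x
  proof -
    have iff: "c \<noteq> 0 \<and> Poly_Mapping.lookup p (s, x) = c \<longleftrightarrow> c \<noteq> 0 \<and> Poly_Mapping.lookup q (s, x) = c" for c
      unfolding mem[symmetric] gr ..
    show ?thesis
      using iff[of "Poly_Mapping.lookup p (s, x)"] iff[of "Poly_Mapping.lookup q (s, x)"]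
      by (cases "Poly_Mapping.lookup p (s, x) = 0"; cases "Poly_Mapping.lookup q (s, x) = 0") simp_all
  qed
  then have pq: "p = q" by (intro poly_mapping_eqI) (simp only: split_paired_all)
  show "C = D"
  proof (rule ccontr)
    assume "C \<noteq> D"
    then have "disjnt C D" by (rule pairwiseD[OF G.rcos_disjoint[OF U.subgroup_axioms] rc[OF C] rc[OF D]])
    then show False using pC qD[folded pq] by (simp only: disjnt_iff) blast
  qed
qed

lemma left_module_mult_kernel:
  assumes L: "left_module S L" shows "left_module S (mult_kernel k S \<phi> L)"
  unfolding mult_kernel_def kernel_module_def
  by (rule left_module_submodule[OF ind_module[OF L] submodule_kernel_left[OF ind_module[OF L] L mul_hom[OF L]]])

lemma mult_kernel_short_exact:
  fixes L :: "('s, ('l, 's \<times> int) formal) rmodule"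
  assumes L: "left_module S L"
  shows "left_module S (transport encode_coset (mult_kernel k S \<phi> L))"
    and "short_exact S (transport encode_coset (mult_kernel k S \<phi> L)) (ind L) L
      (inv_into (carrier (mult_kernel k S \<phi> L)) encode_coset) (mul L)"
proof -
  let ?K = "mult_kernel k S \<phi> L" and ?L' = "transport encode_coset (mult_kernel k S \<phi> L)"
  let ?r = "inv_into (carrier ?K) (encode_coset :: _ \<Rightarrow> ('l, 's \<times> int) formal)"
  have cK: "carrier ?K = kernel (ind L) L (mul L)" by (simp add: mult_kernel_def kernel_module_def)
  have inj: "inj_on (encode_coset :: _ \<Rightarrow> ('l, 's \<times> int) formal) (carrier ?K)"
    by (rule inj_on_subset[OF inj_on_encode_coset[OF L]]) (auto simp: cK kernel_def)
  have K: "left_module S ?K" by (rule left_module_mult_kernel[OF L])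
  interpret Kg: comm_group ?K by (rule left_module_group[OF K])
  show "left_module S ?L'" by (rule left_module_transport[OF inj K])
  have sub: "stable_subgroup S (kernel (ind L) L (mul L)) (ind L)"
    by (rule submodule_kernel_left[OF ind_module[OF L] L mul_hom[OF L]])
  have r: "?r \<in> module_hom S ?L' ?K"
    by (rule transport_inv_hom[OF inj Kg.monoid_axioms left_module_closed[OF K]])
  have 1: "?r \<in> module_hom S ?L' (ind L)"
    by (rule module_hom_comp[OF r]) (unfold mult_kernel_def kernel_module_def, rule submodule_inclusion[OF sub])
  have bij: "bij_betw ?r (carrier ?L') (carrier ?K)"
    unfolding transport_simps(1)[OF inj] by (rule bij_betw_inv_into[OF inj_on_imp_bij_betw[OF inj]])
  have onto: "mul L ` carrier (ind L) = carrier L"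
  proof (intro equalityI subsetI)
    fix x assume "x \<in> mul L ` carrier (ind L)"
    then show "x \<in> carrier L" by (rule imageE) (simp only: module_hom_closed[OF mul_hom[OF L]])
  next
    fix x assume x: "x \<in> carrier L"
    show "x \<in> mul L ` carrier (ind L)"
      using imageI[OF tens_closed[OF L S.one_closed x], of "mul L"] unfolding mul_unit[OF L x] .
  qed
  show "short_exact S ?L' (ind L) L ?r (mul L)"
    unfolding short_exact_def
    by (intro conjI 1 mul_hom[OF L] onto bij_betw_imp_inj_on[OF bij] trans[OF bij_betw_imp_surj_on[OF bij] cK])
qed

abbreviation iter :: "nat \<Rightarrow> ('s, ('s, 's \<times> int) formal) rmodule" where
  "iter j \<equiv> iter_mult_kernel k S \<phi> (left_regular S) j"

abbreviation iter_incl :: "nat \<Rightarrow> ('s, 's \<times> int) formal \<Rightarrow> ('s \<times> ('s, 's \<times> int) formal \<Rightarrow>\<^sub>0 int) set" where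
  "iter_incl j \<equiv> inv_into (carrier (mult_kernel k S \<phi> (iter j))) encode_coset"

lemma iter_module: "left_module S (iter j)"
proof (induction j)
  case 0 then show ?case by (simp add: left_module_transport left_module_regular[OF ring_S] inj_on_def)
next
  case (Suc j) then show ?case using mult_kernel_short_exact(1)[OF Suc] by simp
qed

lemma iter_short_exact: "short_exact S (iter (Suc j)) (ind (iter j)) (iter j) (iter_incl j) (mul (iter j))"
  using mult_kernel_short_exact(2)[OF iter_module] by simp

lemma iter_flat:
  assumes fl: "flat_base"
  shows "flat_left_module k (Lk (iter j))"
proof (induction j)
  case 0
  have inj: "inj_on (Atom :: 's \<Rightarrow> ('s, 's \<times> int) formal) (carrier (left_regular S))" by (simp add: inj_on_def)
  note reg = left_module_regular[OF ring_S]
  interpret reg: comm_group "left_regular S" by (rule left_module_group[OF reg])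
  have a: "inv_into (carrier (left_regular S)) (Atom :: 's \<Rightarrow> ('s, 's \<times> int) formal) \<in> module_hom S (iter 0) (left_regular S)"
    unfolding iter_mult_kernel.simps by (rule transport_inv_hom[OF inj reg.monoid_axioms left_module_closed[OF reg]])
  have b: "Atom \<in> module_hom S (left_regular S) (iter 0)"
    unfolding iter_mult_kernel.simps by (rule transport_hom[OF inj])
  show ?case
  proof (rule flat_retract[OF fl Lk_module[OF iter_module] module_hom_restrict[OF hom_\<phi> a] module_hom_restrict[OF hom_\<phi> b]])
    show "Atom (inv_into (carrier (left_regular S)) Atom y) = y" if "y \<in> carrier (Lk (iter 0))" for y
      using that by (simp add: transport_simps[OF inj] f_inv_into_f)
  qed
next
  case (Suc j)
  show ?case by (rule flat_mult_kernel[OF iter_module fl Suc iter_module iter_short_exact])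
qed

end

section \<open>Columns with restricted entries\<close>

lemma subgroup_of_conditions:
  assumes G: "comm_group G" and K: "comm_group K" and h: "\<And>i. i \<in> I \<Longrightarrow> h i \<in> hom G K" and H: "\<And>i. i \<in> I \<Longrightarrow> subgroup (H i) K"
  shows "subgroup {v \<in> carrier G. \<forall>i\<in>I. h i v \<in> H i} G"
proof -
  interpret G: comm_group G by fact
  show ?thesis
  proof (unfold_locales, goal_cases)
    case (2 v w) then show ?case using hom_mult[OF h] subgroup.m_closed[OF H] by simp
  next
    case 3 then show ?case using comm_hom_one[OF h G K] subgroup.one_closed[OF H] by simp
  next
    case (4 v) then show ?case
      using group_hom.hom_inv[OF comm_group_homI[OF G K h]] subgroup.m_inv_closed[OF H] by simp
  qed auto
qed

lemma (in comm_group) finprod_in_subgroup: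
  assumes H: "subgroup H G" and f: "\<And>i. i \<in> I \<Longrightarrow> f i \<in> H"
  shows "finprod G f I \<in> H"
  using f
proof (induction I rule: infinite_finite_induct)
  case (insert i I)
  have "f \<in> I \<rightarrow> carrier G" "f i \<in> carrier G" using insert.prems subgroup.mem_carrier[OF H] by auto
  then show ?case using insert subgroup.m_closed[OF H] by simp
qed (use subgroup.one_closed[OF H] in auto)

lemma flat_trivial:
  assumes L: "left_module R L" and triv: "carrier L = {\<one>\<^bsub>L\<^esub>}"
  shows "flat_left_module R L"
  unfolding flat_left_module_def
proof (intro conjI allI impI L)
  fix X Y :: "('a, (nat \<Rightarrow> 'a) set) rmodule" and g
  assume "right_module R X \<and> right_module R Y \<and> g \<in> module_hom R X Y \<and> inj_on g (carrier X)"
  then have X: "right_module R X" by blast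
  interpret T: comm_group "tensor R X L" by (rule comm_group_tensor[OF X L])
  have "t \<in> {\<one>\<^bsub>tensor R X L\<^esub>}" if "t \<in> carrier (tensor R X L)" for t
    by (rule tensor_induct[OF X L T.triv_subgroup _ that]) (use triv pure_tensor_one_right[OF X L] in auto)
  then show "inj_on (tensor_left R Y L g) (carrier (tensor R X L))" by (intro inj_onI) blast
qed

context triangular
begin

abbreviation cols :: "('s, 'l) rmodule \<Rightarrow> (('k, 's) triangular_matrix, nat \<Rightarrow> 'l) rmodule" where
  "cols L \<equiv> restrict_scalars \<tau> (columns n L)"

lemma cols_module: "left_module S L \<Longrightarrow> left_module A (cols L)"
  by (rule left_module_restrict[OF ring_triangular \<tau>_ring_hom left_module_columns])

lemma cols_act: "i < n \<Longrightarrow> act (cols L) a v i = finprod L (\<lambda>l. act L (\<tau> a (i, l)) (v l)) {..<n}"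
  by simp

lemma cols_entry: "v \<in> carrier (cols L) \<Longrightarrow> i < n \<Longrightarrow> v i \<in> carrier L"
  by (auto simp: PiE_iff)

lemma cols_eqI:
  assumes "v \<in> carrier (cols L)" "w \<in> carrier (cols L)" "\<And>i. i < n \<Longrightarrow> v i = w i"
  shows "v = w"
  using assms by (intro PiE_ext[of v "{..<n}" "\<lambda>_. carrier L" w]) simp_all

lemma cols_eval_hom: "i < n \<Longrightarrow> (\<lambda>v. v i) \<in> hom (cols L) L"
  by (auto intro!: homI simp: PiE_iff)

lemma cols_map:
  assumes "left_module S L" "left_module S L'" "h \<in> module_hom S L L'"
  shows "(\<lambda>v. \<lambda>i\<in>{..<n}. h (v i)) \<in> module_hom A (cols L) (cols L')"
  by (rule module_hom_restrict[OF \<tau>_ring_hom columns_map[OF assms]])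

text \<open>
  These are the conditions under which the columns with \<open>i\<close>-th entry in \<open>H i\<close> form an \<open>A\<close>-submodule: diagonal
  entries of \<open>A\<close> act through \<open>k\<close>, and the other entries move row \<open>l\<close> to a row \<open>i\<close> below it.
\<close>

definition flag :: "(nat \<Rightarrow> 'l set) \<Rightarrow> ('s, 'l) rmodule \<Rightarrow> bool" where
  "flag H L \<longleftrightarrow> (\<forall>i<n. subgroup (H i) L \<and> (\<forall>c\<in>carrier k. \<forall>x\<in>H i. act L (\<phi> c) x \<in> H i) \<and>
    (\<forall>l<i. \<forall>s\<in>carrier S. \<forall>x\<in>H l. act L s x \<in> H i))"

definition flag_cols :: "(nat \<Rightarrow> 'l set) \<Rightarrow> ('s, 'l) rmodule \<Rightarrow> (('k, 's) triangular_matrix, nat \<Rightarrow> 'l) rmodule" where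
  "flag_cols H L = (cols L)\<lparr>carrier := {v \<in> carrier (cols L). \<forall>i\<in>{..<n}. v i \<in> H i}\<rparr>"

lemma flag_cols_carrier: "v \<in> carrier (flag_cols H L) \<longleftrightarrow> v \<in> carrier (cols L) \<and> (\<forall>i<n. v i \<in> H i)"
  by (auto simp: flag_cols_def)

lemma flag_cols_ops [simp]:
  "monoid.mult (flag_cols H L) = monoid.mult (cols L)" "one (flag_cols H L) = one (cols L)"
  "act (flag_cols H L) = act (cols L)"
  by (simp_all add: flag_cols_def)

lemma flag_cols_stable:
  assumes L: "left_module S L" and H: "flag H L"
  shows "stable_subgroup A {v \<in> carrier (cols L). \<forall>i\<in>{..<n}. v i \<in> H i} (cols L)"
  unfolding stable_subgroup_def
proof (intro conjI ballI)
  note C = cols_module[OF L]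
  interpret L: comm_group L by (rule left_module_group[OF L])
  have sg: "subgroup (H i) L" if "i < n" for i using H that by (simp add: flag_def)
  show "subgroup {v \<in> carrier (cols L). \<forall>i\<in>{..<n}. v i \<in> H i} (cols L)"
    by (rule subgroup_of_conditions[OF left_module_group[OF C] left_module_group[OF L] cols_eval_hom sg]) simp_all
  fix a v assume a: "a \<in> carrier A" and v: "v \<in> {v \<in> carrier (cols L). \<forall>i\<in>{..<n}. v i \<in> H i}"
  then have vc: "v \<in> carrier (cols L)" and vH: "\<And>i. i < n \<Longrightarrow> v i \<in> H i" by simp_all
  have "act (cols L) a v i \<in> H i" if i: "i < n" for i
    unfolding cols_act[OF i]
  proof (rule L.finprod_in_subgroup[OF sg[OF i]])
    fix l assume "l \<in> {..<n}"
    then have l: "l < n" by simp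
    consider "l < i" | "l = i" | "i < l" by linarith
    then show "act L (\<tau> a (i, l)) (v l) \<in> H i"
    proof cases
      case 1 then show ?thesis using H i l vH[OF l] \<tau>_entry_closed[OF a i l] unfolding flag_def by blast
    next
      case 2 then show ?thesis using H i vH[OF l] triangular_fst[OF a i] by (simp add: \<tau>_entry flag_def)
    next
      case 3 then show ?thesis
        using i l left_module_act_zero[OF L cols_entry[OF vc l]] subgroup.one_closed[OF sg[OF i]] by (simp add: \<tau>_entry)
    qed
  qed
  then show "act (cols L) a v \<in> {v \<in> carrier (cols L). \<forall>i\<in>{..<n}. v i \<in> H i}"
    using left_module_closed[OF C a vc] by (simp del: restrict_scalars_simps columns_simps)
qed

lemma flag_cols_module:
  assumes "left_module S L" "flag H L" shows "left_module A (flag_cols H L)"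
  unfolding flag_cols_def by (rule left_module_submodule[OF cols_module[OF assms(1)] flag_cols_stable[OF assms]])

lemma flag_cols_map:
  assumes L: "left_module S L" and L': "left_module S L'" and h: "h \<in> module_hom S L L'"
    and H: "\<And>i x. i < n \<Longrightarrow> x \<in> carrier L \<Longrightarrow> x \<in> H i \<Longrightarrow> h x \<in> H' i"
  shows "(\<lambda>v. \<lambda>i\<in>{..<n}. h (v i)) \<in> module_hom A (flag_cols H L) (flag_cols H' L')"
proof -
  let ?h = "\<lambda>v. \<lambda>i\<in>{..<n}. h (v i)"
  note m = cols_map[OF L L' h]
  show ?thesis
  proof (rule module_homI)
    show "?h v \<in> carrier (flag_cols H' L')" if "v \<in> carrier (flag_cols H L)" for v
      unfolding flag_cols_carrier
    proof (intro conjI allI impI)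
      have v: "v \<in> carrier (cols L)" "\<And>i. i < n \<Longrightarrow> v i \<in> H i" using that unfolding flag_cols_carrier by blast+
      show "?h v \<in> carrier (cols L')" by (rule module_hom_closed[OF m v(1)])
      show "?h v i \<in> H' i" if "i < n" for i using H[OF that cols_entry[OF v(1) that] v(2)[OF that]] that by simp
    qed
    show "?h (v \<otimes>\<^bsub>flag_cols H L\<^esub> w) = ?h v \<otimes>\<^bsub>flag_cols H' L'\<^esub> ?h w"
      if "v \<in> carrier (flag_cols H L)" "w \<in> carrier (flag_cols H L)" for v w
      using module_hom_mult[OF m] that unfolding flag_cols_carrier flag_cols_ops by blast
    show "?h (act (flag_cols H L) a v) = act (flag_cols H' L') a (?h v)"
      if "a \<in> carrier A" "v \<in> carrier (flag_cols H L)" for a v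
      using module_hom_act[OF m] that unfolding flag_cols_carrier flag_cols_ops by blast
  qed
qed

text \<open>These two flags define the modules \<open>N\<^sub>j\<close> and \<open>F\<^sub>j\<close> of the introduction.\<close>

definition lower_part :: "nat \<Rightarrow> ('s, 'l) rmodule \<Rightarrow> nat \<Rightarrow> 'l set" where
  "lower_part j L i = (if i < j then {\<one>\<^bsub>L\<^esub>} else carrier L)"

definition generated_part :: "nat \<Rightarrow> ('s, 'l) rmodule \<Rightarrow> nat \<Rightarrow> ('s \<times> 'l \<Rightarrow>\<^sub>0 int) set set" where
  "generated_part j L i = (if i < j then {\<one>\<^bsub>ind L\<^esub>} else if i = j then tens L \<one>\<^bsub>S\<^esub> ` carrier L else carrier (ind L))"

abbreviation "Ncols j L \<equiv> flag_cols (lower_part j L) L"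
abbreviation "Fcols j L \<equiv> flag_cols (generated_part j L) (ind L)"

lemma flag_lower_part:
  assumes L: "left_module S L" shows "flag (lower_part j L) L"
proof -
  interpret L: comm_group L by (rule left_module_group[OF L])
  show ?thesis
    unfolding flag_def lower_part_def
    using L.triv_subgroup L.subgroup_self left_module_closed[OF L] left_module_act_one[OF L] by simp
qed

lemma flag_generated_part:
  assumes L: "left_module S L" shows "flag (generated_part j L) (ind L)"
proof -
  interpret I: comm_group "ind L" by (rule left_module_group[OF ind_module[OF L]])
  note Lk = Lk_module[OF L]
  have u: "tens L \<one>\<^bsub>S\<^esub> \<in> hom L (ind L)"
    using module_hom_hom[OF unit_hom[OF L]] by (simp add: hom_def)
  have sg: "subgroup (tens L \<one>\<^bsub>S\<^esub> ` carrier L) (ind L)"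
    by (rule hom_image_subgroup[OF left_module_group[OF L] I.comm_group_axioms u])
  have sub: "x \<in> carrier (ind L)" if "x \<in> tens L \<one>\<^bsub>S\<^esub> ` carrier L" for x using subgroup.mem_carrier[OF sg that] .
  have st: "act (ind L) (\<phi> c) x \<in> tens L \<one>\<^bsub>S\<^esub> ` carrier L" if c: "c \<in> carrier k" and x: "x \<in> tens L \<one>\<^bsub>S\<^esub> ` carrier L" for c x
  proof -
    obtain y where y: "y \<in> carrier L" "x = tens L \<one>\<^bsub>S\<^esub> y" using x by blast
    have "act (ind L) (\<phi> c) x = tens L \<one>\<^bsub>S\<^esub> (act L (\<phi> c) y)"
      unfolding y(2) using module_hom_act[OF unit_hom[OF L] c, of y] y(1) by simp
    then show ?thesis using left_module_closed[OF L \<phi>_closed[OF c] y(1)] by simp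
  qed
  note cl = left_module_closed[OF ind_module[OF L]] and one = left_module_act_one[OF ind_module[OF L]]
  show ?thesis
    unfolding flag_def
  proof (intro allI impI conjI ballI)
    fix i assume i: "i < n"
    show "subgroup (generated_part j L i) (ind L)"
      using sg I.triv_subgroup I.subgroup_self by (simp add: generated_part_def del: ind_simps)
    show "act (ind L) (\<phi> c) x \<in> generated_part j L i" if c: "c \<in> carrier k" "x \<in> generated_part j L i" for c x
      using that st[OF c(1)] cl[OF \<phi>_closed[OF c(1)]] one[OF \<phi>_closed[OF c(1)]]
      by (auto simp: generated_part_def simp del: ind_simps split: if_splits)
    show "act (ind L) s x \<in> generated_part j L i" if l: "l < i" and s: "s \<in> carrier S" and x: "x \<in> generated_part j L l" for l s x
    proof (cases "l < j")
      case True
      then have "act (ind L) s x = \<one>\<^bsub>ind L\<^esub>" using x one[OF s] by (simp add: generated_part_def del: ind_simps)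
      moreover have "\<one>\<^bsub>ind L\<^esub> \<in> generated_part j L i"
        using \<open>subgroup (generated_part j L i) (ind L)\<close> by (rule subgroup.one_closed)
      ultimately show ?thesis by simp
    next
      case False
      then have "x \<in> carrier (ind L)" using x sub by (auto simp: generated_part_def simp del: ind_simps split: if_splits)
      then show ?thesis using False l cl[OF s] by (simp add: generated_part_def del: ind_simps)
    qed
  qed
qed

section \<open>Flatness of the covers\<close>

lemma finprod_Sr: "finprod Sr f I = finsum S f I"
  by (simp add: finprod_def finsum_def)

context
  fixes L :: "('s, 'l) rmodule" and j :: nat
  assumes L: "left_module S L" and j: "j < n"
begin

private abbreviation "B \<equiv> column_ideal j"
private abbreviation "B' \<equiv> column_ideal_right j"
private abbreviation "T \<equiv> tensor k B' (Lk L)"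
private abbreviation "I \<equiv> tensor k Sr (Lk L)"
private abbreviation "F0 \<equiv> bimodule_tensor k B B' (Lk L)"

private lemma bim: "bimodule A k B B'" by (rule column_ideal_bimodule[OF j])
private lemma B': "right_module k B'" by (rule bimoduleD(2)[OF bim])
private lemma B: "left_module A B" by (rule bimoduleD(1)[OF bim])
private lemma Lk: "left_module k (Lk L)" by (rule Lk_module[OF L])
private lemma B'_simps [simp]:
  "carrier B' = carrier B" "monoid.mult B' = (\<oplus>\<^bsub>A\<^esub>)" "one B' = \<zero>\<^bsub>A\<^esub>" "act B' c a = a \<otimes>\<^bsub>A\<^esub> scalar c"
  by (simp_all add: column_ideal_right_def)
private lemma T: "comm_group T" by (rule comm_group_tensor[OF B' Lk])
private lemma I: "comm_group I" by (rule comm_group_tensor[OF Sr_module Lk])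
private lemma F0: "left_module A F0" by (rule left_module_bimodule_tensor[OF bim Lk])

private lemma entry_hom: "i < n \<Longrightarrow> (\<lambda>a. \<tau> a (i, j)) \<in> module_hom k B' Sr"
  using column_ideal_closed j
  by (intro module_homI) (simp_all add: \<tau>_entry_closed \<tau>_add_entry \<tau>_mult_scalar)

private lemma diag_unit_mem: "c \<in> carrier k \<Longrightarrow> diag_unit j c \<in> carrier B"
  unfolding column_ideal_carrier[OF j] using j by (simp add: diag_unit_closed fst_units \<tau>_units)

private lemma lower_unit_mem: "s \<in> carrier S \<Longrightarrow> j < i \<Longrightarrow> i < n \<Longrightarrow> lower_unit i j s \<in> carrier B"
  unfolding column_ideal_carrier[OF j] by (simp add: lower_unit_closed fst_units \<tau>_units)

private lemma lower_unit_hom: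
  assumes i: "j < i" "i < n" shows "lower_unit i j \<in> module_hom k Sr B'"
proof (rule module_homI)
  show "lower_unit i j s \<in> carrier B'" if "s \<in> carrier Sr" for s using lower_unit_mem i that by simp
  show "lower_unit i j (s \<otimes>\<^bsub>Sr\<^esub> t) = lower_unit i j s \<otimes>\<^bsub>B'\<^esub> lower_unit i j t" if "s \<in> carrier Sr" "t \<in> carrier Sr" for s t
    unfolding B'_simps
    by (rule triangular_eqI) (use that i in \<open>simp_all add: lower_unit_closed triangular_ops fst_units \<tau>_add_entry \<tau>_units\<close>)
  show "lower_unit i j (act Sr c s) = act B' c (lower_unit i j s)" if "c \<in> carrier k" "s \<in> carrier Sr" for c s
    unfolding B'_simps
    by (rule triangular_eqI) (use that i in \<open>simp_all add: lower_unit_closed scalar_closed triangular_ops fst_units \<tau>_mult_scalar \<tau>_units\<close>)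
qed

private definition component :: "nat \<Rightarrow> ('k, 's) triangular_matrix \<Rightarrow> ('k, 's) triangular_matrix" where
  "component i a = (if i < j then \<zero>\<^bsub>A\<^esub> else if i = j then diag_unit j (fst a j) else lower_unit i j (\<tau> a (i, j)))"

private lemma zero_mem: "\<zero>\<^bsub>A\<^esub> \<in> carrier B"
proof -
  interpret comm_group B by (rule left_module_group[OF B])
  show ?thesis using one_closed by simp
qed

private lemma component_mem: "a \<in> carrier B \<Longrightarrow> i < n \<Longrightarrow> component i a \<in> carrier B"
  using zero_mem diag_unit_mem lower_unit_mem triangular_fst[OF column_ideal_closed] \<tau>_entry_closed[OF column_ideal_closed] j
  by (simp add: component_def)

private lemma sum_components:
  assumes a: "a \<in> carrier B"
  shows "finprod B' (\<lambda>i. component i a) {..<n} = a"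
proof -
  note aA = column_ideal_closed[OF a]
  have Bg: "comm_group B'" by (rule right_module_group[OF B'])
  have cl: "(\<lambda>i. component i a) \<in> {..<n} \<rightarrow> carrier B'" using component_mem[OF a] by simp
  have s: "finprod B' (\<lambda>i. component i a) {..<n} \<in> carrier B"
    using comm_monoid.finprod_closed[OF comm_group.axioms(1)[OF Bg] cl] by simp
  have fh: "(\<lambda>b. fst b p) \<in> hom B' (add_monoid k)" if "p < n" for p
    using that triangular_fst column_ideal_closed by (intro homI) (simp_all add: triangular_ops)
  have th: "(\<lambda>b. \<tau> b (p, q)) \<in> hom B' (add_monoid S)" if "p < n" "q < n" for p q
    using that column_ideal_closed by (intro homI) (simp_all add: \<tau>_entry_closed \<tau>_add_entry)
  have aB: "fst a p = \<zero>\<^bsub>k\<^esub>" if "p < n" "p \<noteq> j" for p using a that unfolding column_ideal_carrier[OF j] by blast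
  have aB': "\<tau> a (p, q) = \<zero>\<^bsub>S\<^esub>" if "q < p" "p < n" "q \<noteq> j" for p q using a that unfolding column_ideal_carrier[OF j] by blast
  show ?thesis
  proof (rule triangular_eqI[OF column_ideal_closed[OF s] aA])
    fix p assume p: "p < n"
    have "fst (finprod B' (\<lambda>i. component i a) {..<n}) p = finprod (add_monoid k) (\<lambda>i. fst (component i a) p) {..<n}"
      by (rule hom_finprod[OF Bg k.a_comm_group fh[OF p] cl])
    also have "\<dots> = fst (component j a) p"
      by (rule comm_group.finprod_delta[OF k.a_comm_group j])
        (use p triangular_fst[OF column_ideal_closed[OF component_mem[OF a j]] p] in \<open>simp_all add: component_def triangular_ops fst_units\<close>)
    also have "\<dots> = fst a p" using p aB by (simp add: component_def fst_units)
    finally show "fst (finprod B' (\<lambda>i. component i a) {..<n}) p = fst a p" .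
  next
    fix p q assume pq: "q < p" "p < n"
    then have q: "q < n" by simp
    have z: "\<tau> \<zero>\<^bsub>A\<^esub> (p, q) = \<zero>\<^bsub>S\<^esub>" using pq q by (simp add: \<tau>_entry triangular_ops below_diag_def)
    have "\<tau> (finprod B' (\<lambda>i. component i a) {..<n}) (p, q) = finprod (add_monoid S) (\<lambda>i. \<tau> (component i a) (p, q)) {..<n}"
      by (rule hom_finprod[OF Bg S.a_comm_group th[OF pq(2) q] cl])
    also have "\<dots> = \<tau> (component p a) (p, q)"
      by (rule comm_group.finprod_delta[OF S.a_comm_group pq(2)])
        (use pq q z \<tau>_entry_closed[OF column_ideal_closed[OF component_mem[OF a pq(2)]] pq(2) q] in
          \<open>auto simp: component_def \<tau>_units\<close>)
    also have "\<dots> = \<tau> a (p, q)" using pq q z aB' by (auto simp: component_def \<tau>_units)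
    finally show "\<tau> (finprod B' (\<lambda>i. component i a) {..<n}) (p, q) = \<tau> a (p, q)" .
  qed
qed

private abbreviation "ent i \<equiv> tensor_left k Sr (Lk L) (\<lambda>a. \<tau> a (i, j))"

text \<open>
  The isomorphism from \<open>Ae\<^sub>j \<otimes>\<^sub>k L\<close> to the cover sends \<open>a \<otimes> x\<close> to the column of all \<open>a\<^sub>i\<^sub>j \<otimes> x\<close>.  Its inverse is
  a sum over the rows.  In row \<open>j\<close> the entry of \<open>a\<close> is in \<open>k\<close> and that of the column is \<open>1 \<otimes> x\<close>, from which
  the multiplication map recovers \<open>x\<close>.
\<close>

private definition coords :: "(('k, 's) triangular_matrix \<times> 'l \<Rightarrow>\<^sub>0 int) set \<Rightarrow> nat \<Rightarrow> ('s \<times> 'l \<Rightarrow>\<^sub>0 int) set" where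
  "coords t = (\<lambda>i\<in>{..<n}. ent i t)"

private definition part :: "nat \<Rightarrow> ('s \<times> 'l \<Rightarrow>\<^sub>0 int) set \<Rightarrow> (('k, 's) triangular_matrix \<times> 'l \<Rightarrow>\<^sub>0 int) set" where
  "part i t = (if i < j then \<one>\<^bsub>T\<^esub> else if i = j then pure_tensor k B' (Lk L) (diag_unit j \<one>\<^bsub>k\<^esub>) (mul L t)
    else tensor_left k B' (Lk L) (lower_unit i j) t)"

private lemma ent_hom: "i < n \<Longrightarrow> ent i \<in> hom T I"
  by (rule tensor_map_hom[OF B' Lk Sr_module Lk entry_hom module_hom_id])

private lemma ent_pure: "i < n \<Longrightarrow> a \<in> carrier B \<Longrightarrow> x \<in> carrier L \<Longrightarrow> ent i (pure_tensor k B' (Lk L) a x) = tens L (\<tau> a (i, j)) x"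
  by (rule tensor_map_pure[OF B' Lk Sr_module Lk entry_hom module_hom_id]) simp_all

private lemma unit_mem: "diag_unit j \<one>\<^bsub>k\<^esub> \<in> carrier B'" using diag_unit_mem by simp

private lemma mulh: "mul L \<in> hom I L" using module_hom_hom[OF mul_hom[OF L]] by simp

private lemma part_hom: "i < n \<Longrightarrow> part i \<in> hom I T"
proof -
  assume i: "i < n"
  consider "i < j" | "i = j" | "j < i" by linarith
  then show ?thesis
  proof cases
    case 1 then show ?thesis using T by (intro homI) (simp_all add: part_def comm_group.axioms(2) group.is_monoid)
  next
    case 2
    have "pure_tensor k B' (Lk L) (diag_unit j \<one>\<^bsub>k\<^esub>) \<in> hom L T"
      using pure_tensor_hom_right[OF B' Lk unit_mem] by (simp add: hom_def)
    then show ?thesis using hom_compose[OF mulh] 2 by (simp add: part_def[abs_def] comp_def)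
  next
    case 3 then show ?thesis
      using tensor_map_hom[OF Sr_module Lk B' Lk lower_unit_hom[OF _ i] module_hom_id] by (simp add: part_def[abs_def])
  qed
qed

private lemma part_entry:
  assumes i: "i < n" and a: "a \<in> carrier B" and x: "x \<in> carrier L"
  shows "part i (tens L (\<tau> a (i, j)) x) = pure_tensor k B' (Lk L) (component i a) x"
proof -
  note aA = column_ideal_closed[OF a]
  have x': "x \<in> carrier (Lk L)" using x by simp
  consider "i < j" | "i = j" | "j < i" by linarith
  then show ?thesis
  proof cases
    case 1 then show ?thesis using pure_tensor_one_left[OF B' Lk x'] by (simp add: part_def component_def)
  next
    case 2
    have c: "fst a j \<in> carrier k" by (rule triangular_fst[OF aA j])
    have e: "diag_unit j \<one>\<^bsub>k\<^esub> \<otimes>\<^bsub>A\<^esub> scalar (fst a j) = diag_unit j (fst a j)"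
      by (rule triangular_eqI) (use c in \<open>auto simp: diag_unit_closed scalar_closed triangular_ops fst_units \<tau>_mult_scalar \<tau>_units\<close>)
    have "part i (tens L (\<tau> a (i, j)) x) = pure_tensor k B' (Lk L) (diag_unit j \<one>\<^bsub>k\<^esub>) (act (Lk L) (fst a j) x)"
      using 2 c x by (simp add: part_def \<tau>_entry j mul_pure[OF L])
    also have "\<dots> = pure_tensor k B' (Lk L) (act B' (fst a j) (diag_unit j \<one>\<^bsub>k\<^esub>)) x"
      by (rule pure_tensor_act[OF B' Lk c unit_mem x', symmetric])
    also have "\<dots> = pure_tensor k B' (Lk L) (component i a) x" using 2 by (simp add: component_def e)
    finally show ?thesis .
  next
    case 3
    then show ?thesis
      using tensor_map_pure[OF Sr_module Lk B' Lk lower_unit_hom[OF 3 i] module_hom_id, of "\<tau> a (i, j)" x]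
        \<tau>_entry_closed[OF aA i j] x
      by (simp add: part_def component_def)
  qed
qed

private lemma recover_tensor:
  assumes t: "t \<in> carrier T"
  shows "finprod T (\<lambda>i. part i (coords t i)) {..<n} = t"
proof -
  interpret T: comm_group T by (rule T)
  have h: "(\<lambda>t. part i (ent i t)) \<in> hom T T" if "i \<in> {..<n}" for i
    using hom_compose[OF ent_hom part_hom, of i] that by (simp add: comp_def)
  have "finprod T (\<lambda>i. part i (coords t i)) {..<n} = finprod T (\<lambda>i. part i (ent i t)) {..<n}"
    by (rule T.finprod_cong'[OF refl]) (use hom_in_carrier[OF h t] in \<open>simp_all add: coords_def\<close>)
  also have "\<dots> = t"
  proof (rule tensor_hom_eqI[OF B' Lk T hom_finprod_pointwise[OF T h] iso_imp_homomorphism[OF iso_set_refl] _ t])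
    fix a x assume a: "a \<in> carrier B'" and x: "x \<in> carrier (Lk L)"
    have aB: "a \<in> carrier B" and xL: "x \<in> carrier L" using a x by simp_all
    have cl: "(\<lambda>i. component i a) \<in> {..<n} \<rightarrow> carrier B'" using component_mem[OF aB] by simp
    have "finprod T (\<lambda>i. part i (ent i (pure_tensor k B' (Lk L) a x))) {..<n} =
        finprod T (\<lambda>i. pure_tensor k B' (Lk L) (component i a) x) {..<n}"
      by (rule T.finprod_cong'[OF refl])
        (use pure_tensor_closed[OF B' Lk _ x] cl in \<open>auto simp: ent_pure aB xL part_entry Pi_iff\<close>)
    also have "\<dots> = pure_tensor k B' (Lk L) (finprod B' (\<lambda>i. component i a) {..<n}) x"
      by (rule hom_finprod[OF right_module_group[OF B'] T pure_tensor_hom_left[OF B' Lk x] cl, symmetric])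
    finally show "finprod T (\<lambda>i. part i (ent i (pure_tensor k B' (Lk L) a x))) {..<n} = pure_tensor k B' (Lk L) a x"
      unfolding sum_components[OF aB] .
  qed
  finally show ?thesis .
qed

private lemma coords_mem:
  assumes t: "t \<in> carrier T"
  shows "coords t \<in> carrier (Fcols j L)"
  unfolding flag_cols_carrier
proof (intro conjI allI impI)
  show "coords t \<in> carrier (cols (ind L))" using hom_in_carrier[OF ent_hom t] by (simp add: coords_def)
  fix i assume i: "i < n"
  consider "i < j" | "i = j" | "j < i" by linarith
  then show "coords t i \<in> generated_part j L i"
  proof cases
    case 1
    have "ent i t = \<one>\<^bsub>I\<^esub>"
      by (rule tensor_map_eq_one[OF B' Lk Sr_module Lk entry_hom[OF i] module_hom_id _ t])
        (use 1 i j in \<open>simp add: \<tau>_entry\<close>)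
    then show ?thesis using 1 i by (simp add: coords_def generated_part_def)
  next
    case 2
    have u: "tens L \<one>\<^bsub>S\<^esub> \<in> hom L I" using module_hom_hom[OF unit_hom[OF L]] by (simp add: hom_def)
    have "ent j t = tens L \<one>\<^bsub>S\<^esub> (mul L (ent j t))"
    proof (rule tensor_hom_eqI[OF B' Lk I ent_hom[OF j] _ _ t])
      show "(\<lambda>t. tens L \<one>\<^bsub>S\<^esub> (mul L (ent j t))) \<in> hom T I"
        using hom_compose[OF hom_compose[OF ent_hom[OF j] mulh] u] by (simp add: comp_def)
      fix a x assume "a \<in> carrier B'" "x \<in> carrier (Lk L)"
      then have a: "a \<in> carrier B" and x: "x \<in> carrier L" by simp_all
      have c: "fst a j \<in> carrier k" by (rule triangular_fst[OF column_ideal_closed[OF a] j])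
      show "ent j (pure_tensor k B' (Lk L) a x) = tens L \<one>\<^bsub>S\<^esub> (mul L (ent j (pure_tensor k B' (Lk L) a x)))"
        unfolding ent_pure[OF j a x] using c x j tens_scalar[OF L S.one_closed c x]
          left_module_closed[OF L \<phi>_closed[OF c] x]
        by (simp add: \<tau>_entry mul_pure[OF L] left_module_one[OF L])
    qed
    then show ?thesis using 2 j hom_in_carrier[OF mulh hom_in_carrier[OF ent_hom[OF j] t]]
      by (simp add: coords_def generated_part_def)
  next
    case 3
    then show ?thesis using i hom_in_carrier[OF ent_hom[OF i] t] by (simp add: coords_def generated_part_def)
  qed
qed

private lemma recover_column:
  assumes v: "v \<in> carrier (Fcols j L)"
  shows "finprod T (\<lambda>i. part i (v i)) {..<n} \<in> carrier T" "coords (finprod T (\<lambda>i. part i (v i)) {..<n}) = v"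
proof -
  interpret T: comm_group T by (rule T)
  have vc: "v \<in> carrier (cols (ind L))" and vH: "\<And>i. i < n \<Longrightarrow> v i \<in> generated_part j L i"
    using v unfolding flag_cols_carrier by blast+
  have vI: "v i \<in> carrier I" if "i < n" for i using cols_entry[OF vc that] by simp
  have cl: "(\<lambda>i. part i (v i)) \<in> {..<n} \<rightarrow> carrier T" using hom_in_carrier[OF part_hom vI] by simp
  show c: "finprod T (\<lambda>i. part i (v i)) {..<n} \<in> carrier T" by (rule T.finprod_closed[OF cl])
  have one: "\<one>\<^bsub>T\<^esub> \<in> carrier T" by simp
  have e: "ent p (part i (v i)) = (if i = p then v p else \<one>\<^bsub>I\<^esub>)" if i: "i < n" and p: "p < n" for i p
  proof -
    consider "i < j" | "i = j" | "j < i" by linarith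
    then show ?thesis
    proof cases
      case 1
      then have "v i = \<one>\<^bsub>I\<^esub>" using vH[OF i] by (simp add: generated_part_def)
      then show ?thesis using 1 comm_hom_one[OF ent_hom[OF p] T I] by (auto simp: part_def)
    next
      case 2
      then obtain x where x: "x \<in> carrier L" "v i = tens L \<one>\<^bsub>S\<^esub> x" using vH[OF i] by (auto simp: generated_part_def)
      have x': "x \<in> carrier (Lk L)" using x by simp
      have "ent p (part i (v i)) = tens L (\<tau> (diag_unit j \<one>\<^bsub>k\<^esub>) (p, j)) x"
        using 2 x mul_unit[OF L x(1)] ent_pure[OF p diag_unit_mem[OF k.one_closed] x(1)] by (simp add: part_def)
      then show ?thesis using p j 2 x pure_tensor_one_left[OF Sr_module Lk x'] by (auto simp: \<tau>_units)
    next
      case 3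
      note lu = lower_unit_hom[OF 3 i]
      have "ent p (part i (v i)) = tensor_left k Sr (Lk L) (\<lambda>s. \<tau> (lower_unit i j s) (p, j)) (v i)"
        using 3 tensor_map_comp[OF Sr_module Lk B' Lk Sr_module Lk lu module_hom_id entry_hom[OF p] module_hom_id vI[OF i]]
        by (simp add: part_def)
      also have "\<dots> = (if i = p then v p else \<one>\<^bsub>I\<^esub>)"
      proof (cases "i = p")
        case True
        then show ?thesis
          using tensor_map_id_cong[OF Sr_module Lk module_hom_comp[OF lu entry_hom[OF p]] module_hom_id _ _ vI[OF i]] 3 i j
          by (simp add: \<tau>_units)
      next
        case False
        then show ?thesis
          using tensor_map_eq_one[OF Sr_module Lk Sr_module Lk module_hom_comp[OF lu entry_hom[OF p]] module_hom_id _ vI[OF i]] 3 p j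
          by (simp add: \<tau>_units)
      qed
      finally show ?thesis .
    qed
  qed
  show "coords (finprod T (\<lambda>i. part i (v i)) {..<n}) = v"
  proof (rule cols_eqI[of _ "ind L"])
    show "coords (finprod T (\<lambda>i. part i (v i)) {..<n}) \<in> carrier (cols (ind L))"
      using coords_mem[OF c] unfolding flag_cols_carrier by blast
    show "v \<in> carrier (cols (ind L))" by (rule vc)
    fix p assume p: "p < n"
    have "ent p (finprod T (\<lambda>i. part i (v i)) {..<n}) = finprod I (\<lambda>i. ent p (part i (v i))) {..<n}"
      by (rule hom_finprod[OF T I ent_hom[OF p] cl])
    also have "\<dots> = ent p (part p (v p))"
      by (rule comm_group.finprod_delta[OF I p]) (use e p vI[OF p] in simp_all)
    also have "\<dots> = v p" using e[OF p p] by simp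
    finally show "coords (finprod T (\<lambda>i. part i (v i)) {..<n}) p = v p" using p by (simp add: coords_def)
  qed
qed

private lemma coords_hom: "coords \<in> module_hom A F0 (Fcols j L)"
proof (rule module_homI)
  show "coords t \<in> carrier (Fcols j L)" if "t \<in> carrier F0" for t using coords_mem that by simp
  show "coords (t \<otimes>\<^bsub>F0\<^esub> u) = coords t \<otimes>\<^bsub>Fcols j L\<^esub> coords u" if "t \<in> carrier F0" "u \<in> carrier F0" for t u
    using that hom_mult[OF ent_hom] by (auto simp: coords_def intro!: restrict_ext)
  fix a t assume a: "a \<in> carrier A" and "t \<in> carrier F0"
  then have t: "t \<in> carrier T" by simp
  have at: "act F0 a t \<in> carrier T" using left_module_closed[OF F0 a] t by simp
  have ct: "coords t \<in> carrier (cols (ind L))" using coords_mem[OF t] unfolding flag_cols_carrier by blast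
  show "coords (act F0 a t) = act (Fcols j L) a (coords t)"
    unfolding flag_cols_ops
  proof (rule cols_eqI[of _ "ind L"])
    show "coords (act F0 a t) \<in> carrier (cols (ind L))" using coords_mem[OF at] unfolding flag_cols_carrier by blast
    show "act (cols (ind L)) a (coords t) \<in> carrier (cols (ind L))"
      by (rule left_module_closed[OF cols_module[OF ind_module[OF L]] a ct])
    fix i assume i: "i < n"
    have sa: "\<tau> a (i, l) \<in> carrier S" if "l < n" for l by (rule \<tau>_entry_closed[OF a i that])
    have lh: "(\<lambda>t. act (ind L) (\<tau> a (i, l)) (ent l t)) \<in> hom T I" if "l \<in> {..<n}" for l
      using hom_compose[OF ent_hom, of l "act (ind L) (\<tau> a (i, l))" I] left_module_hom_action[OF ind_module[OF L] sa, of l] that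
      by (simp add: comp_def)
    have fI: "finprod (ind L) f J = finprod I f J" for f and J :: "nat set" by (simp add: finprod_def)
    have "ent i (act F0 a t) = finprod I (\<lambda>l. act (ind L) (\<tau> a (i, l)) (ent l t)) {..<n}"
    proof (rule tensor_hom_eqI[OF B' Lk I _ hom_finprod_pointwise[OF I lh] _ t])
      show "(\<lambda>t. ent i (act F0 a t)) \<in> hom T I"
        using hom_compose[OF left_module_hom_action[OF F0 a, simplified] ent_hom[OF i]] by (simp add: comp_def)
      fix b x assume "b \<in> carrier B'" "x \<in> carrier (Lk L)"
      then have b: "b \<in> carrier B" and x: "x \<in> carrier L" and x': "x \<in> carrier (Lk L)" by simp_all
      note bA = column_ideal_closed[OF b]
      have ab: "a \<otimes>\<^bsub>A\<^esub> b \<in> carrier B" using left_module_closed[OF B a b] by simp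
      have sc: "(\<lambda>l. \<tau> a (i, l) \<otimes>\<^bsub>S\<^esub> \<tau> b (l, j)) \<in> {..<n} \<rightarrow> carrier S" using sa \<tau>_entry_closed[OF bA _ j] by simp
      have "ent i (act F0 a (pure_tensor k B' (Lk L) b x)) = tens L (\<tau> (a \<otimes>\<^bsub>A\<^esub> b) (i, j)) x"
        using bimodule_tensor_act_pure[OF bim Lk a b x'] ent_pure[OF i ab x] by simp
      also have "\<dots> = tens L (finprod Sr (\<lambda>l. \<tau> a (i, l) \<otimes>\<^bsub>S\<^esub> \<tau> b (l, j)) {..<n}) x"
        unfolding finprod_Sr by (simp add: \<tau>_mult_entry[OF a bA i j])
      also have "\<dots> = finprod I (\<lambda>l. tens L (\<tau> a (i, l) \<otimes>\<^bsub>S\<^esub> \<tau> b (l, j)) x) {..<n}"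
        by (rule hom_finprod[OF right_module_group[OF Sr_module] I pure_tensor_hom_left[OF Sr_module Lk x']]) (use sc in simp)
      also have "\<dots> = finprod I (\<lambda>l. act (ind L) (\<tau> a (i, l)) (ent l (pure_tensor k B' (Lk L) b x))) {..<n}"
      proof (rule comm_monoid.finprod_cong'[OF comm_group.axioms(1)[OF I] refl])
        show "(\<lambda>l. act (ind L) (\<tau> a (i, l)) (ent l (pure_tensor k B' (Lk L) b x))) \<in> {..<n} \<rightarrow> carrier I"
          using hom_in_carrier[OF lh] pure_tensor_closed[OF B' Lk, of b x] b x by simp
        show "tens L (\<tau> a (i, l) \<otimes>\<^bsub>S\<^esub> \<tau> b (l, j)) x = act (ind L) (\<tau> a (i, l)) (ent l (pure_tensor k B' (Lk L) b x))"
          if "l \<in> {..<n}" for l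
          using that ent_pure[OF _ b x, of l] ind_act_pure[OF L sa \<tau>_entry_closed[OF bA _ j] x, of l l] by simp
      qed
      finally show "ent i (act F0 a (pure_tensor k B' (Lk L) b x)) =
          finprod I (\<lambda>l. act (ind L) (\<tau> a (i, l)) (ent l (pure_tensor k B' (Lk L) b x))) {..<n}" .
    qed
    also have "\<dots> = finprod I (\<lambda>l. act (ind L) (\<tau> a (i, l)) (coords t l)) {..<n}"
      by (rule comm_monoid.finprod_cong'[OF comm_group.axioms(1)[OF I] refl])
        (use hom_in_carrier[OF lh t] in \<open>simp_all add: coords_def\<close>)
    finally show "coords (act F0 a t) i = act (cols (ind L)) a (coords t) i"
      unfolding cols_act[OF i] fI using i by (simp add: coords_def)
  qed
qed

text \<open>
  The isomorphism with \<open>Ae\<^sub>j \<otimes>\<^sub>k L\<close> transfers flatness.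
\<close>

lemma Fcols_flat_below:
  assumes fl: "flat_left_module k (Lk L)"
  shows "flat_left_module A (Fcols j L)"
proof -
  have bij: "bij_betw coords (carrier F0) (carrier (Fcols j L))"
    by (rule bij_betw_byWitness[where f' = "\<lambda>v. finprod T (\<lambda>i. part i (v i)) {..<n}"])
      (use recover_tensor recover_column coords_mem in auto)
  interpret F0: comm_group F0 by (rule left_module_group[OF F0])
  have inv: "inv_into (carrier F0) coords \<in> module_hom A (Fcols j L) F0"
    by (rule module_hom_inv_into[OF coords_hom bij F0.monoid_axioms left_module_closed[OF F0]])
  show ?thesis
    by (rule flat_retract[OF flat_bimodule_tensor[OF bim Lk column_ideal_flat[OF j] fl]
          flag_cols_module[OF ind_module[OF L] flag_generated_part[OF L]] inv coords_hom])
      (use bij in \<open>simp add: bij_betw_inv_into_right\<close>)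
qed

end

lemma Fcols_flat:
  assumes L: "left_module S L" and fl: "flat_left_module k (Lk L)"
  shows "flat_left_module A (Fcols j L)"
proof (cases "j < n")
  case True then show ?thesis by (rule Fcols_flat_below[OF L _ fl])
next
  case False
  have F: "left_module A (Fcols j L)" by (rule flag_cols_module[OF ind_module[OF L] flag_generated_part[OF L]])
  interpret F: comm_group "Fcols j L" by (rule left_module_group[OF F])
  have "v = \<one>\<^bsub>Fcols j L\<^esub>" if "v \<in> carrier (Fcols j L)" for v
  proof (rule cols_eqI[of _ "ind L"])
    show "v \<in> carrier (cols (ind L))" using that unfolding flag_cols_carrier by blast
    show "\<one>\<^bsub>Fcols j L\<^esub> \<in> carrier (cols (ind L))" using F.one_closed unfolding flag_cols_carrier by blast
    show "v i = \<one>\<^bsub>Fcols j L\<^esub> i" if "i < n" for i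
      using \<open>v \<in> carrier (Fcols j L)\<close> False that unfolding flag_cols_carrier by (simp add: generated_part_def)
  qed
  then have "carrier (Fcols j L) = {\<one>\<^bsub>Fcols j L\<^esub>}" using F.one_closed by blast
  then show ?thesis by (rule flat_trivial[OF F])
qed

text \<open>
  In row \<open>j\<close> the multiplication map is bijective from \<open>1 \<otimes> L\<close> to \<open>L\<close>, so a column in the kernel has one more
  entry that vanishes.  In the rows below, the map is the surjection with kernel \<open>L'\<close>.
\<close>

lemma columns_short_exact:
  assumes L: "left_module S L" and L': "left_module S L'" and se: "short_exact S L' (ind L) L \<rho> (mul L)"
  shows "short_exact A (Ncols (Suc j) L') (Fcols j L) (Ncols j L)
    (\<lambda>v. \<lambda>i\<in>{..<n}. \<rho> (v i)) (\<lambda>v. \<lambda>i\<in>{..<n}. mul L (v i))"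
proof -
  note s = short_exactD[OF se]
  note IM = ind_module[OF L]
  interpret I: comm_group "ind L" by (rule left_module_group[OF IM])
  interpret Lg: comm_group L by (rule left_module_group[OF L])
  interpret L'g: comm_group L' by (rule left_module_group[OF L'])
  let ?a = "\<lambda>v. \<lambda>i\<in>{..<n}. \<rho> (v i)" and ?b = "\<lambda>v. \<lambda>i\<in>{..<n}. mul L (v i)"
  have \<rho>1: "\<rho> \<one>\<^bsub>L'\<^esub> = \<one>\<^bsub>ind L\<^esub>" by (rule comm_hom_one[OF module_hom_hom[OF s(1)] L'g.comm_group_axioms I.comm_group_axioms])
  have \<mu>1: "mul L \<one>\<^bsub>ind L\<^esub> = \<one>\<^bsub>L\<^esub>" by (rule comm_hom_one[OF module_hom_hom[OF s(3)] I.comm_group_axioms Lg.comm_group_axioms])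
  have u1: "tens L \<one>\<^bsub>S\<^esub> \<one>\<^bsub>L\<^esub> = \<one>\<^bsub>ind L\<^esub>"
    using pure_tensor_one_right[OF Sr_module Lk_module[OF L], of "\<one>\<^bsub>S\<^esub>"] by simp
  have a: "?a \<in> module_hom A (Ncols (Suc j) L') (Fcols j L)"
  proof (rule flag_cols_map[OF L' IM s(1)])
    fix i x assume x: "x \<in> carrier L'" "x \<in> lower_part (Suc j) L' i"
    show "\<rho> x \<in> generated_part j L i"
    proof (cases "i < Suc j")
      case True
      then have "\<rho> x = \<one>\<^bsub>ind L\<^esub>" using x(2) \<rho>1 by (simp add: lower_part_def)
      moreover have "\<one>\<^bsub>ind L\<^esub> \<in> tens L \<one>\<^bsub>S\<^esub> ` carrier L"
        unfolding u1[symmetric] by (rule imageI[OF Lg.one_closed])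
      ultimately show ?thesis using True by (simp add: generated_part_def del: ind_simps)
    next
      case False then show ?thesis using module_hom_closed[OF s(1) x(1)] by (simp add: generated_part_def)
    qed
  qed
  have b: "?b \<in> module_hom A (Fcols j L) (Ncols j L)"
  proof (rule flag_cols_map[OF IM L s(3)])
    fix i x assume x: "x \<in> carrier (ind L)" "x \<in> generated_part j L i"
    show "mul L x \<in> lower_part j L i"
      using x(2) module_hom_closed[OF s(3) x(1)] \<mu>1
      by (auto simp: generated_part_def lower_part_def simp del: ind_simps split: if_splits)
  qed
  have inj: "inj_on ?a (carrier (Ncols (Suc j) L'))"
  proof (rule inj_onI)
    fix v w assume v: "v \<in> carrier (Ncols (Suc j) L')" and w: "w \<in> carrier (Ncols (Suc j) L')" and eq: "?a v = ?a w"
    have vc: "v \<in> carrier (cols L')" and wc: "w \<in> carrier (cols L')" using v w unfolding flag_cols_carrier by blast+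
    show "v = w"
    proof (rule cols_eqI[OF vc wc])
      fix i assume i: "i < n"
      have "\<rho> (v i) = \<rho> (w i)" using fun_cong[OF eq, of i] i by simp
      then show "v i = w i" by (rule inj_onD[OF s(2) _ cols_entry[OF vc i] cols_entry[OF wc i]])
    qed
  qed
  have onto: "carrier (Ncols j L) \<subseteq> ?b ` carrier (Fcols j L)"
  proof
    fix w assume w: "w \<in> carrier (Ncols j L)"
    have wc: "w \<in> carrier (cols L)" and wH: "\<And>i. i < n \<Longrightarrow> w i \<in> lower_part j L i" using w unfolding flag_cols_carrier by blast+
    let ?v = "\<lambda>i\<in>{..<n}. tens L \<one>\<^bsub>S\<^esub> (w i)"
    have wi: "w i \<in> carrier L" if "i < n" for i by (rule cols_entry[OF wc that])
    have vF: "?v \<in> carrier (Fcols j L)"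
      unfolding flag_cols_carrier
    proof (intro conjI allI impI)
      show "?v \<in> carrier (cols (ind L))" using tens_closed[OF L S.one_closed wi] by simp
      fix i assume i: "i < n"
      show "?v i \<in> generated_part j L i"
      proof (cases "i < j")
        case True
        then have "w i = \<one>\<^bsub>L\<^esub>" using wH[OF i] by (simp add: lower_part_def)
        then show ?thesis using True i u1 by (simp add: generated_part_def)
      next
        case False
        have "tens L \<one>\<^bsub>S\<^esub> (w i) \<in> tens L \<one>\<^bsub>S\<^esub> ` carrier L" by (rule imageI[OF wi[OF i]])
        then show ?thesis using False i tens_closed[OF L S.one_closed wi[OF i]]
          by (cases "i = j") (simp_all add: generated_part_def del: ind_simps)
      qed
    qed
    have bv: "?b ?v = w"
    proof (rule cols_eqI[of _ L])
      show "?b ?v \<in> carrier (cols L)" using module_hom_closed[OF b vF] unfolding flag_cols_carrier by blast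
      show "w \<in> carrier (cols L)" by (rule wc)
      show "?b ?v i = w i" if "i < n" for i using that mul_unit[OF L wi[OF that]] by simp
    qed
    show "w \<in> ?b ` carrier (Fcols j L)" using imageI[OF vF, of ?b] unfolding bv .
  qed
  have ker: "?a ` carrier (Ncols (Suc j) L') = kernel (Fcols j L) (Ncols j L) ?b"
  proof (intro equalityI subsetI)
    fix v assume "v \<in> ?a ` carrier (Ncols (Suc j) L')"
    then obtain u where u: "u \<in> carrier (Ncols (Suc j) L')" "v = ?a u" by blast
    have uc: "u \<in> carrier (cols L')" using u(1) unfolding flag_cols_carrier by blast
    have "?b v = \<one>\<^bsub>Ncols j L\<^esub>"
      unfolding u(2) using short_exact_comp_one[OF se cols_entry[OF uc]] by (auto intro!: restrict_ext)
    then show "v \<in> kernel (Fcols j L) (Ncols j L) ?b"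
      using module_hom_closed[OF a u(1)] unfolding u(2) kernel_def by blast
  next
    fix v assume "v \<in> kernel (Fcols j L) (Ncols j L) ?b"
    then have v: "v \<in> carrier (Fcols j L)" and bv: "?b v = \<one>\<^bsub>Ncols j L\<^esub>" unfolding kernel_def by blast+
    have vc: "v \<in> carrier (cols (ind L))" and vH: "\<And>i. i < n \<Longrightarrow> v i \<in> generated_part j L i" using v unfolding flag_cols_carrier by blast+
    have vi: "v i \<in> carrier (ind L)" if "i < n" for i by (rule cols_entry[OF vc that])
    have m: "mul L (v i) = \<one>\<^bsub>L\<^esub>" if "i < n" for i using fun_cong[OF bv, of i] that by simp
    have im: "v i \<in> \<rho> ` carrier L'" if "i < n" for i
      unfolding s(5) kernel_def using vi[OF that] m[OF that] by blast
    have r: "inv_into (carrier L') \<rho> (v i) \<in> carrier L'" "\<rho> (inv_into (carrier L') \<rho> (v i)) = v i" if "i < n" for i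
      by (rule inv_into_into[OF im[OF that]], rule f_inv_into_f[OF im[OF that]])
    let ?u = "\<lambda>i\<in>{..<n}. inv_into (carrier L') \<rho> (v i)"
    have uN: "?u \<in> carrier (Ncols (Suc j) L')"
      unfolding flag_cols_carrier
    proof (intro conjI allI impI)
      show "?u \<in> carrier (cols L')" using r(1) by simp
      fix i assume i: "i < n"
      show "?u i \<in> lower_part (Suc j) L' i"
      proof (cases "i < Suc j")
        case True
        have "v i = \<one>\<^bsub>ind L\<^esub>"
        proof (cases "i = j")
          case True
          then obtain x where x: "x \<in> carrier L" "v i = tens L \<one>\<^bsub>S\<^esub> x" using vH[OF i] by (auto simp: generated_part_def)
          then have "x = \<one>\<^bsub>L\<^esub>" using m[OF i] mul_unit[OF L x(1)] by simp
          then show ?thesis using x(2) u1 by simp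
        next
          case False
          then show ?thesis using vH[OF i] True by (simp add: generated_part_def)
        qed
        then have "\<rho> (inv_into (carrier L') \<rho> (v i)) = \<rho> \<one>\<^bsub>L'\<^esub>" using r(2)[OF i] \<rho>1 by simp
        then have "inv_into (carrier L') \<rho> (v i) = \<one>\<^bsub>L'\<^esub>" by (rule inj_onD[OF s(2) _ r(1)[OF i] L'g.one_closed])
        then show ?thesis using True i by (simp add: lower_part_def)
      next
        case False then show ?thesis using r(1)[OF i] i by (simp add: lower_part_def)
      qed
    qed
    have au: "?a ?u = v"
    proof (rule cols_eqI[of _ "ind L"])
      show "?a ?u \<in> carrier (cols (ind L))" using vi r(2) by simp
      show "v \<in> carrier (cols (ind L))" by (rule vc)
      show "?a ?u i = v i" if "i < n" for i using that r(2)[OF that] by simp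
    qed
    show "v \<in> ?a ` carrier (Ncols (Suc j) L')" using imageI[OF uN, of ?a] unfolding au .
  qed
  show ?thesis
    unfolding short_exact_def
  proof (intro conjI a b inj ker equalityI onto)
    show "?b ` carrier (Fcols j L) \<subseteq> carrier (Ncols j L)" using module_hom_closed[OF b] by (intro image_subsetI)
  qed
qed

end

context triangular
begin

section \<open>Tor through the resolution by covers\<close>

abbreviation "res_N j \<equiv> Ncols j (iter j)"
abbreviation "res_F j \<equiv> Fcols j (iter j)"
abbreviation "res_map j \<equiv> (\<lambda>v. \<lambda>i\<in>{..<n}. iter_incl j (v i))"

lemma res_N_module: "left_module A (res_N j)"
  by (rule flag_cols_module[OF iter_module flag_lower_part[OF iter_module]])

lemma res_F_module: "left_module A (res_F j)"
  by (rule flag_cols_module[OF ind_module[OF iter_module] flag_generated_part[OF iter_module]])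

lemma res_short_exact: "short_exact A (res_N (Suc j)) (res_F j) (res_N j) (res_map j) (\<lambda>v. \<lambda>i\<in>{..<n}. mul (iter j) (v i))"
  by (rule columns_short_exact[OF iter_module iter_module iter_short_exact])

text \<open>
  Each exact sequence lowers the degree by one and raises \<open>j\<close> by one.
\<close>

lemma Tor_res_N:
  assumes fl: "flat_base" and X: "right_module A X"
  shows "Tor A (Suc i) X (res_N j) \<cong> tensor_kernel_right A X (res_N (Suc (i + j))) (res_F (i + j)) (res_map (i + j))"
proof (induction i arbitrary: j)
  case 0
  show ?case
    using Tor_one_dimension_shift[OF X res_N_module res_N_module Fcols_flat[OF iter_module iter_flat[OF fl]] res_short_exact]
    unfolding One_nat_def add_0 .
next
  case (Suc i)
  have "Tor A (Suc (Suc i)) X (res_N j) \<cong> Tor A (Suc i) X (res_N (Suc j))"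
    by (rule Tor_Suc_dimension_shift[OF X res_N_module res_N_module Fcols_flat[OF iter_module iter_flat[OF fl]] res_short_exact])
  from iso_trans[OF this Suc[of "Suc j"]] show ?case by simp
qed

section \<open>The module of rows\<close>

abbreviation "rows \<equiv> restrict_scalars \<tau> (row_module n S)"

definition single_row :: "nat \<Rightarrow> 's \<Rightarrow> nat \<Rightarrow> 's" where
  "single_row p m = (\<lambda>i\<in>{..<n}. if i = p then m else \<zero>\<^bsub>S\<^esub>)"

definition single_col :: "('s, 'l) rmodule \<Rightarrow> nat \<Rightarrow> 'l \<Rightarrow> nat \<Rightarrow> 'l" where
  "single_col L p x = (\<lambda>i\<in>{..<n}. if i = p then x else \<one>\<^bsub>L\<^esub>)"

lemma rows_module: "right_module A rows"
  by (rule right_module_restrict[OF ring_triangular \<tau>_ring_hom right_module_rows[OF ring_S]])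

lemma rows_entry: "v \<in> carrier rows \<Longrightarrow> i < n \<Longrightarrow> v i \<in> carrier S"
  by (auto simp: PiE_iff)

lemma rows_eqI:
  assumes "v \<in> carrier rows" "w \<in> carrier rows" "\<And>i. i < n \<Longrightarrow> v i = w i"
  shows "v = w"
  using assms by (intro PiE_ext[of v "{..<n}" "\<lambda>_. carrier S" w]) simp_all

lemma single_row_closed: "m \<in> carrier S \<Longrightarrow> single_row p m \<in> carrier rows"
  by (simp add: single_row_def)

lemma single_row_entry: "i < n \<Longrightarrow> single_row p m i = (if i = p then m else \<zero>\<^bsub>S\<^esub>)"
  by (simp add: single_row_def)

lemma single_col_entry: "i < n \<Longrightarrow> single_col L p x i = (if i = p then x else \<one>\<^bsub>L\<^esub>)"
  by (simp add: single_col_def)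

lemma single_row_act:
  assumes a: "a \<in> carrier A" and p: "p < n" and m: "m \<in> carrier S" and i: "i < n"
  shows "act rows a (single_row p m) i = m \<otimes>\<^bsub>S\<^esub> \<tau> a (p, i)"
proof -
  have "finsum S (\<lambda>l. single_row p m l \<otimes>\<^bsub>S\<^esub> \<tau> a (l, i)) {..<n} = single_row p m p \<otimes>\<^bsub>S\<^esub> \<tau> a (p, i)"
    by (rule S.finsum_delta[OF p]) (use m p i \<tau>_entry_closed[OF a] in \<open>simp_all add: single_row_entry\<close>)
  then show ?thesis using i p by (simp add: single_row_entry)
qed

lemma single_row_diag:
  assumes p: "p < n" and m: "m \<in> carrier S" and c: "c \<in> carrier k"
  shows "act rows (diag_unit p c) (single_row p m) = single_row p (m \<otimes>\<^bsub>S\<^esub> \<phi> c)"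
proof (rule rows_eqI)
  show "act rows (diag_unit p c) (single_row p m) \<in> carrier rows"
    by (rule right_module_closed[OF rows_module diag_unit_closed[OF c] single_row_closed[OF m]])
  show "act rows (diag_unit p c) (single_row p m) i = single_row p (m \<otimes>\<^bsub>S\<^esub> \<phi> c) i" if "i < n" for i
    unfolding single_row_act[OF diag_unit_closed[OF c] p m that] using that p m by (simp add: \<tau>_units single_row_entry)
qed (use m c in \<open>simp add: single_row_closed del: restrict_scalars_simps\<close>)

lemma single_row_lower:
  assumes q: "q < p" and p: "p < n" and m: "m \<in> carrier S" and s: "s \<in> carrier S"
  shows "act rows (lower_unit p q s) (single_row p m) = single_row q (m \<otimes>\<^bsub>S\<^esub> s)"
proof (rule rows_eqI)
  show "act rows (lower_unit p q s) (single_row p m) \<in> carrier rows"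
    by (rule right_module_closed[OF rows_module lower_unit_closed[OF s] single_row_closed[OF m]])
  show "act rows (lower_unit p q s) (single_row p m) i = single_row q (m \<otimes>\<^bsub>S\<^esub> s) i" if "i < n" for i
    unfolding single_row_act[OF lower_unit_closed[OF s] p m that] using that p q m by (simp add: \<tau>_units single_row_entry)
qed (use m s in \<open>simp add: single_row_closed del: restrict_scalars_simps\<close>)

lemma row_decomposition:
  assumes v: "v \<in> carrier rows"
  shows "finprod rows (\<lambda>i. single_row i (v i)) {..<n} = v"
proof -
  have R: "comm_group rows" by (rule right_module_group[OF rows_module])
  have cl: "(\<lambda>i. single_row i (v i)) \<in> {..<n} \<rightarrow> carrier rows"
    using rows_entry[OF v] single_row_closed by blast
  have ev: "(\<lambda>w. w p) \<in> hom rows (add_monoid S)" if "p < n" for p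
    using that by (intro homI) (auto simp: PiE_iff)
  show ?thesis
  proof (rule rows_eqI[OF _ v])
    show "finprod rows (\<lambda>i. single_row i (v i)) {..<n} \<in> carrier rows"
      by (rule comm_monoid.finprod_closed[OF comm_group.axioms(1)[OF R] cl])
    fix p assume p: "p < n"
    have "finprod rows (\<lambda>i. single_row i (v i)) {..<n} p = finprod (add_monoid S) (\<lambda>i. single_row i (v i) p) {..<n}"
      by (rule hom_finprod[OF R S.a_comm_group ev[OF p] cl])
    also have "\<dots> = single_row p (v p) p"
      by (rule comm_group.finprod_delta[OF S.a_comm_group p])
        (use p rows_entry[OF v p] in \<open>simp_all add: single_row_entry\<close>)
    finally show "finprod rows (\<lambda>i. single_row i (v i)) {..<n} p = v p" using p by (simp add: single_row_entry)
  qed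
qed

context
  fixes L :: "('s, 'l) rmodule" and H :: "nat \<Rightarrow> 'l set"
  assumes L: "left_module S L" and H: "flag H L"
begin

private abbreviation "N \<equiv> flag_cols H L"
private lemma N: "left_module A N" by (rule flag_cols_module[OF L H])
private lemma Lg: "comm_group L" by (rule left_module_group[OF L])
private lemma Hs: "i < n \<Longrightarrow> subgroup (H i) L" using H by (simp add: flag_def)
private lemma HL: "i < n \<Longrightarrow> x \<in> H i \<Longrightarrow> x \<in> carrier L" using subgroup.mem_carrier[OF Hs] .
private lemma TN: "comm_group (tensor A rows N)" by (rule comm_group_tensor[OF rows_module N])

lemma single_col_closed:
  assumes p: "p < n" and x: "x \<in> H p"
  shows "single_col L p x \<in> carrier N"
  unfolding flag_cols_carrier
proof (intro conjI allI impI)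
  show "single_col L p x \<in> carrier (cols L)"
    using HL[OF p x] monoid.one_closed[OF comm_monoid.axioms(1)[OF comm_group.axioms(1)[OF Lg]]]
    by (simp add: single_col_def)
  show "single_col L p x i \<in> H i" if "i < n" for i
    using x subgroup.one_closed[OF Hs[OF that]] that by (simp add: single_col_entry)
qed

lemma single_col_act:
  assumes a: "a \<in> carrier A" and p: "p < n" and x: "x \<in> carrier L" and i: "i < n"
  shows "act (cols L) a (single_col L p x) i = act L (\<tau> a (i, p)) x"
proof -
  have "finprod L (\<lambda>l. act L (\<tau> a (i, l)) (single_col L p x l)) {..<n} = act L (\<tau> a (i, p)) (single_col L p x p)"
    by (rule comm_group.finprod_delta[OF Lg p])
      (use x p left_module_act_one[OF L \<tau>_entry_closed[OF a i]] left_module_closed[OF L \<tau>_entry_closed[OF a i p] x] in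
        \<open>simp_all add: single_col_entry\<close>)
  then show ?thesis using i p by (simp add: single_col_entry)
qed

lemma single_col_diag:
  assumes p: "p < n" and x: "x \<in> H p" and c: "c \<in> carrier k"
  shows "act N (diag_unit p c) (single_col L p x) = single_col L p (act L (\<phi> c) x)"
  unfolding flag_cols_ops
proof (rule cols_eqI[of _ L])
  have "act N (diag_unit p c) (single_col L p x) \<in> carrier N"
    by (rule left_module_closed[OF N diag_unit_closed[OF c] single_col_closed[OF p x]])
  then show "act (cols L) (diag_unit p c) (single_col L p x) \<in> carrier (cols L)"
    unfolding flag_cols_carrier flag_cols_ops by (rule conjunct1)
  have "act L (\<phi> c) x \<in> H p" using H p x c by (simp add: flag_def)
  from single_col_closed[OF p this] show "single_col L p (act L (\<phi> c) x) \<in> carrier (cols L)"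
    unfolding flag_cols_carrier by (rule conjunct1)
  show "act (cols L) (diag_unit p c) (single_col L p x) i = single_col L p (act L (\<phi> c) x) i" if i: "i < n" for i
    unfolding single_col_act[OF diag_unit_closed[OF c] p HL[OF p x] i]
    using i p left_module_act_zero[OF L HL[OF p x]] by (simp add: \<tau>_units single_col_entry)
qed

lemma single_col_lower:
  assumes q: "q < p" and p: "p < n" and x: "x \<in> H q" and s: "s \<in> carrier S"
  shows "act N (lower_unit p q s) (single_col L q x) = single_col L p (act L s x)"
  unfolding flag_cols_ops
proof (rule cols_eqI[of _ L])
  have q': "q < n" using p q by simp
  have "act N (lower_unit p q s) (single_col L q x) \<in> carrier N"
    by (rule left_module_closed[OF N lower_unit_closed[OF s] single_col_closed[OF q' x]])
  then show "act (cols L) (lower_unit p q s) (single_col L q x) \<in> carrier (cols L)"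
    unfolding flag_cols_carrier flag_cols_ops by (rule conjunct1)
  have "act L s x \<in> H p" using H p q x s unfolding flag_def by blast
  from single_col_closed[OF p this] show "single_col L p (act L s x) \<in> carrier (cols L)"
    unfolding flag_cols_carrier by (rule conjunct1)
  show "act (cols L) (lower_unit p q s) (single_col L q x) i = single_col L p (act L s x) i" if i: "i < n" for i
    unfolding single_col_act[OF lower_unit_closed[OF s] q' HL[OF q' x] i]
    using i q q' left_module_act_zero[OF L HL[OF q' x]] by (simp add: \<tau>_units single_col_entry)
qed

abbreviation "entry_tensor p m x \<equiv> pure_tensor A rows N (single_row p m) (single_col L p x)"

lemma entry_tensor_scalar:
  assumes p: "p < n" and m: "m \<in> carrier S" and x: "x \<in> H p" and c: "c \<in> carrier k"
  shows "entry_tensor p (m \<otimes>\<^bsub>S\<^esub> \<phi> c) x = entry_tensor p m (act L (\<phi> c) x)"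
  using pure_tensor_act[OF rows_module N diag_unit_closed[OF c] single_row_closed[OF m] single_col_closed[OF p x], of p p]
  unfolding single_row_diag[OF p m c] single_col_diag[OF p x c] .

text \<open>
  The element of \<open>A\<close> with the single entry \<open>s\<close> in row \<open>p\<close> and column \<open>q\<close> moves a column entry from row \<open>q\<close> to row
  \<open>p\<close>, and a row entry from column \<open>p\<close> to column \<open>q\<close>.
\<close>

lemma entry_tensor_move:
  assumes q: "q < p" and p: "p < n" and m: "m \<in> carrier S" and x: "x \<in> H q" and s: "s \<in> carrier S"
  shows "entry_tensor p m (act L s x) = entry_tensor q (m \<otimes>\<^bsub>S\<^esub> s) x"
  using pure_tensor_act[OF rows_module N lower_unit_closed[OF s] single_row_closed[OF m] single_col_closed[OF _ x], of p q p] p q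
  unfolding single_row_lower[OF q p m s] single_col_lower[OF q p x s] by simp

lemma single_row_hom: "(\<lambda>m. single_row p m) \<in> hom (add_monoid S) rows"
  by (intro homI) (auto simp: single_row_def intro!: restrict_ext)

lemma single_col_hom:
  assumes p: "p < n" shows "single_col L p \<in> hom (L\<lparr>carrier := H p\<rparr>) N"
proof (rule homI)
  interpret L: comm_group L by (rule Lg)
  show "single_col L p x \<in> carrier N" if "x \<in> carrier (L\<lparr>carrier := H p\<rparr>)" for x
    using single_col_closed[OF p] that by simp
  show "single_col L p (x \<otimes>\<^bsub>L\<lparr>carrier := H p\<rparr>\<^esub> y) = single_col L p x \<otimes>\<^bsub>N\<^esub> single_col L p y" for x y
    by (auto simp: single_col_def intro!: restrict_ext)
qed

lemma entry_tensor_hom_right: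
  assumes p: "p < n" and m: "m \<in> carrier S"
  shows "(\<lambda>x. entry_tensor p m x) \<in> hom (L\<lparr>carrier := H p\<rparr>) (tensor A rows N)"
  using hom_compose[OF single_col_hom[OF p] pure_tensor_hom_right[OF rows_module N single_row_closed[OF m]]]
  by (simp add: comp_def)

lemma entry_tensor_hom_left:
  assumes p: "p < n" and x: "x \<in> H p"
  shows "(\<lambda>m. entry_tensor p m x) \<in> hom (add_monoid S) (tensor A rows N)"
  using hom_compose[OF single_row_hom pure_tensor_hom_left[OF rows_module N single_col_closed[OF p x]], of p]
  by (simp add: comp_def)

lemma entry_tensor_closed:
  "p < n \<Longrightarrow> m \<in> carrier S \<Longrightarrow> x \<in> H p \<Longrightarrow> entry_tensor p m x \<in> carrier (tensor A rows N)"
  by (rule pure_tensor_closed[OF rows_module N single_row_closed single_col_closed])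

lemma entry_tensor_one:
  assumes p: "p < n" and m: "m \<in> carrier S"
  shows "entry_tensor p m \<one>\<^bsub>L\<^esub> = \<one>\<^bsub>tensor A rows N\<^esub>"
  using comm_hom_one[OF entry_tensor_hom_right[OF p m] comm_group_subgroup[OF Lg Hs[OF p]] TN] by simp

lemma pure_tensor_entries:
  assumes m: "m \<in> carrier rows" and v: "v \<in> carrier N"
  shows "pure_tensor A rows N m v = finprod (tensor A rows N) (\<lambda>i. entry_tensor i (m i) (v i)) {..<n}"
proof -
  interpret T: comm_group "tensor A rows N" by (rule TN)
  have vc: "v \<in> carrier (cols L)" and vH: "\<And>i. i < n \<Longrightarrow> v i \<in> H i" using v unfolding flag_cols_carrier by blast+
  note mi = rows_entry[OF m]
  have cl: "(\<lambda>i. single_row i (m i)) \<in> {..<n} \<rightarrow> carrier rows" using mi single_row_closed by blast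
  have e: "act N (diag_unit i \<one>\<^bsub>k\<^esub>) v = single_col L i (v i)" if i: "i < n" for i
    unfolding flag_cols_ops
  proof (rule cols_eqI[of _ L])
    have "act N (diag_unit i \<one>\<^bsub>k\<^esub>) v \<in> carrier N" by (rule left_module_closed[OF N diag_unit_closed[OF k.one_closed] v])
    then show "act (cols L) (diag_unit i \<one>\<^bsub>k\<^esub>) v \<in> carrier (cols L)"
      unfolding flag_cols_carrier flag_cols_ops by (rule conjunct1)
    from single_col_closed[OF i vH[OF i]] show "single_col L i (v i) \<in> carrier (cols L)"
      unfolding flag_cols_carrier by (rule conjunct1)
    fix p assume p: "p < n"
    have "finprod L (\<lambda>l. act L (\<tau> (diag_unit i \<one>\<^bsub>k\<^esub>) (p, l)) (v l)) {..<n} = act L (\<tau> (diag_unit i \<one>\<^bsub>k\<^esub>) (p, i)) (v i)"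
      by (rule comm_group.finprod_delta[OF Lg i])
        (use p i left_module_act_zero[OF L cols_entry[OF vc]] left_module_one[OF L cols_entry[OF vc i]] cols_entry[OF vc i]
          monoid.one_closed[OF comm_monoid.axioms(1)[OF comm_group.axioms(1)[OF Lg]]] in \<open>simp_all add: \<tau>_units\<close>)
    then show "act (cols L) (diag_unit i \<one>\<^bsub>k\<^esub>) v p = single_col L i (v i) p"
      unfolding cols_act[OF p] using p i left_module_act_zero[OF L cols_entry[OF vc i]] left_module_one[OF L cols_entry[OF vc i]]
      by (simp add: \<tau>_units single_col_entry)
  qed
  have "pure_tensor A rows N m v = pure_tensor A rows N (finprod rows (\<lambda>i. single_row i (m i)) {..<n}) v"
    unfolding row_decomposition[OF m] ..
  also have "\<dots> = finprod (tensor A rows N) (\<lambda>i. pure_tensor A rows N (single_row i (m i)) v) {..<n}"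
    by (rule hom_finprod[OF right_module_group[OF rows_module] TN pure_tensor_hom_left[OF rows_module N v] cl])
  also have "\<dots> = finprod (tensor A rows N) (\<lambda>i. entry_tensor i (m i) (v i)) {..<n}"
  proof (rule T.finprod_cong'[OF refl])
    show "(\<lambda>i. entry_tensor i (m i) (v i)) \<in> {..<n} \<rightarrow> carrier (tensor A rows N)"
      using entry_tensor_closed[OF _ mi vH] by simp
    fix i assume "i \<in> {..<n}"
    then have i: "i < n" by simp
    have "act rows (diag_unit i \<one>\<^bsub>k\<^esub>) (single_row i (m i)) = single_row i (m i)"
      unfolding single_row_diag[OF i mi[OF i] k.one_closed] using mi[OF i] by simp
    then have "pure_tensor A rows N (single_row i (m i)) v = pure_tensor A rows N (act rows (diag_unit i \<one>\<^bsub>k\<^esub>) (single_row i (m i))) v"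
      by simp
    also have "\<dots> = pure_tensor A rows N (single_row i (m i)) (act N (diag_unit i \<one>\<^bsub>k\<^esub>) v)"
      by (rule pure_tensor_act[OF rows_module N diag_unit_closed[OF k.one_closed] single_row_closed[OF mi[OF i]] v])
    finally show "pure_tensor A rows N (single_row i (m i)) v = entry_tensor i (m i) (v i)" unfolding e[OF i] .
  qed
  finally show ?thesis .
qed

definition pairing :: "((nat \<Rightarrow> 's) \<times> (nat \<Rightarrow> 'l) \<Rightarrow>\<^sub>0 int) set \<Rightarrow> 'l" where
  "pairing = tensor_lift L (\<lambda>m v. finprod L (\<lambda>i. act L (m i) (v i)) {..<n})"

lemma pairing_balanced: "balanced A rows N L (\<lambda>m v. finprod L (\<lambda>i. act L (m i) (v i)) {..<n})"
proof -
  interpret L: comm_group L by (rule Lg)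
  have vc: "v i \<in> carrier L" if "v \<in> carrier N" "i < n" for v i
    using cols_entry[of v L i] that unfolding flag_cols_carrier by blast
  have cl: "(\<lambda>i. act L (m i) (v i)) \<in> {..<n} \<rightarrow> carrier L" if "m \<in> carrier rows" "v \<in> carrier N" for m v
    using left_module_closed[OF L rows_entry[OF that(1)] vc[OF that(2)]] by simp
  show ?thesis
  proof (rule balancedI)
    show "finprod L (\<lambda>i. act L (m i) (v i)) {..<n} \<in> carrier L" if "m \<in> carrier rows" "v \<in> carrier N" for m v
      by (rule L.finprod_closed[OF cl[OF that]])
    show "finprod L (\<lambda>i. act L (m i) ((v \<otimes>\<^bsub>N\<^esub> w) i)) {..<n} =
        finprod L (\<lambda>i. act L (m i) (v i)) {..<n} \<otimes>\<^bsub>L\<^esub> finprod L (\<lambda>i. act L (m i) (w i)) {..<n}"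
      if m: "m \<in> carrier rows" and v: "v \<in> carrier N" and w: "w \<in> carrier N" for m v w
      unfolding L.finprod_multf[OF cl[OF m v] cl[OF m w], symmetric]
      by (rule L.finprod_cong'[OF refl])
        (use left_module_closed[OF L rows_entry[OF m] vc[OF v]] left_module_closed[OF L rows_entry[OF m] vc[OF w]]
          left_module_add[OF L rows_entry[OF m] vc[OF v] vc[OF w]] in \<open>simp_all\<close>)
    show "finprod L (\<lambda>i. act L ((m \<otimes>\<^bsub>rows\<^esub> m') i) (v i)) {..<n} =
        finprod L (\<lambda>i. act L (m i) (v i)) {..<n} \<otimes>\<^bsub>L\<^esub> finprod L (\<lambda>i. act L (m' i) (v i)) {..<n}"
      if m: "m \<in> carrier rows" and m': "m' \<in> carrier rows" and v: "v \<in> carrier N" for m m' v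
      unfolding L.finprod_multf[OF cl[OF m v] cl[OF m' v], symmetric]
      by (rule L.finprod_cong'[OF refl])
        (use left_module_closed[OF L rows_entry[OF m] vc[OF v]] left_module_closed[OF L rows_entry[OF m'] vc[OF v]]
          left_module_scal[OF L rows_entry[OF m] rows_entry[OF m'] vc[OF v]] in \<open>simp_all\<close>)
    fix a m v assume a: "a \<in> carrier A" and m: "m \<in> carrier rows" and v: "v \<in> carrier N"
    have am: "act rows a m \<in> carrier rows" by (rule right_module_closed[OF rows_module a m])
    have av: "act N a v \<in> carrier N" by (rule left_module_closed[OF N a v])
    have "finprod L (\<lambda>l. act L (act rows a m l) (v l)) {..<n} =
        finprod L (\<lambda>l. act L (finsum S (\<lambda>i. m i \<otimes>\<^bsub>S\<^esub> \<tau> a (i, l)) {..<n}) (v l)) {..<n}"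
    proof (rule L.finprod_cong'[OF refl])
      have e: "act rows a m l = finsum S (\<lambda>i. m i \<otimes>\<^bsub>S\<^esub> \<tau> a (i, l)) {..<n}" if "l < n" for l using that by simp
      show "(\<lambda>l. act L (finsum S (\<lambda>i. m i \<otimes>\<^bsub>S\<^esub> \<tau> a (i, l)) {..<n}) (v l)) \<in> {..<n} \<rightarrow> carrier L"
        using left_module_closed[OF L rows_entry[OF am] vc[OF v]] by (simp add: e del: restrict_scalars_simps)
      show "act L (act rows a m l) (v l) = act L (finsum S (\<lambda>i. m i \<otimes>\<^bsub>S\<^esub> \<tau> a (i, l)) {..<n}) (v l)" if "l \<in> {..<n}" for l
        using e that by simp
    qed
    also have "\<dots> = finprod L (\<lambda>i. act L (m i) (finprod L (\<lambda>l. act L (\<tau> a (i, l)) (v l)) {..<n})) {..<n}"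
      by (rule act_sum_assoc[OF L]) (use rows_entry[OF m] \<tau>_entry_closed[OF a] vc[OF v] in blast)+
    also have "\<dots> = finprod L (\<lambda>i. act L (m i) (act N a v i)) {..<n}"
      by (rule L.finprod_cong'[OF refl])
        (use left_module_closed[OF L rows_entry[OF m] vc[OF av]] in \<open>simp_all\<close>)
    finally show "finprod L (\<lambda>l. act L (act rows a m l) (v l)) {..<n} = finprod L (\<lambda>i. act L (m i) (act N a v i)) {..<n}" .
  qed
qed

lemma pairing_hom: "pairing \<in> hom (tensor A rows N) L"
  unfolding pairing_def by (rule tensor_lift_hom[OF rows_module N Lg pairing_balanced])

lemma pairing_pure:
  "m \<in> carrier rows \<Longrightarrow> v \<in> carrier N \<Longrightarrow> pairing (pure_tensor A rows N m v) = finprod L (\<lambda>i. act L (m i) (v i)) {..<n}"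
  unfolding pairing_def by (rule tensor_lift_pure[OF rows_module N Lg pairing_balanced])

lemma pairing_entry:
  assumes p: "p < n" and m: "m \<in> carrier S" and x: "x \<in> H p"
  shows "pairing (entry_tensor p m x) = act L m x"
proof -
  have one: "\<one>\<^bsub>L\<^esub> \<in> carrier L" by (rule monoid.one_closed[OF comm_monoid.axioms(1)[OF comm_group.axioms(1)[OF Lg]]])
  have "finprod L (\<lambda>i. act L (single_row p m i) (single_col L p x i)) {..<n} = act L (single_row p m p) (single_col L p x p)"
    by (rule comm_group.finprod_delta[OF Lg p])
      (use p left_module_act_zero[OF L one] left_module_closed[OF L m HL[OF p x]] in \<open>simp_all add: single_row_entry single_col_entry\<close>)
  then show ?thesis
    unfolding pairing_pure[OF single_row_closed[OF m] single_col_closed[OF p x]]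
    using p by (simp add: single_row_entry single_col_entry)
qed

text \<open>
  Tensors with a single entry generate the tensor product, so on them alone a left inverse of the pairing
  needs to be checked.
\<close>

lemma pairing_left_inverse:
  assumes g: "g \<in> hom L (tensor A rows N)"
    and e: "\<And>i m x. i < n \<Longrightarrow> m \<in> carrier S \<Longrightarrow> x \<in> H i \<Longrightarrow> g (act L m x) = entry_tensor i m x"
    and t: "t \<in> carrier (tensor A rows N)"
  shows "g (pairing t) = t"
proof (rule tensor_hom_eqI[OF rows_module N TN _ iso_imp_homomorphism[OF iso_set_refl] _ t])
  show "(\<lambda>t. g (pairing t)) \<in> hom (tensor A rows N) (tensor A rows N)"
    using hom_compose[OF pairing_hom g] by (simp add: comp_def)
  fix m v assume m: "m \<in> carrier rows" and v: "v \<in> carrier N"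
  interpret T: comm_group "tensor A rows N" by (rule TN)
  have vH: "\<And>i. i < n \<Longrightarrow> v i \<in> H i" using v unfolding flag_cols_carrier by blast
  have "g (pairing (pure_tensor A rows N m v)) = g (finprod L (\<lambda>i. act L (m i) (v i)) {..<n})"
    unfolding pairing_pure[OF m v] ..
  also have "\<dots> = finprod (tensor A rows N) (\<lambda>i. g (act L (m i) (v i))) {..<n}"
    by (rule hom_finprod[OF Lg TN g]) (use left_module_closed[OF L rows_entry[OF m] HL[OF _ vH]] in simp)
  also have "\<dots> = finprod (tensor A rows N) (\<lambda>i. entry_tensor i (m i) (v i)) {..<n}"
    by (rule T.finprod_cong'[OF refl])
      (use entry_tensor_closed[OF _ rows_entry[OF m] vH] e[OF _ rows_entry[OF m] vH] in simp_all)
  finally show "g (pairing (pure_tensor A rows N m v)) = pure_tensor A rows N m v"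
    unfolding pure_tensor_entries[OF m v] .
qed

end

end

lemma trivial_group_of_iso:
  assumes "G \<cong> H" "group G" "group H" "\<And>x. x \<in> carrier H \<Longrightarrow> x = \<one>\<^bsub>H\<^esub>"
  shows "trivial_group G"
proof -
  obtain h where h: "h \<in> hom G H" "bij_betw h (carrier G) (carrier H)" using assms(1) by (auto simp: is_iso_def iso_def)
  interpret G: group G by fact
  have "x = \<one>\<^bsub>G\<^esub>" if "x \<in> carrier G" for x
  proof -
    have "h x = h \<one>\<^bsub>G\<^esub>" using assms(4)[OF hom_in_carrier[OF h(1) that]] assms(4)[OF hom_in_carrier[OF h(1) G.one_closed]] by simp
    then show ?thesis using h(2) that by (auto simp: bij_betw_def inj_on_def)
  qed
  then show ?thesis unfolding trivial_group_def using assms(2) G.one_closed by blast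
qed

lemma carrier_update_self [simp]: "L\<lparr>carrier := carrier L\<rparr> = (L :: ('r, 'm) rmodule)"
  by simp

declare iter_mult_kernel.simps(2) [simp del]

context triangular
begin

section \<open>Tensor products with the module of rows\<close>

text \<open>
  Every tensor with an entry in row \<open>j\<close> or below can be moved to the last row and back to row \<open>j\<close>, where the first
  factor becomes 1.  This requires that row \<open>j\<close> is not the last one.
\<close>

lemma rows_tensor_columns:
  assumes L: "left_module S L" and j: "Suc j < n"
  shows "pairing L \<in> iso (tensor A rows (Ncols j L)) L"
proof -
  let ?H = "lower_part j L" and ?T = "tensor A rows (Ncols j L)"
  note H = flag_lower_part[OF L, of j]
  define p where "p = n - 1"
  have p: "p < n" "j < p" "\<And>i. i < n \<Longrightarrow> i < p \<or> i = p" using j by (auto simp: p_def)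
  have jn: "j < n" using j by simp
  have Hj: "?H q = carrier L" if "j \<le> q" for q using that by (simp add: lower_part_def)
  let ?e = "\<lambda>i m x. entry_tensor L ?H i m x"
  let ?g = "\<lambda>x. ?e j \<one>\<^bsub>S\<^esub> x"
  have Lg: "comm_group L" by (rule left_module_group[OF L])
  have T: "comm_group ?T" by (rule comm_group_tensor[OF rows_module flag_cols_module[OF L H]])
  have g: "?g \<in> hom L ?T" using entry_tensor_hom_right[OF L H jn S.one_closed] by (simp add: Hj)
  note ac = left_module_closed[OF L]
  have mv: "?e q (m \<otimes>\<^bsub>S\<^esub> s) x = ?e p m (act L s x)"
    if "j \<le> q" "q < p" "m \<in> carrier S" "s \<in> carrier S" "x \<in> carrier L" for q m s x
    using entry_tensor_move[OF L H that(2) p(1) that(3) _ that(4), of x] that(1,5) by (simp add: Hj)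
  have e: "?g (act L m x) = ?e i m x" if i: "i < n" and m: "m \<in> carrier S" and x: "x \<in> ?H i" for i m x
  proof (cases "i < j")
    case True
    then have "x = \<one>\<^bsub>L\<^esub>" using x by (simp add: lower_part_def)
    then show ?thesis
      using left_module_act_one[OF L m] entry_tensor_one[OF L H jn S.one_closed] entry_tensor_one[OF L H i m] by simp
  next
    case False
    then have ji: "j \<le> i" and xL: "x \<in> carrier L" using x by (simp_all add: lower_part_def)
    have 1: "?e j \<one>\<^bsub>S\<^esub> (act L m x) = ?e p \<one>\<^bsub>S\<^esub> (act L m x)"
      using mv[OF order_refl p(2) S.one_closed S.one_closed ac[OF m xL]] left_module_one[OF L ac[OF m xL]] by simp
    have 2: "?e q m x = ?e p \<one>\<^bsub>S\<^esub> (act L m x)" if "j \<le> q" "q < p" for q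
      using mv[OF that S.one_closed m xL] m by simp
    show ?thesis
    proof (cases "i = p")
      case True
      have "?e p m x = ?e j m x" using mv[OF order_refl p(2) m S.one_closed xL] left_module_one[OF L xL] m by simp
      then show ?thesis unfolding True 1 2[OF order_refl p(2), symmetric] by simp
    next
      case False
      then have ip: "i < p" using p(3)[OF i] by simp
      show ?thesis unfolding 1 2[OF ji ip] by (rule refl)
    qed
  qed
  have "bij_betw (pairing L) (carrier ?T) (carrier L)"
  proof (rule bij_betw_byWitness[where f' = ?g])
    show "\<forall>t\<in>carrier ?T. ?g (pairing L t) = t"
      by (intro ballI pairing_left_inverse[OF L H g e])
    show "\<forall>x\<in>carrier L. pairing L (?g x) = x"
    proof
      fix x assume x: "x \<in> carrier L"
      have "pairing L (?g x) = act L \<one>\<^bsub>S\<^esub> x" by (rule pairing_entry[OF L H jn S.one_closed]) (simp add: Hj x)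
      then show "pairing L (?g x) = x" using left_module_one[OF L x] by simp
    qed
    show "pairing L ` carrier ?T \<subseteq> carrier L" by (rule hom_carrier[OF pairing_hom[OF L H]])
    show "?g ` carrier L \<subseteq> carrier ?T" by (rule hom_carrier[OF g])
  qed
  then show ?thesis by (rule isoI[OF pairing_hom[OF L H]])
qed

text \<open>
  Only the diagonal entry of \<open>A\<close> in the last row, an element of \<open>k\<close>, still acts on such a column.
\<close>

lemma rows_tensor_last_column:
  assumes L: "left_module S L" and j: "Suc j = n"
  obtains h where "h \<in> iso (tensor A rows (Ncols j L)) (ind L)"
    "\<And>t. t \<in> carrier (tensor A rows (Ncols j L)) \<Longrightarrow> mul L (h t) = pairing L t"
proof -
  let ?H = "lower_part j L" and ?T = "tensor A rows (Ncols j L)" and ?I = "tensor k Sr (Lk L)"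
  let ?N = "Ncols j L"
  note H = flag_lower_part[OF L, of j]
  note N = flag_cols_module[OF L H]
  have jn: "j < n" using j by simp
  have Hj: "?H j = carrier L" by (simp add: lower_part_def)
  note Lk = Lk_module[OF L]
  have Lg: "comm_group L" by (rule left_module_group[OF L])
  interpret Lg: comm_group L by (rule Lg)
  have T: "comm_group ?T" by (rule comm_group_tensor[OF rows_module N])
  interpret T: comm_group ?T by (rule T)
  have I: "comm_group ?I" by (rule comm_group_tensor[OF Sr_module Lk])
  have vc: "v i \<in> carrier L" if "v \<in> carrier ?N" "i < n" for v i
    using cols_entry[of v L i] that unfolding flag_cols_carrier by blast
  have v1: "v i = \<one>\<^bsub>L\<^esub>" if "v \<in> carrier ?N" "i < n" "i \<noteq> j" for v i
  proof -
    have "v i \<in> ?H i" "i < j" using that j unfolding flag_cols_carrier by auto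
    then show ?thesis by (simp add: lower_part_def)
  qed
  let ?q = "\<lambda>m v. tens L (m j) (v j)"
  have bal: "balanced A rows ?N ?I ?q"
  proof (rule balancedI)
    show "?q m v \<in> carrier ?I" if "m \<in> carrier rows" "v \<in> carrier ?N" for m v
      using tens_closed[OF L rows_entry[OF that(1) jn] vc[OF that(2) jn]] by simp
    show "?q m (v \<otimes>\<^bsub>?N\<^esub> w) = ?q m v \<otimes>\<^bsub>?I\<^esub> ?q m w" if "m \<in> carrier rows" "v \<in> carrier ?N" "w \<in> carrier ?N" for m v w
      using pure_tensor_mult_right[OF Sr_module Lk, of "m j" "v j" "w j"] rows_entry[OF that(1) jn] vc[OF that(2) jn] vc[OF that(3) jn] jn
      by simp
    show "?q (m \<otimes>\<^bsub>rows\<^esub> m') v = ?q m v \<otimes>\<^bsub>?I\<^esub> ?q m' v" if "m \<in> carrier rows" "m' \<in> carrier rows" "v \<in> carrier ?N" for m m' v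
      using pure_tensor_mult_left[OF Sr_module Lk, of "m j" "m' j" "v j"] rows_entry[OF that(1) jn] rows_entry[OF that(2) jn] vc[OF that(3) jn] jn
      by simp
    fix a m v assume a: "a \<in> carrier A" and m: "m \<in> carrier rows" and v: "v \<in> carrier ?N"
    have ta: "\<tau> a (i, l) \<in> carrier S" if "i < n" "l < n" for i l by (rule \<tau>_entry_closed[OF a that])
    have c: "fst a j \<in> carrier k" by (rule triangular_fst[OF a jn])
    have "finsum S (\<lambda>l. m l \<otimes>\<^bsub>S\<^esub> \<tau> a (l, j)) {..<n} = m j \<otimes>\<^bsub>S\<^esub> \<tau> a (j, j)"
    proof (rule S.finsum_delta[OF jn])
      show "m l \<otimes>\<^bsub>S\<^esub> \<tau> a (l, j) = \<zero>\<^bsub>S\<^esub>" if "l < n" "l \<noteq> j" for l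
        using that j jn rows_entry[OF m] by (simp add: \<tau>_entry)
      show "m j \<otimes>\<^bsub>S\<^esub> \<tau> a (j, j) \<in> carrier S" by (rule S.m_closed[OF rows_entry[OF m jn] ta[OF jn jn]])
    qed
    then have 1: "act rows a m j = m j \<otimes>\<^bsub>S\<^esub> \<phi> (fst a j)" using jn by (simp add: \<tau>_entry)
    have "finprod L (\<lambda>l. act L (\<tau> a (j, l)) (v l)) {..<n} = act L (\<tau> a (j, j)) (v j)"
      by (rule Lg.finprod_delta[OF jn])
        (use v1[OF v] left_module_act_one[OF L ta[OF jn]] left_module_closed[OF L ta[OF jn jn] vc[OF v jn]] in simp_all)
    then have 2: "act ?N a v j = act L (\<phi> (fst a j)) (v j)" using jn by (simp add: \<tau>_entry)
    show "?q (act rows a m) v = ?q m (act ?N a v)"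
      unfolding 1 2 by (rule tens_scalar[OF L rows_entry[OF m jn] c vc[OF v jn]])
  qed
  define h where "h = tensor_lift ?I ?q"
  have h: "h \<in> hom ?T ?I" unfolding h_def by (rule tensor_lift_hom[OF rows_module N I bal])
  have hp: "h (pure_tensor A rows ?N m v) = tens L (m j) (v j)" if "m \<in> carrier rows" "v \<in> carrier ?N" for m v
    unfolding h_def by (rule tensor_lift_pure[OF rows_module N I bal that])
  let ?e = "\<lambda>s x. entry_tensor L ?H j s x"
  have bal': "balanced k Sr (Lk L) ?T ?e"
  proof (rule balancedI)
    show "?e s x \<in> carrier ?T" if "s \<in> carrier Sr" "x \<in> carrier (Lk L)" for s x
      using entry_tensor_closed[OF L H jn, of s x] that by (simp add: Hj)
    show "?e s (x \<otimes>\<^bsub>Lk L\<^esub> y) = ?e s x \<otimes>\<^bsub>?T\<^esub> ?e s y" if "s \<in> carrier Sr" "x \<in> carrier (Lk L)" "y \<in> carrier (Lk L)" for s x y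
      using hom_mult[OF entry_tensor_hom_right[OF L H jn, of s], of x y] that by (simp add: Hj)
    show "?e (s \<otimes>\<^bsub>Sr\<^esub> t) x = ?e s x \<otimes>\<^bsub>?T\<^esub> ?e t x" if "s \<in> carrier Sr" "t \<in> carrier Sr" "x \<in> carrier (Lk L)" for s t x
      using hom_mult[OF entry_tensor_hom_left[OF L H jn, of x], of s t] that by (simp add: Hj)
    show "?e (act Sr c s) x = ?e s (act (Lk L) c x)" if "c \<in> carrier k" "s \<in> carrier Sr" "x \<in> carrier (Lk L)" for c s x
      using entry_tensor_scalar[OF L H jn _ _ that(1), of s x] that by (simp add: Hj)
  qed
  define g where "g = tensor_lift ?T ?e"
  have g: "g \<in> hom ?I ?T" unfolding g_def by (rule tensor_lift_hom[OF Sr_module Lk T bal'])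
  have gp: "g (tens L s x) = ?e s x" if "s \<in> carrier S" "x \<in> carrier L" for s x
    unfolding g_def by (rule tensor_lift_pure[OF Sr_module Lk T bal']) (simp_all add: that)
  have pe: "pure_tensor A rows ?N m v = ?e (m j) (v j)" if m: "m \<in> carrier rows" and v: "v \<in> carrier ?N" for m v
  proof -
    have "v j \<in> ?H j" using vc[OF v jn] by (simp add: Hj)
    then show ?thesis
      unfolding pure_tensor_entries[OF L H m v]
      by (intro T.finprod_delta[OF jn] entry_tensor_closed[OF L H jn rows_entry[OF m jn]])
        (use v1[OF v] entry_tensor_one[OF L H _ rows_entry[OF m]] in simp_all)
  qed
  have gh: "g (h t) = t" if t: "t \<in> carrier ?T" for t
  proof (rule tensor_hom_eqI[OF rows_module N T _ iso_imp_homomorphism[OF iso_set_refl] _ t])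
    show "(\<lambda>t. g (h t)) \<in> hom ?T ?T" using hom_compose[OF h g] by (simp add: comp_def)
    show "g (h (pure_tensor A rows ?N m v)) = pure_tensor A rows ?N m v" if "m \<in> carrier rows" "v \<in> carrier ?N" for m v
      unfolding hp[OF that] gp[OF rows_entry[OF that(1) jn] vc[OF that(2) jn]] by (rule pe[OF that, symmetric])
  qed
  have hg: "h (g t) = t" if t: "t \<in> carrier ?I" for t
  proof (rule tensor_hom_eqI[OF Sr_module Lk I _ iso_imp_homomorphism[OF iso_set_refl] _ t])
    show "(\<lambda>t. h (g t)) \<in> hom ?I ?I" using hom_compose[OF g h] by (simp add: comp_def)
    show "h (g (tens L s x)) = tens L s x" if "s \<in> carrier Sr" "x \<in> carrier (Lk L)" for s x
    proof -
      have s: "s \<in> carrier S" and x: "x \<in> carrier L" using that by simp_all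
      have "single_col L j x \<in> carrier ?N" by (rule single_col_closed[OF L H jn]) (simp add: Hj x)
      then show ?thesis unfolding gp[OF s x] using hp[OF single_row_closed[OF s]] jn by (simp add: single_row_entry single_col_entry)
    qed
  qed
  show thesis
  proof (rule that)
    have "bij_betw h (carrier ?T) (carrier ?I)"
      by (rule bij_betw_byWitness[where f' = g]) (use gh hg hom_carrier[OF h] hom_carrier[OF g] in blast)+
    then show "h \<in> iso ?T (ind L)" using h by (simp add: iso_def)
    show "mul L (h t) = pairing L t" if t: "t \<in> carrier ?T" for t
    proof (rule tensor_hom_eqI[OF rows_module N Lg _ pairing_hom[OF L H] _ t])
      show "(\<lambda>t. mul L (h t)) \<in> hom ?T L"
        using hom_compose[OF h, of "mul L" L] module_hom_hom[OF mul_hom[OF L]] by (simp add: comp_def)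
      fix m v assume m: "m \<in> carrier rows" and v: "v \<in> carrier ?N"
      have "v j \<in> ?H j" using vc[OF v jn] by (simp add: Hj)
      then show "mul L (h (pure_tensor A rows ?N m v)) = pairing L (pure_tensor A rows ?N m v)"
        unfolding hp[OF m v] mul_pure[OF L rows_entry[OF m jn] vc[OF v jn]]
        unfolding pe[OF m v] by (rule pairing_entry[OF L H jn rows_entry[OF m jn], symmetric])
    qed
  qed
qed

text \<open>
  Below row \<open>j\<close> an entry \<open>s \<otimes> x\<close> is \<open>s (1 \<otimes> x)\<close> and comes from the entry \<open>1 \<otimes> x\<close> in row \<open>j\<close>; so all tensors can
  be moved to row \<open>j\<close>, and \<open>s \<otimes> x \<mapsto> s \<otimes> (1 \<otimes> x)\<close>, in row \<open>j\<close>, undoes the pairing.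
\<close>

lemma pairing_cover_injective:
  assumes L: "left_module S L" and j: "j < n"
  shows "inj_on (pairing (ind L)) (carrier (tensor A rows (Fcols j L)))"
proof -
  let ?H = "generated_part j L" and ?T = "tensor A rows (Fcols j L)" and ?I = "tensor k Sr (Lk L)"
  note H = flag_generated_part[OF L, of j] and IM = ind_module[OF L]
  note Lk = Lk_module[OF L]
  have T: "comm_group ?T" by (rule comm_group_tensor[OF rows_module flag_cols_module[OF IM H]])
  let ?e = "\<lambda>i m x. entry_tensor (ind L) ?H i m x"
  have u: "tens L \<one>\<^bsub>S\<^esub> x \<in> ?H j" if "x \<in> carrier L" for x using that by (simp add: generated_part_def)
  have uh: "tens L \<one>\<^bsub>S\<^esub> \<in> hom L ((ind L)\<lparr>carrier := ?H j\<rparr>)"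
    using module_hom_mult[OF unit_hom[OF L]] u by (intro homI) simp_all
  let ?\<beta> = "\<lambda>s x. ?e j s (tens L \<one>\<^bsub>S\<^esub> x)"
  have bal: "balanced k Sr (Lk L) ?T ?\<beta>"
  proof (rule balancedI)
    show "?\<beta> s x \<in> carrier ?T" if "s \<in> carrier Sr" "x \<in> carrier (Lk L)" for s x
      using entry_tensor_closed[OF IM H j _ u, of s x] that by simp
    show "?\<beta> s (x \<otimes>\<^bsub>Lk L\<^esub> y) = ?\<beta> s x \<otimes>\<^bsub>?T\<^esub> ?\<beta> s y" if "s \<in> carrier Sr" "x \<in> carrier (Lk L)" "y \<in> carrier (Lk L)" for s x y
      using hom_mult[OF hom_compose[OF uh entry_tensor_hom_right[OF IM H j, of s]], of x y] that by simp
    show "?\<beta> (s \<otimes>\<^bsub>Sr\<^esub> t) x = ?\<beta> s x \<otimes>\<^bsub>?T\<^esub> ?\<beta> t x" if "s \<in> carrier Sr" "t \<in> carrier Sr" "x \<in> carrier (Lk L)" for s t x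
      using hom_mult[OF entry_tensor_hom_left[OF IM H j u, of x], of s t] that by simp
    show "?\<beta> (act Sr c s) x = ?\<beta> s (act (Lk L) c x)" if "c \<in> carrier k" "s \<in> carrier Sr" "x \<in> carrier (Lk L)" for c s x
      using entry_tensor_scalar[OF IM H j _ u that(1), of s x] module_hom_act[OF unit_hom[OF L] that(1), of x] that by simp
  qed
  define g where "g = tensor_lift ?T ?\<beta>"
  have g: "g \<in> hom (ind L) ?T" unfolding g_def using tensor_lift_hom[OF Sr_module Lk T bal] by simp
  have gp: "g (tens L s x) = ?\<beta> s x" if "s \<in> carrier S" "x \<in> carrier L" for s x
    unfolding g_def by (rule tensor_lift_pure[OF Sr_module Lk T bal]) (simp_all add: that)
  have Ig: "comm_group (ind L)" by (rule left_module_group[OF IM])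
  have e: "g (act (ind L) m y) = ?e i m y" if i: "i < n" and m: "m \<in> carrier S" and y: "y \<in> ?H i" for i m y
  proof -
    consider "i < j" | "i = j" | "j < i" by linarith
    then show ?thesis
    proof cases
      case 1
      then have "y = \<one>\<^bsub>ind L\<^esub>" using y by (simp add: generated_part_def del: ind_simps)
      then show ?thesis
        using left_module_act_one[OF IM m] entry_tensor_one[OF IM H i m] comm_hom_one[OF g Ig T] by (simp del: ind_simps)
    next
      case 2
      then obtain x where x: "x \<in> carrier L" "y = tens L \<one>\<^bsub>S\<^esub> x" using y by (auto simp: generated_part_def)
      have "g (act (ind L) m y) = ?\<beta> m x"
        unfolding x(2) ind_act_pure[OF L m S.one_closed x(1)] using gp[OF m x(1)] m by simp
      then show ?thesis using 2 x(2) by simp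
    next
      case 3
      have Hi: "?H i = carrier (ind L)" using 3 by (simp add: generated_part_def)
      have y': "y \<in> carrier ?I" using y unfolding Hi by simp
      show ?thesis
      proof (rule tensor_hom_eqI[OF Sr_module Lk T _ _ _ y'])
        show "(\<lambda>y. g (act (ind L) m y)) \<in> hom ?I ?T"
          using hom_compose[OF left_module_hom_action[OF IM m] g] by (simp add: comp_def)
        show "(\<lambda>y. ?e i m y) \<in> hom ?I ?T"
          using entry_tensor_hom_right[OF IM H i m] unfolding Hi carrier_update_self by simp
        fix s x assume "s \<in> carrier Sr" "x \<in> carrier (Lk L)"
        then have s: "s \<in> carrier S" and x: "x \<in> carrier L" by simp_all
        have "?e i m (tens L s x) = ?e i m (act (ind L) s (tens L \<one>\<^bsub>S\<^esub> x))"
          unfolding ind_act_pure[OF L s S.one_closed x] using s by simp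
        also have "\<dots> = ?e j (m \<otimes>\<^bsub>S\<^esub> s) (tens L \<one>\<^bsub>S\<^esub> x)"
          by (rule entry_tensor_move[OF IM H 3 i m u[OF x] s])
        also have "\<dots> = g (act (ind L) m (tens L s x))"
          unfolding ind_act_pure[OF L m s x] by (rule gp[OF S.m_closed[OF m s] x, symmetric])
        finally show "g (act (ind L) m (tens L s x)) = ?e i m (tens L s x)" by (rule sym)
      qed
    qed
  qed
  show ?thesis by (rule inj_on_inverseI[of _ g]) (rule pairing_left_inverse[OF IM H g e])
qed

text \<open>
  The pairing is natural, and it is injective on the cover; moreover \<open>\<rho>\<close> is injective.
\<close>

lemma rows_kernel:
  assumes L: "left_module S L" and L': "left_module S L'" and se: "short_exact S L' (ind L) L \<rho> (mul L)" and j: "j < n"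
  shows "tensor_kernel_right A rows (Ncols (Suc j) L') (Fcols j L) (\<lambda>v. \<lambda>i\<in>{..<n}. \<rho> (v i)) =
    (tensor A rows (Ncols (Suc j) L'))\<lparr>carrier := {t \<in> carrier (tensor A rows (Ncols (Suc j) L')). pairing L' t = \<one>\<^bsub>L'\<^esub>}\<rparr>"
proof -
  let ?N = "Ncols (Suc j) L'" and ?F = "Fcols j L" and ?a = "\<lambda>v. \<lambda>i\<in>{..<n}. \<rho> (v i)"
  note HN = flag_lower_part[OF L', of "Suc j"] and HF = flag_generated_part[OF L, of j] and IM = ind_module[OF L]
  note N = flag_cols_module[OF L' HN] and F = flag_cols_module[OF IM HF]
  note a = short_exactD(1)[OF columns_short_exact[OF L L' se, of j]] and \<rho> = short_exactD(1,2)[OF se]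
  have Ig: "comm_group (ind L)" by (rule left_module_group[OF IM])
  have L'g: "comm_group L'" by (rule left_module_group[OF L'])
  have ah: "tensor_right A rows ?F ?a \<in> hom (tensor A rows ?N) (tensor A rows ?F)"
    by (rule tensor_map_hom[OF rows_module N rows_module F module_hom_id a])
  have nat: "pairing (ind L) (tensor_right A rows ?F ?a t) = \<rho> (pairing L' t)" if t: "t \<in> carrier (tensor A rows ?N)" for t
  proof (rule tensor_hom_eqI[OF rows_module N Ig _ _ _ t])
    show "(\<lambda>t. pairing (ind L) (tensor_right A rows ?F ?a t)) \<in> hom (tensor A rows ?N) (ind L)"
      using hom_compose[OF ah pairing_hom[OF IM HF]] by (simp add: comp_def)
    show "(\<lambda>t. \<rho> (pairing L' t)) \<in> hom (tensor A rows ?N) (ind L)"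
      using hom_compose[OF pairing_hom[OF L' HN] module_hom_hom[OF \<rho>(1)]] by (simp add: comp_def)
    fix m v assume m: "m \<in> carrier rows" and v: "v \<in> carrier ?N"
    have vc: "v i \<in> carrier L'" if "i < n" for i using cols_entry[of v L' i] v that unfolding flag_cols_carrier by blast
    have cl: "act L' (m i) (v i) \<in> carrier L'" if "i < n" for i by (rule left_module_closed[OF L' rows_entry[OF m that] vc[OF that]])
    have "pairing (ind L) (tensor_right A rows ?F ?a (pure_tensor A rows ?N m v)) =
        finprod (ind L) (\<lambda>i. act (ind L) (m i) (?a v i)) {..<n}"
      unfolding tensor_map_pure[OF rows_module N rows_module F module_hom_id a m v]
      by (rule pairing_pure[OF IM HF m module_hom_closed[OF a v]])
    also have "\<dots> = finprod (ind L) (\<lambda>i. \<rho> (act L' (m i) (v i))) {..<n}"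
    proof (rule comm_monoid.finprod_cong'[OF comm_group.axioms(1)[OF Ig] refl])
      show "(\<lambda>i. \<rho> (act L' (m i) (v i))) \<in> {..<n} \<rightarrow> carrier (ind L)"
        using module_hom_closed[OF \<rho>(1) cl] by blast
      show "act (ind L) (m i) (?a v i) = \<rho> (act L' (m i) (v i))" if "i \<in> {..<n}" for i
        using that module_hom_act[OF \<rho>(1) rows_entry[OF m] vc, of i i] by simp
    qed
    also have "\<dots> = \<rho> (pairing L' (pure_tensor A rows ?N m v))"
      unfolding pairing_pure[OF L' HN m v]
      by (rule hom_finprod[OF L'g Ig module_hom_hom[OF \<rho>(1)], symmetric]) (use cl in blast)
    finally show "pairing (ind L) (tensor_right A rows ?F ?a (pure_tensor A rows ?N m v)) =
        \<rho> (pairing L' (pure_tensor A rows ?N m v))" .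
  qed
  have "tensor_right A rows ?F ?a t = \<one>\<^bsub>tensor A rows ?F\<^esub> \<longleftrightarrow> pairing L' t = \<one>\<^bsub>L'\<^esub>"
    if t: "t \<in> carrier (tensor A rows ?N)" for t
    using injective_hom_eq_one_iff[OF comm_group_tensor[OF rows_module F] Ig pairing_hom[OF IM HF]
        pairing_cover_injective[OF L j] hom_in_carrier[OF ah t]]
      injective_hom_eq_one_iff[OF L'g Ig module_hom_hom[OF \<rho>(1)] \<rho>(2) hom_in_carrier[OF pairing_hom[OF L' HN] t]]
    unfolding nat[OF t] by blast
  then have "kernel (tensor A rows ?N) (tensor A rows ?F) (tensor_right A rows ?F ?a) =
      {t \<in> carrier (tensor A rows ?N). pairing L' t = \<one>\<^bsub>L'\<^esub>}"
    unfolding kernel_def by blast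
  then show ?thesis unfolding tensor_kernel_right_def by simp
qed

section \<open>Tor of rows and columns\<close>

lemma tensor_trivial_right:
  assumes X: "right_module R X" and L: "left_module R L" and triv: "\<And>v. v \<in> carrier L \<Longrightarrow> v = \<one>\<^bsub>L\<^esub>"
    and t: "t \<in> carrier (tensor R X L)"
  shows "t = \<one>\<^bsub>tensor R X L\<^esub>"
proof -
  interpret T: comm_group "tensor R X L" by (rule comm_group_tensor[OF X L])
  have "t \<in> {\<one>\<^bsub>tensor R X L\<^esub>}"
    by (rule tensor_induct[OF X L T.triv_subgroup _ t]) (use triv pure_tensor_one_right[OF X L] in blast)
  then show ?thesis by simp
qed

lemma group_tensor_kernel_right:
  assumes X: "right_module R X" and L: "left_module R L" and F: "left_module R F" and a: "a \<in> module_hom R L F"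
  shows "comm_group (tensor_kernel_right R X L F a)"
  unfolding tensor_kernel_right_def
  by (intro comm_group_subgroup kernel_subgroup comm_group_tensor tensor_map_hom X L F module_hom_id a)

text \<open>
  The kernel is that of the pairing on \<open>M \<otimes> N\<^sub>i\<^sub>+\<^sub>1\<close>, which is injective if \<open>i + 1 < n - 1\<close>; for \<open>i + 1 \<ge> n\<close> all
  columns in \<open>N\<^sub>i\<^sub>+\<^sub>1\<close> vanish.
\<close>

theorem Tor_rows_middle:
  assumes fl: "flat_base" and i: "Suc i \<noteq> n - 1"
  shows "trivial_group (Tor A (Suc i) rows (res_N 0))"
proof -
  let ?K = "tensor_kernel_right A rows (res_N (Suc i)) (res_F i) (res_map i)"
  have K: "comm_group ?K"
    by (rule group_tensor_kernel_right[OF rows_module res_N_module res_F_module short_exactD(1)[OF res_short_exact]])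
  have iso: "Tor A (Suc i) rows (res_N 0) \<cong> ?K" using Tor_res_N[OF fl rows_module, of i 0] unfolding add_0_right .
  have "t = \<one>\<^bsub>?K\<^esub>" if t: "t \<in> carrier ?K" for t
  proof -
    have tc: "t \<in> carrier (tensor A rows (res_N (Suc i)))" using t by (simp add: tensor_kernel_right_def kernel_def)
    have "t = \<one>\<^bsub>tensor A rows (res_N (Suc i))\<^esub>"
    proof (cases "Suc i < n")
      case True
      then have i': "i < n" "Suc (Suc i) < n" using i by simp_all
      have p1: "pairing (iter (Suc i)) t = \<one>\<^bsub>iter (Suc i)\<^esub>"
        using t unfolding rows_kernel[OF iter_module iter_module iter_short_exact i'(1)] by simp
      note p = rows_tensor_columns[OF iter_module i'(2)]
      show ?thesis
        using injective_hom_eq_one_iff[OF comm_group_tensor[OF rows_module res_N_module] left_module_group[OF iter_module]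
            iso_imp_homomorphism[OF p] _ tc] p p1
        by (simp add: iso_def bij_betw_def)
    next
      case False
      have "v = \<one>\<^bsub>res_N (Suc i)\<^esub>" if v: "v \<in> carrier (res_N (Suc i))" for v
      proof (rule cols_eqI[of _ "iter (Suc i)"])
        show "v \<in> carrier (cols (iter (Suc i)))" using v unfolding flag_cols_carrier by blast
        have "\<one>\<^bsub>res_N (Suc i)\<^esub> \<in> carrier (res_N (Suc i))"
          by (rule monoid.one_closed[OF comm_monoid.axioms(1)[OF comm_group.axioms(1)[OF left_module_group[OF res_N_module]]]])
        then show "\<one>\<^bsub>res_N (Suc i)\<^esub> \<in> carrier (cols (iter (Suc i)))" unfolding flag_cols_carrier by (rule conjunct1)
        show "v l = \<one>\<^bsub>res_N (Suc i)\<^esub> l" if l: "l < n" for l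
        proof -
          have "v l \<in> lower_part (Suc i) (iter (Suc i)) l" using v l unfolding flag_cols_carrier by blast
          then show ?thesis using False l by (simp add: lower_part_def)
        qed
      qed
      then show ?thesis by (rule tensor_trivial_right[OF rows_module res_N_module _ tc])
    qed
    then show ?thesis by (simp add: tensor_kernel_right_def)
  qed
  then show ?thesis
    by (rule trivial_group_of_iso[OF iso group_Tor_Suc[OF rows_module res_N_module] comm_group.axioms(2)[OF K]])
qed

text \<open>
  Here the pairing on \<open>M \<otimes> N\<^sub>n\<^sub>-\<^sub>1\<close> is the multiplication map of the \<open>n-1\<close>-st iterated kernel.
\<close>

theorem Tor_rows_top:
  assumes fl: "flat_base" and i: "Suc (Suc i) = n"
  shows "Tor A (Suc i) rows (res_N 0) \<cong> iter n"
proof -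
  let ?L = "iter (Suc i)"
  have iso: "Tor A (Suc i) rows (res_N 0) \<cong> tensor_kernel_right A rows (res_N (Suc i)) (res_F i) (res_map i)"
    using Tor_res_N[OF fl rows_module, of i 0] unfolding add_0_right .
  have i': "i < n" using i by simp
  have e: "iter n = transport encode_coset (mult_kernel k S \<phi> ?L)"
    unfolding i[symmetric] by (rule iter_mult_kernel.simps(2))
  obtain h where h: "h \<in> iso (tensor A rows (res_N (Suc i))) (ind ?L)"
    and hm: "\<And>t. t \<in> carrier (tensor A rows (res_N (Suc i))) \<Longrightarrow> mul ?L (h t) = pairing ?L t"
    using rows_tensor_last_column[OF iter_module i] by blast
  have "tensor_kernel_right A rows (res_N (Suc i)) (res_F i) (res_map i) \<cong> (ind ?L)\<lparr>carrier := kernel (ind ?L) ?L (mul ?L)\<rparr>"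
    unfolding rows_kernel[OF iter_module iter_module iter_short_exact i']
  proof (rule iso_restrict_carrier[OF h])
    show "t \<in> {t \<in> carrier (tensor A rows (res_N (Suc i))). pairing ?L t = \<one>\<^bsub>?L\<^esub>} \<longleftrightarrow> h t \<in> kernel (ind ?L) ?L (mul ?L)"
      if t: "t \<in> carrier (tensor A rows (res_N (Suc i)))" for t
      using hm[OF t] hom_in_carrier[OF iso_imp_homomorphism[OF h] t] t unfolding kernel_def by simp
  qed (auto simp: kernel_def)
  also have "(ind ?L)\<lparr>carrier := kernel (ind ?L) ?L (mul ?L)\<rparr> = mult_kernel k S \<phi> ?L"
    by (simp only: mult_kernel_def kernel_module_def)
  also have "\<dots> \<cong> iter n"
    unfolding e
  proof (rule is_isoI, rule isoI)
    have inj: "inj_on (encode_coset :: _ \<Rightarrow> ('s, 's \<times> int) formal) (carrier (mult_kernel k S \<phi> ?L))"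
      by (rule inj_on_subset[OF inj_on_encode_coset[OF iter_module[of "Suc i"]]]) (auto simp: mult_kernel_def kernel_module_def kernel_def)
    show "encode_coset \<in> hom (mult_kernel k S \<phi> ?L) (transport encode_coset (mult_kernel k S \<phi> ?L))"
      by (rule module_hom_hom[OF transport_hom[OF inj]])
    show "bij_betw encode_coset (carrier (mult_kernel k S \<phi> ?L)) (carrier (transport encode_coset (mult_kernel k S \<phi> ?L)))"
      unfolding transport_simps(1)[OF inj] by (rule inj_on_imp_bij_betw[OF inj])
  qed
  finally (iso_trans) have "tensor_kernel_right A rows (res_N (Suc i)) (res_F i) (res_map i) \<cong> iter n" .
  from iso_trans[OF iso this] show ?thesis .
qed

end

section \<open>Finite direct sums\<close>

text \<open>
  The maps \<open>q r\<close> and \<open>p r\<close> are the injections and projections of a direct sum \<open>Y\<close> of copies of \<open>X\<close>.  Tensor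
  products preserve their equations, so no choice of a model for the sum is involved.
\<close>

definition biproduct :: "'r ring \<Rightarrow> 'i set \<Rightarrow> ('r, 'y) rmodule \<Rightarrow> ('r, 'x) rmodule \<Rightarrow> ('i \<Rightarrow> 'x \<Rightarrow> 'y) \<Rightarrow> ('i \<Rightarrow> 'y \<Rightarrow> 'x) \<Rightarrow> bool" where
  "biproduct R I Y X q p \<longleftrightarrow> finite I \<and> (\<forall>r\<in>I. p r \<in> module_hom R Y X \<and> q r \<in> module_hom R X Y) \<and>
    (\<forall>r\<in>I. \<forall>s\<in>I. \<forall>x\<in>carrier X. p r (q s x) = (if r = s then x else \<one>\<^bsub>X\<^esub>)) \<and>
    (\<forall>y\<in>carrier Y. finprod Y (\<lambda>r. q r (p r y)) I = y)"

lemma biproductD: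
  assumes "biproduct R I Y X q p"
  shows "finite I" "r \<in> I \<Longrightarrow> p r \<in> module_hom R Y X" "r \<in> I \<Longrightarrow> q r \<in> module_hom R X Y"
    "r \<in> I \<Longrightarrow> x \<in> carrier X \<Longrightarrow> p r (q r x) = x"
    "r \<in> I \<Longrightarrow> s \<in> I \<Longrightarrow> r \<noteq> s \<Longrightarrow> x \<in> carrier X \<Longrightarrow> p r (q s x) = \<one>\<^bsub>X\<^esub>"
    "y \<in> carrier Y \<Longrightarrow> finprod Y (\<lambda>r. q r (p r y)) I = y"
  using assms by (simp_all add: biproduct_def)

lemma biproduct_iso:
  assumes G: "comm_group G" and H: "comm_group H" and I: "finite I"
    and p: "\<And>r. r \<in> I \<Longrightarrow> p r \<in> hom G H" and q: "\<And>r. r \<in> I \<Longrightarrow> q r \<in> hom H G"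
    and id: "\<And>r x. r \<in> I \<Longrightarrow> x \<in> carrier H \<Longrightarrow> p r (q r x) = x"
    and tr: "\<And>r s x. r \<in> I \<Longrightarrow> s \<in> I \<Longrightarrow> r \<noteq> s \<Longrightarrow> x \<in> carrier H \<Longrightarrow> p r (q s x) = \<one>\<^bsub>H\<^esub>"
    and sum: "\<And>x. x \<in> carrier G \<Longrightarrow> finprod G (\<lambda>r. q r (p r x)) I = x"
  shows "(\<lambda>x. \<lambda>r\<in>I. p r x) \<in> iso G (product_group I (\<lambda>_. H))"
proof (rule isoI)
  interpret G: comm_group G by fact
  interpret H: comm_group H by fact
  note pc = hom_in_carrier[OF p] and qc = hom_in_carrier[OF q]
  show "(\<lambda>x. \<lambda>r\<in>I. p r x) \<in> hom G (product_group I (\<lambda>_. H))"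
    using pc hom_mult[OF p] by (intro homI) (auto intro!: restrict_ext)
  show "bij_betw (\<lambda>x. \<lambda>r\<in>I. p r x) (carrier G) (carrier (product_group I (\<lambda>_. H)))"
  proof (rule bij_betw_byWitness[where f' = "\<lambda>v. finprod G (\<lambda>r. q r (v r)) I"])
    show "\<forall>x\<in>carrier G. finprod G (\<lambda>r. q r ((\<lambda>r\<in>I. p r x) r)) I = x"
    proof
      fix x assume x: "x \<in> carrier G"
      have "finprod G (\<lambda>r. q r ((\<lambda>r\<in>I. p r x) r)) I = finprod G (\<lambda>r. q r (p r x)) I"
        by (rule G.finprod_cong') (use qc pc x in auto)
      then show "finprod G (\<lambda>r. q r ((\<lambda>r\<in>I. p r x) r)) I = x" using sum[OF x] by simp
    qed
    show "\<forall>v\<in>carrier (product_group I (\<lambda>_. H)). (\<lambda>s\<in>I. p s (finprod G (\<lambda>r. q r (v r)) I)) = v"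
    proof
      fix v assume v: "v \<in> carrier (product_group I (\<lambda>_. H))"
      then have vc: "v r \<in> carrier H" if "r \<in> I" for r using that by (auto simp: PiE_iff)
      have "p s (finprod G (\<lambda>r. q r (v r)) I) = v s" if s: "s \<in> I" for s
      proof -
        have "p s (finprod G (\<lambda>r. q r (v r)) I) = finprod H (\<lambda>r. p s (q r (v r))) I"
          by (rule hom_finprod[OF G H p[OF s]]) (use qc vc in blast)
        also have "\<dots> = finprod H (\<lambda>r. if s = r then v r else \<one>\<^bsub>H\<^esub>) I"
          by (rule H.finprod_cong') (use id tr s vc in auto)
        also have "\<dots> = v s" by (rule H.finprod_singleton[OF s I]) (use vc in blast)
        finally show ?thesis .
      qed
      then show "(\<lambda>s\<in>I. p s (finprod G (\<lambda>r. q r (v r)) I)) = v"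
        using v by (auto intro: restrict_ext PiE_ext simp: PiE_iff extensional_def)
    qed
    show "(\<lambda>x. \<lambda>r\<in>I. p r x) ` carrier G \<subseteq> carrier (product_group I (\<lambda>_. H))" using pc by auto
    show "(\<lambda>v. finprod G (\<lambda>r. q r (v r)) I) ` carrier (product_group I (\<lambda>_. H)) \<subseteq> carrier G"
      using qc by (auto intro!: G.finprod_closed simp: PiE_iff)
  qed
qed

lemma tensor_biproduct_left:
  assumes Y: "right_module R Y" and X: "right_module R X" and L: "left_module R L" and B: "biproduct R I Y X q p"
  shows "(\<lambda>t. \<lambda>r\<in>I. tensor_left R X L (p r) t) \<in> iso (tensor R Y L) (product_group I (\<lambda>_. tensor R X L))"
proof -
  note B = biproductD[OF B] and id = module_hom_id
  note T = comm_group_tensor[OF Y L] comm_group_tensor[OF X L]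
  interpret T: comm_group "tensor R Y L" by (rule T(1))
  let ?p = "\<lambda>r. tensor_left R X L (p r)" and ?q = "\<lambda>r. tensor_left R Y L (q r)"
  have ph: "?p r \<in> hom (tensor R Y L) (tensor R X L)" if "r \<in> I" for r by (rule tensor_map_hom[OF Y L X L B(2)[OF that] id])
  have qh: "?q r \<in> hom (tensor R X L) (tensor R Y L)" if "r \<in> I" for r by (rule tensor_map_hom[OF X L Y L B(3)[OF that] id])
  have pq: "?p r (?q s t) = tensor_left R X L (\<lambda>x. p r (q s x)) t" if "r \<in> I" "s \<in> I" "t \<in> carrier (tensor R X L)" for r s t
    by (rule tensor_map_comp[OF X L Y L X L B(3)[OF that(2)] id B(2)[OF that(1)] id that(3)])
  show ?thesis
  proof (rule biproduct_iso[OF T B(1) ph qh])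
    show "?p r (?q r t) = t" if "r \<in> I" "t \<in> carrier (tensor R X L)" for r t
      unfolding pq[OF that(1,1,2)]
      by (rule tensor_map_id_cong[OF X L module_hom_comp[OF B(3,2)[OF that(1)]] id B(4)[OF that(1)] refl that(2)])
    show "?p r (?q s t) = \<one>\<^bsub>tensor R X L\<^esub>" if "r \<in> I" "s \<in> I" "r \<noteq> s" "t \<in> carrier (tensor R X L)" for r s t
      unfolding pq[OF that(1,2,4)]
      by (rule tensor_map_eq_one[OF X L X L module_hom_comp[OF B(3)[OF that(2)] B(2)[OF that(1)]] id _ that(4)])
        (simp add: B(5)[OF that(1-3)])
    show "finprod (tensor R Y L) (\<lambda>r. ?q r (?p r t)) I = t" if t: "t \<in> carrier (tensor R Y L)" for t
    proof (rule tensor_hom_eqI[OF Y L T(1) _ iso_imp_homomorphism[OF iso_set_refl] _ t])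
      show "(\<lambda>t. finprod (tensor R Y L) (\<lambda>r. ?q r (?p r t)) I) \<in> hom (tensor R Y L) (tensor R Y L)"
        by (rule hom_finprod_pointwise[OF T(1)]) (use hom_compose[OF ph qh] in \<open>simp add: comp_def\<close>)
      fix y l assume y: "y \<in> carrier Y" and l: "l \<in> carrier L"
      have qp: "q r (p r y) \<in> carrier Y" if "r \<in> I" for r by (rule module_hom_closed[OF B(3)[OF that] module_hom_closed[OF B(2)[OF that] y]])
      have "finprod (tensor R Y L) (\<lambda>r. ?q r (?p r (pure_tensor R Y L y l))) I =
          finprod (tensor R Y L) (\<lambda>r. pure_tensor R Y L (q r (p r y)) l) I"
      proof (rule T.finprod_cong'[OF refl])
        show "(\<lambda>r. pure_tensor R Y L (q r (p r y)) l) \<in> I \<rightarrow> carrier (tensor R Y L)" using pure_tensor_closed[OF Y L qp l] by blast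
        show "?q r (?p r (pure_tensor R Y L y l)) = pure_tensor R Y L (q r (p r y)) l" if "r \<in> I" for r
          unfolding tensor_map_pure[OF Y L X L B(2)[OF that] id y l]
          by (rule tensor_map_pure[OF X L Y L B(3)[OF that] id module_hom_closed[OF B(2)[OF that] y] l])
      qed
      also have "\<dots> = pure_tensor R Y L (finprod Y (\<lambda>r. q r (p r y)) I) l"
        by (rule hom_finprod[OF right_module_group[OF Y] T(1) pure_tensor_hom_left[OF Y L l], symmetric]) (use qp in blast)
      finally show "finprod (tensor R Y L) (\<lambda>r. ?q r (?p r (pure_tensor R Y L y l))) I = pure_tensor R Y L y l"
        unfolding B(6)[OF y] .
    qed
  qed
qed

lemma tensor_biproduct_right:
  assumes X: "right_module R X" and Y: "left_module R Y" and L: "left_module R L" and B: "biproduct R I Y L q p"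
  shows "(\<lambda>t. \<lambda>r\<in>I. tensor_right R X L (p r) t) \<in> iso (tensor R X Y) (product_group I (\<lambda>_. tensor R X L))"
proof -
  note B = biproductD[OF B] and id = module_hom_id
  note T = comm_group_tensor[OF X Y] comm_group_tensor[OF X L]
  interpret T: comm_group "tensor R X Y" by (rule T(1))
  let ?p = "\<lambda>r. tensor_right R X L (p r)" and ?q = "\<lambda>r. tensor_right R X Y (q r)"
  have ph: "?p r \<in> hom (tensor R X Y) (tensor R X L)" if "r \<in> I" for r by (rule tensor_map_hom[OF X Y X L id B(2)[OF that]])
  have qh: "?q r \<in> hom (tensor R X L) (tensor R X Y)" if "r \<in> I" for r by (rule tensor_map_hom[OF X L X Y id B(3)[OF that]])
  have pq: "?p r (?q s t) = tensor_right R X L (\<lambda>l. p r (q s l)) t" if "r \<in> I" "s \<in> I" "t \<in> carrier (tensor R X L)" for r s t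
    by (rule tensor_map_comp[OF X L X Y X L id B(3)[OF that(2)] id B(2)[OF that(1)] that(3)])
  show ?thesis
  proof (rule biproduct_iso[OF T B(1) ph qh])
    show "?p r (?q r t) = t" if "r \<in> I" "t \<in> carrier (tensor R X L)" for r t
      unfolding pq[OF that(1,1,2)]
      by (rule tensor_map_id_cong[OF X L id module_hom_comp[OF B(3,2)[OF that(1)]] refl B(4)[OF that(1)] that(2)])
    show "?p r (?q s t) = \<one>\<^bsub>tensor R X L\<^esub>" if "r \<in> I" "s \<in> I" "r \<noteq> s" "t \<in> carrier (tensor R X L)" for r s t
      unfolding pq[OF that(1,2,4)]
      by (rule tensor_map_eq_one[OF X L X L id module_hom_comp[OF B(3)[OF that(2)] B(2)[OF that(1)]] _ that(4)])
        (simp add: B(5)[OF that(1-3)])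
    show "finprod (tensor R X Y) (\<lambda>r. ?q r (?p r t)) I = t" if t: "t \<in> carrier (tensor R X Y)" for t
    proof (rule tensor_hom_eqI[OF X Y T(1) _ iso_imp_homomorphism[OF iso_set_refl] _ t])
      show "(\<lambda>t. finprod (tensor R X Y) (\<lambda>r. ?q r (?p r t)) I) \<in> hom (tensor R X Y) (tensor R X Y)"
        by (rule hom_finprod_pointwise[OF T(1)]) (use hom_compose[OF ph qh] in \<open>simp add: comp_def\<close>)
      fix x y assume x: "x \<in> carrier X" and y: "y \<in> carrier Y"
      have qp: "q r (p r y) \<in> carrier Y" if "r \<in> I" for r by (rule module_hom_closed[OF B(3)[OF that] module_hom_closed[OF B(2)[OF that] y]])
      have "finprod (tensor R X Y) (\<lambda>r. ?q r (?p r (pure_tensor R X Y x y))) I =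
          finprod (tensor R X Y) (\<lambda>r. pure_tensor R X Y x (q r (p r y))) I"
      proof (rule T.finprod_cong'[OF refl])
        show "(\<lambda>r. pure_tensor R X Y x (q r (p r y))) \<in> I \<rightarrow> carrier (tensor R X Y)" using pure_tensor_closed[OF X Y x qp] by blast
        show "?q r (?p r (pure_tensor R X Y x y)) = pure_tensor R X Y x (q r (p r y))" if "r \<in> I" for r
          unfolding tensor_map_pure[OF X Y X L id B(2)[OF that] x y]
          by (rule tensor_map_pure[OF X L X Y id B(3)[OF that] x module_hom_closed[OF B(2)[OF that] y]])
      qed
      also have "\<dots> = pure_tensor R X Y x (finprod Y (\<lambda>r. q r (p r y)) I)"
        by (rule hom_finprod[OF left_module_group[OF Y] T(1) pure_tensor_hom_right[OF X Y x], symmetric]) (use qp in blast)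
      finally show "finprod (tensor R X Y) (\<lambda>r. ?q r (?p r (pure_tensor R X Y x y))) I = pure_tensor R X Y x y"
        unfolding B(6)[OF y] .
    qed
  qed
qed

text \<open>
  Kernels of natural maps between direct sums are the direct sums of the kernels, which makes Tor additive.
\<close>

lemma kernel_product_iso:
  assumes G: "comm_group G'" "comm_group H'" and a: "a \<in> hom G G'"
    and f: "(\<lambda>x. \<lambda>r\<in>I. p r x) \<in> iso G (product_group I (\<lambda>_. H))"
    and f': "(\<lambda>x. \<lambda>r\<in>I. p' r x) \<in> iso G' (product_group I (\<lambda>_. H'))"
    and comm: "\<And>r x. r \<in> I \<Longrightarrow> x \<in> carrier G \<Longrightarrow> p' r (a x) = b (p r x)"
  shows "(G\<lparr>carrier := kernel G G' a\<rparr>) \<cong> product_group I (\<lambda>_. H\<lparr>carrier := kernel H H' b\<rparr>)"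
proof -
  let ?P = "product_group I (\<lambda>_. H)" and ?P' = "product_group I (\<lambda>_. H')"
  let ?b = "\<lambda>v. \<lambda>r\<in>I. b (v r)"
  have "(G\<lparr>carrier := kernel G G' a\<rparr>) \<cong> (?P\<lparr>carrier := kernel ?P ?P' ?b\<rparr>)"
    by (rule kernel_iso[OF G(1) comm_group_product_group[OF G(2)] f f' a]) (auto intro!: restrict_ext simp: comm)
  also have "kernel ?P ?P' ?b = PiE I (\<lambda>_. kernel H H' b)"
    by (auto simp: kernel_def PiE_iff restrict_def fun_eq_iff extensional_def)
  also have "?P\<lparr>carrier := PiE I (\<lambda>_. kernel H H' b)\<rparr> = product_group I (\<lambda>_. H\<lparr>carrier := kernel H H' b\<rparr>)"
    by (simp add: product_group_def)
  finally show ?thesis .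
qed

lemma tensor_kernel_biproduct_left:
  assumes Y: "right_module R Y" and X: "right_module R X" and L: "left_module R L" and F: "left_module R F"
    and a: "a \<in> module_hom R L F" and B: "biproduct R I Y X q p"
  shows "tensor_kernel_right R Y L F a \<cong> product_group I (\<lambda>_. tensor_kernel_right R X L F a)"
  unfolding tensor_kernel_right_def
proof (rule kernel_product_iso[OF comm_group_tensor[OF Y F] comm_group_tensor[OF X F] tensor_map_hom[OF Y L Y F module_hom_id a]
      tensor_biproduct_left[OF Y X L B] tensor_biproduct_left[OF Y X F B]])
  fix r t assume r: "r \<in> I" and t: "t \<in> carrier (tensor R Y L)"
  note p = biproductD(2)[OF B r] and id = module_hom_id
  show "tensor_left R X F (p r) (tensor_right R Y F a t) = tensor_right R X F a (tensor_left R X L (p r) t)"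
    unfolding tensor_map_comp[OF Y L Y F X F id a p id t] tensor_map_comp[OF Y L X L X F p id id a t] ..
qed

lemma tensor_kernel_biproduct_right:
  assumes X: "right_module R X" and P: "right_module R P" and Y: "left_module R Y" and L: "left_module R L"
    and i: "i \<in> module_hom R X P" and B: "biproduct R I Y L q p"
  shows "tensor_kernel_left R X P i Y \<cong> product_group I (\<lambda>_. tensor_kernel_left R X P i L)"
  unfolding tensor_kernel_left_def
proof (rule kernel_product_iso[OF comm_group_tensor[OF P Y] comm_group_tensor[OF P L] tensor_map_hom[OF X Y P Y i module_hom_id]
      tensor_biproduct_right[OF X Y L B] tensor_biproduct_right[OF P Y L B]])
  fix r t assume r: "r \<in> I" and t: "t \<in> carrier (tensor R X Y)"
  note p = biproductD(2)[OF B r] and id = module_hom_id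
  show "tensor_right R P L (p r) (tensor_left R P Y i t) = tensor_left R P L i (tensor_right R X L (p r) t)"
    unfolding tensor_map_comp[OF X Y P Y P L i id id p t] tensor_map_comp[OF X Y X L P L id p i id t] ..
qed

lemma group_Tor:
  assumes "right_module R X" "left_module R L" shows "group (Tor R i X L)"
  by (cases i) (simp_all add: group_Tor_zero group_Tor_Suc assms)

lemma group_tensor_kernel_left:
  assumes X: "right_module R X" and P: "right_module R P" and L: "left_module R L" and i: "i \<in> module_hom R X P"
  shows "comm_group (tensor_kernel_left R X P i L)"
  unfolding tensor_kernel_left_def
  by (intro comm_group_subgroup kernel_subgroup comm_group_tensor tensor_map_hom X L P module_hom_id i)

lemma product_iso_chain:
  assumes "G \<cong> G'" "G' \<cong> product_group I (\<lambda>_. H')" "H \<cong> H'" "group H" "group H'"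
  shows "G \<cong> product_group I (\<lambda>_. H)"
proof -
  have "product_group I (\<lambda>_. H') \<cong> product_group I (\<lambda>_. H)"
    using iso_product_groupI[of I "\<lambda>_. H'" "\<lambda>_. H"] group.iso_sym[OF assms(4,3)] assms(4,5) by blast
  then show ?thesis using iso_trans[OF assms(1) iso_trans[OF assms(2)]] by blast
qed

theorem Tor_biproduct_right:
  assumes X: "right_module R X" and Y: "left_module R Y" and L: "left_module R L" and B: "biproduct R I Y L q p"
  shows "Tor R i X Y \<cong> product_group I (\<lambda>_. Tor R i X L)"
proof (cases i)
  case 0
  show ?thesis unfolding 0
    by (rule product_iso_chain[OF Tor_zero_iso(1)[OF X Y] is_isoI[OF tensor_biproduct_right[OF X Y L B]] Tor_zero_iso(1)[OF X L]
          group_Tor[OF X L] comm_group.axioms(2)[OF comm_group_tensor[OF X L]]])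
next
  case (Suc j)
  note s = right_module_syzygy[OF X] right_module_resolution[OF X] and i = short_exactD(1)[OF syzygy_short_exact[OF X]]
  show ?thesis unfolding Suc
    by (rule product_iso_chain[OF Tor_Suc_iso(1)[OF X Y] tensor_kernel_biproduct_right[OF s Y L i B] Tor_Suc_iso(1)[OF X L]
          group_Tor[OF X L] comm_group.axioms(2)[OF group_tensor_kernel_left[OF s L i]]])
qed

theorem Tor_iso_right:
  assumes X: "right_module R X" and Y: "left_module R Y" and L: "left_module R L" and h: "h \<in> module_hom R Y L" "bij_betw h (carrier Y) (carrier L)"
  shows "Tor R i X Y \<cong> Tor R i X L"
proof -
  note id = module_hom_id
  have t: "tensor_right R Z L h \<in> iso (tensor R Z Y) (tensor R Z L)" if Z: "right_module R Z" for Z :: "('a, 'z) rmodule"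
    by (rule tensor_map_iso[OF Z Y Z L id _ h]) (simp add: bij_betw_def)
  show ?thesis
  proof (cases i)
    case 0
    show ?thesis unfolding 0
      by (rule iso_trans[OF iso_trans[OF Tor_zero_iso(1)[OF X Y] is_isoI[OF t[OF X]]] group.iso_sym[OF group_Tor_zero[OF X L] Tor_zero_iso(1)[OF X L]]])
  next
    case (Suc j)
    note s = right_module_syzygy[OF X, of "Suc j"] right_module_resolution[OF X, of j] and i = short_exactD(1)[OF syzygy_short_exact[OF X], of j]
    have "tensor_kernel_left R (syzygy R X (Suc j)) (resolution R X j) (syzygy_inclusion R X j) Y \<cong>
        tensor_kernel_left R (syzygy R X (Suc j)) (resolution R X j) (syzygy_inclusion R X j) L"
      unfolding tensor_kernel_left_def
    proof (rule kernel_iso[OF comm_group_tensor[OF s(2) Y] comm_group_tensor[OF s(2) L] t[OF s(1)] t[OF s(2)] tensor_map_hom[OF s(1) Y s(2) Y i id]])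
      fix u assume u: "u \<in> carrier (tensor R (syzygy R X (Suc j)) Y)"
      show "tensor_right R (resolution R X j) L h (tensor_left R (resolution R X j) Y (syzygy_inclusion R X j) u) =
          tensor_left R (resolution R X j) L (syzygy_inclusion R X j) (tensor_right R (syzygy R X (Suc j)) L h u)"
        unfolding tensor_map_comp[OF s(1) Y s(2) Y s(2) L i id id h(1) u] tensor_map_comp[OF s(1) Y s(1) L s(2) L id h(1) i id u] ..
    qed
    then show ?thesis unfolding Suc
      by (rule iso_trans[OF iso_trans[OF Tor_Suc_iso(1)[OF X Y]] group.iso_sym[OF group_Tor_Suc[OF X L] Tor_Suc_iso(1)[OF X L]]])
  qed
qed

section \<open>Matrices as sums of rows and of columns\<close>

lemma trivial_group_iso:
  assumes "G \<cong> H" "group G" "trivial_group H" shows "trivial_group G"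
  by (rule trivial_group_of_iso[OF assms(1,2)]) (use assms(3) in \<open>simp_all add: trivial_group_def\<close>)

lemma product_product_group:
  "product_group I (\<lambda>_. product_group J (\<lambda>_. G)) \<cong> product_group (I \<times> J) (\<lambda>_. G)"
proof (rule is_isoI, rule isoI)
  let ?h = "\<lambda>F. \<lambda>(i, j)\<in>I \<times> J. F i j" and ?g = "\<lambda>X. \<lambda>i\<in>I. \<lambda>j\<in>J. X (i, j)"
  show "?h \<in> hom (product_group I (\<lambda>_. product_group J (\<lambda>_. G))) (product_group (I \<times> J) (\<lambda>_. G))"
    by (rule homI) (auto simp: PiE_iff intro!: restrict_ext)
  show "bij_betw ?h (carrier (product_group I (\<lambda>_. product_group J (\<lambda>_. G)))) (carrier (product_group (I \<times> J) (\<lambda>_. G)))"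
  proof (rule bij_betw_byWitness[where f' = ?g])
    show "\<forall>F\<in>carrier (product_group I (\<lambda>_. product_group J (\<lambda>_. G))). ?g (?h F) = F"
      by (auto simp: PiE_iff extensional_def restrict_def fun_eq_iff)
    show "\<forall>X\<in>carrier (product_group (I \<times> J) (\<lambda>_. G)). ?h (?g X) = X"
      by (auto simp: PiE_iff extensional_def restrict_def fun_eq_iff)
    show "?h ` carrier (product_group I (\<lambda>_. product_group J (\<lambda>_. G))) \<subseteq> carrier (product_group (I \<times> J) (\<lambda>_. G))"
      unfolding carrier_product_group by (intro image_subsetI restrict_PiE_iff[THEN iffD2]) auto
    show "?g ` carrier (product_group (I \<times> J) (\<lambda>_. G)) \<subseteq> carrier (product_group I (\<lambda>_. product_group J (\<lambda>_. G)))"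
      by (auto simp: PiE_iff)
  qed
qed

lemma matrix_group_iso:
  assumes "G \<cong> H" "group G" "group H" shows "matrix_group n G \<cong> matrix_group n H"
  unfolding matrix_group_def using assms by (intro iso_product_groupI)

context triangular
begin

abbreviation "Mat_l \<equiv> restrict_scalars \<tau> (left_regular Mat)"
abbreviation "Mat_r \<equiv> restrict_scalars \<tau> (right_regular Mat)"
abbreviation "colS \<equiv> restrict_scalars \<tau> (column_module n S)"

lemma Mat_l_module: "left_module A Mat_l"
  by (rule left_module_restrict[OF ring_triangular \<tau>_ring_hom left_module_regular[OF Mat.ring_axioms]])

lemma Mat_r_module: "right_module A Mat_r"
  by (rule right_module_restrict[OF ring_triangular \<tau>_ring_hom right_module_regular[OF Mat.ring_axioms]])

lemma colS_eq: "colS = cols (left_regular S)"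
  by (simp only: column_module_eq)

lemma Ncols_zero: "Ncols 0 L = cols L"
proof -
  have "v i \<in> lower_part 0 L i" if "v \<in> carrier (cols L)" "i \<in> {..<n}" for v i
    unfolding lower_part_def using cols_entry[OF that(1)] that(2) by (simp del: restrict_scalars_simps)
  then have e: "{v \<in> carrier (cols L). \<forall>i\<in>{..<n}. v i \<in> lower_part 0 L i} = carrier (cols L)" by blast
  show ?thesis unfolding flag_cols_def e by (rule carrier_update_self)
qed

lemma colS_module: "left_module A colS"
  unfolding colS_eq by (rule cols_module[OF left_module_regular[OF ring_S]])

lemma matrix_finsum_single:
  assumes Q: "\<And>r. r < n \<Longrightarrow> Q r \<in> carrier Mat" and X: "X \<in> carrier Mat"
    and g: "\<And>i j. i < n \<Longrightarrow> j < n \<Longrightarrow> g i j < n" "\<And>i j. i < n \<Longrightarrow> j < n \<Longrightarrow> Q (g i j) (i, j) = X (i, j)"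
    and z: "\<And>i j r. i < n \<Longrightarrow> j < n \<Longrightarrow> r < n \<Longrightarrow> r \<noteq> g i j \<Longrightarrow> Q r (i, j) = \<zero>\<^bsub>S\<^esub>"
  shows "finsum Mat Q {..<n} = X"
proof (rule matrix_eqI)
  have s: "finsum Mat Q {..<n} \<in> carrier Mat" by (rule Mat.finsum_closed) (use Q in blast)
  then show "finsum Mat Q {..<n} \<in> {..<n} \<times> {..<n} \<rightarrow>\<^sub>E carrier S" unfolding matrix_ring_simps .
  show "X \<in> {..<n} \<times> {..<n} \<rightarrow>\<^sub>E carrier S" using X unfolding matrix_ring_simps .
  fix i j assume ij: "i < n" "j < n"
  have ev: "(\<lambda>X. X (i, j)) \<in> hom (add_monoid Mat) (add_monoid S)"
    using ij by (intro homI) (auto simp: matrix_ring_simps PiE_iff)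
  have "finsum Mat Q {..<n} (i, j) = finsum S (\<lambda>r. Q r (i, j)) {..<n}"
    unfolding finsum_def
    by (rule hom_finprod[OF Mat.a_comm_group S.a_comm_group ev]) (use Q in simp)
  also have "\<dots> = Q (g i j) (i, j)"
  proof (rule S.finsum_delta[OF g(1)[OF ij] z[OF ij]])
    show "Q (g i j) (i, j) \<in> carrier S" using Q[OF g(1)[OF ij]] ij by (auto simp: matrix_ring_simps PiE_iff)
  qed
  finally show "finsum Mat Q {..<n} (i, j) = X (i, j)" unfolding g(2)[OF ij] .
qed

lemma finprod_Mat_r: "finprod Mat_r f I = finsum Mat f I"
  and finprod_Mat_l: "finprod Mat_l f I = finsum Mat f I"
  by (simp_all add: finsum_def finprod_def left_regular_def right_regular_def)

lemma Mat_entry: "X \<in> carrier Mat \<Longrightarrow> i < n \<Longrightarrow> j < n \<Longrightarrow> X (i, j) \<in> carrier S"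
  by (auto simp: matrix_ring_simps PiE_iff)

lemma matrix_rows_biproduct:
  "biproduct A {..<n} Mat_r rows (\<lambda>r v. \<lambda>(i, j)\<in>{..<n} \<times> {..<n}. if i = r then v j else \<zero>\<^bsub>S\<^esub>) (\<lambda>r X. \<lambda>j\<in>{..<n}. X (r, j))"
    (is "biproduct _ _ _ _ ?q ?p")
  unfolding biproduct_def
proof (intro conjI ballI)
  fix r assume "r \<in> {..<n}"
  then have r: "r < n" by simp
  show "?p r \<in> module_hom A Mat_r rows"
  proof (rule module_hom_restrict[OF \<tau>_ring_hom module_homI])
    show "?p r X \<in> carrier (row_module n S)" if "X \<in> carrier (right_regular Mat)" for X
      using that r by (auto simp: right_regular_def matrix_ring_simps PiE_iff)
    show "?p r (X \<otimes>\<^bsub>right_regular Mat\<^esub> Y) = ?p r X \<otimes>\<^bsub>row_module n S\<^esub> ?p r Y" for X Y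
      using r by (auto simp: right_regular_def matrix_ring_simps intro!: restrict_ext)
    show "?p r (act (right_regular Mat) a X) = act (row_module n S) a (?p r X)" if "a \<in> carrier Mat" "X \<in> carrier (right_regular Mat)" for a X
      using r that
      by (auto simp: right_regular_def matrix_ring_simps(2) mat_mult_entry intro!: restrict_ext S.add.finprod_cong' S.m_closed Mat_entry)
  qed
  show "?q r \<in> module_hom A rows Mat_r"
  proof (rule module_hom_restrict[OF \<tau>_ring_hom module_homI])
    show "?q r v \<in> carrier (right_regular Mat)" if "v \<in> carrier (row_module n S)" for v
      using that by (auto simp: right_regular_def matrix_ring_simps PiE_iff)
    show "?q r (v \<otimes>\<^bsub>row_module n S\<^esub> w) = ?q r v \<otimes>\<^bsub>right_regular Mat\<^esub> ?q r w" for v w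
      by (auto simp: right_regular_def matrix_ring_simps intro!: restrict_ext)
    fix a v assume a: "a \<in> carrier Mat" and v: "v \<in> carrier (row_module n S)"
    show "?q r (act (row_module n S) a v) = act (right_regular Mat) a (?q r v)"
    proof (rule ext, clarify)
      fix i j
      have "(\<Oplus>\<^bsub>S\<^esub>l\<in>{..<n}. ?q r v (i, l) \<otimes>\<^bsub>S\<^esub> a (l, j)) = (if i = r then \<Oplus>\<^bsub>S\<^esub>l\<in>{..<n}. v l \<otimes>\<^bsub>S\<^esub> a (l, j) else \<zero>\<^bsub>S\<^esub>)"
        if ij: "i < n" "j < n"
      proof -
        have vc: "v l \<in> carrier S" if "l < n" for l using v that by (auto simp: PiE_iff)
        have "(\<Oplus>\<^bsub>S\<^esub>l\<in>{..<n}. ?q r v (i, l) \<otimes>\<^bsub>S\<^esub> a (l, j)) = (\<Oplus>\<^bsub>S\<^esub>l\<in>{..<n}. if i = r then v l \<otimes>\<^bsub>S\<^esub> a (l, j) else \<zero>\<^bsub>S\<^esub>)"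
          by (rule S.add.finprod_cong') (use ij vc Mat_entry[OF a] in auto)
        then show ?thesis by auto
      qed
      then show "?q r (act (row_module n S) a v) (i, j) = act (right_regular Mat) a (?q r v) (i, j)"
        by (auto simp: right_regular_def matrix_ring_simps(2) mat_mult_def)
    qed
  qed
  fix s v assume "s \<in> {..<n}" and v: "v \<in> carrier rows"
  then have s: "s < n" by simp
  show "?p r (?q s v) = (if r = s then v else \<one>\<^bsub>rows\<^esub>)"
    using r s v by (auto simp: PiE_iff extensional_def restrict_def fun_eq_iff)
next
  fix X assume "X \<in> carrier Mat_r"
  then have X: "X \<in> carrier Mat" by (simp add: right_regular_def)
  show "finprod Mat_r (\<lambda>r. ?q r (?p r X)) {..<n} = X"
    unfolding finprod_Mat_r
    by (rule matrix_finsum_single[where g = "\<lambda>i j. i"]) (use X Mat_entry[OF X] in \<open>auto simp: matrix_ring_simps(1)\<close>)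
qed simp

lemma matrix_columns_biproduct:
  "biproduct A {..<n} Mat_l colS (\<lambda>r v. \<lambda>(i, j)\<in>{..<n} \<times> {..<n}. if j = r then v i else \<zero>\<^bsub>S\<^esub>) (\<lambda>r X. \<lambda>i\<in>{..<n}. X (i, r))"
    (is "biproduct _ _ _ _ ?q ?p")
  unfolding biproduct_def
proof (intro conjI ballI)
  fix r assume "r \<in> {..<n}"
  then have r: "r < n" by simp
  show "?p r \<in> module_hom A Mat_l colS"
  proof (rule module_hom_restrict[OF \<tau>_ring_hom module_homI])
    show "?p r X \<in> carrier (column_module n S)" if "X \<in> carrier (left_regular Mat)" for X
      using that r by (auto simp: left_regular_def column_module_def matrix_ring_simps PiE_iff)
    show "?p r (X \<otimes>\<^bsub>left_regular Mat\<^esub> Y) = ?p r X \<otimes>\<^bsub>column_module n S\<^esub> ?p r Y" for X Y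
      using r by (auto simp: left_regular_def column_module_def matrix_ring_simps intro!: restrict_ext)
    show "?p r (act (left_regular Mat) a X) = act (column_module n S) a (?p r X)" if "a \<in> carrier Mat" "X \<in> carrier (left_regular Mat)" for a X
      using r that
      by (auto simp: left_regular_def column_module_def matrix_ring_simps(2) mat_mult_entry
          intro!: restrict_ext S.add.finprod_cong' S.m_closed Mat_entry)
  qed
  show "?q r \<in> module_hom A colS Mat_l"
  proof (rule module_hom_restrict[OF \<tau>_ring_hom module_homI])
    show "?q r v \<in> carrier (left_regular Mat)" if "v \<in> carrier (column_module n S)" for v
      using that by (auto simp: left_regular_def column_module_def matrix_ring_simps PiE_iff)
    show "?q r (v \<otimes>\<^bsub>column_module n S\<^esub> w) = ?q r v \<otimes>\<^bsub>left_regular Mat\<^esub> ?q r w" for v w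
      by (auto simp: left_regular_def column_module_def matrix_ring_simps intro!: restrict_ext)
    fix a v assume a: "a \<in> carrier Mat" and v: "v \<in> carrier (column_module n S)"
    show "?q r (act (column_module n S) a v) = act (left_regular Mat) a (?q r v)"
    proof (rule ext, clarify)
      fix i j
      have "(\<Oplus>\<^bsub>S\<^esub>l\<in>{..<n}. a (i, l) \<otimes>\<^bsub>S\<^esub> ?q r v (l, j)) = (if j = r then \<Oplus>\<^bsub>S\<^esub>l\<in>{..<n}. a (i, l) \<otimes>\<^bsub>S\<^esub> v l else \<zero>\<^bsub>S\<^esub>)"
        if ij: "i < n" "j < n"
      proof -
        have vc: "v l \<in> carrier S" if "l < n" for l using v that by (auto simp: column_module_def PiE_iff)
        have "(\<Oplus>\<^bsub>S\<^esub>l\<in>{..<n}. a (i, l) \<otimes>\<^bsub>S\<^esub> ?q r v (l, j)) = (\<Oplus>\<^bsub>S\<^esub>l\<in>{..<n}. if j = r then a (i, l) \<otimes>\<^bsub>S\<^esub> v l else \<zero>\<^bsub>S\<^esub>)"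
          by (rule S.add.finprod_cong') (use ij vc Mat_entry[OF a] in auto)
        then show ?thesis by auto
      qed
      then show "?q r (act (column_module n S) a v) (i, j) = act (left_regular Mat) a (?q r v) (i, j)"
        by (auto simp: left_regular_def column_module_def matrix_ring_simps(2) mat_mult_def)
    qed
  qed
  fix s v assume "s \<in> {..<n}" and v: "v \<in> carrier colS"
  then have s: "s < n" by simp
  show "?p r (?q s v) = (if r = s then v else \<one>\<^bsub>colS\<^esub>)"
    using r s v by (auto simp: column_module_def PiE_iff extensional_def restrict_def fun_eq_iff)
next
  fix X assume "X \<in> carrier Mat_l"
  then have X: "X \<in> carrier Mat" by (simp add: left_regular_def)
  show "finprod Mat_l (\<lambda>r. ?q r (?p r X)) {..<n} = X"
    unfolding finprod_Mat_l
    by (rule matrix_finsum_single[where g = "\<lambda>i j. j"]) (use X Mat_entry[OF X] in \<open>auto simp: matrix_ring_simps(1)\<close>)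
qed simp

section \<open>The Tor groups\<close>

lemma Tor_columns_res:
  assumes X: "right_module A X" shows "Tor A i X colS \<cong> Tor A i X (res_N 0)"
proof (rule Tor_iso_right[OF X colS_module res_N_module])
  let ?h = "\<lambda>v. \<lambda>i\<in>{..<n}. Atom (v i) :: ('s, 's \<times> int) formal"
  have inj: "inj_on (Atom :: 's \<Rightarrow> ('s, 's \<times> int) formal) (carrier (left_regular S))" by (simp add: inj_on_def)
  have a: "Atom \<in> module_hom S (left_regular S) (iter 0)" unfolding iter_mult_kernel.simps(1) by (rule transport_hom[OF inj])
  note e = Ncols_zero[of "iter 0"]
  note h = cols_map[OF left_module_regular[OF ring_S] iter_module a]
  show "?h \<in> module_hom A colS (res_N 0)" unfolding colS_eq e by (rule h)
  have c: "carrier (iter 0) = Atom ` carrier S" unfolding iter_mult_kernel.simps(1) transport_simps(1)[OF inj] by simp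
  show "bij_betw ?h (carrier colS) (carrier (res_N 0))"
    unfolding colS_eq e
  proof (rule bij_betw_byWitness[where f' = "\<lambda>w. \<lambda>i\<in>{..<n}. (THE x. w i = Atom x)"])
    show "\<forall>v\<in>carrier (cols (left_regular S)). (\<lambda>i\<in>{..<n}. (THE x. ?h v i = Atom x)) = v"
      by (auto simp: PiE_iff extensional_def restrict_def fun_eq_iff)
    show "\<forall>w\<in>carrier (cols (iter 0)). ?h (\<lambda>i\<in>{..<n}. (THE x. w i = Atom x)) = w"
    proof
      fix w assume w: "w \<in> carrier (cols (iter 0))"
      have "Atom (THE x. w i = Atom x) = w i" if i: "i < n" for i
      proof -
        obtain x where "w i = Atom x" using cols_entry[OF w i] unfolding c by blast
        then show ?thesis by simp
      qed
      then show "?h (\<lambda>i\<in>{..<n}. (THE x. w i = Atom x)) = w"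
        using w by (auto simp: PiE_iff extensional_def restrict_def fun_eq_iff)
    qed
    show "?h ` carrier (cols (left_regular S)) \<subseteq> carrier (cols (iter 0))"
      by (rule image_subsetI) (rule module_hom_closed[OF h])
    show "(\<lambda>w. \<lambda>i\<in>{..<n}. (THE x. w i = Atom x)) ` carrier (cols (iter 0)) \<subseteq> carrier (cols (left_regular S))"
    proof (rule image_subsetI)
      fix w assume w: "w \<in> carrier (cols (iter 0))"
      have "(THE x. w i = Atom x) \<in> carrier S" if i: "i < n" for i
      proof -
        obtain x where "w i = Atom x" "x \<in> carrier S" using cols_entry[OF w i] unfolding c by blast
        then show ?thesis by simp
      qed
      then show "(\<lambda>i\<in>{..<n}. (THE x. w i = Atom x)) \<in> carrier (cols (left_regular S))" by simp
    qed
  qed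
qed

text \<open>
  The canonical resolution of a direct sum is not the direct sum of the resolutions.  Additivity in the first
  variable is therefore read off from the resolution of the second one.
\<close>

lemma Tor_matrix_rows:
  assumes fl: "flat_base"
  shows "Tor A i Mat_r colS \<cong> product_group {..<n} (\<lambda>_. Tor A i rows colS)"
proof (cases i)
  case 0
  show ?thesis unfolding 0
    by (rule product_iso_chain[OF Tor_zero_iso(1)[OF Mat_r_module colS_module]
          is_isoI[OF tensor_biproduct_left[OF Mat_r_module rows_module colS_module matrix_rows_biproduct]]
          Tor_zero_iso(1)[OF rows_module colS_module] group_Tor[OF rows_module colS_module]
          comm_group.axioms(2)[OF comm_group_tensor[OF rows_module colS_module]]])
next
  case (Suc j)
  have K: "Tor A (Suc j) X colS \<cong> tensor_kernel_right A X (res_N (Suc j)) (res_F j) (res_map j)"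
    if "right_module A X" for X :: "(_, 'x) rmodule"
    using iso_trans[OF Tor_columns_res[OF that] Tor_res_N[OF fl that, of j 0]] unfolding add_0_right .
  note a = short_exactD(1)[OF res_short_exact]
  show ?thesis unfolding Suc
    by (rule product_iso_chain[OF K[OF Mat_r_module]
          tensor_kernel_biproduct_left[OF Mat_r_module rows_module res_N_module res_F_module a matrix_rows_biproduct]
          K[OF rows_module] group_Tor[OF rows_module colS_module]
          comm_group.axioms(2)[OF group_tensor_kernel_right[OF rows_module res_N_module res_F_module a]]])
qed

theorem Tor_matrix_ring:
  assumes fl: "flat_base"
  shows "Tor A i Mat_r Mat_l \<cong> matrix_group n (Tor A i rows colS)"
proof -
  have "Tor A i Mat_r Mat_l \<cong> product_group {..<n} (\<lambda>_. Tor A i Mat_r colS)"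
    by (rule Tor_biproduct_right[OF Mat_r_module Mat_l_module colS_module matrix_columns_biproduct])
  also have "\<dots> \<cong> product_group {..<n} (\<lambda>_. product_group {..<n} (\<lambda>_. Tor A i rows colS))"
    by (rule iso_product_groupI[OF Tor_matrix_rows[OF fl]])
      (intro group_Tor Mat_r_module rows_module colS_module product_group)+
  also have "\<dots> \<cong> matrix_group n (Tor A i rows colS)"
    unfolding matrix_group_def by (rule product_product_group)
  finally (iso_trans) show ?thesis .
qed

theorem Tor_zero_rows_columns:
  assumes n: "2 \<le> n" shows "Tor A 0 rows colS \<cong> add_monoid S"
proof -
  have "Tor A 0 rows colS \<cong> tensor A rows colS" by (rule Tor_zero_iso(1)[OF rows_module colS_module])
  also have "\<dots> \<cong> left_regular S"
    unfolding colS_eq Ncols_zero[symmetric] by (rule is_isoI[OF rows_tensor_columns[OF left_module_regular[OF ring_S]]]) (use n in simp)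
  also have "left_regular S \<cong> add_monoid S"
    by (rule is_isoI[of "\<lambda>x. x"], rule isoI) (auto intro: homI simp: bij_betw_def)
  finally (iso_trans) show ?thesis .
qed

end

theorem proposition2p9:
  fixes k :: "'k ring" and S :: "'s ring" and \<phi> :: "'k \<Rightarrow> 's" and n :: nat
  defines "A \<equiv> triangular_ring k S \<phi> n"
    and "N \<equiv> restrict_scalars (triangular_to_matrix S \<phi> n) (column_module n S)"
    and "M \<equiv> restrict_scalars (triangular_to_matrix S \<phi> n) (row_module n S)"
    and "Mat_l \<equiv> restrict_scalars (triangular_to_matrix S \<phi> n) (left_regular (matrix_ring n S))"
    and "Mat_r \<equiv> restrict_scalars (triangular_to_matrix S \<phi> n) (right_regular (matrix_ring n S))"
    and "Kn \<equiv> iter_mult_kernel k S \<phi> (left_regular S) n"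
  assumes "ring k" and "ring S" and "\<phi> \<in> ring_hom k S"
    and "flat_left_module k (restrict_scalars \<phi> (left_regular S))"
    and "n \<ge> 2"
  shows "(\<forall>i.
      (i = 0 \<longrightarrow> Tor A i M N \<cong> add_monoid S) \<and>
      (i = n - 1 \<longrightarrow> Tor A i M N \<cong> Kn) \<and>
      (i \<noteq> 0 \<and> i \<noteq> n - 1 \<longrightarrow> trivial_group (Tor A i M N))) \<and>
    (\<forall>i. Tor A i Mat_r Mat_l \<cong> matrix_group n (Tor A i M N)) \<and>
    (\<forall>i.
      (i = 0 \<longrightarrow> Tor A i Mat_r Mat_l \<cong> matrix_group n (add_monoid S)) \<and>
      (i = n - 1 \<longrightarrow> Tor A i Mat_r Mat_l \<cong> matrix_group n Kn) \<and>
      (i \<noteq> 0 \<and> i \<noteq> n - 1 \<longrightarrow> trivial_group (Tor A i Mat_r Mat_l)))"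
proof -
  interpret triangular k S \<phi> n by (rule triangular.intro[OF assms(7-9)])
  note fl = assms(10) and n = assms(11)
  note d = A_def N_def M_def
  have T: "group (Tor A i M N)" for i unfolding d by (rule group_Tor[OF rows_module colS_module])
  have zero: "Tor A 0 M N \<cong> add_monoid S" unfolding d by (rule Tor_zero_rows_columns[OF n])
  have top: "Tor A (n - 1) M N \<cong> Kn"
  proof -
    obtain i where i: "Suc (Suc i) = n" using n by (metis add_2_eq_Suc le_Suc_ex)
    have "Tor A (Suc i) M N \<cong> Kn" unfolding d Kn_def
      by (rule iso_trans[OF Tor_columns_res[OF rows_module] Tor_rows_top[OF fl i]])
    moreover have "n - 1 = Suc i" using i by simp
    ultimately show ?thesis by simp
  qed
  have middle: "trivial_group (Tor A i M N)" if i: "i \<noteq> 0" "i \<noteq> n - 1" for i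
  proof -
    obtain j where j: "i = Suc j" using i(1) not0_implies_Suc by blast
    have "trivial_group (Tor A i M (res_N 0))" unfolding d j by (rule Tor_rows_middle[OF fl i(2)[unfolded j]])
    then show ?thesis
      by (rule trivial_group_iso[rotated 2]) (unfold d, rule Tor_columns_res[OF rows_module], rule group_Tor[OF rows_module colS_module])
  qed
  have mat: "Tor A i Mat_r Mat_l \<cong> matrix_group n (Tor A i M N)" for i
    unfolding d Mat_r_def Mat_l_def by (rule Tor_matrix_ring[OF fl])
  have Kg: "group Kn" unfolding Kn_def by (rule comm_group.axioms(2)[OF left_module_group[OF iter_module]])
  have m0: "Tor A 0 Mat_r Mat_l \<cong> matrix_group n (add_monoid S)"
    by (rule iso_trans[OF mat matrix_group_iso[OF zero T comm_group.axioms(2)[OF S.a_comm_group]]])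
  have m1: "Tor A (n - 1) Mat_r Mat_l \<cong> matrix_group n Kn"
    by (rule iso_trans[OF mat matrix_group_iso[OF top T Kg]])
  have m2: "trivial_group (Tor A i Mat_r Mat_l)" if i: "i \<noteq> 0" "i \<noteq> n - 1" for i
  proof -
    have tr: "trivial_group (matrix_group n (Tor A i M N))"
      unfolding matrix_group_def trivial_product_group using middle[OF i] by blast
    have g: "group (Tor A i Mat_r Mat_l)" unfolding Mat_r_def Mat_l_def A_def by (rule group_Tor[OF Mat_r_module Mat_l_module])
    show ?thesis by (rule trivial_group_iso[OF mat g tr])
  qed
  show ?thesis
    by (intro conjI allI impI; (elim conjE)?; hypsubst?;
        (rule zero top mat m0 m1 | (rule middle, assumption+) | (rule m2, assumption+)))
qed

end
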